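(* Let $n\geq 2$ and $k\in\{1,\dots,n\}$. There is a constant $D_{n,k}$ depending only on $n$ and $k$ such that the following holds. Let $g:\mathbb{R}\to\mathbb{R}$ be a nonnegative and nonincreasing locally Lipschitz function, let $u\in W^{1,k+1}(B_1,|x|^{1-k})$ be a semistable radial solution of $S_k(D^2u)=g(u)$ in $B_1$, and set $C=D_{n,k}\min_{t\in[1/2,1]}u'(t)$. (i) If $n<2k+8$, then $|u(r)-u(1)|\leq C(1-r)$ for all $r\in(0,1]$. (ii) If $n=2k+8$, then $|u(r)-u(1)|\leq C|\log r|$ for all $r\in(0,1]$. (iii) If $n>2k+8$, then $$|u(r)-u(1)|\leq C\left(r^{\frac{-(k+1)n+2\sqrt{2(k+1)n-4k}+2k^2+6k}{(k+1)^2}}-1\right)\quad\text{for all } r\in(0,1].$$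
   Context: $B_1$ is the open unit ball of $\mathbb{R}^n$, $c_{n,k}=\binom{n}{k}/n$, $(\cdot,\cdot)$ is the Euclidean inner product. A function is radial if $u(x)=u(r)$, $r=|x|$; $u'$ is its derivative in $r$. $W^{1,k+1}(B_1,|x|^{1-k})$ is the space of weakly differentiable $u\in L^{k+1}(B_1)$ with $\int_{B_1}|x|^{1-k}|\nabla u|^{k+1}dx<\infty$. $S_k(D^2u)=\sigma_k(\lambda(D^2u))$ is the $k$-th elementary symmetric function of the eigenvalues of the Hessian $D^2u$, and $S_k^{ij}(D^2u)=\frac{\partial}{\partial u_{ij}}S_k(D^2u)$, where $u_i=u_{x_i}$, $u_{ij}=u_{x_ix_j}$. For radial $u$, with $\lambda_1=u''$ and $\lambda_2=u'/r$, one has at $x\neq0$ $$S_k^{ij}(D^2u)=k\,c_{n,k}\left(\lambda_2^{k-1}\delta_{ij}+\frac{k-1}{n-1}\lambda_2^{k-2}(\lambda_1-\lambda_2)\Big(\delta_{ij}-\frac{x_ix_j}{|x|^2}\Big)\right)$$ (the second term is absent when $k=1$). Classical solution: $u\in C^2(B_1)\cap C(\overline{B_1})$, $u=0$ on $\partial B_1$, $\sigma_i(\lambda(D^2u))>0$ in $B_1$ for $i=1,\dots,k$, and $S_k(D^2u)=g(u)$ in $B_1$. Weak solution: $u\in L^{k+1}(B_1)$, $\int_{B_1}\sum u_iu_jS_k^{ij}(D^2u)<\infty$, $g(u)\in L^1(B_1)$ and $\int_{B_1}\{\frac1k\sum u_i\eta_jS_k^{ij}(D^2u)+g(u)\eta\}=0$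 for all $\eta\in C_c^1(B_1)$ (for radial $u$, $\sum u_iu_jS_k^{ij}(D^2u)=k\,c_{n,k}(u'/r)^{k-1}(u')^2$ and $\sum u_i\eta_jS_k^{ij}(D^2u)=k\,c_{n,k}(u'/r)^k(x,\nabla\eta)$, which do not involve $u''$). "Solution" means classical or weak solution. Radial solutions are understood with $u'\ge0$; $u$ denotes the continuous representative on $(0,1]$. A solution $u$ is semistable if $\int_{B_1}\{\sum\varphi_i\varphi_jS_k^{ij}(D^2u)+g'(u)\varphi^2\}dx\ge0$ for all $\varphi\in C_c^1(B_1\setminus\{0\})$. *)

theory Defs
  imports "HOL-Analysis.Analysis"
begin

definition grad :: "(real^'n \<Rightarrow> real) \<Rightarrow> real^'n \<Rightarrow> real^'n" where
  "grad u x = (\<chi> i. frechet_derivative u (at x) (axis i 1))"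

definition hessian :: "(real^'n \<Rightarrow> real) \<Rightarrow> real^'n \<Rightarrow> real^'n^'n" where
  "hessian u x = jacobian (grad u) (at x)"

definition C2_on :: "(real^'n) set \<Rightarrow> (real^'n \<Rightarrow> real) \<Rightarrow> bool" where
  "C2_on \<Omega> u \<longleftrightarrow> (\<forall>x\<in>\<Omega>. u differentiable (at x)) \<and> (\<forall>x\<in>\<Omega>. grad u differentiable (at x))
     \<and> continuous_on \<Omega> (hessian u)"

text \<open>\<open>C1c \<Omega>\<close> is the space of continuously differentiable functions with compact support in the
  open set \<open>\<Omega>\<close>, extended by zero to the whole space.\<close>

definition C1c :: "(real^'n) set \<Rightarrow> (real^'n \<Rightarrow> real) set" where
  "C1c \<Omega> = {\<eta>. (\<forall>x. \<eta> differentiable (at x)) \<and> continuous_on UNIV (grad \<eta>)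
     \<and> compact (closure {x. \<eta> x \<noteq> 0}) \<and> closure {x. \<eta> x \<noteq> 0} \<subseteq> \<Omega>}"

definition has_weak_gradient ::
    "(real^'n) set \<Rightarrow> (real^'n \<Rightarrow> real) \<Rightarrow> (real^'n \<Rightarrow> real^'n) \<Rightarrow> bool" where
  "has_weak_gradient \<Omega> u Du \<longleftrightarrow>
     (\<forall>K. compact K \<and> K \<subseteq> \<Omega> \<longrightarrow> u absolutely_integrable_on K \<and> Du absolutely_integrable_on K)
     \<and> (\<forall>\<eta>\<in>C1c \<Omega>. \<forall>i. (LINT x:\<Omega>|lebesgue. u x * grad \<eta> x $ i)
          = - (LINT x:\<Omega>|lebesgue. Du x $ i * \<eta> x))"

definition Lp_on :: "nat \<Rightarrow> (real^'n) set \<Rightarrow> (real^'n \<Rightarrow> real) \<Rightarrow> bool" where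
  "Lp_on p \<Omega> u \<longleftrightarrow> u \<in> borel_measurable (lebesgue_on \<Omega>)
     \<and> (\<lambda>x. \<bar>u x\<bar> ^ p) absolutely_integrable_on \<Omega>"

text \<open>\<open>weighted_sobolev k u Du\<close>: the function \<open>u\<close> lies in \<open>W\<^sup>1\<^sup>,\<^sup>k\<^sup>+\<^sup>1(B\<^sub>1, |x|\<^sup>1\<^sup>-\<^sup>k)\<close> and its weak
  gradient is \<open>Du\<close>.\<close>

definition weighted_sobolev :: "nat \<Rightarrow> (real^'n \<Rightarrow> real) \<Rightarrow> (real^'n \<Rightarrow> real^'n) \<Rightarrow> bool" where
  "weighted_sobolev k u Du \<longleftrightarrow> Lp_on (k + 1) (ball 0 1) u \<and> has_weak_gradient (ball 0 1) u Du
     \<and> (\<lambda>x. norm x powr (1 - real k) * norm (Du x) ^ (k + 1)) absolutely_integrable_on ball 0 1"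

text \<open>Eigenvalues are listed with algebraic multiplicity. They are taken in \<open>\<complex>\<close> so that \<open>S_k\<close> is
  defined on all real matrices: the partial derivatives \<open>\<partial>S\<^sub>k/\<partial>u\<^sub>i\<^sub>j\<close> treat the \<open>n\<^sup>2\<close> entries as
  independent variables, so non-symmetric matrices occur. The elementary symmetric functions of the
  eigenvalues of a real matrix are real, hence \<open>Re\<close> below loses nothing.\<close>

definition eigenvalue_tuple :: "real^'n^'n \<Rightarrow> ('n \<Rightarrow> complex) \<Rightarrow> bool" where
  "eigenvalue_tuple A l \<longleftrightarrow>
     (\<forall>z. det (mat z - map_matrix complex_of_real A) = (\<Prod>i\<in>UNIV. z - l i))"

definition elem_sym :: "nat \<Rightarrow> ('n::finite \<Rightarrow> 'a::comm_ring_1) \<Rightarrow> 'a" where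
  "elem_sym k l = (\<Sum>I | card I = k. \<Prod>i\<in>I. l i)"

definition S_k :: "nat \<Rightarrow> real^'n^'n \<Rightarrow> real" where
  "S_k k A = Re (elem_sym k (SOME l. eigenvalue_tuple A l))"

text \<open>The matrix \<open>axis i (axis j 1)\<close> has entry 1 at position \<open>(i, j)\<close> and 0 elsewhere.\<close>

definition S_k_deriv :: "nat \<Rightarrow> real^'n^'n \<Rightarrow> 'n \<Rightarrow> 'n \<Rightarrow> real" where
  "S_k_deriv k A i j = deriv (\<lambda>t. S_k k (A + t *\<^sub>R axis i (axis j 1))) 0"

definition radial_with_profile :: "(real^'n \<Rightarrow> real) \<Rightarrow> (real \<Rightarrow> real) \<Rightarrow> bool" where
  "radial_with_profile u v \<longleftrightarrow> (\<forall>x\<in>cball 0 1. u x = v (norm x)) \<and> continuous_on {0<..1} v"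

definition classical_solution :: "nat \<Rightarrow> (real \<Rightarrow> real) \<Rightarrow> (real^'n \<Rightarrow> real) \<Rightarrow> bool" where
  "classical_solution k g u \<longleftrightarrow> C2_on (ball 0 1) u \<and> continuous_on (cball 0 1) u
     \<and> (\<forall>x\<in>sphere 0 1. u x = 0)
     \<and> (\<forall>x\<in>ball 0 1. \<forall>i\<in>{1..k}. S_k i (hessian u x) > 0)
     \<and> (\<forall>x\<in>ball 0 1. S_k k (hessian u x) = g (u x))"

text \<open>For a radial function with weak gradient \<open>Du\<close>, the derivative in \<open>r = |x|\<close>, as a function
  of \<open>x\<close>.\<close>

definition radial_deriv :: "(real^'n \<Rightarrow> real^'n) \<Rightarrow> real^'n \<Rightarrow> real" where
  "radial_deriv Du x = Du x \<bullet> x / norm x"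

definition c_nk :: "nat \<Rightarrow> nat \<Rightarrow> real" where
  "c_nk n k = real (n choose k) / real n"

text \<open>A radial weak solution need not have second derivatives a priori. The expressions
  \<open>\<Sum> u\<^sub>i u\<^sub>j S\<^sub>k\<^sup>i\<^sup>j(D\<^sup>2u)\<close> and \<open>\<Sum> u\<^sub>i \<eta>\<^sub>j S\<^sub>k\<^sup>i\<^sup>j(D\<^sup>2u)\<close> reduce, for radial \<open>u\<close>, to
  \<open>k c\<^sub>n\<^sub>,\<^sub>k (u'/r)\<^sup>k\<^sup>-\<^sup>1 (u')\<^sup>2\<close> and \<open>k c\<^sub>n\<^sub>,\<^sub>k (u'/r)\<^sup>k (x, \<nabla>\<eta>)\<close>, which involve the weak gradient only;
  weak solutions are defined through these.\<close>

definition radial_weak_solution ::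
    "nat \<Rightarrow> (real \<Rightarrow> real) \<Rightarrow> (real^'n \<Rightarrow> real) \<Rightarrow> (real^'n \<Rightarrow> real^'n) \<Rightarrow> bool" where
  "radial_weak_solution k g u Du \<longleftrightarrow>
     Lp_on (k + 1) (ball 0 1) u \<and> has_weak_gradient (ball 0 1) u Du
     \<and> (\<lambda>x. real k * c_nk CARD('n) k * (radial_deriv Du x / norm x) ^ (k - 1)
          * (radial_deriv Du x)\<^sup>2) absolutely_integrable_on ball 0 1
     \<and> (\<lambda>x. g (u x)) absolutely_integrable_on ball 0 1
     \<and> (\<forall>\<eta>\<in>C1c (ball 0 1).
          (LINT x:ball 0 1|lebesgue.
             1 / real k * (real k * c_nk CARD('n) k * (radial_deriv Du x / norm x) ^ k
               * (x \<bullet> grad \<eta> x)) + g (u x) * \<eta> x) = 0)"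

text \<open>The integrability clause makes explicit that the integral exists, since a divergent integral
  has the value 0 in the library. A locally Lipschitz \<open>g\<close> is differentiable almost everywhere;
  \<open>deriv g\<close> is arbitrary elsewhere.\<close>

definition semistable :: "nat \<Rightarrow> (real \<Rightarrow> real) \<Rightarrow> (real^'n \<Rightarrow> real) \<Rightarrow> bool" where
  "semistable k g u \<longleftrightarrow> (\<forall>\<phi>\<in>C1c (ball 0 1 - {0}).
     let F = (\<lambda>x. (\<Sum>i\<in>UNIV. \<Sum>j\<in>UNIV.
                grad \<phi> x $ i * grad \<phi> x $ j * S_k_deriv k (hessian u x) i j)
              + deriv g (u x) * (\<phi> x)\<^sup>2)
     in F absolutely_integrable_on ball 0 1 \<and> (LINT x:ball 0 1|lebesgue. F x) \<ge> 0)"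

definition locally_lipschitz :: "(real \<Rightarrow> real) \<Rightarrow> bool" where
  "locally_lipschitz g \<longleftrightarrow> (\<forall>s. \<exists>e>0. \<exists>L. L-lipschitz_on (ball s e) g)"

text \<open>The minimum over \<open>[1/2, 1]\<close> of the derivative of the profile, one-sided at \<open>1\<close>.
  For the solutions considered the profile is continuously differentiable on \<open>(0, 1]\<close>, so that the
  infimum is attained.\<close>

definition min_deriv :: "(real \<Rightarrow> real) \<Rightarrow> real" where
  "min_deriv v = (INF t\<in>{1/2..1}. vector_derivative v (at t within {0<..1}))"

end

theory Submission
  imports Defs "HOL-Computational_Algebra.Fundamental_Theorem_Algebra"
begin

text \<open>Let \<open>v\<close> be the profile of \<open>u\<close>, \<open>w = v'\<close> and \<open>n\<close> the dimension. The estimate on \<open>v\<close> follows by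
  integration from the pointwise bound \<open>w(r) \<le> C w(1/2) r\<^sup>\<gamma>\<^sup>-\<^sup>1\<close>, in which \<open>\<gamma>\<close> is, for
  \<open>n \<ge> 2k\<close>, the exponent of case (iii); it is positive, zero or negative according to whether \<open>n\<close> is below, at or above \<open>2k+8\<close>.

  The profile solves \<open>c (r\<^sup>n (w/r)\<^sup>k)' = r\<^sup>n\<^sup>-\<^sup>1 g(v)\<close> with \<open>c = c_nk n k\<close>, classically even when \<open>u\<close> is a
  weak solution (\<open>radial_weak_solution_profile\<close>). As \<open>g\<close> is nonnegative and nonincreasing, \<open>r\<^sup>n (w/r)\<^sup>k\<close>
  increases and \<open>w/r\<close> decreases (\<open>profile_ode_monotone\<close>). These two facts compare the values of \<open>w\<close> on
  \<open>[1/2, 1]\<close> with each other, hence with the minimum of \<open>v'\<close>, and for \<open>n < 2k\<close> the first of them already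
  is the pointwise bound.

  For \<open>n \<ge> 2k\<close> semistability is used with the test functions \<open>w \<eta>\<close>, \<open>\<eta>\<close> radial. The function \<open>w\<close> solves the
  equation linearized at \<open>u\<close> up to an explicit lower order term, so \<open>g'\<close> drops out, and what remains is an
  inequality that only involves \<open>w\<close> and \<open>\<eta>\<close> (\<open>semistable_reduced_inequality\<close>):
  \<open>0 \<le> \<integral> r\<^sup>n\<^sup>-\<^sup>k w\<^sup>k\<^sup>+\<^sup>1 (\<eta>'\<^sup>2 + 2b \<eta>\<eta>'/r - d \<eta>\<^sup>2/r\<^sup>2) dr\<close> with \<open>b = (k-1)/(k+1)\<close> and \<open>d = (2n-k-1)/(k+1)\<close>.
  The quadratic \<open>t\<^sup>2 + 2bt - d\<close>, to which the bracket reduces for powers \<open>\<eta> = r\<^sup>t\<close>, has the roots \<open>-\<alpha>\<close> and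
  \<open>\<beta>\<close>, both \<open>\<alpha>\<close> and \<open>\<beta>\<close> positive. A test function that behaves like \<open>r\<^sup>\<beta>\<close> below a given radius \<open>r\<^sub>0\<close> and
  like \<open>r\<^sup>-\<^sup>\<alpha>\<close> above it makes the integrand strictly negative near \<open>r\<^sub>0\<close>, and the contributions of the cut-offs
  near \<open>0\<close> and near \<open>1/2\<close> are controlled by the finite energy of \<open>u\<close> and by \<open>w(1/2)\<close>. As \<open>w/r\<close> decreases,
  the integral near \<open>r\<^sub>0\<close> controls the value \<open>w(r\<^sub>0)\<close> (\<open>profile_decay\<close>).

  Two points need care because \<open>g\<close> is only locally Lipschitz. Differentiability of \<open>g\<close> almost everywhere
  has to be transported to the composition \<open>g \<circ> v\<close>, and \<open>g'(v) w\<close> is never integrated by parts as a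
  function: it is treated as the limit of difference quotients of \<open>g \<circ> v\<close>.\<close>

section \<open>Elementary symmetric functions as coefficients of the characteristic polynomial\<close>

definition charpoly :: "'a::comm_ring_1^'n^'n \<Rightarrow> 'a poly" where
  "charpoly A = det (\<chi> i j. [:- A$i$j, if i = j then 1 else 0:])"

lemma poly_charpoly: "poly (charpoly A) z = det (mat z - A)"
  unfolding charpoly_def det_def
  by (auto simp: poly_sum poly_prod mat_def intro!: sum.cong prod.cong arg_cong2[of _ _ _ _ "(*)"])

text \<open>Of all permutations in the expansion of the determinant only the identity reaches degree \<open>n\<close>.\<close>

lemma charpoly_monic:
  fixes A :: "'a::idom^'n^'n"
  shows "degree (charpoly A) = CARD('n)" "lead_coeff (charpoly A) = 1"
proof -
  let ?t = "\<lambda>p. of_int (sign p) * (\<Prod>i\<in>UNIV. [:- A$i$p i, if i = p i then 1 else 0:]) :: 'a poly"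
  let ?P = "{p::'n\<Rightarrow>'n. p permutes UNIV}"
  have deg: "degree (?t p) < CARD('n)" if "p \<noteq> id" for p
  proof -
    have "\<exists>i. p i \<noteq> i" using that by (auto simp: fun_eq_iff)
    then obtain i0 where i0: "p i0 \<noteq> i0" by blast
    have "degree (?t p) \<le> degree (of_int (sign p) :: 'a poly) + degree (\<Prod>i\<in>UNIV. [:- A$i$p i, if i = p i then 1 else 0:])"
      by (rule degree_mult_le)
    also have "degree (of_int (sign p) :: 'a poly) = 0" by simp
    also have "degree (\<Prod>i\<in>UNIV. [:- A$i$p i, if i = p i then 1 else 0:]) \<le> (\<Sum>i\<in>UNIV. if i = p i then 1 else 0)"
      by (rule order_trans[OF degree_prod_sum_le]) (auto intro!: sum_mono)
    also have "\<dots> < (\<Sum>i\<in>(UNIV::'n set). 1)"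
      by (rule sum_strict_mono_ex1) (use i0 in \<open>auto, metis\<close>)
    finally show ?thesis by simp
  qed
  have sp: "charpoly A = (\<Prod>i\<in>UNIV. [:- A$i$i, 1:]) + (\<Sum>p\<in>?P - {id}. ?t p)"
    unfolding charpoly_def det_def
    by (subst sum.remove[of _ id]) (auto simp: permutes_id)
  have d1: "degree (\<Prod>i\<in>UNIV. [:- A$i$i, 1:]) = CARD('n)"
    by (subst degree_prod_sum_eq) auto
  have l1: "lead_coeff (\<Prod>i\<in>UNIV. [:- A$i$i, 1:]) = 1"
    by (simp add: lead_coeff_prod)
  have d2: "degree (\<Sum>p\<in>?P - {id}. ?t p) < CARD('n)"
    by (rule degree_sum_less) (use deg in auto)
  show d: "degree (charpoly A) = CARD('n)"
    unfolding sp using d1 d2 by (simp add: degree_add_eq_left)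
  have "coeff (charpoly A) CARD('n) = 1"
    unfolding sp using l1 d1 d2 by (simp add: coeff_eq_0)
  then show "lead_coeff (charpoly A) = 1" using d by simp
qed

lemma coeff_prod_linear_factors:
  fixes l :: "'n::finite \<Rightarrow> 'a::comm_ring_1"
  assumes "k \<le> CARD('n)"
  shows "coeff (\<Prod>i\<in>UNIV. [:- l i, 1:]) (CARD('n) - k) = (-1)^k * elem_sym k l"
proof -
  have "(\<Prod>i\<in>UNIV. [:- l i, 1:]) = (\<Prod>i\<in>UNIV. [:- l i:] + monom 1 1)"
    by (rule prod.cong) (auto simp: monom_altdef)
  also have "\<dots> = (\<Sum>X\<in>Pow UNIV. (\<Prod>i\<in>X. [:- l i:]) * (\<Prod>i\<in>UNIV - X. monom 1 1))"
    by (rule prod_add) simp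
  also have "\<dots> = (\<Sum>X\<in>Pow UNIV. monom ((-1) ^ card X * (\<Prod>i\<in>X. l i)) (CARD('n) - card X))"
  proof (rule sum.cong[OF refl])
    fix X :: "'n set"
    have "(\<Prod>i\<in>X. [:- l i:]) = [: (-1) ^ card X * (\<Prod>i\<in>X. l i) :]"
      using finite[of X] by (induction X rule: finite_induct) (auto simp: algebra_simps)
    moreover have "(\<Prod>i\<in>UNIV - X. monom 1 1) = (monom 1 (CARD('n) - card X) :: 'a poly)"
      by (simp add: monom_power card_Diff_subset)
    ultimately show "(\<Prod>i\<in>X. [:- l i:]) * (\<Prod>i\<in>UNIV - X. monom 1 1) = monom ((-1) ^ card X * (\<Prod>i\<in>X. l i)) (CARD('n) - card X)"
      by (simp add: smult_monom)
  qed
  finally have "coeff (\<Prod>i\<in>UNIV. [:- l i, 1:]) (CARD('n) - k)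
     = (\<Sum>X\<in>Pow UNIV. if CARD('n) - card X = CARD('n) - k then (-1) ^ card X * (\<Prod>i\<in>X. l i) else 0)"
    by (simp add: coeff_sum)
  also have "\<dots> = (\<Sum>X\<in>Pow UNIV. if card X = k then (-1) ^ k * (\<Prod>i\<in>X. l i) else 0)"
  proof (intro sum.cong refl)
    fix X :: "'n set"
    have "card X \<le> CARD('n)" by (rule card_mono) auto
    then have "(CARD('n) - card X = CARD('n) - k) = (card X = k)" using assms by auto
    then show "(if CARD('n) - card X = CARD('n) - k then (-1) ^ card X * (\<Prod>i\<in>X. l i) else 0)
       = (if card X = k then (-1) ^ k * (\<Prod>i\<in>X. l i) else 0)" by auto
  qed
  also have "\<dots> = (-1)^k * elem_sym k l"
    by (simp add: elem_sym_def sum_distrib_left flip: sum.inter_filter)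
  finally show ?thesis .
qed

text \<open>The characteristic polynomial splits over \<open>\<complex>\<close> and has degree \<open>CARD('n)\<close>, so its roots can be indexed by
  the type \<open>'n\<close>.\<close>

lemma ex_eigenvalue_tuple: "\<exists>l. eigenvalue_tuple (A :: real^'n^'n) l"
proof -
  let ?p = "charpoly (map_matrix complex_of_real A)"
  have "?p \<noteq> 0" using charpoly_monic(2)[of "map_matrix complex_of_real A"] by auto
  then obtain M where M: "size M = degree ?p" "?p = smult (lead_coeff ?p) (\<Prod>x\<in>#M. [:-x, 1:])"
    using alg_closed_imp_factorization[OF \<open>?p \<noteq> 0\<close>] by (elim exE conjE) (rule that)
  obtain xs where xs: "mset xs = M" using ex_mset by blast
  obtain f :: "'n \<Rightarrow> nat" where f: "bij_betw f UNIV {0..<CARD('n)}"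
    using ex_bij_betw_finite_nat[of "UNIV :: 'n set"] by auto
  have len: "length xs = CARD('n)" using M(1) xs charpoly_monic(1) by (metis size_mset)
  have "?p = (\<Prod>x\<leftarrow>xs. [:-x, 1:])"
    using M(2) xs charpoly_monic(2)[of "map_matrix complex_of_real A"]
    by (simp flip: prod_mset_prod_list)
  also have "\<dots> = (\<Prod>i\<in>{0..<CARD('n)}. [:- xs ! i, 1:])"
    by (simp add: prod.list_conv_set_nth len)
  also have "\<dots> = (\<Prod>i\<in>UNIV. [:- xs ! f i, 1:])"
    by (rule prod.reindex_bij_betw[OF f, symmetric])
  finally have "eigenvalue_tuple A (\<lambda>i. xs ! f i)"
    unfolding eigenvalue_tuple_def poly_charpoly[symmetric] by (simp add: poly_prod)
  then show ?thesis by blast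
qed

lemma poly_map_poly_of_real:
  "poly (map_poly of_real p) (of_real x) = (of_real (poly p x) :: 'a::{comm_ring_1,real_algebra_1})"
  by (induction p) (auto simp: map_poly_pCons)

lemma charpoly_of_real: "charpoly (map_matrix complex_of_real A) = map_poly of_real (charpoly A)"
proof (rule ccontr)
  assume ne: "charpoly (map_matrix complex_of_real A) \<noteq> map_poly of_real (charpoly A)"
  let ?d = "charpoly (map_matrix complex_of_real A) - map_poly of_real (charpoly A)"
  have "poly ?d (of_real x) = 0" for x
  proof -
    have "det (mat (complex_of_real x) - map_matrix complex_of_real A) = of_real (det (mat x - A))"
      unfolding det_def
      by (auto simp: mat_def intro!: sum.cong prod.cong arg_cong2[of _ _ _ _ "(*)"])
    then show ?thesis by (simp add: poly_charpoly poly_map_poly_of_real)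
  qed
  then have "range complex_of_real \<subseteq> {z. poly ?d z = 0}" by auto
  moreover have "finite {z. poly ?d z = 0}" using ne by (intro poly_roots_finite) auto
  moreover have "infinite (range complex_of_real)"
    using inj_of_real by (metis finite_imageD infinite_UNIV_char_0)
  ultimately show False using finite_subset by blast
qed

text \<open>Vieta's formulas: the value of \<open>S_k\<close> is the same for every eigenvalue tuple, and it is a polynomial in
  the entries of the matrix. All further properties of \<open>S_k\<close> are read off from this.\<close>

lemma S_k_eq_coeff_charpoly:
  fixes A :: "real^'n^'n"
  assumes "k \<le> CARD('n)"
  shows "S_k k A = (-1)^k * coeff (charpoly A) (CARD('n) - k)"
proof -
  define l where "l = (SOME l. eigenvalue_tuple A l)"
  have l: "eigenvalue_tuple A l" unfolding l_def by (rule someI_ex[OF ex_eigenvalue_tuple])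
  have "charpoly (map_matrix complex_of_real A) = (\<Prod>i\<in>UNIV. [:- l i, 1:])"
    using l by (subst poly_eq_poly_eq_iff[symmetric]) (auto simp: fun_eq_iff poly_charpoly poly_prod eigenvalue_tuple_def)
  then have "coeff (map_poly of_real (charpoly A)) (CARD('n) - k) = (-1)^k * elem_sym k l"
    using coeff_prod_linear_factors[OF assms, of l] by (simp add: charpoly_of_real)
  then have "elem_sym k l = (-1)^k * of_real (coeff (charpoly A) (CARD('n) - k))"
    by (simp add: coeff_map_poly)
  then show ?thesis unfolding S_k_def l_def[symmetric]
    by (cases "even k") auto
qed

lemma differentiable_coeff_prod:
  fixes P :: "'i \<Rightarrow> 'a::real_normed_vector \<Rightarrow> real poly"
  assumes "finite I" "\<And>i j. i \<in> I \<Longrightarrow> (\<lambda>x. coeff (P i x) j) differentiable (at a)"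
  shows "(\<lambda>x. coeff (\<Prod>i\<in>I. P i x) j) differentiable (at a)"
  using assms
proof (induction I arbitrary: j rule: finite_induct)
  case (insert i I)
  then show ?case by (auto simp: coeff_mult intro!: derivative_intros)
qed auto

lemma S_k_differentiable:
  assumes "k \<le> CARD('n)"
  shows "S_k k differentiable (at (A :: real^'n^'n))"
proof -
  have "(\<lambda>B::real^'n^'n. B $ i $ j) differentiable (at A)" for i j
    by (intro bounded_linear_imp_differentiable bounded_linear_compose[OF bounded_linear_vec_nth bounded_linear_vec_nth])
  then have *: "(\<lambda>B::real^'n^'n. coeff [:- B$i$j, if i = j then 1 else 0:] m) differentiable (at A)" for i j m
    by (cases m) (auto simp: coeff_pCons split: nat.splits intro!: derivative_intros)
  have "(\<lambda>B::real^'n^'n. coeff (charpoly B) m) differentiable (at A)" for m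
    unfolding charpoly_def det_def
    by (simp add: coeff_sum, intro differentiable_sum)
      (auto simp: of_int_poly intro!: differentiable_mult differentiable_coeff_prod *)
  then have "(\<lambda>B::real^'n^'n. (-1)^k * coeff (charpoly B) (CARD('n) - k)) differentiable (at A)"
    by (intro differentiable_mult differentiable_const)
  moreover have "S_k k = (\<lambda>B::real^'n^'n. (-1)^k * coeff (charpoly B) (CARD('n) - k))"
    by (rule ext) (rule S_k_eq_coeff_charpoly[OF assms])
  ultimately show ?thesis by simp
qed


text \<open>For a unit vector \<open>y\<close>, the symmetric matrix with eigenvalue \<open>b\<close> on the line through \<open>y\<close> and eigenvalue \<open>a\<close>
  on its orthogonal complement. Hessians of radial functions have this form.\<close>

definition rank_one_pert :: "real \<Rightarrow> real \<Rightarrow> real^'n \<Rightarrow> real^'n^'n" where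
  "rank_one_pert a b y = (\<chi> i j. (if i = j then a else 0) + (b - a) * (y$i * y$j))"

text \<open>An orthogonal matrix with first column \<open>y\<close>, up to the choice of the index, diagonalizes.\<close>

lemma det_mat_minus_rank_one_pert:
  fixes y :: "real^'n"
  assumes "norm y = 1"
  shows "det (mat z - rank_one_pert a b y) = (z - a) ^ (CARD('n) - 1) * (z - b)"
proof -
  obtain k0 :: 'n where True by blast
  obtain Q where Q: "orthogonal_matrix Q" "Q *v (axis k0 1) = y"
    using orthogonal_matrix_exists_basis[OF assms, of k0] by blast
  have yi: "Q $ i $ k0 = y $ i" for i
    using Q(2) by (auto simp: matrix_vector_mult_basis column_def)
  have QQ: "(\<Sum>l\<in>UNIV. Q$i$l * Q$j$l) = (if i = j then 1 else 0)" for i j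
  proof -
    have "Q ** transpose Q = mat 1" using Q(1) by (simp add: orthogonal_matrix_def)
    then have "(Q ** transpose Q) $ i $ j = mat 1 $ i $ j" by simp
    then show ?thesis by (simp add: matrix_matrix_mult_def transpose_def mat_def)
  qed
  define D :: "real^'n^'n" where "D = (\<chi> i j. if i = j then z - (if i = k0 then b else a) else 0)"
  have "mat z - rank_one_pert a b y = Q ** D ** transpose Q"
  proof -
    have "(Q ** D ** transpose Q) $ i $ j = (mat z - rank_one_pert a b y) $ i $ j" for i j
    proof -
      have "(Q ** D) $ i $ l = Q$i$l * (z - (if l = k0 then b else a))" for l
        by (simp add: matrix_matrix_mult_def D_def if_distrib[of "\<lambda>t. _ * t"] cong: if_cong)
      then have "(Q ** D ** transpose Q) $ i $ j
          = (\<Sum>l\<in>UNIV. Q$i$l * (z - (if l = k0 then b else a)) * Q$j$l)"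
        by (simp add: matrix_matrix_mult_def[of "Q ** D"] transpose_def)
      also have "\<dots> = (\<Sum>l\<in>UNIV. (z - a) * (Q$i$l * Q$j$l) - (if l = k0 then (b - a) * (Q$i$l * Q$j$l) else 0))"
        by (rule sum.cong) (auto simp: algebra_simps)
      also have "\<dots> = (z - a) * (if i = j then 1 else 0) - (b - a) * (y$i * y$j)"
        by (simp add: sum_subtractf sum_distrib_left[symmetric] QQ yi)
      finally show ?thesis
        by (auto simp: rank_one_pert_def mat_def)
    qed
    then show ?thesis by (simp add: vec_eq_iff)
  qed
  moreover have "det Q * det (transpose Q) = 1"
    using Q(1) by (metis det_I det_mul orthogonal_matrix_def)
  moreover have "det D = (z - b) * (z - a) ^ (CARD('n) - 1)"
  proof -
    have "det D = (\<Prod>i\<in>UNIV. D$i$i)" by (rule det_diagonal) (simp add: D_def)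
    also have "\<dots> = (\<Prod>i\<in>UNIV. z - (if i = k0 then b else a))" by (simp add: D_def)
    also have "\<dots> = (z - b) * (\<Prod>i\<in>UNIV - {k0}. z - (if i = k0 then b else a))"
      by (subst prod.remove[of _ k0]) auto
    also have "(\<Prod>i\<in>UNIV - {k0}. z - (if i = k0 then b else a)) = (z - a) ^ (CARD('n) - 1)"
      by (subst prod.cong[OF refl, of _ _ "\<lambda>_. z - a"]) (auto simp: card_Diff_subset)
    finally show ?thesis .
  qed
  ultimately show ?thesis by (simp add: det_mul algebra_simps)
qed

text \<open>The two terms count the choices of \<open>k\<close> of the eigenvalues \<open>a, \<dots>, a, b\<close> that omit and that contain \<open>b\<close>.\<close>

lemma S_k_rank_one_pert:
  fixes y :: "real^'n"
  assumes "norm y = 1" "1 \<le> k" "k \<le> CARD('n)"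
  shows "S_k k (rank_one_pert a b y)
    = real ((CARD('n) - 1) choose k) * a ^ k + real ((CARD('n) - 1) choose (k - 1)) * a ^ (k - 1) * b"
proof -
  let ?n = "CARD('n)"
  have p: "charpoly (rank_one_pert a b y) = [:-b, 1:] * [:-a, 1:] ^ (?n - 1)"
    by (subst poly_eq_poly_eq_iff[symmetric])
      (auto simp: fun_eq_iff poly_charpoly det_mat_minus_rank_one_pert[OF assms(1)] algebra_simps)
  have n0: "?n \<ge> 1" using assms by linarith
  have c1: "coeff ([:-a, 1:] ^ (?n - 1)) (?n - k) = real ((?n - 1) choose (k - 1)) * (-a) ^ (k - 1)"
  proof -
    have "(?n - 1) - (?n - k) = k - 1" using assms by linarith
    moreover have "(?n - 1) choose (?n - k) = (?n - 1) choose (k - 1)"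
      using assms by (subst binomial_symmetric) (auto simp: calculation)
    ultimately show ?thesis using assms by (subst coeff_linear_poly_power) auto
  qed
  have c2: "coeff ([:0, 1:] * [:-a, 1:] ^ (?n - 1)) (?n - k) = real ((?n - 1) choose k) * (-a) ^ k"
  proof (cases "k = ?n")
    case True
    then show ?thesis using n0 by (simp add: coeff_pCons)
  next
    case False
    then obtain m where m: "?n - k = Suc m" using assms by (metis diff_is_0_eq le_antisym not0_implies_Suc)
    have e: "(?n - 1) - m = k" "m \<le> ?n - 1" using m assms by linarith+
    have "(?n - 1) choose m = (?n - 1) choose k"
      using e by (subst binomial_symmetric) auto
    then show ?thesis using e m by (simp add: coeff_linear_poly_power)
  qed
  have "coeff (charpoly (rank_one_pert a b y)) (?n - k)
     = coeff ([:0, 1:] * [:-a, 1:] ^ (?n - 1)) (?n - k) - b * coeff ([:-a, 1:] ^ (?n - 1)) (?n - k)"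
  proof -
    have "[:-b, 1:] = [:0, 1:] - [:b:]" by simp
    then show ?thesis unfolding p by (simp only: left_diff_distrib) simp
  qed
  also have "\<dots> = real ((?n - 1) choose k) * (-a) ^ k - b * (real ((?n - 1) choose (k - 1)) * (-a) ^ (k - 1))"
    by (simp only: c1 c2)
  finally have "S_k k (rank_one_pert a b y) = (-1)^k * (real ((?n - 1) choose k) * (-a) ^ k - b * (real ((?n - 1) choose (k - 1)) * (-a) ^ (k - 1)))"
    using S_k_eq_coeff_charpoly[of k "rank_one_pert a b y"] assms by simp
  moreover have "(-1::real)^k * (-a)^k = a^k" by (simp flip: power_mult_distrib)
  moreover have "(-1::real)^k * (-a)^(k - 1) = - (a^(k - 1))"
  proof -
    have "(-1::real)^k = - ((-1)^(k - 1))" using assms(2) by (cases k) auto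
    then show ?thesis by (simp flip: power_mult_distrib)
  qed
  moreover have "s * (p * x - b * (q * z)) = (s * x) * p - (s * z) * (b * q)" for s p x q z :: real
    by (simp add: algebra_simps)
  ultimately have "S_k k (rank_one_pert a b y)
      = a ^ k * real ((?n - 1) choose k) - (- (a ^ (k - 1))) * (b * real ((?n - 1) choose (k - 1)))"
    by (simp only:)
  then show ?thesis by (simp add: algebra_simps)
qed

text \<open>The double sum is the derivative of \<open>S_k\<close> in the direction of the matrix \<open>y y\<^sup>T\<close>. In this direction only
  the eigenvalue \<open>b\<close> moves, and \<open>S_k\<close> is affine in \<open>b\<close>.\<close>

lemma sum_S_k_deriv_rank_one_pert:
  fixes y :: "real^'n"
  assumes "norm y = 1" "1 \<le> k" "k \<le> CARD('n)"
  shows "(\<Sum>i\<in>UNIV. \<Sum>j\<in>UNIV. y$i * y$j * S_k_deriv k (rank_one_pert a b y) i j)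
    = real ((CARD('n) - 1) choose (k - 1)) * a ^ (k - 1)"
proof -
  let ?A = "rank_one_pert a b y"
  obtain D where D: "(S_k k has_derivative D) (at ?A)"
    using S_k_differentiable[OF assms(3)] by (auto simp: differentiable_def)
  interpret D: bounded_linear D using D by (rule has_derivative_bounded_linear)
  have along: "((\<lambda>t. S_k k (?A + t *\<^sub>R B)) has_field_derivative D B) (at 0)" for B
  proof -
    have "((\<lambda>t. ?A + t *\<^sub>R B) has_derivative (\<lambda>t. t *\<^sub>R B)) (at 0)"
      by (auto intro!: derivative_eq_intros)
    then have "((\<lambda>t. S_k k (?A + t *\<^sub>R B)) has_derivative (\<lambda>t. D (t *\<^sub>R B))) (at (0::real))"
      using has_derivative_compose[of "\<lambda>t. ?A + t *\<^sub>R B" "\<lambda>t. t *\<^sub>R B" 0 UNIV "S_k k" D] D by simp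
    then show ?thesis
      by (simp add: has_field_derivative_def D.scaleR mult.commute[of _ "D B"])
  qed
  have "S_k_deriv k ?A i j = D (axis i (axis j 1))" for i j
    unfolding S_k_deriv_def by (rule DERIV_imp_deriv[OF along])
  then have "(\<Sum>i\<in>UNIV. \<Sum>j\<in>UNIV. y$i * y$j * S_k_deriv k ?A i j)
     = D (\<Sum>i\<in>UNIV. \<Sum>j\<in>UNIV. (y$i * y$j) *\<^sub>R axis i (axis j 1))"
    by (simp add: D.sum D.scaleR)
  also have "(\<Sum>i\<in>UNIV. \<Sum>j\<in>UNIV. (y$i * y$j) *\<^sub>R axis i (axis j 1)) = (\<chi> i j. y$i * y$j)"
  proof -
    have "(\<Sum>l\<in>UNIV. \<Sum>m\<in>UNIV. (y$l * y$m) *\<^sub>R axis l (axis m 1)) $ i $ j = y$i * y$j" for i j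
    proof -
      have "(\<Sum>l\<in>UNIV. \<Sum>m\<in>UNIV. (y$l * y$m) *\<^sub>R axis l (axis m 1)) $ i $ j
        = (\<Sum>l\<in>UNIV. if l = i then (\<Sum>m\<in>UNIV. if m = j then y$i * y$j else 0) else 0)"
        unfolding sum_component
        by (intro sum.cong refl) (auto simp: axis_def if_distrib[of "\<lambda>t. _ * t"] cong: if_cong)
      then show ?thesis by simp
    qed
    then show ?thesis by (simp add: vec_eq_iff)
  qed
  finally have sum: "(\<Sum>i\<in>UNIV. \<Sum>j\<in>UNIV. y$i * y$j * S_k_deriv k ?A i j) = D (\<chi> i j. y$i * y$j)" .
  have "?A + t *\<^sub>R (\<chi> i j. y$i * y$j) = rank_one_pert a (b + t) y" for t
    by (simp add: rank_one_pert_def vec_eq_iff algebra_simps)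
  then have d1: "((\<lambda>t. S_k k (rank_one_pert a (b + t) y)) has_field_derivative D (\<chi> i j. y$i * y$j)) (at 0)"
    using along[of "\<chi> i j. y$i * y$j"] by simp
  have d2: "((\<lambda>t. S_k k (rank_one_pert a (b + t) y)) has_field_derivative
      real ((CARD('n) - 1) choose (k - 1)) * a ^ (k - 1)) (at 0)"
    unfolding S_k_rank_one_pert[OF assms] by (auto intro!: derivative_eq_intros)
  show ?thesis unfolding sum by (rule DERIV_unique[OF d1 d2])
qed

section \<open>Almost everywhere differentiability of monotone Lipschitz functions\<close>

text \<open>The covering theorem for balls applies: an open interval is the ball around its midpoint, and the covered
  points are not required to be centres.\<close>

lemma vitali_open_intervals:
  fixes S :: "real set"
  assumes T: "open T" "S \<subseteq> T"
    and Q: "\<And>x d. x \<in> S \<Longrightarrow> 0 < d \<Longrightarrow> \<exists>a b. a < x \<and> x < b \<and> b - a < d \<and> Q a b"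
  obtains C where "countable C" "disjoint_family_on (\<lambda>(a, b). {a<..<b}) C"
    "\<And>a b. (a, b) \<in> C \<Longrightarrow> a < b \<and> {a<..<b} \<subseteq> T \<and> Q a b"
    "negligible (S - (\<Union>(a, b)\<in>C. {a<..<b}))"
proof -
  define K where "K = {(a, b). a < b \<and> {a<..<b} \<subseteq> T \<and> Q a b}"
  let ?c = "\<lambda>(a, b). (a + b) / 2 :: real" and ?r = "\<lambda>(a, b). (b - a) / 2 :: real"
  have ball: "ball (?c i) (?r i) = (case i of (a, b) \<Rightarrow> {a<..<b})" for i
    by (cases i) (auto simp: ball_def dist_real_def abs_if field_simps split: if_splits)
  have "\<exists>i\<in>K. x \<in> ball (?c i) (?r i) \<and> ?r i < d" if x: "x \<in> S" and d: "0 < d" for x d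
  proof -
    obtain e where e: "e > 0" "ball x e \<subseteq> T" using T x open_contains_ball by blast
    obtain a b where ab: "a < x" "x < b" "b - a < min d e" "Q a b"
      using Q[OF x, of "min d e"] d e by auto
    have "{a<..<b} \<subseteq> ball x e" using ab by (auto simp: dist_real_def)
    then have "(a, b) \<in> K" using ab e by (auto simp: K_def)
    moreover have "x \<in> ball (?c (a, b)) (?r (a, b))" unfolding ball using ab by auto
    ultimately show ?thesis using ab by (intro bexI[of _ "(a, b)"]) auto
  qed
  then have "\<And>x d. \<lbrakk>x \<in> S; 0 < d\<rbrakk> \<Longrightarrow> \<exists>i. i \<in> K \<and> x \<in> ball (?c i) (?r i) \<and> ?r i < d" by blast
  from Vitali_covering_theorem_balls[OF this]
  obtain C where C: "countable C" "C \<subseteq> K"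
    "pairwise (\<lambda>i j. disjnt (ball (?c i) (?r i)) (ball (?c j) (?r j))) C"
    "negligible (S - (\<Union>i\<in>C. ball (?c i) (?r i)))" by blast
  show thesis
  proof (rule that[OF C(1)])
    show "disjoint_family_on (\<lambda>(a, b). {a<..<b}) C"
      using C(3) unfolding ball by (auto simp: disjoint_family_on_def pairwise_def disjnt_def)
    show "a < b \<and> {a<..<b} \<subseteq> T \<and> Q a b" if "(a, b) \<in> C" for a b
      using C(2) that by (auto simp: K_def)
    show "negligible (S - (\<Union>(a, b)\<in>C. {a<..<b}))" using C(4) unfolding ball .
  qed
qed

text \<open>The increments of \<open>F\<close> become a measure, so that they can be added over disjoint families of intervals.\<close>

lemma emeasure_interval_measure_Ioo:
  assumes "a \<le> b" "mono F" "continuous_on UNIV F"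
  shows "emeasure (interval_measure F) {a<..<b} = ennreal (F b - F a)"
proof (cases "a = b")
  case False
  have s: "emeasure (interval_measure F) {c} = 0" for c
    using emeasure_interval_measure_Icc[of c c F] assms by (auto simp: mono_def)
  have "emeasure (interval_measure F) {a..b} = emeasure (interval_measure F) ({a<..<b} \<union> {a, b})"
    using assms(1) by (intro arg_cong2[of _ _ _ _ emeasure]) auto
  also have "\<dots> = emeasure (interval_measure F) {a<..<b}"
  proof (rule emeasure_Un_null_set)
    show "{a, b} \<in> null_sets (interval_measure F)"
      using s[of a] s[of b] null_sets.Un[of "{a}" "interval_measure F" "{b}"]
      by (auto simp: null_sets_def insert_commute)
  qed auto
  finally show ?thesis
    using emeasure_interval_measure_Icc[of a b F] assms by (auto simp: mono_def)
qed auto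

lemma emeasure_Union_Ioo_le:
  assumes C: "countable C" "disjoint_family_on (\<lambda>(a, b). {a<..<b}) C"
    and M: "sets M = sets borel" and N: "sets N = sets borel"
    and le: "\<And>a b. (a, b) \<in> C \<Longrightarrow> emeasure M {a<..<b::real} \<le> c * emeasure N {a<..<b}"
  shows "emeasure M (\<Union>(a, b)\<in>C. {a<..<b}) \<le> c * emeasure N (\<Union>(a, b)\<in>C. {a<..<b})"
proof -
  have UN: "emeasure K (\<Union>(a, b)\<in>C. {a<..<b}) = (\<integral>\<^sup>+i. emeasure K (case i of (a, b) \<Rightarrow> {a<..<b}) \<partial>count_space C)"
    if "sets K = sets borel" for K :: "real measure"
  proof (rule emeasure_UN_countable[OF _ C])
    show "(case i of (a, b) \<Rightarrow> {a<..<b}) \<in> sets K" for i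
      unfolding that by (cases i) simp
  qed
  have "emeasure M (\<Union>(a, b)\<in>C. {a<..<b}) = (\<integral>\<^sup>+i. emeasure M (case i of (a, b) \<Rightarrow> {a<..<b}) \<partial>count_space C)"
    by (rule UN[OF M])
  also have "\<dots> \<le> (\<integral>\<^sup>+i. c * emeasure N (case i of (a, b) \<Rightarrow> {a<..<b}) \<partial>count_space C)"
    by (rule nn_integral_mono) (use le in auto)
  also have "\<dots> = c * (\<integral>\<^sup>+i. emeasure N (case i of (a, b) \<Rightarrow> {a<..<b}) \<partial>count_space C)"
    by (rule nn_integral_cmult) simp
  also have "(\<integral>\<^sup>+i. emeasure N (case i of (a, b) \<Rightarrow> {a<..<b}) \<partial>count_space C) = emeasure N (\<Union>(a, b)\<in>C. {a<..<b})"
    by (rule UN[OF N, symmetric])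
  finally show ?thesis .
qed

text \<open>Lebesgue's argument. Let \<open>s\<close> be the outer measure of \<open>S\<close>. Up to a null set, \<open>S\<close> is covered by disjoint
  intervals on which \<open>f\<close> grows by less than \<open>p\<close> times the length, inside an open set of measure close to \<open>s\<close>.
  Inside these intervals it is covered once more by disjoint intervals on which \<open>f\<close> grows by more than
  \<open>q\<close> times the length. Comparing the total growth on both families gives \<open>q s \<le> p s\<close>.\<close>

lemma negligible_distinct_derivates:
  fixes f :: "real \<Rightarrow> real"
  assumes f: "mono f" "continuous_on UNIV f" and pq: "0 < p" "p < q" and S: "bounded S"
    and lo: "\<And>x d. x \<in> S \<Longrightarrow> 0 < d \<Longrightarrow> \<exists>a b. a < x \<and> x < b \<and> b - a < d \<and> f b - f a < p * (b - a)"
    and hi: "\<And>x d. x \<in> S \<Longrightarrow> 0 < d \<Longrightarrow> \<exists>a b. a < x \<and> x < b \<and> b - a < d \<and> f b - f a > q * (b - a)"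
  shows "negligible S"
proof -
  let ?\<nu> = "interval_measure f"
  \<comment> \<open>the outer measure of \<open>S\<close>\<close>
  define s where "s = (INF U\<in>{U. open U \<and> S \<subseteq> U}. emeasure lborel U)"
  have s_le: "s \<le> emeasure lborel U" if "open U" "S \<subseteq> U" for U
    unfolding s_def using that by (intro INF_lower) auto
  obtain R where R: "S \<subseteq> ball 0 R" using S bounded_subset_ballD by blast
  have "s \<le> emeasure lborel (ball (0::real) R)" using R by (intro s_le) auto
  also have "\<dots> < \<infinity>" by (intro emeasure_bounded_finite) auto
  finally have sfin: "s < \<infinity>" .
  have null_cover: "\<exists>V. open V \<and> N \<subseteq> V \<and> emeasure lborel V < ennreal e" if N: "negligible N" and e: "e > 0" for N e
  proof -
    have "N \<in> sets lebesgue" using N by (simp add: negligible_imp_sets)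
    then obtain T where T: "open T" "N \<subseteq> T" "emeasure lebesgue (T - N) < ennreal e"
      using sets_lebesgue_outer_open[OF _ e] by metis
    have "emeasure lborel T = emeasure lebesgue ((T - N) \<union> N)" using T(1,2) by (simp add: Un_absorb2)
    also have "\<dots> = emeasure lebesgue (T - N)"
      using N T(1) by (intro emeasure_Un_null_set) (auto simp: negligible_iff_null_sets negligible_imp_sets)
    also note T(3)
    finally show ?thesis using T by blast
  qed
  have bound: "q * enn2real s \<le> p * (enn2real s + e) + q * e" if e: "e > 0" for e
  proof -
    have "s < s + ennreal e" using sfin e by (simp add: ennreal_lessI ennreal_add_left_cancel_less)
    then obtain U where U: "open U" "S \<subseteq> U" "emeasure lborel U < s + ennreal e"
      unfolding s_def INF_less_iff by auto
    obtain C where C: "countable C" "disjoint_family_on (\<lambda>(a, b). {a<..<b}) C"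
      "\<And>a b. (a, b) \<in> C \<Longrightarrow> a < b \<and> {a<..<b} \<subseteq> U \<and> f b - f a < p * (b - a)"
      "negligible (S - (\<Union>(a, b)\<in>C. {a<..<b}))"
      using vitali_open_intervals[OF U(1,2), of "\<lambda>a b. f b - f a < p * (b - a)"] lo by metis
    define A where "A = (\<Union>(a, b)\<in>C. {a<..<b})"
    have A: "open A" "A \<subseteq> U" unfolding A_def using C(3) by auto
    have "emeasure ?\<nu> A \<le> ennreal p * emeasure lborel A"
      unfolding A_def
      by (rule emeasure_Union_Ioo_le[OF C(1,2)])
        (use C(3) f pq in \<open>auto simp: emeasure_interval_measure_Ioo less_imp_le simp flip: ennreal_mult intro!: ennreal_leI\<close>)
    also have "\<dots> \<le> ennreal p * (s + ennreal e)"
      using U A by (intro mult_left_mono order.trans[OF emeasure_mono[of A U]]) auto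
    finally have \<nu>A: "emeasure ?\<nu> A \<le> ennreal p * (s + ennreal e)" .
    have "S \<inter> A \<subseteq> A" by auto
    from vitali_open_intervals[OF A(1) this, of "\<lambda>a b. f b - f a > q * (b - a)"] hi
    obtain B where B: "countable B" "disjoint_family_on (\<lambda>(a, b). {a<..<b}) B"
      "\<And>a b. (a, b) \<in> B \<Longrightarrow> a < b \<and> {a<..<b} \<subseteq> A \<and> f b - f a > q * (b - a)"
      "negligible (S \<inter> A - (\<Union>(a, b)\<in>B. {a<..<b}))"
      by (metis IntD1)
    define A' where "A' = (\<Union>(a, b)\<in>B. {a<..<b})"
    have A': "open A'" "A' \<subseteq> A" unfolding A'_def using B(3) by auto
    have "negligible (S - A')"
      using negligible_Un[OF C(4) B(4)] unfolding A_def[symmetric] A'_def[symmetric]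
      by (rule negligible_subset) auto
    then obtain V where V: "open V" "S - A' \<subseteq> V" "emeasure lborel V < ennreal e"
      using null_cover e by blast
    have "s \<le> emeasure lborel (A' \<union> V)" using A' V by (intro s_le) auto
    also have "\<dots> \<le> emeasure lborel A' + emeasure lborel V"
      using A' V by (intro emeasure_subadditive) auto
    also have "\<dots> \<le> emeasure lborel A' + ennreal e" using V by (intro add_left_mono) auto
    finally have sA': "s \<le> emeasure lborel A' + ennreal e" .
    have "ennreal q * emeasure lborel A' \<le> 1 * emeasure ?\<nu> A'"
    proof -
      have "emeasure lborel A' \<le> ennreal (1 / q) * emeasure ?\<nu> A'"
        unfolding A'_def
        by (rule emeasure_Union_Ioo_le[OF B(1,2)])
          (use B(3) f pq in \<open>auto simp: emeasure_interval_measure_Ioo less_imp_le field_simps simp flip: ennreal_mult' intro!: ennreal_leI\<close>)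
      then have "ennreal q * emeasure lborel A' \<le> ennreal q * (ennreal (1 / q) * emeasure ?\<nu> A')"
        by (intro mult_left_mono) auto
      also have "\<dots> = 1 * emeasure ?\<nu> A'"
        using pq by (simp add: mult.assoc[symmetric] flip: ennreal_mult')
      finally show ?thesis .
    qed
    also have "\<dots> \<le> emeasure ?\<nu> A" using A A' by (simp add: emeasure_mono)
    also note \<nu>A
    finally have qA': "ennreal q * emeasure lborel A' \<le> ennreal p * (s + ennreal e)" .
    have "ennreal q * s \<le> ennreal q * (emeasure lborel A' + ennreal e)"
      by (intro mult_left_mono sA') auto
    also have "\<dots> \<le> ennreal p * (s + ennreal e) + ennreal q * ennreal e"
      using qA' by (simp add: distrib_left add_right_mono)
    finally have fin: "ennreal q * s \<le> ennreal p * (s + ennreal e) + ennreal q * ennreal e" .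
    obtain t where t: "t \<ge> 0" "s = ennreal t" using sfin by (cases s) auto
    have "ennreal q * s = ennreal (q * t)" using t pq by (simp add: ennreal_mult)
    moreover have "ennreal p * (s + ennreal e) + ennreal q * ennreal e = ennreal (p * (t + e) + q * e)"
      using t pq e by (simp add: ennreal_mult)
    ultimately have "ennreal (q * t) \<le> ennreal (p * (t + e) + q * e)" using fin by simp
    then show ?thesis using t pq e by (subst (asm) ennreal_le_iff) (auto simp: t)
  qed
  have "q * enn2real s \<le> p * enn2real s"
  proof (rule field_le_epsilon)
    fix e :: real assume "e > 0"
    then have "q * enn2real s \<le> p * (enn2real s + e / (p + q)) + q * (e / (p + q))"
      using pq by (intro bound) simp
    also have "\<dots> = p * enn2real s + (p + q) * (e / (p + q))" by (simp only: algebra_simps)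
    also have "(p + q) * (e / (p + q)) = e" using pq by simp
    finally show "q * enn2real s \<le> p * enn2real s + e" .
  qed
  then have "\<not> 0 < enn2real s" using pq by (simp add: mult_le_cancel_right)
  then have "enn2real s = 0" using enn2real_nonneg[of s] by linarith
  then have s0: "s = 0" using sfin by (simp add: enn2real_eq_0_iff top.not_eq_extremum less_imp_neq)
  show ?thesis unfolding negligible_outer
  proof (intro allI impI)
    fix e :: real assume e: "e > 0"
    then have "s < ennreal e" using s0 by simp
    then obtain U where U: "open U" "S \<subseteq> U" "emeasure lborel U < ennreal e"
      unfolding s_def INF_less_iff by auto
    then have eU: "emeasure lebesgue U < ennreal e" by simp
    then have "emeasure lebesgue U < \<infinity>" by (rule less_trans) simp
    then have "U \<in> lmeasurable" using U(1) by (auto simp: fmeasurable_def)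
    moreover have "measure lebesgue U < e"
      using eU e \<open>U \<in> lmeasurable\<close> by (simp add: emeasure_eq_measure2 ennreal_less_iff)
    ultimately show "\<exists>T. S \<subseteq> T \<and> T \<in> lmeasurable \<and> measure lebesgue T < e"
      using U(2) by blast
  qed
qed

text \<open>A point of non-differentiability separates the lower from the upper derivate by rational numbers
  \<open>p < q\<close>; the Lipschitz bound excludes infinite derivates. There are countably many pairs \<open>(p, q)\<close>.\<close>

lemma lipschitz_mono_ae_differentiable:
  fixes f :: "real \<Rightarrow> real"
  assumes f: "mono f" "L-lipschitz_on UNIV f"
  shows "negligible {x. \<not> f differentiable (at x)}"
proof -
  have cont: "continuous_on UNIV f" using f(2) by (rule lipschitz_on_continuous_on)
  define lo where "lo = (\<lambda>p x. \<forall>d>0. \<exists>a b. a < x \<and> x < b \<and> b - a < d \<and> f b - f a < p * (b - a))"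
  define hi where "hi = (\<lambda>q x. \<forall>d>0. \<exists>a b. a < x \<and> x < b \<and> b - a < d \<and> f b - f a > q * (b - a))"
  define E where "E = (\<lambda>(p, q, m). {x. lo p x \<and> hi q x} \<inter> ball 0 (real m))"
  define I where "I = {(p, q, m). (p::real) \<in> \<rat> \<and> (q::real) \<in> \<rat> \<and> 0 < p \<and> p < q \<and> (m::nat) \<in> UNIV}"
  have "countable I"
  proof (rule countable_subset)
    show "I \<subseteq> \<rat> \<times> \<rat> \<times> UNIV" by (auto simp: I_def)
    show "countable (\<rat> \<times> \<rat> \<times> (UNIV :: nat set) :: (real \<times> real \<times> nat) set)"
      by (intro countable_SIGMA countable_rat) auto
  qed
  moreover have "negligible (E i)" if "i \<in> I" for i
  proof -
    obtain p q m where i: "i = (p, q, m)" by (cases i)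
    show ?thesis unfolding i E_def prod.case
      by (rule negligible_distinct_derivates[OF f(1) cont, of p q])
        (use that i in \<open>auto simp: I_def lo_def hi_def intro: bounded_subset[OF bounded_ball]\<close>)
  qed
  ultimately have neg: "negligible (\<Union> (E ` I))"
    by (intro negligible_countable_Union) auto
  have mem: "x \<in> \<Union> (E ` I)" if nd: "\<not> f differentiable (at x)" for x
  proof (rule ccontr)
    assume nx: "x \<notin> \<Union> (E ` I)"
    have sep: "\<not> (lo p x \<and> hi q x)" if p0: "0 < p" and pq: "p < q" for p q
    proof
      assume A: "lo p x \<and> hi q x"
      obtain p' where p': "p' \<in> \<rat>" "p < p'" "p' < q" using Rats_dense_in_real[OF pq] by blast
      obtain q' where q': "q' \<in> \<rat>" "p' < q'" "q' < q" using Rats_dense_in_real[OF p'(3)] by blast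
      obtain m :: nat where m: "\<bar>x\<bar> < real m" using reals_Archimedean2 by blast
      have "lo p' x" unfolding lo_def
      proof (intro allI impI)
        fix d :: real assume "d > 0"
        then obtain a b where "a < x" "x < b" "b - a < d" "f b - f a < p * (b - a)"
          using A unfolding lo_def by blast
        moreover have "p * (b - a) \<le> p' * (b - a)" using p' calculation by (intro mult_right_mono) auto
        ultimately show "\<exists>a b. a < x \<and> x < b \<and> b - a < d \<and> f b - f a < p' * (b - a)"
          by (intro exI[of _ a] exI[of _ b] conjI) linarith+
      qed
      moreover have "hi q' x" unfolding hi_def
      proof (intro allI impI)
        fix d :: real assume "d > 0"
        then obtain a b where "a < x" "x < b" "b - a < d" "f b - f a > q * (b - a)"
          using A unfolding hi_def by blast
        moreover have "q' * (b - a) \<le> q * (b - a)" using q' calculation by (intro mult_right_mono) auto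
        ultimately show "\<exists>a b. a < x \<and> x < b \<and> b - a < d \<and> f b - f a > q' * (b - a)"
          by (intro exI[of _ a] exI[of _ b] conjI) linarith+
      qed
      ultimately have "x \<in> E (p', q', m)" using m by (auto simp: E_def dist_real_def)
      moreover have "(p', q', m) \<in> I" using p' q' p0 by (auto simp: I_def)
      ultimately show False using nx by blast
    qed
    \<comment> \<open>its infimum is the lower derivate of \<open>f\<close> at \<open>x\<close>, the candidate for the derivative\<close>
    define P where "P = {p. 0 < p \<and> lo p x}"
    have L0: "L \<ge> 0" using f(2) by (rule lipschitz_on_nonneg)
    have Lb: "f b - f a \<le> L * (b - a)" if "a < b" for a b
      using lipschitz_onD[OF f(2), of b a] that by (auto simp: dist_real_def)
    have "L + 1 \<in> P"
    proof -
      have "lo (L + 1) x" unfolding lo_def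
      proof (intro allI impI)
        fix d :: real assume d: "d > 0"
        show "\<exists>a b. a < x \<and> x < b \<and> b - a < d \<and> f b - f a < (L + 1) * (b - a)"
          by (intro exI[of _ "x - d / 3"] exI[of _ "x + d / 3"])
            (use d Lb[of "x - d/3" "x + d/3"] in \<open>auto simp: algebra_simps\<close>)
      qed
      then show ?thesis using L0 by (auto simp: P_def)
    qed
    define D where "D = Inf P"
    have bdd: "bdd_below P" by (auto simp: P_def intro!: bdd_belowI[of _ 0])
    have slopes: "\<exists>d>0. \<forall>a b. a < x \<and> x < b \<and> b - a < d \<longrightarrow> \<bar>f b - f a - D * (b - a)\<bar> \<le> e * (b - a)"
      if e: "e > 0" for e
    proof -
      obtain p where p: "p \<in> P" "p < D + e"
        using cInf_lessD[of P "D + e"] \<open>L + 1 \<in> P\<close> e unfolding D_def by auto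
      have "\<not> hi (D + e) x" using sep[of p "D + e"] p by (auto simp: P_def)
      then obtain d1 where d1: "d1 > 0" "\<And>a b. a < x \<Longrightarrow> x < b \<Longrightarrow> b - a < d1 \<Longrightarrow> f b - f a \<le> (D + e) * (b - a)"
        unfolding hi_def by force
      obtain d2 where d2: "d2 > 0" "\<And>a b. a < x \<Longrightarrow> x < b \<Longrightarrow> b - a < d2 \<Longrightarrow> f b - f a \<ge> (D - e) * (b - a)"
      proof (cases "D - e > 0")
        case True
        then have "\<not> lo (D - e) x"
          using cInf_lower[OF _ bdd, of "D - e"] e unfolding D_def P_def by auto
        then show thesis using that unfolding lo_def by force
      next
        case False
        have "f b - f a \<ge> (D - e) * (b - a)" if "a < b" for a b
        proof -
          have "(D - e) * (b - a) \<le> 0" using False that by (simp add: mult_nonpos_nonneg)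
          also have "0 \<le> f b - f a" using monoD[OF f(1), of a b] that by simp
          finally show ?thesis .
        qed
        then show thesis using that[of 1] by auto
      qed
      show ?thesis
      proof (intro exI[of _ "min d1 d2"] conjI allI impI)
        fix a b assume "a < x \<and> x < b \<and> b - a < min d1 d2"
        then show "\<bar>f b - f a - D * (b - a)\<bar> \<le> e * (b - a)"
          using d1(2)[of a b] d2(2)[of a b] by (auto simp: algebra_simps abs_le_iff)
      qed (use d1 d2 in auto)
    qed
    have "(f has_derivative (\<lambda>h. D * h)) (at x)"
      unfolding has_derivative_at_alt
    proof (intro conjI allI impI)
      show "bounded_linear (\<lambda>h. D * h)" by (rule bounded_linear_mult_right)
      fix e :: real assume "e > 0"
      from slopes[OF this] obtain d where d: "d > 0"
        "\<forall>a b. a < x \<and> x < b \<and> b - a < d \<longrightarrow> \<bar>f b - f a - D * (b - a)\<bar> \<le> e * (b - a)"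
        by (elim exE conjE)
      have tl: "(f \<longlongrightarrow> f x) (at x within T)" for T
        using cont by (auto simp: continuous_on_eq_continuous_at isCont_def intro: tendsto_within_subset)
      have "norm (f y - f x - D * (y - x)) \<le> e * norm (y - x)" if y: "norm (y - x) < d" for y
      proof (cases y x rule: linorder_cases)
        case greater
        have ev: "\<forall>\<^sub>F a in at_left x. \<bar>f y - f a - D * (y - a)\<bar> \<le> e * (y - a)"
          by (intro eventually_mono[OF eventually_at_leftI[of "y - d" x]]) (use greater y d(2) in auto)
        have "\<bar>f y - f x - D * (y - x)\<bar> \<le> e * (y - x)"
          by (rule tendsto_le[OF _ _ _ ev]) (auto intro!: tendsto_intros tl)
        then show ?thesis using greater by simp
      next
        case less
        have ev: "\<forall>\<^sub>F b in at_right x. \<bar>f b - f y - D * (b - y)\<bar> \<le> e * (b - y)"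
          by (intro eventually_mono[OF eventually_at_rightI[of x "y + d"]]) (use less y d(2) in auto)
        have "\<bar>f x - f y - D * (x - y)\<bar> \<le> e * (x - y)"
          by (rule tendsto_le[OF _ _ _ ev]) (auto intro!: tendsto_intros tl)
        then show ?thesis using less by (simp add: abs_if algebra_simps split: if_splits)
      qed auto
      then show "\<exists>d>0. \<forall>y. norm (y - x) < d \<longrightarrow> norm (f y - f x - D * (y - x)) \<le> e * norm (y - x)"
        using d(1) by blast
    qed
    then show False using nd by (auto simp: differentiable_def)
  qed
  show ?thesis by (rule negligible_subset[OF neg]) (use mem in blast)
qed

section \<open>Radial functions and polar coordinates\<close>

lemma has_derivative_imp_grad:
  assumes "(u has_derivative (\<lambda>h. G \<bullet> h)) (at x)"
  shows "grad u x = G"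
  using frechet_derivative_at[OF assms, symmetric]
  by (simp add: grad_def vec_eq_iff inner_axis)

lemma differentiable_has_derivative_grad:
  assumes "u differentiable (at x)"
  shows "(u has_derivative (\<lambda>h. grad u x \<bullet> h)) (at x)"
proof -
  let ?D = "frechet_derivative u (at x)"
  have D: "(u has_derivative ?D) (at x)" using assms by (simp add: frechet_derivative_works)
  interpret D: bounded_linear ?D using D by (rule has_derivative_bounded_linear)
  have "?D h = grad u x \<bullet> h" for h
  proof -
    have "?D h = ?D (\<Sum>i\<in>UNIV. h $ i *\<^sub>R axis i 1)" using basis_expansion[of h] by (simp add: scalar_mult_eq_scaleR)
    also have "\<dots> = (\<Sum>i\<in>UNIV. h $ i * ?D (axis i 1))" by (simp add: D.sum D.scaleR)
    finally show ?thesis by (simp add: grad_def inner_vec_def mult.commute)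
  qed
  then have "?D = (\<lambda>h. grad u x \<bullet> h)" by (rule ext)
  then show ?thesis using D by simp
qed

lemma C1cI:
  fixes \<eta> :: "real^'n \<Rightarrow> real"
  assumes K: "compact K" "K \<subseteq> \<Omega>" and O: "open \<Omega>"
    and zero: "\<And>x. x \<notin> K \<Longrightarrow> \<eta> x = 0"
    and D: "\<And>x. x \<in> \<Omega> \<Longrightarrow> (\<eta> has_derivative (\<lambda>h. G x \<bullet> h)) (at x)"
    and G: "continuous_on \<Omega> G"
  shows "\<eta> \<in> C1c \<Omega>" "\<And>x. x \<in> \<Omega> \<Longrightarrow> grad \<eta> x = G x" "\<And>x. x \<notin> K \<Longrightarrow> grad \<eta> x = 0"
proof -
  show g1: "grad \<eta> x = G x" if "x \<in> \<Omega>" for x by (rule has_derivative_imp_grad[OF D[OF that]])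
  have oK: "open (- K)" using compact_imp_closed[OF K(1)] by (simp add: open_Compl)
  have D0: "(\<eta> has_derivative (\<lambda>h. 0 \<bullet> h)) (at x)" if "x \<notin> K" for x
  proof (rule has_derivative_transform_within_open[OF _ oK])
    show "((\<lambda>x. 0) has_derivative (\<lambda>h. 0 \<bullet> h)) (at x)" by simp
  qed (use that zero in auto)
  show g2: "grad \<eta> x = 0" if "x \<notin> K" for x by (rule has_derivative_imp_grad[OF D0[OF that]])
  have "continuous_on \<Omega> (grad \<eta>)" using G g1 by (simp cong: continuous_on_cong)
  moreover have "continuous_on (- K) (grad \<eta>)" by (rule continuous_on_eq[of _ "\<lambda>_. 0"]) (auto simp: g2)
  ultimately have "continuous_on (\<Omega> \<union> - K) (grad \<eta>)"
    using O oK by (intro continuous_on_open_Un)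
  moreover have "\<Omega> \<union> - K = UNIV" using K by auto
  moreover have "\<eta> differentiable (at x)" for x
    using D D0 K(2) by (cases "x \<in> K") (auto simp: differentiable_def)
  moreover have cl: "closure {x. \<eta> x \<noteq> 0} \<subseteq> K"
    using zero K(1) by (intro closure_minimal compact_imp_closed) auto
  moreover have "compact (closure {x. \<eta> x \<noteq> 0})"
    using compact_Int_closed[OF K(1) closed_closure[of "{x. \<eta> x \<noteq> 0}"]] cl by (simp add: Int_absorb1)
  ultimately show "\<eta> \<in> C1c \<Omega>"
    unfolding C1c_def using K by auto
qed

lemma C1cD:
  assumes "\<eta> \<in> C1c \<Omega>"
  obtains K where "compact K" "K \<subseteq> \<Omega>" "\<And>x. x \<notin> K \<Longrightarrow> \<eta> x = 0" "\<And>x. x \<notin> K \<Longrightarrow> grad \<eta> x = 0"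
    "\<And>x. (\<eta> has_derivative (\<lambda>h. grad \<eta> x \<bullet> h)) (at x)" "continuous_on UNIV (grad \<eta>)" "continuous_on UNIV \<eta>"
proof
  let ?K = "closure {x. \<eta> x \<noteq> 0}"
  show "compact ?K" "?K \<subseteq> \<Omega>" "continuous_on UNIV (grad \<eta>)" using assms by (auto simp: C1c_def)
  show z: "\<eta> x = 0" if "x \<notin> ?K" for x using that closure_subset[of "{x. \<eta> x \<noteq> 0}"] by auto
  show D: "(\<eta> has_derivative (\<lambda>h. grad \<eta> x \<bullet> h)) (at x)" for x
    using assms by (intro differentiable_has_derivative_grad) (auto simp: C1c_def)
  show "continuous_on UNIV \<eta>"
    using has_derivative_continuous[OF D] by (simp add: continuous_on_eq_continuous_at)
  show "grad \<eta> x = 0" if "x \<notin> ?K" for x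
  proof (rule has_derivative_imp_grad, rule has_derivative_transform_within_open)
    show "((\<lambda>x. 0) has_derivative (\<lambda>h. 0 \<bullet> h)) (at x)" by simp
    show "open (- ?K)" by (rule open_Compl[OF closed_closure])
    show "x \<in> - ?K" using that by simp
    show "0 = \<eta> y" if "y \<in> - ?K" for y using z[of y] that by simp
  qed
qed

lemma radial_has_derivative:
  fixes x :: "'a::real_inner"
  assumes "x \<noteq> 0" "(f has_real_derivative d) (at (norm x))"
  shows "((\<lambda>x. f (norm x)) has_derivative (\<lambda>h. ((d / norm x) *\<^sub>R x) \<bullet> h)) (at x)"
proof -
  have "(norm has_derivative (\<lambda>h. x \<bullet> h / norm x)) (at x)"
    using has_derivative_norm[OF assms(1)] by (simp add: sgn_div_norm inner_commute divide_inverse mult.commute)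
  from has_derivative_compose[OF this assms(2)[unfolded has_field_derivative_def]]
  show ?thesis by (simp add: mult.commute)
qed

lemma annulus_compact:
  assumes "0 < a" "b < 1"
  shows "compact {x::'a::euclidean_space. a \<le> norm x \<and> norm x \<le> b}"
    "{x::'a. a \<le> norm x \<and> norm x \<le> b} \<subseteq> ball 0 1 - {0}"
proof -
  have "{x::'a. a \<le> norm x \<and> norm x \<le> b} = cball 0 b - ball 0 a" by (auto simp: not_less)
  then show "compact {x::'a. a \<le> norm x \<and> norm x \<le> b}" by (simp add: compact_diff)
  show "{x::'a. a \<le> norm x \<and> norm x \<le> b} \<subseteq> ball 0 1 - {0}" using assms by auto
qed

text \<open>The supply of radial test functions: support in an annulus makes it sufficient that the profile is
  continuously differentiable on \<open>(0, 1)\<close>.\<close>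

lemma radial_C1c:
  fixes \<psi> \<psi>' :: "real \<Rightarrow> real"
  assumes ab: "0 < a" "b < 1" and z: "\<And>r. r \<in> {0<..<1} \<Longrightarrow> r \<notin> {a..b} \<Longrightarrow> \<psi> r = 0"
    and D: "\<And>r. r \<in> {0<..<1} \<Longrightarrow> (\<psi> has_real_derivative \<psi>' r) (at r)" and c: "continuous_on {0<..<1} \<psi>'"
  defines "\<eta> \<equiv> (\<lambda>x::real^'n. if norm x \<in> {a..b} then \<psi> (norm x) else 0)"
  shows "\<eta> \<in> C1c (ball 0 1 - {0})" "\<And>x. x \<in> ball 0 1 - {0} \<Longrightarrow> grad \<eta> x = (\<psi>' (norm x) / norm x) *\<^sub>R x"
    "\<And>x. norm x \<notin> {a..b} \<Longrightarrow> grad \<eta> x = 0"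
proof -
  let ?O = "ball 0 1 - {0::real^'n}"
  have oO: "open ?O" by auto
  have *: "(\<eta> has_derivative (\<lambda>h. ((\<psi>' (norm x) / norm x) *\<^sub>R x) \<bullet> h)) (at x)" if "x \<in> ?O" for x
  proof (rule has_derivative_transform_within_open[OF _ oO that])
    show "((\<lambda>x. \<psi> (norm x)) has_derivative (\<lambda>h. ((\<psi>' (norm x) / norm x) *\<^sub>R x) \<bullet> h)) (at x)"
      using that by (intro radial_has_derivative D) auto
  qed (auto simp: \<eta>_def z)
  have cont: "continuous_on ?O (\<lambda>x. (\<psi>' (norm x) / norm x) *\<^sub>R x)"
    by (intro continuous_intros continuous_on_compose2[OF c]) auto
  note R = C1cI[OF annulus_compact[OF ab] oO _ * cont, unfolded \<eta>_def]
  show "\<eta> \<in> C1c ?O" unfolding \<eta>_def by (rule R(1)) auto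
  show "grad \<eta> x = (\<psi>' (norm x) / norm x) *\<^sub>R x" if "x \<in> ?O" for x
    unfolding \<eta>_def by (rule R(2)[OF _ _ that]) auto
  show "grad \<eta> x = 0" if "norm x \<notin> {a..b}" for x
    unfolding \<eta>_def by (rule R(3)) (use that in auto)
qed

text \<open>The surface measure of the unit sphere.\<close>

definition sphere_area :: "'n::finite itself \<Rightarrow> real" where
  "sphere_area _ = real CARD('n) * unit_ball_vol (real CARD('n))"

lemma sphere_area_pos: "sphere_area TYPE('n::finite) > 0"
  by (simp add: sphere_area_def)

text \<open>Polar coordinates for radial functions, as an identity of measures on the line. Two finite measures
  agree if they agree on all half-lines \<open>(x, \<infinity>)\<close>, and there both sides are volumes of shells.\<close>

lemma distr_norm_ball:
  "distr (density lborel (indicator (ball (0::real^'n) 1))) borel norm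
    = density lborel (\<lambda>r. ennreal (indicator {0<..<1} r * (sphere_area TYPE('n) * r ^ (CARD('n) - 1))))"
  (is "?M = ?N")
proof (rule measure_eqI_lessThan)
  let ?n = "CARD('n)"
  have n0: "?n \<ge> 1" by (simp add: Suc_leI)
  show "sets ?M = sets borel" "sets ?N = sets borel" by auto
  have M: "emeasure ?M {x<..} = emeasure lborel (ball (0::real^'n) 1 - cball 0 x)" for x
  proof -
    have "emeasure ?M {x<..} = (\<integral>\<^sup>+y. indicator (ball (0::real^'n) 1) y * indicator (norm -` {x<..}) y \<partial>lborel)"
    proof -
      have op: "(norm -` {x<..} :: (real^'n) set) \<in> sets borel"
        by (intro borel_open open_vimage continuous_on_norm_id) auto
      have "emeasure ?M {x<..} = emeasure (density lborel (indicator (ball (0::real^'n) 1))) (norm -` {x<..})"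
        by (subst emeasure_distr) auto
      also have "\<dots> = (\<integral>\<^sup>+y. indicator (ball (0::real^'n) 1) y * indicator (norm -` {x<..}) y \<partial>lborel)"
        by (rule emeasure_density) (use op in \<open>auto intro!: borel_measurable_indicator\<close>)
      finally show ?thesis .
    qed
    also have "\<dots> = (\<integral>\<^sup>+y. indicator (ball (0::real^'n) 1 - cball 0 x) y \<partial>lborel)"
      by (intro nn_integral_cong) (auto split: split_indicator)
    finally show ?thesis by simp
  qed
  have "emeasure lborel (ball (0::real^'n) 1 - cball 0 x) \<le> emeasure lborel (ball (0::real^'n) 1)" for x
    by (intro emeasure_mono) auto
  also have "\<dots> < \<infinity>" by (intro emeasure_bounded_finite) auto
  finally show "emeasure ?M {x<..} < \<infinity>" for x unfolding M .
  have fin: "emeasure lborel S \<noteq> top" if "bounded S" for S :: "(real^'n) set"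
    using emeasure_bounded_finite[OF that] by simp
  show "emeasure ?M {x<..} = emeasure ?N {x<..}" for x
  proof -
    define y where "y = min 1 (max 0 x)"
    have y: "0 \<le> y" "y \<le> 1" by (auto simp: y_def)
    have "emeasure lborel (ball (0::real^'n) 1 - cball 0 x) = emeasure lborel (cball (0::real^'n) 1 - cball 0 y)"
    proof -
      have "emeasure lborel (ball (0::real^'n) 1 - cball 0 x) = emeasure lborel (ball (0::real^'n) 1 - cball 0 y)"
      proof (cases "x < 0")
        case True
        then have "ball (0::real^'n) 1 - cball 0 x = ball 0 1" "ball (0::real^'n) 1 - cball 0 y = ball 0 1 - {0}"
          by (auto simp: y_def)
        moreover have "emeasure lborel (ball (0::real^'n) 1 - {0}) = emeasure lborel (ball (0::real^'n) 1)"
          by (rule emeasure_Diff_null_set) auto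
        ultimately show ?thesis by simp
      next
        case False
        then have "ball (0::real^'n) 1 - cball 0 x = ball 0 1 - cball 0 y" by (auto simp: y_def)
        then show ?thesis by simp
      qed
      also have "\<dots> = emeasure lborel (ball (0::real^'n) 1) - emeasure lborel (ball (0::real^'n) 1 \<inter> cball 0 y)"
        by (subst emeasure_Diff[symmetric]) (auto intro!: arg_cong2[of _ _ _ _ emeasure] fin bounded_Int)
      also have "\<dots> = emeasure lborel (cball (0::real^'n) 1) - emeasure lborel (cball (0::real^'n) y)"
      proof (cases "y = 1")
        case True
        then have "ball (0::real^'n) 1 \<inter> cball 0 y = ball 0 1" by auto
        then show ?thesis using True by (simp add: emeasure_ball emeasure_cball)
      next
        case False
        then have "ball (0::real^'n) 1 \<inter> cball 0 y = cball 0 y" using y by auto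
        then show ?thesis by (simp add: emeasure_ball emeasure_cball)
      qed
      also have "\<dots> = emeasure lborel (cball (0::real^'n) 1 - cball 0 y)"
        using y by (subst emeasure_Diff) (auto intro!: fin)
      finally show ?thesis .
    qed
    also have "\<dots> = emeasure lborel (cball (0::real^'n) 1) - emeasure lborel (cball (0::real^'n) y)"
      using y by (subst emeasure_Diff) (auto intro!: fin)
    also have "\<dots> = ennreal (unit_ball_vol ?n * 1 ^ ?n - unit_ball_vol ?n * y ^ ?n)"
      using y by (simp add: emeasure_cball ennreal_minus)
    also have "\<dots> = (\<integral>\<^sup>+r. ennreal (sphere_area TYPE('n) * r ^ (?n - 1)) * indicator {y..1} r \<partial>lborel)"
    proof (rule nn_integral_FTC_Icc[symmetric])
      fix r :: real
      show "((\<lambda>r. unit_ball_vol ?n * r ^ ?n) has_real_derivative sphere_area TYPE('n) * r ^ (?n - 1)) (at r)"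
        unfolding sphere_area_def
        by (auto intro!: derivative_eq_intros)
      show "0 \<le> sphere_area TYPE('n) * r ^ (?n - 1)" if "r \<in> {y..1}"
        using that y sphere_area_pos[where 'n='n] by (auto intro!: mult_nonneg_nonneg)
    qed (use y in auto)
    also have "\<dots> = emeasure ?N {x<..}"
    proof -
      have "AE r in lborel. r \<noteq> y \<and> r \<noteq> (1::real)"
        using AE_lborel_singleton[of y] AE_lborel_singleton[of 1] by eventually_elim simp
      then have "AE r in lborel. ennreal (sphere_area TYPE('n) * r ^ (?n - 1)) * indicator {y..1} r
        = ennreal (indicator {0<..<1} r * (sphere_area TYPE('n) * r ^ (?n - 1))) * indicator {x<..} r"
        by eventually_elim (auto simp: y_def split: split_indicator)
      then show ?thesis
        by (subst emeasure_density) (auto intro!: nn_integral_cong_AE)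
    qed
    finally show ?thesis unfolding M .
  qed
qed

lemma polar_integral:
  fixes f :: "real \<Rightarrow> real"
  assumes f[measurable]: "f \<in> borel_measurable borel"
  shows "(LINT x:ball (0::real^'n) 1|lebesgue. f (norm x))
    = sphere_area TYPE('n) * (LINT r:{0<..<1}|lborel. r ^ (CARD('n) - 1) * f r)"
proof -
  have "(LINT x:ball (0::real^'n) 1|lebesgue. f (norm x)) = (LINT x|lborel. indicator (ball (0::real^'n) 1) x *\<^sub>R f (norm x))"
    unfolding set_lebesgue_integral_def
    by (rule integral_completion) (intro borel_measurable_scaleR borel_measurable_indicator; simp)
  also have "\<dots> = (LINT x|density lborel (indicator (ball (0::real^'n) 1)). f (norm x))"
  proof -
    have "(LINT x|density lborel (\<lambda>x. ennreal (indicator (ball (0::real^'n) 1) x)). f (norm x))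
        = (LINT x|lborel. indicator (ball (0::real^'n) 1) x *\<^sub>R f (norm x))"
      by (rule integral_density) (auto intro!: borel_measurable_indicator)
    then show ?thesis by (simp only: ennreal_indicator)
  qed
  also have "\<dots> = (LINT r|distr (density lborel (indicator (ball (0::real^'n) 1))) borel norm. f r)"
    by (rule integral_distr[symmetric]) measurable
  also have "\<dots> = (LINT r|lborel. (indicator {0<..<1} r * (sphere_area TYPE('n) * r ^ (CARD('n) - 1))) *\<^sub>R f r)"
    unfolding distr_norm_ball using sphere_area_pos[where 'n='n]
    by (intro integral_density) (auto split: split_indicator simp: less_imp_le)
  also have "\<dots> = (LINT r|lborel. sphere_area TYPE('n) * (indicator {0<..<1} r *\<^sub>R (r ^ (CARD('n) - 1) * f r)))"
    by (simp add: mult_ac)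
  finally show ?thesis by (simp add: set_lebesgue_integral_def)
qed

text \<open>The image of Lebesgue measure on the ball under the norm has a density, so null sets of radii have null
  preimages.\<close>

lemma AE_norm_ball:
  assumes "AE r in lborel. r \<in> {0<..<1} \<longrightarrow> P r"
  shows "AE x in lebesgue. x \<in> ball (0::real^'n) 1 \<longrightarrow> x \<noteq> 0 \<longrightarrow> P (norm x)"
proof -
  obtain N where N: "N \<in> null_sets lborel" "{r. \<not> (r \<in> {0<..<1} \<longrightarrow> P r)} \<subseteq> N"
    using assms by (auto elim!: AE_E simp: null_sets_def)
  then have [measurable]: "N \<in> sets borel" by auto
  have [measurable]: "ball (0::real^'n) 1 \<in> sets borel" by simp
  have "AE r in density lborel (\<lambda>r. ennreal (indicator {0<..<1} r * (sphere_area TYPE('n) * r ^ (CARD('n) - 1)))). r \<notin> N"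
    using AE_not_in[OF N(1)] by (subst AE_density) auto
  then have "AE r in distr (density lborel (indicator (ball (0::real^'n) 1))) borel norm. r \<notin> N"
    unfolding distr_norm_ball .
  then have "AE x in density lborel (indicator (ball (0::real^'n) 1)). norm x \<notin> N"
    by (subst (asm) AE_distr_iff) auto
  then have "AE x in lborel. x \<in> ball (0::real^'n) 1 \<longrightarrow> norm x \<notin> N"
  proof (subst (asm) AE_density)
    show "indicator (ball (0::real^'n) 1) \<in> borel_measurable lborel"
      by (intro borel_measurable_indicator) simp
  qed (auto elim!: eventually_mono split: split_indicator_asm)
  then have "AE x in lebesgue. x \<in> ball (0::real^'n) 1 \<longrightarrow> norm x \<notin> N"
    by (rule AE_completion)
  then show ?thesis
  proof eventually_elim
    case (elim x)
    then have "x \<noteq> 0 \<Longrightarrow> x \<in> ball 0 1 \<Longrightarrow> norm x \<in> {0<..<1} \<and> norm x \<notin> N" by auto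
    then show ?case using N(2) by blast
  qed
qed

section \<open>Tools from integration theory\<close>

lemma sets_borel_eq_cboxes:
  "sets (borel :: 'a::euclidean_space measure) = sigma_sets UNIV (range (\<lambda>(a, b). cbox a b))"
proof (rule antisym)
  show "sets (borel :: 'a measure) \<subseteq> sigma_sets UNIV (range (\<lambda>(a, b). cbox a b))"
    unfolding borel_def
  proof (simp, rule sigma_sets_mono, safe)
    fix S :: "'a set" assume "open S"
    obtain D where D: "countable D" "\<And>X. X \<in> D \<Longrightarrow> \<exists>a b. X = cbox a b" "\<Union>D = S"
      using open_countable_Union_open_cbox[OF \<open>open S\<close>] by metis
    have "\<Union>D \<in> sigma_sets UNIV (range (\<lambda>(a, b). cbox a b))"
    proof (rule sigma_sets_UNION[OF D(1)])
      fix X assume "X \<in> D"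
      then obtain a b where "X = cbox a b" using D(2) by blast
      then show "X \<in> sigma_sets UNIV (range (\<lambda>(a, b). cbox a b))"
        by (intro sigma_sets.Basic) auto
    qed
    then show "S \<in> sigma_sets UNIV (range (\<lambda>(a, b). cbox a b))" unfolding D(3) .
  qed
  show "sigma_sets UNIV (range (\<lambda>(a, b). cbox a b)) \<subseteq> sets (borel :: 'a measure)"
    by (subst sets.sigma_sets_subset[of _ borel, simplified]) auto
qed

text \<open>The boxes generate the Borel sets and are stable under intersection, so the integrals of \<open>f\<close> over all
  Borel sets vanish.\<close>

lemma AE_zero_if_cbox_integrals_zero:
  fixes f :: "'a::euclidean_space \<Rightarrow> real"
  assumes f: "integrable lebesgue f" and z: "\<And>a b. (LINT x:cbox a b|lebesgue. f x) = 0"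
  shows "AE x in lebesgue. f x = 0"
proof -
  obtain g where g: "g \<in> borel_measurable lborel" "AE x in lborel. f x = g x"
    using completion_ex_borel_measurable_real[of f lborel] f by auto
  have gl: "g \<in> borel_measurable lebesgue" using g(1) by (rule measurable_completion)
  have AE: "AE x in lebesgue. f x = g x" using g(2) by (rule AE_completion)
  have gi: "integrable lborel g"
    using integrable_cong_AE_imp[OF f gl] AE integrable_completion[OF g(1)]
    by (metis (mono_tags, lifting) AE_symmetric)
  have eq: "(LINT x:A|lborel. g x) = (LINT x:A|lebesgue. f x)" if "A \<in> sets borel" for A
  proof -
    have m: "(\<lambda>x. indicator A x *\<^sub>R g x) \<in> borel_measurable lborel"
      using that g(1) by (intro borel_measurable_scaleR borel_measurable_indicator) auto
    have "(LINT x:A|lborel. g x) = (LINT x|lebesgue. indicator A x *\<^sub>R g x)"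
      unfolding set_lebesgue_integral_def by (rule integral_completion[OF m, symmetric])
    also have "\<dots> = (LINT x|lebesgue. indicator A x *\<^sub>R f x)"
    proof (rule integral_cong_AE)
      show "(\<lambda>x. indicator A x *\<^sub>R g x) \<in> borel_measurable lebesgue" using m by (rule measurable_completion)
      show "(\<lambda>x. indicator A x *\<^sub>R f x) \<in> borel_measurable lebesgue"
        using that f by (intro borel_measurable_scaleR borel_measurable_indicator) auto
    qed (use AE in \<open>auto elim!: eventually_mono\<close>)
    finally show ?thesis by (simp add: set_lebesgue_integral_def)
  qed
  have "(LINT x:A|lborel. g x) = 0" if A: "A \<in> sigma_sets UNIV (range (\<lambda>(a, b). cbox a b))" for A
  proof -
    have st: "Int_stable (range (\<lambda>(a, b). cbox a b :: 'a set))"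
      by (auto simp: Int_stable_def Int_interval)
    have sub: "range (\<lambda>(a, b). cbox a b :: 'a set) \<subseteq> Pow UNIV" by auto
    have si: "set_integrable lborel A g" if "A \<in> sets borel" for A
      using that gi unfolding set_integrable_def by (intro integrable_mult_indicator) auto
    have full: "(LINT x|lborel. g x) = 0"
    proof -
      have "(\<lambda>m. LINT x:cbox (- (real m *\<^sub>R One)) (real m *\<^sub>R One)|lborel. g x) \<longlonglongrightarrow> (LINT x:(\<Union>m. cbox (- (real m *\<^sub>R One)) (real m *\<^sub>R One))|lborel. g x)"
      proof (rule set_integral_cont_up)
        show "incseq (\<lambda>m. cbox (- (real m *\<^sub>R One)) (real m *\<^sub>R One) :: 'a set)"
          unfolding incseq_def
          by (intro allI impI subset_box_imp) (auto simp: inner_sum_left inner_Basis)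
      qed (auto simp: si)
      also have "(\<Union>m. cbox (- (real m *\<^sub>R One)) (real m *\<^sub>R One)) = (UNIV :: 'a set)"
      proof -
        have "\<exists>m::nat. x \<in> cbox (- (real m *\<^sub>R One)) (real m *\<^sub>R One)" for x :: 'a
        proof -
          obtain m :: nat where "norm x < real m" using reals_Archimedean2 by blast
          then have "\<bar>x \<bullet> i\<bar> \<le> real m" if "i \<in> Basis" for i
            using Basis_le_norm[OF that, of x] by linarith
          then have "x \<in> cbox (- (real m *\<^sub>R One)) (real m *\<^sub>R One)"
            by (auto simp: mem_box inner_sum_left inner_Basis abs_le_iff minus_le_iff)
          then show ?thesis by blast
        qed
        then show ?thesis by auto
      qed
      finally have "(\<lambda>m. 0) \<longlonglongrightarrow> (LINT x:UNIV|lborel. g x)" by (simp add: eq z)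
      then show ?thesis by (simp add: LIMSEQ_const_iff set_lebesgue_integral_def)
    qed
    show ?thesis
      using st sub A
    proof (induction rule: sigma_sets_induct_disjoint)
      case (compl A)
      then have Ab: "A \<in> sets borel" by (simp add: sets_borel_eq_cboxes)
      have "(LINT x:(A \<union> (UNIV - A))|lborel. g x) = (LINT x:A|lborel. g x) + (LINT x:UNIV - A|lborel. g x)"
        by (rule set_integral_Un) (use Ab si in auto)
      then show ?case using compl full by (simp add: set_lebesgue_integral_def Un_Diff_cancel)
    next
      case (union A)
      then have Ab: "\<And>i. A i \<in> sets borel" by (auto simp: sets_borel_eq_cboxes)
      have "(LINT x:(\<Union>i. A i)|lborel. g x) = (\<Sum>i. (LINT x:A i|lborel. g x))"
        by (rule lebesgue_integral_countable_add) (use union Ab si in \<open>auto simp: disjoint_family_on_def\<close>)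
      then show ?case using union by simp
    next
      case (basic A)
      then obtain a b where "A = cbox a b" by auto
      then show ?case by (simp add: eq z)
    qed (simp add: set_lebesgue_integral_def)
  qed
  then have "AE x in lborel. g x = 0"
    by (intro density_unique_real[OF gi, of "\<lambda>_. 0"]) (auto simp: sets_borel_eq_cboxes set_lebesgue_integral_def)
  then have "AE x in lebesgue. g x = 0" by (rule AE_completion)
  then show ?thesis using AE by eventually_elim simp
qed

lemma has_field_derivative_within_Un:
  assumes "(f has_field_derivative d) (at x within S)" "(f has_field_derivative d) (at x within T)"
  shows "(f has_field_derivative d) (at x within S \<union> T)"
  using filterlim_sup[OF assms[unfolded has_field_derivative_iff]]
  by (simp add: has_field_derivative_iff flip: at_within_union)

text \<open>A continuously differentiable transition from 0 to 1: the slope of the cubic vanishes at 0 and at 1.\<close>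

definition smoothstep :: "real \<Rightarrow> real" where
  "smoothstep t = (let c = max 0 (min 1 t) in 3 * c^2 - 2 * c^3)"

definition smoothstep' :: "real \<Rightarrow> real" where
  "smoothstep' t = (let c = max 0 (min 1 t) in 6 * c * (1 - c))"

lemma smoothstep_simps:
  "t \<le> 0 \<Longrightarrow> smoothstep t = 0" "t \<ge> 1 \<Longrightarrow> smoothstep t = 1"
  "t \<le> 0 \<Longrightarrow> smoothstep' t = 0" "t \<ge> 1 \<Longrightarrow> smoothstep' t = 0"
  by (auto simp: smoothstep_def smoothstep'_def max_def min_def)

lemma smoothstep_bounds:
  "0 \<le> smoothstep t" "smoothstep t \<le> 1" "0 \<le> smoothstep' t" "smoothstep' t \<le> 2"
proof -
  define c where "c = max 0 (min 1 t)"
  have c: "0 \<le> c" "c \<le> 1" by (auto simp: c_def)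
  have 1: "smoothstep t = c^2 * (3 - 2 * c)" "smoothstep' t = 6 * c * (1 - c)"
    by (simp_all add: smoothstep_def smoothstep'_def c_def[symmetric] Let_def algebra_simps power2_eq_square power3_eq_cube)
  show "0 \<le> smoothstep t" "0 \<le> smoothstep' t" using c by (auto simp: 1)
  have "1 - smoothstep t = (1 - c)^2 * (1 + 2 * c)" by (simp add: 1 algebra_simps power2_eq_square)
  also have "\<dots> \<ge> 0" using c by auto
  finally show "smoothstep t \<le> 1" by simp
  have "2 - smoothstep' t = 6 * (c - 1/2)^2 + 1/2" by (simp add: 1 algebra_simps power2_eq_square)
  also have "\<dots> \<ge> 0" by auto
  finally show "smoothstep' t \<le> 2" by simp
qed

lemma continuous_smoothstep': "continuous_on A smoothstep'"
  unfolding smoothstep'_def Let_def by (intro continuous_intros)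

lemma smoothstep_has_derivative: "(smoothstep has_real_derivative smoothstep' t) (at t)"
proof -
  have 1: "((\<lambda>t. 3 * t^2 - 2 * t^3) has_real_derivative 6 * t * (1 - t)) (at t within S)" for t :: real and S
    by (auto intro!: derivative_eq_intros simp: algebra_simps power2_eq_square)
  have mid: "(smoothstep has_real_derivative smoothstep' t) (at t within {0..1})" if "t \<in> {0..1}" for t
  proof -
    have eq: "3 * x^2 - 2 * x^3 = smoothstep x" "6 * x * (1 - x) = smoothstep' x" if "x \<in> {0..1}" for x
      using that by (auto simp: smoothstep_def smoothstep'_def Let_def max_absorb2 min_absorb2)
    show ?thesis
      using has_field_derivative_transform_within[OF 1 zero_less_one that eq(1)] eq(2)[OF that] by simp
  qed
  have low: "(smoothstep has_real_derivative smoothstep' t) (at t within {..0})" if "t \<le> 0" for t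
    using has_field_derivative_transform_within[OF DERIV_const[of 0], of 1 t "{..0}" smoothstep] that
    by (auto simp: smoothstep_simps)
  have high: "(smoothstep has_real_derivative smoothstep' t) (at t within {1..})" if "t \<ge> 1" for t
    using has_field_derivative_transform_within[OF DERIV_const[of 1], of 1 t "{1..}" smoothstep] that
    by (auto simp: smoothstep_simps)
  consider "t < 0" | "t = 0" | "0 < t" "t < 1" | "t = 1" | "t > 1" by linarith
  then show ?thesis
  proof cases
    case 1
    then show ?thesis using low[of t] at_within_interior[of t "{..0}"] by (simp add: interior_Iic)
  next
    case 2
    have "(smoothstep has_real_derivative smoothstep' 0) (at 0 within {..0} \<union> {0..1})"
      using has_field_derivative_within_Un[OF low[of 0] mid[of 0]] by simp
    moreover have "0 \<in> interior ({..0} \<union> {0..1::real})" by (rule interiorI[of "{-1<..<1}"]) auto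
    ultimately show ?thesis unfolding \<open>t = 0\<close> by (simp only: at_within_interior)
  next
    case 3
    then show ?thesis using mid[of t] at_within_interior[of t "{0..1}"] by (simp add: interior_atLeastAtMost_real)
  next
    case 4
    have "(smoothstep has_real_derivative smoothstep' 1) (at 1 within {0..1} \<union> {1..})"
      using has_field_derivative_within_Un[OF mid[of 1] high[of 1]] by simp
    moreover have "1 \<in> interior ({0..1::real} \<union> {1..})" by (rule interiorI[of "{0<..<2}"]) auto
    ultimately show ?thesis unfolding \<open>t = 1\<close> by (simp only: at_within_interior)
  next
    case 5
    then show ?thesis using high[of t] at_within_interior[of t "{1..}"] by (simp add: interior_Ici)
  qed
qed

section \<open>The radial part of a weak gradient\<close>

definition annulus :: "real \<Rightarrow> real \<Rightarrow> 'a::real_normed_vector set" where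
  "annulus a b = {x. a \<le> norm x \<and> norm x \<le> b}"

lemma compact_annulus: "compact (annulus a b :: 'a::euclidean_space set)"
proof -
  have "annulus a b = cball (0::'a) b - ball 0 a" by (auto simp: annulus_def not_less)
  then show ?thesis by (simp add: compact_diff)
qed

lemma annulus_subset: "0 < a \<Longrightarrow> b < 1 \<Longrightarrow> annulus a b \<subseteq> ball 0 1 - {0}"
  by (auto simp: annulus_def)

lemma annulus_sets [measurable, simp]: "(annulus a b :: 'a::euclidean_space set) \<in> sets borel"
  using compact_annulus by (intro borel_compact)

lemma compact_in_annulus:
  fixes K :: "'a::euclidean_space set"
  assumes "compact K" "K \<subseteq> ball 0 1 - {0}"
  obtains a b where "0 < a" "a < b" "b < 1" "K \<subseteq> annulus a b"
proof (cases "K = {}")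
  case True
  then show thesis using that[of "1/4" "1/2"] by auto
next
  case False
  have c: "continuous_on K norm" by (intro continuous_intros)
  obtain x where x: "x \<in> K" "\<And>y. y \<in> K \<Longrightarrow> norm x \<le> norm y"
    using continuous_attains_inf[OF assms(1) False c] by blast
  obtain y where y: "y \<in> K" "\<And>z. z \<in> K \<Longrightarrow> norm z \<le> norm y"
    using continuous_attains_sup[OF assms(1) False c] by blast
  have 1: "0 < norm x" "norm y < 1" "norm x \<le> norm y" using x y assms(2) by auto
  show thesis
  proof (rule that[of "norm x / 2" "(norm y + 1) / 2"])
    show "K \<subseteq> annulus (norm x / 2) ((norm y + 1) / 2)"
    proof
      fix z assume z: "z \<in> K"
      have "norm x / 2 \<le> norm z" using x(2)[OF z] norm_ge_zero[of x] by linarith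
      moreover have "norm z \<le> (norm y + 1) / 2" using y(2)[OF z] 1(2)
        by (metis (no_types) add_mono_thms_linordered_field(3) less_eq_real_def mult_2 order_trans le_divide_eq_numeral1(1) mult.commute nless_le add_le_cancel_left)
      ultimately show "z \<in> annulus (norm x / 2) ((norm y + 1) / 2)" by (simp add: annulus_def)
    qed
  qed (use 1 in auto)
qed

lemma C1c_mono: "\<Omega> \<subseteq> \<Omega>' \<Longrightarrow> C1c \<Omega> \<subseteq> C1c \<Omega>'"
  by (auto simp: C1c_def)

text \<open>A compact subset of the punctured ball keeps a positive distance from the origin and from the sphere.\<close>

lemma C1c_annulusE:
  assumes "\<eta> \<in> C1c (ball 0 1 - {0::real^'n})"
  obtains a b M where "0 < a" "a < b" "b < 1" "0 \<le> M" "\<And>x. x \<notin> annulus a b \<Longrightarrow> \<eta> x = 0"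
    "\<And>x. x \<notin> annulus a b \<Longrightarrow> grad \<eta> x = 0" "\<And>x. \<bar>\<eta> x\<bar> \<le> M" "\<And>x. norm (grad \<eta> x) \<le> M"
    "\<And>x. (\<eta> has_derivative (\<lambda>h. grad \<eta> x \<bullet> h)) (at x)"
    "continuous_on UNIV (grad \<eta>)" "continuous_on UNIV \<eta>"
proof -
  obtain K where K: "compact K" "K \<subseteq> ball 0 1 - {0}" "\<And>x. x \<notin> K \<Longrightarrow> \<eta> x = 0"
    "\<And>x. x \<notin> K \<Longrightarrow> grad \<eta> x = 0" "\<And>x. (\<eta> has_derivative (\<lambda>h. grad \<eta> x \<bullet> h)) (at x)"
    "continuous_on UNIV (grad \<eta>)" "continuous_on UNIV \<eta>"
    using C1cD[OF assms] by blast
  obtain a b where ab: "0 < a" "a < b" "b < 1" "K \<subseteq> annulus a b"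
    using compact_in_annulus[OF K(1,2)] by blast
  have "bounded (\<eta> ` K)" "bounded (grad \<eta> ` K)"
    by (intro compact_imp_bounded compact_continuous_image K(1) continuous_on_subset[OF K(6)]
        continuous_on_subset[OF K(7)]; simp)+
  then obtain M1 M2 where "\<And>x. x \<in> K \<Longrightarrow> \<bar>\<eta> x\<bar> \<le> M1" "\<And>x. x \<in> K \<Longrightarrow> norm (grad \<eta> x) \<le> M2"
    unfolding bounded_iff by (metis imageI real_norm_def)
  then have M: "\<bar>\<eta> x\<bar> \<le> \<bar>M1\<bar> + \<bar>M2\<bar>" "norm (grad \<eta> x) \<le> \<bar>M1\<bar> + \<bar>M2\<bar>" for x
    using K(3,4)[of x] by (cases "x \<in> K"; fastforce)+
  show thesis
    by (rule that[OF ab(1-3) _ _ _ M K(5,6,7)]) (use ab K(3,4) in auto)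
qed

lemma absolutely_integrable_mult_continuous:
  fixes u :: "real^'n \<Rightarrow> real"
  assumes u: "u absolutely_integrable_on K" and K: "compact K" "K \<subseteq> S" and S: "S \<in> sets lebesgue"
    and G: "continuous_on K G" "\<And>x. x \<in> S \<Longrightarrow> x \<notin> K \<Longrightarrow> G x = 0"
  shows "(\<lambda>x. u x * G x) absolutely_integrable_on S"
proof -
  have Ks: "K \<in> sets lebesgue" using K(1) by (simp add: lmeasurable_compact fmeasurableD)
  have "(\<lambda>x. (\<lambda>a b. b * a) (G x) (u x)) absolutely_integrable_on K"
    by (rule absolutely_integrable_bounded_measurable_product[OF _ _ Ks _ u])
      (use G(1) K(1) Ks in \<open>auto intro!: compact_imp_bounded compact_continuous_image continuous_imp_measurable_on_sets_lebesgue
        simp: bilinear_def linear_iff algebra_simps\<close>)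
  moreover have "(\<lambda>x. indicator S x *\<^sub>R (u x * G x)) = (\<lambda>x. indicator K x *\<^sub>R (u x * G x))"
    using G(2) K(2) by (auto simp: fun_eq_iff split: split_indicator)
  ultimately show ?thesis by (simp add: set_integrable_def)
qed

lemma lborel_integral_dilation:
  fixes h :: "'a::euclidean_space \<Rightarrow> real"
  assumes "0 < s" and [measurable]: "h \<in> borel_measurable borel"
  shows "(LINT x|lborel. s ^ DIM('a) * h (s *\<^sub>R x)) = (LINT x|lborel. h x)"
proof -
  have "(LINT x|lborel. h x) = (LINT x|density (distr lborel borel (\<lambda>x::'a. 0 + s *\<^sub>R x)) (\<lambda>_. ennreal (s ^ DIM('a))). h x)"
    using assms(1) by (subst lborel_affine[of s 0]) (auto simp: ennreal_power)
  also have "\<dots> = (LINT x|distr lborel borel (\<lambda>x::'a. 0 + s *\<^sub>R x). s ^ DIM('a) *\<^sub>R h x)"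
    using assms(1) by (intro integral_density) auto
  also have "\<dots> = (LINT x|lborel. s ^ DIM('a) * h (s *\<^sub>R x))"
    by (subst integral_distr) auto
  finally show ?thesis ..
qed

text \<open>The measure with density \<open>|x|\<^sup>-\<^sup>n\<close> is invariant under dilations. Hence the difference quotients of \<open>f\<close> along
  \<open>x \<mapsto> (1 + t) x\<close> have integral zero, and so has their limit \<open>grad f x \<bullet> x\<close>.\<close>

lemma integral_radial_derivative_zero:
  fixes f :: "real^'n \<Rightarrow> real"
  assumes f: "f \<in> C1c (ball 0 1 - {0})"
  shows "(LINT x|lborel. (grad f x \<bullet> x) / norm x ^ CARD('n)) = 0"
proof -
  let ?n = "CARD('n)"
  obtain a b M where ab: "0 < a" "a < b" "b < 1" "0 \<le> M" and z: "\<And>x. x \<notin> annulus a b \<Longrightarrow> f x = 0"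
    "\<And>x. x \<notin> annulus a b \<Longrightarrow> grad f x = 0" and M: "\<And>x. \<bar>f x\<bar> \<le> M" "\<And>x. norm (grad f x) \<le> M"
    and D: "\<And>x. (f has_derivative (\<lambda>h. grad f x \<bullet> h)) (at x)"
    and cont: "continuous_on UNIV (grad f)" "continuous_on UNIV f"
    using C1c_annulusE[OF f] by blast
  have [measurable]: "f \<in> borel_measurable borel" "grad f \<in> borel_measurable borel"
    using cont by (auto intro: borel_measurable_continuous_onI)
  \<comment> \<open>dilation factors tending to 1\<close>
  define s where "s = (\<lambda>m. 1 + 1 / real (Suc m))"
  have s: "1 < s m" "s m \<le> 2" for m by (auto simp: s_def field_simps)
  define F where "F = (\<lambda>m x. real (Suc m) * (f (s m *\<^sub>R x) - f x) / norm x ^ ?n)"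
  have lip: "\<bar>f y - f x\<bar> \<le> M * norm (y - x)" for x y
  proof -
    have "onorm (\<lambda>h. grad f z \<bullet> h) \<le> M" for z
    proof (rule onorm_bound[OF ab(4)])
      fix h
      show "norm (grad f z \<bullet> h) \<le> M * norm h"
        using Cauchy_Schwarz_ineq2[of "grad f z" h] mult_right_mono[OF M(2)[of z] norm_ge_zero[of h]] by simp
    qed
    then show ?thesis
      using differentiable_bound[OF convex_UNIV, of f "\<lambda>x h. grad f x \<bullet> h" M y x] D by auto
  qed
  have intf: "integrable lborel (\<lambda>x. f x / norm x ^ ?n)"
  proof -
    have "integrable lborel (\<lambda>x. indicator (annulus a b) x *\<^sub>R (f x / norm x ^ ?n))"
      by (rule borel_integrable_compact[OF compact_annulus])
        (use ab cont(2) in \<open>auto intro!: continuous_intros simp: annulus_def intro: continuous_on_subset\<close>)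
    moreover have "(\<lambda>x. indicator (annulus a b) x *\<^sub>R (f x / norm x ^ ?n)) = (\<lambda>x. f x / norm x ^ ?n)"
      using z(1) by (auto simp: fun_eq_iff split: split_indicator)
    ultimately show ?thesis by simp
  qed
  have F0: "(LINT x|lborel. F m x) = 0" for m
  proof -
    have sc: "(\<lambda>x. f (s m *\<^sub>R x) / norm x ^ ?n) = (\<lambda>x. s m ^ ?n * (f (s m *\<^sub>R x) / norm (s m *\<^sub>R x) ^ ?n))"
      using s[of m] by (auto simp: fun_eq_iff power_mult_distrib)
    have i1: "(LINT x|lborel. f (s m *\<^sub>R x) / norm x ^ ?n) = (LINT x|lborel. f x / norm x ^ ?n)"
      unfolding sc using lborel_integral_dilation[of "s m" "\<lambda>x. f x / norm x ^ ?n"] s[of m] by simp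
    have "integrable lborel (\<lambda>x. f (s m *\<^sub>R x) / norm x ^ ?n)"
    proof -
      have "continuous_on UNIV (\<lambda>x. f (s m *\<^sub>R x))"
        by (rule continuous_on_compose2[OF cont(2)]) (auto intro!: continuous_intros)
      then have "integrable lborel (\<lambda>x. indicator (annulus (a/2) b) x *\<^sub>R (f (s m *\<^sub>R x) / norm x ^ ?n))"
        using ab by (intro borel_integrable_compact[OF compact_annulus])
          (auto intro!: continuous_intros simp: annulus_def intro: continuous_on_subset)
      moreover have "f (s m *\<^sub>R x) = 0" if "x \<notin> annulus (a/2) b" for x
      proof (rule z(1))
        have "norm (s m *\<^sub>R x) = s m * norm x" using s[of m] by simp
        moreover have "s m * norm x \<le> 2 * norm x" "1 * norm x \<le> s m * norm x"
          using s[of m] mult_right_mono[of "s m" 2 "norm x"] mult_right_mono[of 1 "s m" "norm x"] by auto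
        ultimately show "s m *\<^sub>R x \<notin> annulus a b" using that by (auto simp: annulus_def)
      qed
      then have "(\<lambda>x. indicator (annulus (a/2) b) x *\<^sub>R (f (s m *\<^sub>R x) / norm x ^ ?n)) = (\<lambda>x. f (s m *\<^sub>R x) / norm x ^ ?n)"
        by (auto simp: fun_eq_iff split: split_indicator)
      ultimately show ?thesis by simp
    qed
    then have "(LINT x|lborel. real (Suc m) * (f (s m *\<^sub>R x) / norm x ^ ?n - f x / norm x ^ ?n)) = 0"
      using intf i1 by (simp add: Bochner_Integration.integral_diff)
    then show ?thesis by (simp add: F_def diff_divide_distrib algebra_simps)
  qed
  have "(\<lambda>m. LINT x|lborel. F m x) \<longlonglongrightarrow> (LINT x|lborel. (grad f x \<bullet> x) / norm x ^ ?n)"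
  proof (rule integral_dominated_convergence)
    show "integrable lborel (\<lambda>x::real^'n. indicator (annulus (a/2) b) x *\<^sub>R (M / (a/2) ^ ?n))"
      by (rule borel_integrable_compact[OF compact_annulus]) auto
    show "AE x in lborel. (\<lambda>m. F m x) \<longlonglongrightarrow> (grad f x \<bullet> x) / norm x ^ ?n"
    proof (rule AE_I2)
      fix x :: "real^'n"
      have "((\<lambda>t. (1 + t) *\<^sub>R x) has_derivative (\<lambda>t. t *\<^sub>R x)) (at 0)"
        by (auto intro!: derivative_eq_intros)
      moreover have "(f has_derivative (\<lambda>h. grad f x \<bullet> h)) (at ((1 + 0) *\<^sub>R x))" using D by simp
      ultimately have "((\<lambda>t. f ((1 + t) *\<^sub>R x)) has_derivative (\<lambda>t. grad f x \<bullet> (t *\<^sub>R x))) (at 0)"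
        by (rule has_derivative_compose)
      then have "((\<lambda>t. f ((1 + t) *\<^sub>R x)) has_real_derivative (grad f x \<bullet> x)) (at 0)"
        by (simp add: has_field_derivative_def mult_commute_abs)
      then have "((\<lambda>h. (f ((1 + h) *\<^sub>R x) - f x) / h) \<longlongrightarrow> grad f x \<bullet> x) (at 0)"
        by (simp add: has_field_derivative_iff)
      moreover have "filterlim (\<lambda>m. 1 / real (Suc m)) (at 0) sequentially"
        using LIMSEQ_inverse_real_of_nat by (auto simp: filterlim_at inverse_eq_divide)
      ultimately have "(\<lambda>m. (f ((1 + 1 / real (Suc m)) *\<^sub>R x) - f x) / (1 / real (Suc m))) \<longlonglongrightarrow> grad f x \<bullet> x"
        by (rule filterlim_compose)
      then have "(\<lambda>m. ((f ((1 + 1 / real (Suc m)) *\<^sub>R x) - f x) / (1 / real (Suc m))) * (1 / norm x ^ ?n)) \<longlonglongrightarrow> (grad f x \<bullet> x) * (1 / norm x ^ ?n)"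
        by (rule tendsto_mult_right)
      then show "(\<lambda>m. F m x) \<longlonglongrightarrow> (grad f x \<bullet> x) / norm x ^ ?n"
        by (simp add: F_def s_def mult_ac)
    qed
    show "AE x in lborel. norm (F m x) \<le> indicator (annulus (a/2) b) x *\<^sub>R (M / (a/2) ^ ?n)" for m
    proof (rule AE_I2)
      fix x :: "real^'n"
      show "norm (F m x) \<le> indicator (annulus (a/2) b) x *\<^sub>R (M / (a/2) ^ ?n)"
      proof (cases "x \<in> annulus (a/2) b")
        case True
        then have x: "a/2 \<le> norm x" "norm x \<le> 1" using ab by (auto simp: annulus_def)
        have "\<bar>f (s m *\<^sub>R x) - f x\<bar> \<le> M * norm (s m *\<^sub>R x - x)" by (rule lip)
        also have "s m *\<^sub>R x - x = (1 / real (Suc m)) *\<^sub>R x" by (simp add: s_def algebra_simps)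
        also have "M * norm ((1 / real (Suc m)) *\<^sub>R x) \<le> M * (1 / real (Suc m))"
          using ab x by (intro mult_left_mono) (simp_all add: divide_right_mono)
        finally have 1: "real (Suc m) * \<bar>f (s m *\<^sub>R x) - f x\<bar> \<le> M"
          by (simp add: field_simps)
        have "norm (F m x) = (real (Suc m) * \<bar>f (s m *\<^sub>R x) - f x\<bar>) / norm x ^ ?n"
          by (simp add: F_def abs_mult)
        also have "\<dots> \<le> M / (a/2) ^ ?n"
          using 1 x ab by (intro frac_le power_mono zero_less_power) auto
        finally show ?thesis using True by simp
      next
        case False
        have "norm (s m *\<^sub>R x) = s m * norm x" using s[of m] by simp
        moreover have "s m * norm x \<le> 2 * norm x" "1 * norm x \<le> s m * norm x"
          using s[of m] mult_right_mono[of "s m" 2 "norm x"] mult_right_mono[of 1 "s m" "norm x"] by auto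
        ultimately have "s m *\<^sub>R x \<notin> annulus a b" "x \<notin> annulus a b" using False ab by (auto simp: annulus_def)
        then show ?thesis using z(1) False by (simp add: F_def)
      qed
    qed
  qed (auto simp: F_def)
  then show ?thesis using F0 by (simp add: LIMSEQ_const_iff)
qed

lemma has_real_derivative_inverse_power:
  fixes r :: real
  assumes "r \<noteq> 0"
  shows "((\<lambda>r. inverse (r ^ n)) has_real_derivative (- real n / r ^ (n + 1))) (at r)"
proof (cases n)
  case (Suc m)
  have "((\<lambda>r. inverse (r ^ Suc m)) has_real_derivative - (inverse (r ^ Suc m) * (real (Suc m) * r ^ m) * inverse (r ^ Suc m))) (at r)"
  proof (rule DERIV_inverse')
    show "((\<lambda>r. r ^ Suc m) has_real_derivative real (Suc m) * r ^ m) (at r)"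
      by (rule derivative_eq_intros refl)+ (simp add: algebra_simps)
  qed (use assms in simp)
  moreover have "- (inverse (r ^ Suc m) * (real (Suc m) * r ^ m) * inverse (r ^ Suc m)) = - real n / r ^ (n + 1)"
    using assms Suc by (simp add: field_simps)
  ultimately show ?thesis using Suc by simp
qed simp

text \<open>The definition of the weak gradient, applied to the vector field \<open>\<eta>(x) x/|x|\<^sup>n\<close>. As \<open>x/|x|\<^sup>n\<close> is free of
  divergence, only the derivative of \<open>\<eta>\<close> remains. The weight makes the radial measure \<open>r\<^sup>n\<^sup>-\<^sup>1 dr\<close> cancel.\<close>

lemma weak_gradient_radial_identity:
  fixes u :: "real^'n \<Rightarrow> real"
  assumes wg: "has_weak_gradient (ball 0 1) u Du" and eta: "\<eta> \<in> C1c (ball 0 1 - {0})"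
  shows "(LINT x:ball 0 1|lebesgue. u x * ((grad \<eta> x \<bullet> x) / norm x ^ CARD('n)))
    = - (LINT x:ball 0 1|lebesgue. (Du x \<bullet> x) / norm x ^ CARD('n) * \<eta> x)"
proof -
  let ?n = "CARD('n)" and ?B = "ball (0::real^'n) 1"
  obtain a b M where ab: "0 < a" "a < b" "b < 1" "0 \<le> M" and z: "\<And>x. x \<notin> annulus a b \<Longrightarrow> \<eta> x = 0"
    "\<And>x. x \<notin> annulus a b \<Longrightarrow> grad \<eta> x = 0" and M: "\<And>x. \<bar>\<eta> x\<bar> \<le> M" "\<And>x. norm (grad \<eta> x) \<le> M"
    and D: "\<And>x. (\<eta> has_derivative (\<lambda>h. grad \<eta> x \<bullet> h)) (at x)"
    and cont: "continuous_on UNIV (grad \<eta>)" "continuous_on UNIV \<eta>"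
    using C1c_annulusE[OF eta] by blast
  have sub: "annulus a b \<subseteq> ?B - {0}" using ab by (intro annulus_subset)
  have ui: "u absolutely_integrable_on annulus a b" and Di: "Du absolutely_integrable_on annulus a b"
    using wg[unfolded has_weak_gradient_def, THEN conjunct1, rule_format, of "annulus a b"] sub compact_annulus[of a b]
    by auto
  define \<eta>i where "\<eta>i = (\<lambda>i x. \<eta> x * (x $ i * inverse (norm x ^ ?n)))"
  define G where "G = (\<lambda>i x. (x $ i * inverse (norm x ^ ?n)) *\<^sub>R grad \<eta> x
     + (\<eta> x * inverse (norm x ^ ?n)) *\<^sub>R axis i 1
     - (\<eta> x * x $ i * (real ?n / norm x ^ (?n + 2))) *\<^sub>R x)"
  have dD: "(\<eta>i i has_derivative (\<lambda>h. G i x \<bullet> h)) (at x)" if x: "x \<in> ?B - {0}" for i x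
  proof -
    have x0: "norm x \<noteq> 0" using x by auto
    have "((\<lambda>r. inverse (r ^ ?n)) has_real_derivative (- real ?n / norm x ^ (?n + 1))) (at (norm x))"
      by (rule has_real_derivative_inverse_power[OF x0])
    from radial_has_derivative[OF _ this]
    have inv: "((\<lambda>x::real^'n. inverse (norm x ^ ?n)) has_derivative (\<lambda>h. ((- real ?n / norm x ^ (?n + 1) / norm x) *\<^sub>R x) \<bullet> h)) (at x)"
      using x by auto
    have comp: "((\<lambda>x::real^'n. x $ i) has_derivative (\<lambda>h. h $ i)) (at x)"
      by (rule bounded_linear_imp_has_derivative[OF bounded_linear_vec_nth])
    have "G i x \<bullet> h = \<eta> x * (x $ i * (((- real ?n / norm x ^ (?n + 1) / norm x) *\<^sub>R x) \<bullet> h) + h $ i * inverse (norm x ^ ?n))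
        + (grad \<eta> x \<bullet> h) * (x $ i * inverse (norm x ^ ?n))" for h
      by (simp add: G_def inner_add_left inner_diff_left inner_axis' algebra_simps)
    then show ?thesis unfolding \<eta>i_def
      using has_derivative_mult[OF D has_derivative_mult[OF comp inv]] by (simp add: ext)
  qed
  have Gc: "continuous_on (?B - {0}) (G i)" for i
    unfolding G_def
    by (intro continuous_intros continuous_on_subset[OF cont(1)] continuous_on_subset[OF cont(2)]) auto
  have etai: "\<eta>i i \<in> C1c (?B - {0})" "\<And>x. x \<in> ?B - {0} \<Longrightarrow> grad (\<eta>i i) x = G i x"
    "\<And>x. x \<notin> annulus a b \<Longrightarrow> grad (\<eta>i i) x = 0" for i
    using C1cI[OF compact_annulus sub _ _ dD Gc, of i] z(1) by (auto simp: \<eta>i_def)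
  have eq: "(LINT x:?B|lebesgue. u x * grad (\<eta>i i) x $ i) = - (LINT x:?B|lebesgue. Du x $ i * \<eta>i i x)" for i
    using wg[unfolded has_weak_gradient_def, THEN conjunct2] etai(1)[of i] C1c_mono[of "?B - {0}" ?B] by blast
  have Bs: "?B \<in> sets lebesgue" by simp
  have i1: "(\<lambda>x. u x * grad (\<eta>i i) x $ i) absolutely_integrable_on ?B" for i
  proof (rule absolutely_integrable_mult_continuous[OF ui compact_annulus _ Bs])
    show "continuous_on (annulus a b) (\<lambda>x. grad (\<eta>i i) x $ i)"
      using continuous_on_subset[OF Gc sub, of i] etai(2)[of _ i] sub
      by (intro continuous_intros) (metis (mono_tags, lifting) continuous_on_cong subsetD)
  qed (use sub etai(3) in auto)
  have i2: "(\<lambda>x. Du x $ i * \<eta>i i x) absolutely_integrable_on ?B" for i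
  proof (rule absolutely_integrable_mult_continuous[OF _ compact_annulus _ Bs])
    show "(\<lambda>x. Du x $ i) absolutely_integrable_on annulus a b"
      using absolutely_integrable_component[OF Di, of "axis i 1"] by (simp add: inner_axis)
    show "continuous_on (annulus a b) (\<eta>i i)"
      unfolding \<eta>i_def using sub
      by (intro continuous_intros continuous_on_subset[OF cont(2)]) auto
  qed (use sub z(1) in \<open>auto simp: \<eta>i_def\<close>)
  have div: "(\<Sum>i\<in>UNIV. grad (\<eta>i i) x $ i) = (grad \<eta> x \<bullet> x) / norm x ^ ?n" for x
  proof (cases "x \<in> annulus a b")
    case True
    then have x: "x \<in> ?B - {0}" using sub by auto
    then have x0: "norm x \<noteq> 0" by auto
    have "(\<Sum>i\<in>UNIV. grad (\<eta>i i) x $ i) = (\<Sum>i\<in>UNIV. inverse (norm x ^ ?n) * (grad \<eta> x $ i * x $ i))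
        + (\<Sum>i\<in>(UNIV::'n set). \<eta> x * inverse (norm x ^ ?n)) - (\<Sum>i\<in>UNIV. (\<eta> x * (real ?n / norm x ^ (?n + 2))) * (x $ i * x $ i))"
      unfolding sum.distrib[symmetric] sum_subtractf[symmetric] etai(2)[OF x]
      by (rule sum.cong) (simp_all add: G_def algebra_simps)
    also have "\<dots> = inverse (norm x ^ ?n) * (grad \<eta> x \<bullet> x) + real ?n * (\<eta> x * inverse (norm x ^ ?n))
        - (\<eta> x * (real ?n / norm x ^ (?n + 2))) * (x \<bullet> x)"
      by (simp only: sum_distrib_left[symmetric] sum_constant inner_vec_def inner_real_def) (simp only: mult_ac)
    also have "x \<bullet> x = norm x ^ 2" by (simp add: power2_norm_eq_inner)
    also have "inverse (norm x ^ ?n) * (grad \<eta> x \<bullet> x) + real ?n * (\<eta> x * inverse (norm x ^ ?n))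
        - (\<eta> x * (real ?n / norm x ^ (?n + 2))) * norm x ^ 2 = (grad \<eta> x \<bullet> x) / norm x ^ ?n"
      using x0 by (simp add: power_add power2_eq_square field_simps)
    finally show ?thesis .
  qed (use etai(3) z in auto)
  have "(LINT x:?B|lebesgue. u x * ((grad \<eta> x \<bullet> x) / norm x ^ ?n)) = (LINT x:?B|lebesgue. (\<Sum>i\<in>UNIV. u x * grad (\<eta>i i) x $ i))"
    by (simp add: div flip: sum_distrib_left)
  also have "\<dots> = (\<Sum>i\<in>UNIV. (LINT x:?B|lebesgue. u x * grad (\<eta>i i) x $ i))"
    using i1 unfolding set_lebesgue_integral_def set_integrable_def scaleR_sum_right
    by (intro Bochner_Integration.integral_sum) auto
  also have "\<dots> = - (\<Sum>i\<in>UNIV. (LINT x:?B|lebesgue. Du x $ i * \<eta>i i x))"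
    by (simp add: eq sum_negf)
  also have "(\<Sum>i\<in>UNIV. (LINT x:?B|lebesgue. Du x $ i * \<eta>i i x)) = (LINT x:?B|lebesgue. (\<Sum>i\<in>UNIV. Du x $ i * \<eta>i i x))"
    using i2 unfolding set_lebesgue_integral_def set_integrable_def scaleR_sum_right
    by (intro Bochner_Integration.integral_sum[symmetric]) auto
  also have "(\<lambda>x. \<Sum>i\<in>UNIV. Du x $ i * \<eta>i i x) = (\<lambda>x. (Du x \<bullet> x) / norm x ^ ?n * \<eta> x)"
  proof (rule ext)
    fix x
    have "Du x $ i * \<eta>i i x = Du x $ i * x $ i / norm x ^ ?n * \<eta> x" for i
      by (simp add: \<eta>i_def divide_inverse)
    then show "(\<Sum>i\<in>UNIV. Du x $ i * \<eta>i i x) = (Du x \<bullet> x) / norm x ^ ?n * \<eta> x"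
      by (simp only: inner_vec_def inner_real_def sum_divide_distrib sum_distrib_right)
  qed
  finally show ?thesis .
qed

lemma integral_smoothstep': "(LINT t|lborel. smoothstep' t) = 1" "integrable lborel smoothstep'"
proof -
  have e: "smoothstep' = (\<lambda>t. smoothstep' t * indicator {0..1} t)"
    using smoothstep_simps(3,4) by (auto simp: fun_eq_iff split: split_indicator)
  have m: "smoothstep' \<in> borel_measurable borel"
    by (intro borel_measurable_continuous_onI continuous_smoothstep')
  have "(LINT t|lborel. smoothstep' t * indicator {0..1} t) = smoothstep 1 - smoothstep 0"
    by (rule integral_FTC_Icc_nonneg) (use m smoothstep_has_derivative smoothstep_bounds in auto)
  then show "(LINT t|lborel. smoothstep' t) = 1" by (subst e) (simp add: smoothstep_simps)
  have "integrable lborel (\<lambda>t. smoothstep' t * indicator {0..1} t)"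
    by (rule integrable_FTC_Icc_nonneg[where F = smoothstep]) (use m smoothstep_has_derivative smoothstep_bounds in auto)
  then show "integrable lborel smoothstep'" by (subst e)
qed

text \<open>The rescaled bumps have integral one and concentrate at \<open>c\<close>.\<close>

lemma tendsto_integral_approximate_delta:
  fixes V :: "real \<Rightarrow> real"
  assumes V: "continuous_on UNIV V" "\<And>r. \<bar>V r\<bar> \<le> B"
  shows "(\<lambda>m. LINT r|lborel. V r * (real (Suc m) * smoothstep' (real (Suc m) * (r - c)))) \<longlonglongrightarrow> V c"
    "integrable lborel (\<lambda>r. V r * (real (Suc m) * smoothstep' (real (Suc m) * (r - c))))"
proof -
  have [measurable]: "V \<in> borel_measurable borel" "smoothstep' \<in> borel_measurable borel"
    using V by (auto intro!: borel_measurable_continuous_onI continuous_smoothstep')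
  have sub: "(LINT r|lborel. V r * (real (Suc m) * smoothstep' (real (Suc m) * (r - c))))
     = (LINT t|lborel. V (c + t / real (Suc m)) * smoothstep' t)" for m
    using lborel_integral_real_affine[of "1 / real (Suc m)" "\<lambda>r. V r * (real (Suc m) * smoothstep' (real (Suc m) * (r - c)))" c]
    by (simp add: mult.left_commute[of "V _" "1 + real m"])
  have int0: "integrable lborel (\<lambda>t. B * smoothstep' t)" using integral_smoothstep'(2) by simp
  have int: "integrable lborel (\<lambda>t. V (c + t / real (Suc m)) * smoothstep' t)" for m
    by (rule Bochner_Integration.integrable_bound[OF int0])
      (auto simp: abs_mult smoothstep_bounds intro!: mult_mono order_trans[OF V(2)])
  show "integrable lborel (\<lambda>r. V r * (real (Suc m) * smoothstep' (real (Suc m) * (r - c))))"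
    using int[of m] lborel_integrable_real_affine_iff[of "1 / real (Suc m)" "\<lambda>r. V r * (real (Suc m) * smoothstep' (real (Suc m) * (r - c)))" c]
    by (simp add: mult.left_commute[of "V _" "1 + real m"])
  have "(\<lambda>m. LINT t|lborel. V (c + t / real (Suc m)) * smoothstep' t) \<longlonglongrightarrow> (LINT t|lborel. V c * smoothstep' t)"
  proof (rule integral_dominated_convergence[OF _ _ int0])
    show "AE t in lborel. (\<lambda>m. V (c + t / real (Suc m)) * smoothstep' t) \<longlonglongrightarrow> V c * smoothstep' t"
    proof (rule AE_I2)
      fix t
      have "(\<lambda>m. c + t * inverse (real (Suc m))) \<longlonglongrightarrow> c + t * 0"
        by (intro tendsto_intros LIMSEQ_inverse_real_of_nat)
      then have "(\<lambda>m. V (c + t / real (Suc m))) \<longlonglongrightarrow> V c"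
        using V(1) by (intro isCont_tendsto_compose[of c V]) (auto simp: continuous_on_eq_continuous_at divide_inverse)
      then show "(\<lambda>m. V (c + t / real (Suc m)) * smoothstep' t) \<longlonglongrightarrow> V c * smoothstep' t"
        by (intro tendsto_intros)
    qed
    show "AE t in lborel. norm (V (c + t / real (Suc m)) * smoothstep' t) \<le> B * smoothstep' t" for m
      using V(2) smoothstep_bounds(3) by (auto simp: abs_mult intro!: mult_right_mono)
  qed auto
  then show "(\<lambda>m. LINT r|lborel. V r * (real (Suc m) * smoothstep' (real (Suc m) * (r - c)))) \<longlonglongrightarrow> V c"
    unfolding sub using integral_smoothstep'(1) by simp
qed

text \<open>Test functions that approximate the indicator of the shell have as radial derivative the difference of
  two approximate delta functions, at \<open>a\<close> and at \<open>b\<close>.\<close>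

lemma radial_flux_integral:
  fixes u :: "real^'n \<Rightarrow> real"
  assumes wg: "has_weak_gradient (ball 0 1) u Du" and rad: "\<And>x. x \<in> ball 0 1 \<Longrightarrow> u x = v (norm x)"
    and v: "continuous_on {0<..<1} v" and ab: "0 < a" "a < b" "b < 1"
  shows "(LINT x:{x. a < norm x \<and> norm x \<le> b}|lebesgue. (Du x \<bullet> x) / norm x ^ CARD('n)) = sphere_area TYPE('n) * (v b - v a)"
    and "(\<lambda>x. (Du x \<bullet> x) / norm x ^ CARD('n)) absolutely_integrable_on annulus a b"
proof -
  let ?n = "CARD('n)" and ?B = "ball (0::real^'n) 1" and ?A = "sphere_area TYPE('n)"
  define Q where "Q = (\<lambda>x::real^'n. (Du x \<bullet> x) / norm x ^ ?n)"
  have Qi: "Q absolutely_integrable_on annulus c d" if cd: "0 < c" "d < 1" for c d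
  proof -
    have sub: "annulus c d \<subseteq> ?B - {0}" using annulus_subset[OF cd] .
    have Di: "Du absolutely_integrable_on annulus c d"
      using wg[unfolded has_weak_gradient_def, THEN conjunct1, rule_format, of "annulus c d"] sub compact_annulus[of c d]
      by auto
    have "(\<lambda>x. Du x $ i * (x $ i / norm x ^ ?n)) absolutely_integrable_on annulus c d" for i
    proof (rule absolutely_integrable_mult_continuous[OF _ compact_annulus order_refl])
      show "(\<lambda>x. Du x $ i) absolutely_integrable_on annulus c d"
        using absolutely_integrable_component[OF Di, of "axis i 1"] by (simp add: inner_axis)
      show "continuous_on (annulus c d) (\<lambda>x. x $ i / norm x ^ ?n)"
        using sub by (intro continuous_intros) auto
    qed auto
    then have "(\<lambda>x. \<Sum>i\<in>UNIV. Du x $ i * (x $ i / norm x ^ ?n)) absolutely_integrable_on annulus c d"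
      by (intro absolutely_integrable_sum) auto
    moreover have "(\<lambda>x. \<Sum>i\<in>UNIV. Du x $ i * (x $ i / norm x ^ ?n)) = Q"
      by (simp add: Q_def fun_eq_iff inner_vec_def sum_divide_distrib)
    ultimately show ?thesis by simp
  qed
  show "(\<lambda>x. (Du x \<bullet> x) / norm x ^ CARD('n)) absolutely_integrable_on annulus a b"
    using Qi ab unfolding Q_def by auto
  define b' where "b' = (b + 1) / 2"
  have b': "b < b'" "b' < 1" using ab by (auto simp: b'_def)
  define V where "V = (\<lambda>r. v (max a (min b' r)))"
  have Vc: "continuous_on UNIV V"
    unfolding V_def by (intro continuous_on_compose2[OF v] continuous_intros) (use ab b' in auto)
  have "bounded (v ` {a..b'})"
    using ab b' by (intro compact_imp_bounded compact_continuous_image continuous_on_subset[OF v]) auto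
  then obtain B where "\<And>r. r \<in> {a..b'} \<Longrightarrow> \<bar>v r\<bar> \<le> B"
    unfolding bounded_iff by (metis imageI real_norm_def)
  then have VB: "\<bar>V r\<bar> \<le> B" for r using ab b' by (auto simp: V_def)
  define \<rho> where "\<rho> = (\<lambda>c m r. real (Suc m) * smoothstep' (real (Suc m) * (r - c)))"
  \<comment> \<open>tends to the indicator of \<open>(a, b]\<close>; the half-open interval is forced by the one-sided bumps\<close>
  define \<psi> where "\<psi> = (\<lambda>m r. smoothstep (real (Suc m) * (r - a)) - smoothstep (real (Suc m) * (r - b)))"
  define \<psi>' where "\<psi>' = (\<lambda>m r. \<rho> a m r - \<rho> b m r)"
  have D\<psi>: "(\<psi> m has_real_derivative \<psi>' m r) (at r)" for m r
    unfolding \<psi>_def \<psi>'_def \<rho>_def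
    by (auto intro!: derivative_eq_intros DERIV_chain2[OF smoothstep_has_derivative])
  have c\<psi>': "continuous_on S (\<psi>' m)" for S m
    unfolding \<psi>'_def \<rho>_def by (intro continuous_intros continuous_on_compose2[OF continuous_smoothstep']) auto
  obtain M0 :: nat where M0: "1 / (b' - b) < real M0" using reals_Archimedean2 by blast
  have big: "1 \<le> real (Suc m) * (r - c)" if "m \<ge> M0" "r \<ge> b'" "c \<le> b" for m r c
  proof -
    have "1 \<le> (b' - b) * real M0" using M0 b' by (simp add: field_simps)
    also have "\<dots> \<le> (r - c) * real (Suc m)" using that b' by (intro mult_mono) auto
    finally show ?thesis by (simp add: mult.commute)
  qed
  have z: "\<psi> m r = 0" "\<psi>' m r = 0" if m: "m \<ge> M0" and r: "r \<notin> {a<..<b'}" for m r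
  proof -
    consider "r \<le> a" | "r \<ge> b'" using r by force
    then have "\<psi> m r = 0 \<and> \<psi>' m r = 0"
    proof cases
      case 1
      then show ?thesis using ab by (auto simp: \<psi>_def \<psi>'_def \<rho>_def smoothstep_simps mult_nonneg_nonpos)
    next
      case 2
      then show ?thesis using big[OF m, of r a] big[OF m, of r b] ab
        by (auto simp: \<psi>_def \<psi>'_def \<rho>_def smoothstep_simps)
    qed
    then show "\<psi> m r = 0" "\<psi>' m r = 0" by auto
  qed
  define \<eta> where "\<eta> = (\<lambda>m (x::real^'n). if norm x \<in> {a..b'} then \<psi> m (norm x) else 0)"
  have eta: "\<eta> m \<in> C1c (?B - {0})" "\<And>x. x \<in> ?B - {0} \<Longrightarrow> grad (\<eta> m) x = (\<psi>' m (norm x) / norm x) *\<^sub>R x"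
    if m: "m \<ge> M0" for m
  proof -
    have z': "\<psi> m r = 0" if "r \<in> {0<..<1}" "r \<notin> {a..b'}" for r
      using z(1)[OF m, of r] that by auto
    note R = radial_C1c[OF ab(1) b'(2) z' D\<psi> c\<psi>', where 'n='n]
    show "\<eta> m \<in> C1c (?B - {0})" unfolding \<eta>_def by (rule R(1))
    show "grad (\<eta> m) x = (\<psi>' m (norm x) / norm x) *\<^sub>R x" if "x \<in> ?B - {0}" for x
      unfolding \<eta>_def by (rule R(2)[OF _ _ that])
  qed
  have LHS: "(LINT x:?B|lebesgue. u x * ((grad (\<eta> m) x \<bullet> x) / norm x ^ ?n))
     = ?A * ((LINT r|lborel. V r * \<rho> a m r) - (LINT r|lborel. V r * \<rho> b m r))" if m: "m \<ge> M0" for m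
  proof -
    define f where "f = (\<lambda>r. indicator {a..b'} r * (V r * \<psi>' m r * (r / r ^ ?n)))"
    have fm: "f \<in> borel_measurable borel"
    proof -
      have "continuous_on {a..b'} (\<lambda>r. V r * \<psi>' m r * (r / r ^ ?n))"
        using ab by (intro continuous_intros continuous_on_subset[OF Vc] c\<psi>') auto
      then have "(\<lambda>r. indicator {a..b'} r *\<^sub>R (V r * \<psi>' m r * (r / r ^ ?n))) \<in> borel_measurable borel"
        by (intro borel_measurable_continuous_on_indicator) auto
      then show ?thesis by (simp add: f_def)
    qed
    have "(LINT x:?B|lebesgue. u x * ((grad (\<eta> m) x \<bullet> x) / norm x ^ ?n)) = (LINT x:?B|lebesgue. f (norm x))"
    proof (rule set_lebesgue_integral_cong; safe?)
      fix x :: "real^'n" assume x: "x \<in> ?B"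
      show "u x * ((grad (\<eta> m) x \<bullet> x) / norm x ^ ?n) = f (norm x)"
      proof (cases "x = 0")
        case True
        then show ?thesis using ab by (simp add: f_def)
      next
        case False
        then have g: "grad (\<eta> m) x \<bullet> x = \<psi>' m (norm x) * norm x"
          using eta(2)[OF m, of x] x by (simp add: power2_norm_eq_inner[symmetric] power2_eq_square)
        show ?thesis
        proof (cases "norm x \<in> {a..b'}")
          case True
          then show ?thesis using rad[OF x] by (simp add: f_def V_def g)
        next
          case F: False
          then have "\<psi>' m (norm x) = 0" using z(2)[OF m, of "norm x"] by auto
          then show ?thesis by (simp add: f_def g)
        qed
      qed
    qed auto
    also have "\<dots> = ?A * (LINT r:{0<..<1}|lborel. r ^ (?n - 1) * f r)" by (rule polar_integral[OF fm])
    also have "(LINT r:{0<..<1}|lborel. r ^ (?n - 1) * f r) = (LINT r|lborel. V r * \<rho> a m r - V r * \<rho> b m r)"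
      unfolding set_lebesgue_integral_def
    proof (rule Bochner_Integration.integral_cong[OF refl])
      fix r :: real
      show "indicator {0<..<1} r *\<^sub>R (r ^ (?n - 1) * f r) = V r * \<rho> a m r - V r * \<rho> b m r"
      proof (cases "r \<in> {a..b'}")
        case True
        then have r0: "r > 0" "r < 1" using ab b' by auto
        have "r ^ (?n - 1) * (r / r ^ ?n) = 1" using r0
          by (metis (no_types, opaque_lifting) One_nat_def Suc_pred divide_self mult.commute power_Suc times_divide_eq_right zero_less_card_finite less_irrefl power_eq_0_iff)
        then have "r ^ (?n - 1) * f r = V r * \<psi>' m r" using True by (simp add: f_def mult_ac)
        then show ?thesis using r0 by (simp add: \<psi>'_def right_diff_distrib)
      next
        case False
        then have "\<psi>' m r = 0" using z(2)[OF m, of r] by auto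
        then have "V r * \<rho> a m r - V r * \<rho> b m r = 0" by (simp add: \<psi>'_def flip: right_diff_distrib)
        then show ?thesis using False by (simp add: f_def)
      qed
    qed
    also have "\<dots> = (LINT r|lborel. V r * \<rho> a m r) - (LINT r|lborel. V r * \<rho> b m r)"
      using tendsto_integral_approximate_delta(2)[OF Vc VB] unfolding \<rho>_def by (intro Bochner_Integration.integral_diff) auto
    finally show ?thesis .
  qed
  have lim1: "(\<lambda>m. LINT x:?B|lebesgue. u x * ((grad (\<eta> m) x \<bullet> x) / norm x ^ ?n)) \<longlonglongrightarrow> ?A * (V a - V b)"
  proof (rule Lim_transform_eventually)
    show "(\<lambda>m. ?A * ((LINT r|lborel. V r * \<rho> a m r) - (LINT r|lborel. V r * \<rho> b m r))) \<longlonglongrightarrow> ?A * (V a - V b)"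
      unfolding \<rho>_def by (intro tendsto_intros tendsto_integral_approximate_delta(1)[OF Vc VB])
    show "\<forall>\<^sub>F m in sequentially. ?A * ((LINT r|lborel. V r * \<rho> a m r) - (LINT r|lborel. V r * \<rho> b m r))
        = (LINT x:?B|lebesgue. u x * ((grad (\<eta> m) x \<bullet> x) / norm x ^ ?n))"
      by (rule eventually_mono[OF eventually_ge_at_top[of M0]]) (rule LHS[symmetric])
  qed
  let ?H = "{x::real^'n. a < norm x \<and> norm x \<le> b}"
  have QB: "(\<lambda>x. indicator (annulus a b') x *\<^sub>R Q x) \<in> borel_measurable lebesgue"
    "integrable lebesgue (\<lambda>x. indicator (annulus a b') x *\<^sub>R \<bar>Q x\<bar>)"
    using Qi[OF ab(1) b'(2)] set_integrable_abs[OF Qi[OF ab(1) b'(2)]] by (auto simp: set_integrable_def)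
  have Hs: "?H \<in> sets borel"
  proof -
    have "?H = cball 0 b - cball 0 a" by auto
    then show ?thesis by simp
  qed
  have eta_eq: "indicator ?B x *\<^sub>R (Q x * \<eta> m x) = \<eta> m x * (indicator (annulus a b') x *\<^sub>R Q x)" for m x
    using b' by (auto simp: \<eta>_def annulus_def split: split_indicator)
  have lim2: "(\<lambda>m. LINT x:?B|lebesgue. Q x * \<eta> m x) \<longlonglongrightarrow> (LINT x:?H|lebesgue. Q x)"
    unfolding set_lebesgue_integral_def
  proof (rule integral_dominated_convergence[OF _ _ QB(2)])
    have e: "\<eta> m = (\<lambda>x. indicator (annulus a b') x *\<^sub>R \<psi> m (norm x))" for m
      by (auto simp: \<eta>_def annulus_def fun_eq_iff split: split_indicator)
    have c: "continuous_on S (\<lambda>x::real^'n. \<psi> m (norm x))" for S m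
      by (rule continuous_on_compose2[of UNIV "\<psi> m"])
        (auto intro!: continuous_intros DERIV_continuous_on D\<psi>)
    have "\<eta> m \<in> borel_measurable borel" for m
      unfolding e by (rule borel_measurable_continuous_on_indicator[OF annulus_sets c])
    then have [measurable]: "\<eta> m \<in> borel_measurable lebesgue" for m
      by (intro measurable_completion) simp
    show "(\<lambda>x. indicator ?B x *\<^sub>R (Q x * \<eta> m x)) \<in> borel_measurable lebesgue" for m
      unfolding eta_eq using QB(1) by (intro borel_measurable_times) auto
    have "(\<lambda>x. indicator ?H x *\<^sub>R Q x) = (\<lambda>x. indicator ?H x *\<^sub>R (indicator (annulus a b') x *\<^sub>R Q x))"
      using b' by (auto simp: fun_eq_iff annulus_def split: split_indicator)
    moreover have "(\<lambda>x. indicator ?H x *\<^sub>R (indicator (annulus a b') x *\<^sub>R Q x)) \<in> borel_measurable lebesgue"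
      by (rule borel_measurable_scaleR[OF borel_measurable_indicator QB(1)]) (use Hs in simp)
    ultimately show "(\<lambda>x. indicator ?H x *\<^sub>R Q x) \<in> borel_measurable lebesgue" by simp
    show "AE x in lebesgue. (\<lambda>m. indicator ?B x *\<^sub>R (Q x * \<eta> m x)) \<longlonglongrightarrow> indicator ?H x *\<^sub>R Q x"
    proof (rule AE_I2)
      fix x :: "real^'n"
      have "(\<lambda>m. \<eta> m x) \<longlonglongrightarrow> indicator ?H x"
      proof (cases "x \<in> ?H")
        case True
        obtain M1 :: nat where M1: "1 / (norm x - a) < real M1" using reals_Archimedean2 by blast
        have "\<eta> m x = 1" if "m \<ge> M1" for m
        proof -
          have "1 \<le> (norm x - a) * real M1" using M1 True by (simp add: field_simps)
          also have "\<dots> \<le> (norm x - a) * real (Suc m)" using that True by (intro mult_left_mono) auto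
          finally show ?thesis using True b'
            by (auto simp: \<eta>_def \<psi>_def smoothstep_simps mult_nonpos_nonneg mult.commute)
        qed
        then have "\<forall>\<^sub>F m in sequentially. \<eta> m x = 1" by (auto simp: eventually_sequentially)
        then show ?thesis using True by (simp add: tendsto_eventually)
      next
        case False
        have "\<forall>\<^sub>F m in sequentially. \<eta> m x = 0"
        proof (cases "norm x \<le> a")
          case True
          then show ?thesis using ab
            by (auto simp: \<eta>_def \<psi>_def smoothstep_simps mult_nonneg_nonpos)
        next
          case F: False
          then have xb: "norm x > b" using False by auto
          obtain M1 :: nat where M1: "1 / (norm x - b) < real M1" using reals_Archimedean2 by blast
          have "\<eta> m x = 0" if "m \<ge> M1" for m
          proof -
            have 1: "1 \<le> (norm x - b) * real M1" using M1 xb by (simp add: field_simps)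
            also have "\<dots> \<le> (norm x - b) * real (Suc m)" using that xb by (intro mult_left_mono) auto
            finally have 2: "1 \<le> real (Suc m) * (norm x - b)" by (simp add: mult.commute)
            also have "\<dots> \<le> real (Suc m) * (norm x - a)" using ab by (intro mult_left_mono) auto
            finally show ?thesis using 2 by (simp add: \<eta>_def \<psi>_def smoothstep_simps)
          qed
          then show ?thesis by (auto simp: eventually_sequentially)
        qed
        then show ?thesis using False by (simp add: tendsto_eventually)
      qed
      then have "(\<lambda>m. \<eta> m x * (indicator (annulus a b') x *\<^sub>R Q x)) \<longlonglongrightarrow> indicator ?H x * (indicator (annulus a b') x *\<^sub>R Q x)"
        by (intro tendsto_intros)
      moreover have "indicator ?H x * (indicator (annulus a b') x *\<^sub>R Q x) = indicator ?H x *\<^sub>R Q x"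
        using b' by (auto simp: annulus_def split: split_indicator)
      ultimately show "(\<lambda>m. indicator ?B x *\<^sub>R (Q x * \<eta> m x)) \<longlonglongrightarrow> indicator ?H x *\<^sub>R Q x"
        unfolding eta_eq by (simp only:)
    qed
    have eb: "\<bar>\<eta> m x\<bar> \<le> 1" for m x
      using smoothstep_bounds(1,2)[of "real (Suc m) * (norm x - a)"] smoothstep_bounds(1,2)[of "real (Suc m) * (norm x - b)"]
      by (auto simp: \<eta>_def \<psi>_def abs_le_iff)
    show "AE x in lebesgue. norm (indicator ?B x *\<^sub>R (Q x * \<eta> m x)) \<le> indicator (annulus a b') x *\<^sub>R \<bar>Q x\<bar>" for m
    proof (rule AE_I2)
      fix x :: "real^'n"
      have "norm (\<eta> m x * (indicator (annulus a b') x *\<^sub>R Q x)) = \<bar>\<eta> m x\<bar> * (indicator (annulus a b') x *\<^sub>R \<bar>Q x\<bar>)"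
        by (simp add: abs_mult)
      also have "\<dots> \<le> 1 * (indicator (annulus a b') x *\<^sub>R \<bar>Q x\<bar>)"
        by (intro mult_right_mono eb) auto
      finally show "norm (indicator ?B x *\<^sub>R (Q x * \<eta> m x)) \<le> indicator (annulus a b') x *\<^sub>R \<bar>Q x\<bar>"
        unfolding eta_eq by simp
    qed
  qed
  have "(\<lambda>m. LINT x:?B|lebesgue. u x * ((grad (\<eta> m) x \<bullet> x) / norm x ^ ?n)) \<longlonglongrightarrow> - (LINT x:?H|lebesgue. Q x)"
  proof (rule Lim_transform_eventually[OF tendsto_minus[OF lim2]])
    show "\<forall>\<^sub>F m in sequentially. - (LINT x:?B|lebesgue. Q x * \<eta> m x)
       = (LINT x:?B|lebesgue. u x * ((grad (\<eta> m) x \<bullet> x) / norm x ^ ?n))"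
      by (rule eventually_mono[OF eventually_ge_at_top[of M0]])
        (use weak_gradient_radial_identity[OF wg eta(1)] in \<open>simp add: Q_def\<close>)
  qed
  from LIMSEQ_unique[OF this lim1] have "(LINT x:?H|lebesgue. Q x) = ?A * (V b - V a)" by (simp add: algebra_simps)
  moreover have "V a = v a" "V b = v b" using ab b' by (auto simp: V_def)
  ultimately show "(LINT x:?H|lebesgue. (Du x \<bullet> x) / norm x ^ ?n) = ?A * (v b - v a)"
    unfolding Q_def by simp
qed


text \<open>Absolute continuity of the measure of fluxes rests on this.\<close>

lemma lborel_null_preimage_norm:
  assumes "B \<in> null_sets lborel"
  shows "AE x in lebesgue. x \<in> ball (0::real^'n) 1 - {0} \<longrightarrow> norm x \<notin> B"
proof -
  have "AE r in lborel. r \<in> {0<..<1} \<longrightarrow> r \<notin> B" using AE_not_in[OF assms] by eventually_elim simp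
  from AE_norm_ball[OF this, where 'n='n] show ?thesis by eventually_elim auto
qed

text \<open>For a weakly differentiable radial function the profile is absolutely continuous. The fluxes through shells
  define a measure on radii; it is absolutely continuous since null sets of radii have null preimages, and its
  Radon-Nikodym density is the derivative. The sign condition makes it a positive measure.\<close>

lemma radial_profile_density:
  fixes u :: "real^'n \<Rightarrow> real"
  assumes wg: "has_weak_gradient (ball 0 1) u Du" and rad: "\<And>x. x \<in> ball 0 1 \<Longrightarrow> u x = v (norm x)"
    and v: "continuous_on {0<..<1} v" and nn: "AE x in lebesgue. x \<in> ball 0 1 \<longrightarrow> Du x \<bullet> x \<ge> 0"
  obtains w where "w \<in> borel_measurable borel" "\<And>r. 0 \<le> w r"
    "\<And>a b. 0 < a \<Longrightarrow> a < b \<Longrightarrow> b < 1 \<Longrightarrow> set_integrable lborel {a..b} w"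
    "\<And>a b. 0 < a \<Longrightarrow> a < b \<Longrightarrow> b < 1 \<Longrightarrow> (LINT r:{a..b}|lborel. w r) = v b - v a"
proof -
  let ?n = "CARD('n)" and ?B = "ball (0::real^'n) 1" and ?A = "sphere_area TYPE('n)"
  define Q where "Q = (\<lambda>x::real^'n. (Du x \<bullet> x) / norm x ^ ?n)"
  define Q' where "Q' = (\<lambda>x. indicator (?B - {0}) x *\<^sub>R Q x)"
  have flux:
    "(LINT x:{x. a < norm x \<and> norm x \<le> b}|lebesgue. Q x) = ?A * (v b - v a)"
    "Q absolutely_integrable_on annulus a b" if "0 < a" "a < b" "b < 1" for a b
    unfolding Q_def by (rule radial_flux_integral[OF wg _ v that], rule rad, assumption)+
  have Q'm: "Q' \<in> borel_measurable lebesgue"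
  proof (rule borel_measurable_LIMSEQ_real)
    let ?An = "\<lambda>m::nat. annulus (1 / real (m + 3)) (1 - 1 / real (m + 3)) :: (real^'n) set"
    show "(\<lambda>x. indicator (?An m) x *\<^sub>R Q x) \<in> borel_measurable lebesgue" for m
    proof -
      have "1 / real (m + 3) < 1 / 2" by (simp add: field_simps)
      then show ?thesis using flux(2)[of "1 / real (m + 3)" "1 - 1 / real (m + 3)"]
        by (auto simp: set_integrable_def)
    qed
    fix x :: "real^'n"
    show "(\<lambda>m. indicator (?An m) x *\<^sub>R Q x) \<longlonglongrightarrow> Q' x"
    proof (cases "x \<in> ?B - {0}")
      case True
      define d where "d = min (norm x) (1 - norm x)"
      have d: "d > 0" using True by (auto simp: d_def)
      obtain m0 :: nat where m0: "1 / d < real m0" using reals_Archimedean2 by blast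
      have "x \<in> ?An m" if "m \<ge> m0" for m
      proof -
        have "1 / d < real (m + 3)" using m0 that by simp
        then have "1 / real (m + 3) < d" using d by (simp add: field_simps)
        then show ?thesis by (auto simp: annulus_def d_def)
      qed
      then have "\<forall>\<^sub>F m in sequentially. indicator (?An m) x *\<^sub>R Q x = Q' x"
        using True by (auto simp: eventually_sequentially Q'_def intro!: exI[of _ m0])
      then show ?thesis by (rule tendsto_eventually)
    next
      case False
      have "x \<notin> ?An m" for m
      proof -
        have "0 < 1 / real (m + 3)" by simp
        moreover have "norm x = 0 \<or> 1 \<le> norm x" using False by auto
        ultimately have "\<not> (1 / real (m + 3) \<le> norm x \<and> norm x \<le> 1 - 1 / real (m + 3))" by linarith
        then show ?thesis by (simp add: annulus_def)
      qed
      then show ?thesis using False by (simp add: Q'_def)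
    qed
  qed
  have Q'nn: "AE x in lebesgue. 0 \<le> Q' x"
    using nn by eventually_elim (auto simp: Q'_def Q_def split: split_indicator)
  define N where "N = density lebesgue (\<lambda>x. ennreal (Q' x))"
  \<comment> \<open>the measure of fluxes on radii\<close>
  define \<nu> where "\<nu> = distr N borel (norm :: real^'n \<Rightarrow> real)"
  have nm: "(norm :: real^'n \<Rightarrow> real) \<in> measurable lebesgue borel"
    by (intro measurable_completion) simp
  have nmN: "(norm :: real^'n \<Rightarrow> real) \<in> measurable N borel"
    using nm by (simp add: N_def)
  have \<nu>e: "emeasure \<nu> B = (\<integral>\<^sup>+x. ennreal (Q' x) * indicator (norm -` B) x \<partial>lebesgue)" if "B \<in> sets borel" for B
  proof -
    have "norm -` B \<in> sets (lebesgue :: (real^'n) measure)" using measurable_sets[OF nm that] by simp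
    then have "emeasure N (norm -` B) = (\<integral>\<^sup>+x. ennreal (Q' x) * indicator (norm -` B) x \<partial>lebesgue)"
      using Q'm unfolding N_def by (intro emeasure_density) auto
    moreover have "emeasure \<nu> B = emeasure N (norm -` B)"
      unfolding \<nu>_def emeasure_distr[OF nmN that] by (simp add: N_def)
    ultimately show ?thesis by simp
  qed
  have ac: "absolutely_continuous lborel \<nu>"
    unfolding absolutely_continuous_def
  proof
    fix B assume B: "B \<in> null_sets (lborel :: real measure)"
    then have Bs: "B \<in> sets borel" by auto
    have "AE x in lebesgue. ennreal (Q' x) * indicator (norm -` B) x = 0"
      using lborel_null_preimage_norm[OF B, where 'n='n] by eventually_elim (auto simp: Q'_def split: split_indicator)
    then have "emeasure \<nu> B = (\<integral>\<^sup>+x. 0 \<partial>(lebesgue :: (real^'n) measure))"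
      unfolding \<nu>e[OF Bs] by (rule nn_integral_cong_AE)
    then show "B \<in> null_sets \<nu>" using Bs by (auto simp: null_sets_def \<nu>_def)
  qed
  obtain f where f: "f \<in> borel_measurable lborel" "density lborel f = \<nu>"
    using sigma_finite_measure.Radon_Nikodym[OF sigma_finite_lborel ac] by (auto simp: \<nu>_def)
  have fm[measurable]: "f \<in> borel_measurable borel" using f(1) by simp
  have \<nu>I: "(\<integral>\<^sup>+r. f r * indicator {a<..b} r \<partial>lborel) = ennreal (?A * (v b - v a))" "v a \<le> v b"
    if ab: "0 < a" "a < b" "b < 1" for a b
  proof -
    let ?H = "{x::real^'n. a < norm x \<and> norm x \<le> b}"
    have H: "(LINT x:?H|lebesgue. Q x) = (LINT x|lebesgue. indicator ?H x *\<^sub>R Q x)" by (simp add: set_lebesgue_integral_def)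
    have Hs: "?H \<in> sets borel"
    proof -
      have "?H = cball 0 b - cball 0 a" by auto
      then show ?thesis by simp
    qed
    have e: "indicator ?H x *\<^sub>R Q x = indicator ?H x *\<^sub>R (indicator (annulus a b) x *\<^sub>R Q x)" for x
      by (auto simp: annulus_def split: split_indicator)
    have int: "integrable lebesgue (\<lambda>x. indicator ?H x *\<^sub>R Q x)"
      unfolding e
      by (rule integrable_mult_indicator) (use flux(2)[OF ab] Hs in \<open>auto simp: set_integrable_def\<close>)
    have e2: "indicator ?H x *\<^sub>R Q x = Q' x * indicator (norm -` {a<..b}) x" for x
      using ab by (auto simp: Q'_def split: split_indicator)
    have nn': "AE x in lebesgue. 0 \<le> indicator ?H x *\<^sub>R Q x"
      using Q'nn unfolding e2 by eventually_elim (auto split: split_indicator)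
    have "0 \<le> (LINT x|lebesgue. indicator ?H x *\<^sub>R Q x)" using nn' by (rule integral_nonneg_AE)
    then show "v a \<le> v b" using flux(1)[OF ab] sphere_area_pos[where 'n='n] by (simp add: H zero_le_mult_iff)
    have "(\<integral>\<^sup>+r. f r * indicator {a<..b} r \<partial>lborel) = emeasure \<nu> {a<..b}"
      by (simp add: f(2)[symmetric] emeasure_density)
    also have "\<dots> = (\<integral>\<^sup>+x. ennreal (indicator ?H x *\<^sub>R Q x) \<partial>lebesgue)"
      unfolding e2 by (subst \<nu>e) (auto intro!: nn_integral_cong split: split_indicator)
    also have "\<dots> = ennreal (LINT x|lebesgue. indicator ?H x *\<^sub>R Q x)"
      by (rule nn_integral_eq_integral[OF int nn'])
    finally show "(\<integral>\<^sup>+r. f r * indicator {a<..b} r \<partial>lborel) = ennreal (?A * (v b - v a))"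
      using flux(1)[OF ab] by (simp add: H)
  qed
  define w where "w = (\<lambda>r. enn2real (f r) / ?A)"
  have A0: "?A > 0" by (rule sphere_area_pos)
  have wI: "has_bochner_integral lborel (\<lambda>r. indicator {a..b} r *\<^sub>R w r) (v b - v a)"
    if ab: "0 < a" "a < b" "b < 1" for a b
  proof -
    have "(\<integral>\<^sup>+r. f r * indicator {a<..b} r \<partial>lborel) \<noteq> \<infinity>" using \<nu>I(1)[OF ab] by simp
    then have "AE r in lborel. f r * indicator {a<..b} r \<noteq> \<infinity>"
      by (intro nn_integral_PInf_AE) auto
    then have AEw: "AE r in lborel. ennreal (indicator {a..b} r *\<^sub>R w r) = ennreal (1 / ?A) * (f r * indicator {a<..b} r)"
      using AE_lborel_singleton[of a]
    proof eventually_elim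
      case (elim r)
      then show ?case using A0 ab
        by (cases "f r") (auto simp: w_def ennreal_mult[symmetric] split: split_indicator)
    qed
    have nn: "(\<integral>\<^sup>+r. ennreal (indicator {a..b} r *\<^sub>R w r) \<partial>lborel) = ennreal (v b - v a)"
    proof -
      have "(\<integral>\<^sup>+r. ennreal (indicator {a..b} r *\<^sub>R w r) \<partial>lborel) = (\<integral>\<^sup>+r. ennreal (1 / ?A) * (f r * indicator {a<..b} r) \<partial>lborel)"
        by (rule nn_integral_cong_AE[OF AEw])
      also have "\<dots> = ennreal (1 / ?A) * ennreal (?A * (v b - v a))"
        by (subst nn_integral_cmult) (auto simp: \<nu>I(1)[OF ab])
      also have "\<dots> = ennreal (v b - v a)"
        using A0 \<nu>I(2)[OF ab] by (simp add: ennreal_mult[symmetric])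
      finally show ?thesis .
    qed
    show ?thesis
      by (rule has_bochner_integral_nn_integral[OF _ _ _ nn])
        (use A0 \<nu>I(2)[OF ab] in \<open>auto simp: w_def split: split_indicator\<close>)
  qed
  show thesis
  proof (rule that[of w])
    show "w \<in> borel_measurable borel" by (simp add: w_def)
    show "0 \<le> w r" for r using A0 by (simp add: w_def)
    show "set_integrable lborel {a..b} w" "(LINT r:{a..b}|lborel. w r) = v b - v a" if "0 < a" "a < b" "b < 1" for a b
      using wI[OF that] by (auto simp: set_integrable_def set_lebesgue_integral_def has_bochner_integral_iff)
  qed
qed

lemma polar_integrable_iff:
  fixes f :: "real \<Rightarrow> real"
  assumes f[measurable]: "f \<in> borel_measurable borel"
  shows "integrable lborel (\<lambda>x::real^'n. indicator (ball 0 1) x * f (norm x))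
    \<longleftrightarrow> integrable lborel (\<lambda>r. indicator {0<..<1} r * (r ^ (CARD('n) - 1) * f r))"
proof -
  let ?A = "sphere_area TYPE('n)"
  have A: "?A > 0" by (rule sphere_area_pos)
  have nm: "(\<lambda>x::real^'n. f (norm x)) \<in> borel_measurable lborel" by simp
  have "integrable lborel (\<lambda>x::real^'n. indicator (ball 0 1) x *\<^sub>R f (norm x))
    \<longleftrightarrow> integrable (density lborel (\<lambda>x::real^'n. ennreal (indicator (ball 0 1) x))) (\<lambda>x. f (norm x))"
    by (rule integrable_density[symmetric, OF nm]) (auto intro!: borel_measurable_indicator)
  also have "\<dots> \<longleftrightarrow> integrable (distr (density lborel (indicator (ball (0::real^'n) 1))) borel norm) f"
    by (subst integrable_distr_eq) (auto simp: ennreal_indicator)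
  also have "\<dots> \<longleftrightarrow> integrable lborel (\<lambda>r. (indicator {0<..<1} r * (?A * r ^ (CARD('n) - 1))) *\<^sub>R f r)"
    unfolding distr_norm_ball using A
    by (intro integrable_density) (auto split: split_indicator)
  also have "(\<lambda>r. (indicator {0<..<1} r * (?A * r ^ (CARD('n) - 1))) *\<^sub>R f r) = (\<lambda>r. ?A * (indicator {0<..<1} r * (r ^ (CARD('n) - 1) * f r)))"
    by (simp add: fun_eq_iff mult_ac)
  finally show ?thesis using A by simp
qed

lemma set_integral_mono_domain:
  fixes f :: "'a \<Rightarrow> real"
  assumes "set_integrable M B f" "A \<in> sets M" "A \<subseteq> B" "\<And>x. 0 \<le> f x"
  shows "(LINT x:A|M. f x) \<le> (LINT x:B|M. f x)"
proof -
  have "set_integrable M A f" by (rule set_integrable_subset[OF assms(1-3)])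
  then show ?thesis
    using assms(1,3,4) unfolding set_lebesgue_integral_def set_integrable_def
    by (intro integral_mono) (auto split: split_indicator)
qed

lemma integrable_mult_continuous_Icc:
  fixes w h :: "real \<Rightarrow> real"
  assumes [measurable]: "w \<in> borel_measurable borel" and w: "set_integrable lborel {a..b} w" and h: "continuous_on {a..b} h"
  shows "set_integrable lborel {a..b} (\<lambda>r. w r * h r)"
proof -
  have "bounded (h ` {a..b})" by (intro compact_imp_bounded compact_continuous_image h) auto
  then obtain B where B: "\<And>r. r \<in> {a..b} \<Longrightarrow> \<bar>h r\<bar> \<le> B" unfolding bounded_iff by (metis imageI real_norm_def)
  have hm[measurable]: "(\<lambda>r. indicator {a..b} r *\<^sub>R h r) \<in> borel_measurable borel"
    by (intro borel_measurable_continuous_on_indicator h) auto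
  have eq: "indicator {a..b} r *\<^sub>R (w r * h r) = w r * (indicator {a..b} r *\<^sub>R h r)" for r by simp
  show ?thesis unfolding set_integrable_def eq
  proof (rule Bochner_Integration.integrable_bound)
    show "integrable lborel (\<lambda>r. \<bar>B\<bar> * (indicator {a..b} r *\<^sub>R w r))" using w by (simp add: set_integrable_def)
    show "AE r in lborel. norm (w r * (indicator {a..b} r *\<^sub>R h r)) \<le> norm (\<bar>B\<bar> * (indicator {a..b} r *\<^sub>R w r))"
    proof (rule AE_I2)
      fix r
      show "norm (w r * (indicator {a..b} r *\<^sub>R h r)) \<le> norm (\<bar>B\<bar> * (indicator {a..b} r *\<^sub>R w r))"
      proof (cases "r \<in> {a..b}")
        case True
        have "\<bar>w r\<bar> * \<bar>h r\<bar> \<le> \<bar>w r\<bar> * \<bar>B\<bar>" using B[OF True] by (intro mult_left_mono) auto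
        then show ?thesis using True by (simp add: abs_mult mult.commute)
      qed simp
    qed
  qed measurable
qed

lemma polar_annulus:
  fixes f :: "real \<Rightarrow> real"
  assumes f[measurable]: "f \<in> borel_measurable borel" and ab: "0 < a" "b < 1" and i: "set_integrable lborel {a..b} f"
  shows "integrable lborel (\<lambda>x::real^'n. indicator (annulus a b) x * f (norm x))"
    and "(LINT x|lborel. indicator (annulus a b :: (real^'n) set) x * f (norm x))
      = sphere_area TYPE('n) * (LINT r:{a..b}|lborel. r ^ (CARD('n) - 1) * f r)"
proof -
  let ?F = "\<lambda>r. indicator {a..b} r * f r"
  have e1: "indicator (annulus a b) x * f (norm x) = indicator (ball 0 1) x * ?F (norm x)" for x :: "real^'n"
    using ab by (auto simp: annulus_def split: split_indicator)
  have e2: "indicator {0<..<1} r * (r ^ (CARD('n) - 1) * ?F r) = indicator {a..b} r *\<^sub>R (f r * r ^ (CARD('n) - 1))" for r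
    using ab by (auto split: split_indicator)
  have "set_integrable lborel {a..b} (\<lambda>r. f r * r ^ (CARD('n) - 1))"
    by (intro integrable_mult_continuous_Icc f i continuous_intros)
  then have "integrable lborel (\<lambda>r. indicator {0<..<1} r * (r ^ (CARD('n) - 1) * ?F r))"
    unfolding e2 set_integrable_def .
  moreover have "?F \<in> borel_measurable borel" by measurable
  ultimately show "integrable lborel (\<lambda>x::real^'n. indicator (annulus a b) x * f (norm x))"
    unfolding e1 using polar_integrable_iff[of ?F, where 'n='n] by blast
  have m: "(\<lambda>x::real^'n. indicator (ball 0 1) x * ?F (norm x)) \<in> borel_measurable lborel"
    by (intro borel_measurable_times borel_measurable_indicator) auto
  have "(LINT x|lborel. indicator (annulus a b :: (real^'n) set) x * f (norm x)) = (LINT x:ball (0::real^'n) 1|lebesgue. ?F (norm x))"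
    unfolding e1 set_lebesgue_integral_def using integral_completion[OF m] by simp
  also have "\<dots> = sphere_area TYPE('n) * (LINT r:{0<..<1}|lborel. r ^ (CARD('n) - 1) * ?F r)"
    by (rule polar_integral) measurable
  also have "(LINT r:{0<..<1}|lborel. r ^ (CARD('n) - 1) * ?F r) = (LINT r:{a..b}|lborel. r ^ (CARD('n) - 1) * f r)"
    unfolding set_lebesgue_integral_def real_scaleR_def[symmetric, of "indicator {0<..<1} _"] 
    by (intro Bochner_Integration.integral_cong refl) (use e2 in \<open>simp add: mult.commute\<close>)
  finally show "(LINT x|lborel. indicator (annulus a b :: (real^'n) set) x * f (norm x))
      = sphere_area TYPE('n) * (LINT r:{a..b}|lborel. r ^ (CARD('n) - 1) * f r)" .
qed

text \<open>Truncation at height \<open>j\<close> allows dominated convergence for continuous functions that converge almost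
  everywhere; a diagonal choice then removes the truncation.\<close>

lemma continuous_L1_approximation:
  fixes w :: "real \<Rightarrow> real"
  assumes w[measurable]: "w \<in> borel_measurable borel" and nn: "\<And>r. 0 \<le> w r" and i: "set_integrable lborel {c..d} w"
  obtains g where "\<And>m. continuous_on UNIV (g m)" "(\<lambda>m::nat. LINT r:{c..d}|lborel. \<bar>g m r - w r\<bar>) \<longlonglongrightarrow> 0"
proof -
  have "w \<in> borel_measurable lebesgue" by (rule measurable_completion) simp
  then have "w measurable_on {c..d}" by (rule lebesgue_measurable_imp_measurable_on_real) simp
  then obtain N h where N: "negligible N" and h: "\<And>n. continuous_on UNIV (h n)"
    "\<And>x. x \<notin> N \<Longrightarrow> (\<lambda>n. h n x) \<longlonglongrightarrow> (if x \<in> {c..d} then w x else 0)"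
    unfolding measurable_on_def by blast
  have "AE r in lebesgue. r \<notin> N" using N by (simp add: AE_not_in negligible_iff_null_sets)
  then have AEN: "AE r in lborel. r \<notin> N" by (simp add: AE_completion_iff)
  define H where "H = (\<lambda>j n r. max 0 (min (real j) (h n r)))"
  have Hc: "continuous_on UNIV (H j n)" for j n unfolding H_def by (intro continuous_intros h)
  then have [measurable]: "H j n \<in> borel_measurable borel" for j n by (rule borel_measurable_continuous_onI)
  have ic: "set_integrable lborel {c..d} (\<lambda>r. K)" for K :: real by (intro borel_integrable_atLeastAtMost') auto
  have Hlim: "(\<lambda>n. LINT r:{c..d}|lborel. \<bar>H j n r - min (real j) (w r)\<bar>) \<longlonglongrightarrow> 0" for j
  proof -
    have "(\<lambda>n. LINT r|lborel. indicator {c..d} r *\<^sub>R \<bar>H j n r - min (real j) (w r)\<bar>) \<longlonglongrightarrow> (LINT r|(lborel::real measure). 0)"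
    proof (rule integral_dominated_convergence)
      show "integrable lborel (\<lambda>r. indicator {c..d} r *\<^sub>R (2 * real j))" using ic[of "2 * real j"] by (simp add: set_integrable_def)
      show "AE r in lborel. (\<lambda>n. indicator {c..d} r *\<^sub>R \<bar>H j n r - min (real j) (w r)\<bar>) \<longlonglongrightarrow> 0"
        using AEN
      proof eventually_elim
        case (elim r)
        show ?case
        proof (cases "r \<in> {c..d}")
          case True
          have "(\<lambda>n. \<bar>H j n r - min (real j) (w r)\<bar>) \<longlonglongrightarrow> \<bar>max 0 (min (real j) (w r)) - min (real j) (w r)\<bar>"
            unfolding H_def using h(2)[OF elim] True by (intro tendsto_intros) auto
          then show ?thesis using True nn[of r] by (simp add: max_absorb2)
        qed simp
      qed
      show "AE r in lborel. norm (indicator {c..d} r *\<^sub>R \<bar>H j n r - min (real j) (w r)\<bar>) \<le> indicator {c..d} r *\<^sub>R (2 * real j)" for n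
      proof (rule AE_I2)
        fix r
        have "0 \<le> H j n r" "H j n r \<le> real j" "0 \<le> min (real j) (w r)" "min (real j) (w r) \<le> real j"
          using nn[of r] by (auto simp: H_def)
        then have "\<bar>H j n r - min (real j) (w r)\<bar> \<le> 2 * real j" by linarith
        then show "norm (indicator {c..d} r *\<^sub>R \<bar>H j n r - min (real j) (w r)\<bar>) \<le> indicator {c..d} r *\<^sub>R (2 * real j)"
          by (auto split: split_indicator)
      qed
    qed measurable
    then show ?thesis by (simp add: set_lebesgue_integral_def)
  qed
  have "\<exists>n. (LINT r:{c..d}|lborel. \<bar>H j n r - min (real j) (w r)\<bar>) < 1 / real (Suc j)" for j
    using order_tendstoD(2)[OF Hlim[of j], of "1 / real (Suc j)"] by (auto simp: eventually_sequentially)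
  then obtain k where k: "\<And>j. (LINT r:{c..d}|lborel. \<bar>H j (k j) r - min (real j) (w r)\<bar>) < 1 / real (Suc j)" by metis
  have mlim: "(\<lambda>j. LINT r:{c..d}|lborel. \<bar>min (real j) (w r) - w r\<bar>) \<longlonglongrightarrow> 0"
  proof -
    have "(\<lambda>j. LINT r|lborel. indicator {c..d} r *\<^sub>R \<bar>min (real j) (w r) - w r\<bar>) \<longlonglongrightarrow> (LINT r|(lborel::real measure). 0)"
    proof (rule integral_dominated_convergence)
      show "integrable lborel (\<lambda>r. indicator {c..d} r *\<^sub>R w r)" using i by (simp add: set_integrable_def)
      show "AE r in lborel. (\<lambda>j. indicator {c..d} r *\<^sub>R \<bar>min (real j) (w r) - w r\<bar>) \<longlonglongrightarrow> 0"
      proof (rule AE_I2)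
        fix r
        obtain j0 :: nat where j0: "w r < real j0" using reals_Archimedean2 by blast
        have "\<forall>\<^sub>F j in sequentially. indicator {c..d} r *\<^sub>R \<bar>min (real j) (w r) - w r\<bar> = 0"
          by (rule eventually_mono[OF eventually_ge_at_top[of j0]]) (use j0 in \<open>auto simp: min_def\<close>)
        then show "(\<lambda>j. indicator {c..d} r *\<^sub>R \<bar>min (real j) (w r) - w r\<bar>) \<longlonglongrightarrow> 0" by (rule tendsto_eventually)
      qed
      show "AE r in lborel. norm (indicator {c..d} r *\<^sub>R \<bar>min (real j) (w r) - w r\<bar>) \<le> indicator {c..d} r *\<^sub>R w r" for j
        using nn by (auto simp: min_def abs_if split: split_indicator)
    qed measurable
    then show ?thesis by (simp add: set_lebesgue_integral_def)
  qed
  show thesis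
  proof (rule that[of "\<lambda>j. H j (k j)"])
    show "(\<lambda>m. LINT r:{c..d}|lborel. \<bar>H m (k m) r - w r\<bar>) \<longlonglongrightarrow> 0"
    proof (rule tendsto_sandwich[OF _ _ tendsto_const])
      show "\<forall>\<^sub>F m in sequentially. 0 \<le> (LINT r:{c..d}|lborel. \<bar>H m (k m) r - w r\<bar>)"
        by (auto simp: set_lebesgue_integral_def)
      have i1: "set_integrable lborel {c..d} (H j n)" for j n
        by (intro borel_integrable_atLeastAtMost' continuous_on_subset[OF Hc]) auto
      have i2: "set_integrable lborel {c..d} (\<lambda>r. min (real j) (w r))" for j
        unfolding set_integrable_def
        by (rule Bochner_Integration.integrable_bound[OF i[unfolded set_integrable_def]])
          (use nn in \<open>auto simp: min_def split: split_indicator\<close>)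
      note abs_i = set_integrable_abs[OF set_integral_diff(1)]
      show "\<forall>\<^sub>F m in sequentially. (LINT r:{c..d}|lborel. \<bar>H m (k m) r - w r\<bar>)
        \<le> 1 / real (Suc m) + (LINT r:{c..d}|lborel. \<bar>min (real m) (w r) - w r\<bar>)"
      proof (rule always_eventually, rule allI)
        fix m
        have "(LINT r:{c..d}|lborel. \<bar>H m (k m) r - w r\<bar>)
          \<le> (LINT r:{c..d}|lborel. \<bar>H m (k m) r - min (real m) (w r)\<bar> + \<bar>min (real m) (w r) - w r\<bar>)"
          by (intro set_integral_mono set_integral_add abs_i i1 i2 i) auto
        also have "\<dots> = (LINT r:{c..d}|lborel. \<bar>H m (k m) r - min (real m) (w r)\<bar>) + (LINT r:{c..d}|lborel. \<bar>min (real m) (w r) - w r\<bar>)"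
          by (intro set_integral_add abs_i i1 i2 i)
        finally show "(LINT r:{c..d}|lborel. \<bar>H m (k m) r - w r\<bar>)
          \<le> 1 / real (Suc m) + (LINT r:{c..d}|lborel. \<bar>min (real m) (w r) - w r\<bar>)" using k[of m] by linarith
      qed
      have "(\<lambda>m. 1 / real (Suc m)) \<longlonglongrightarrow> 0" using LIMSEQ_inverse_real_of_nat by (simp add: inverse_eq_divide)
      from tendsto_add[OF this mlim]
      show "(\<lambda>m. 1 / real (Suc m) + (LINT r:{c..d}|lborel. \<bar>min (real m) (w r) - w r\<bar>)) \<longlonglongrightarrow> 0" by simp
    qed
  qed (rule Hc)
qed

lemma tendsto_if_abs_diff_le:
  fixes f e :: "nat \<Rightarrow> real"
  assumes "\<And>m. \<bar>f m - l\<bar> \<le> e m" "e \<longlonglongrightarrow> 0"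
  shows "f \<longlonglongrightarrow> l"
proof -
  have "(\<lambda>m. f m - l) \<longlonglongrightarrow> 0"
    by (rule Lim_null_comparison[OF always_eventually assms(2)]) (simp add: assms(1))
  then show ?thesis by (rule LIM_zero_cancel)
qed

text \<open>Integration by parts for the primitive of a function that is merely integrable. For a continuous \<open>w\<close> it is
  the statement that the radial derivative of a test function has weighted integral zero, applied to
  \<open>v(|x|) \<eta>(x)\<close>; both sides are continuous in \<open>w\<close> with respect to \<open>L\<^sup>1\<close> on compact intervals.\<close>

lemma radial_primitive_identity:
  fixes v w :: "real \<Rightarrow> real" and \<eta> :: "real^'n \<Rightarrow> real"
  assumes w[measurable]: "w \<in> borel_measurable borel" and nn: "\<And>r. 0 \<le> w r"
    and wi: "\<And>a b. 0 < a \<Longrightarrow> a < b \<Longrightarrow> b < 1 \<Longrightarrow> set_integrable lborel {a..b} w"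
    and wv: "\<And>a b. 0 < a \<Longrightarrow> a < b \<Longrightarrow> b < 1 \<Longrightarrow> (LINT r:{a..b}|lborel. w r) = v b - v a"
    and v: "continuous_on {0<..<1} v" and eta: "\<eta> \<in> C1c (ball 0 1 - {0})"
  shows "(LINT x|lborel. v (norm x) * ((grad \<eta> x \<bullet> x) / norm x ^ CARD('n)))
    = - (LINT x|lborel. w (norm x) * norm x / norm x ^ CARD('n) * \<eta> x)"
proof -
  let ?n = "CARD('n)"
  obtain a b M where ab: "0 < a" "a < b" "b < 1" "0 \<le> M" and z: "\<And>x. x \<notin> annulus a b \<Longrightarrow> \<eta> x = 0"
    "\<And>x. x \<notin> annulus a b \<Longrightarrow> grad \<eta> x = 0" and M: "\<And>x. \<bar>\<eta> x\<bar> \<le> M" "\<And>x. norm (grad \<eta> x) \<le> M"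
    and D: "\<And>x. (\<eta> has_derivative (\<lambda>h. grad \<eta> x \<bullet> h)) (at x)"
    and cont: "continuous_on UNIV (grad \<eta>)" "continuous_on UNIV \<eta>"
    using C1c_annulusE[OF eta] by blast
  \<comment> \<open>room around the support of the test function\<close>
  define a' b' where "a' = a / 2" and "b' = (b + 1) / 2"
  have ab': "0 < a'" "a' < a" "b < b'" "b' < 1" "a' < b'" using ab by (auto simp: a'_def b'_def)
  have sub: "annulus a b \<subseteq> ball (0::real^'n) 1 - {0}" using ab by (intro annulus_subset)
  obtain g where g: "\<And>m. continuous_on UNIV (g m)" "(\<lambda>m::nat. LINT r:{a'..b'}|lborel. \<bar>g m r - w r\<bar>) \<longlonglongrightarrow> 0"
    using continuous_L1_approximation[OF w nn wi[OF ab'(1,5,4)]] by blast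
  define \<epsilon> where "\<epsilon> = (\<lambda>m. LINT r:{a'..b'}|lborel. \<bar>g m r - w r\<bar>)"
  define V where "V = (\<lambda>m r. LINT s:{a'..r}|lborel. g m s)"
  have gi: "set_integrable lborel S (g m)" if "S \<subseteq> {a'..b'}" "S \<in> sets borel" for S m
    by (rule set_integrable_subset[OF borel_integrable_atLeastAtMost'[of a' b']])
      (use g(1) that in \<open>auto intro: continuous_on_subset\<close>)
  have gm[measurable]: "g m \<in> borel_measurable borel" for m using g(1) by (rule borel_measurable_continuous_onI)
  have VD: "(V m has_real_derivative g m r) (at r)" if r: "r \<in> {a'<..<b'}" for m r
  proof -
    have "((\<lambda>r. integral {a'..r} (g m)) has_real_derivative g m r) (at r within {a'..b'})"
      by (rule integral_has_real_derivative) (use g(1) r in \<open>auto intro: continuous_on_subset\<close>)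
    moreover have "at r within {a'..b'} = at r"
      by (rule at_within_interior) (use r in \<open>simp add: interior_atLeastAtMost_real\<close>)
    ultimately have D': "((\<lambda>r. integral {a'..r} (g m)) has_real_derivative g m r) (at r)"
      by simp
    show ?thesis
    proof (rule has_field_derivative_transform_within_open[OF D', of "{a'<..<b'}"])
      fix s assume "s \<in> {a'<..<b'}"
      then show "integral {a'..s} (g m) = V m s"
        unfolding V_def using set_borel_integral_eq_integral(2)[OF gi[of "{a'..s}" m]] by auto
    qed (use r in auto)
  qed
  have Vv: "\<bar>V m r - (v r - v a')\<bar> \<le> \<epsilon> m" if r: "r \<in> {a<..<b'} \<or> r \<in> {a..b}" for m r
  proof -
    have r': "a' < r" "r < b'" using r ab' by auto
    have i: "set_integrable lborel {a'..r} w" using wi[of a' r] r' ab' by auto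
    have gi': "set_integrable lborel {a'..r} (g m)" by (rule gi) (use r' in auto)
    have "V m r - (v r - v a') = (LINT s:{a'..r}|lborel. g m s - w s)"
      using wv[of a' r] r' ab' i gi' by (simp add: V_def set_integral_diff)
    also have "\<bar>\<dots>\<bar> \<le> (LINT s:{a'..r}|lborel. \<bar>g m s - w s\<bar>)"
      using set_integral_norm_bound[OF set_integral_diff(1)[OF gi' i]] by simp
    also have "\<dots> \<le> \<epsilon> m"
      unfolding \<epsilon>_def
    proof (rule set_integral_mono_domain)
      show "set_integrable lborel {a'..b'} (\<lambda>s. \<bar>g m s - w s\<bar>)"
        by (intro set_integrable_abs set_integral_diff gi wi) (use ab' in auto)
    qed (use r' in auto)
    finally show ?thesis .
  qed
  have zero: "(LINT x|lborel. g m (norm x) * norm x / norm x ^ ?n * \<eta> x) + (LINT x|lborel. V m (norm x) * ((grad \<eta> x \<bullet> x) / norm x ^ ?n)) = 0"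
    and int1: "integrable lborel (\<lambda>x::real^'n. V m (norm x) * ((grad \<eta> x \<bullet> x) / norm x ^ ?n))"
    and int2: "integrable lborel (\<lambda>x::real^'n. g m (norm x) * norm x / norm x ^ ?n * \<eta> x)" for m
  proof -
    let ?O = "{x::real^'n. a' < norm x \<and> norm x < b'}"
    let ?G = "\<lambda>x. \<eta> x *\<^sub>R ((g m (norm x) / norm x) *\<^sub>R x) + V m (norm x) *\<^sub>R grad \<eta> x"
    have oO: "open ?O" by (intro open_Collect_conj open_Collect_less continuous_intros)
    have subO: "annulus a b \<subseteq> ?O" using ab' by (auto simp: annulus_def)
    have dV: "((\<lambda>x. V m (norm x)) has_derivative (\<lambda>h. ((g m (norm x) / norm x) *\<^sub>R x) \<bullet> h)) (at x)" if "x \<in> ?O" for x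
      by (rule radial_has_derivative[OF _ VD]) (use that ab' in auto)
    have dF: "((\<lambda>x. V m (norm x) * \<eta> x) has_derivative (\<lambda>h. ?G x \<bullet> h)) (at x)" if "x \<in> ?O" for x
      using has_derivative_mult[OF dV[OF that] D[of x]] by (simp add: inner_add_left algebra_simps)
    have Vc: "continuous_on S (V m)" if "S \<subseteq> {a'<..<b'}" for S
      by (rule continuous_on_subset[OF DERIV_continuous_on that]) (use VD in \<open>auto intro: DERIV_subset\<close>)
    have V2: "continuous_on S (\<lambda>x::real^'n. V m (norm x))" if "S \<subseteq> ?O" for S
      by (rule continuous_on_compose2[OF Vc[OF order_refl]]) (use that in \<open>auto intro!: continuous_intros\<close>)
    have g2: "continuous_on S (\<lambda>x::real^'n. g m (norm x))" for S
      by (rule continuous_on_compose2[OF g(1)]) (auto intro!: continuous_intros)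
    have Gc: "continuous_on ?O ?G"
      by (intro continuous_intros V2 g2 continuous_on_subset[OF cont(1)] continuous_on_subset[OF cont(2)]) (use ab' in auto)
    have zz: "V m (norm x) * \<eta> x = 0" if "x \<notin> annulus a b" for x using z(1)[OF that] by simp
    have C1: "(\<lambda>x. V m (norm x) * \<eta> x) \<in> C1c ?O"
      by (rule C1cI(1)[OF compact_annulus subO oO zz dF Gc])
    have C2: "grad (\<lambda>x. V m (norm x) * \<eta> x) x = ?G x" if "x \<in> ?O" for x
      by (rule C1cI(2)[OF compact_annulus subO oO zz dF Gc that])
    have C3: "grad (\<lambda>x. V m (norm x) * \<eta> x) x = 0" if "x \<notin> annulus a b" for x
      by (rule C1cI(3)[OF compact_annulus subO oO zz dF Gc that])
    have f: "(\<lambda>x. V m (norm x) * \<eta> x) \<in> C1c (ball 0 1 - {0})"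
    proof -
      have "?O \<subseteq> ball 0 1 - {0}" using ab' by auto
      from C1c_mono[OF this] show ?thesis using C1 by blast
    qed
    have gr: "grad (\<lambda>x. V m (norm x) * \<eta> x) x \<bullet> x / norm x ^ ?n
        = g m (norm x) * norm x / norm x ^ ?n * \<eta> x + V m (norm x) * ((grad \<eta> x \<bullet> x) / norm x ^ ?n)" for x
    proof (cases "x \<in> annulus a b")
      case True
      then have xO: "x \<in> ?O" using subO by blast
      then have x0: "norm x \<noteq> 0" using ab' by auto
      have "x \<bullet> x = norm x * norm x" by (simp add: power2_norm_eq_inner[symmetric] power2_eq_square)
      then show ?thesis using x0 unfolding C2[OF xO]
        by (simp add: inner_add_left field_simps)
    next
      case False
      then show ?thesis using C3[OF False] z by simp
    qed
    have bci: "integrable lborel F" if "continuous_on (annulus a b) F" "\<And>x. x \<notin> annulus a b \<Longrightarrow> F x = 0" for F :: "real^'n \<Rightarrow> real"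
    proof -
      have "integrable lborel (\<lambda>x. indicator (annulus a b) x *\<^sub>R F x)"
        by (rule borel_integrable_compact[OF compact_annulus that(1)])
      moreover have "(\<lambda>x. indicator (annulus a b) x *\<^sub>R F x) = F"
        using that(2) by (auto simp: fun_eq_iff split: split_indicator)
      ultimately show ?thesis by simp
    qed
    have n0: "\<And>x::real^'n. x \<in> annulus a b \<Longrightarrow> x \<noteq> 0" using ab by (auto simp: annulus_def)
    show i1: "integrable lborel (\<lambda>x::real^'n. V m (norm x) * ((grad \<eta> x \<bullet> x) / norm x ^ ?n))"
      by (rule bci) (use subO n0 z in \<open>auto intro!: continuous_intros V2 continuous_on_subset[OF cont(1)]\<close>)
    show i2: "integrable lborel (\<lambda>x::real^'n. g m (norm x) * norm x / norm x ^ ?n * \<eta> x)"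
      by (rule bci) (use n0 z in \<open>auto intro!: continuous_intros g2 continuous_on_subset[OF cont(2)]\<close>)
    show "(LINT x|lborel. g m (norm x) * norm x / norm x ^ ?n * \<eta> x) + (LINT x|lborel. V m (norm x) * ((grad \<eta> x \<bullet> x) / norm x ^ ?n)) = 0"
      using integral_radial_derivative_zero[OF f] i1 i2 by (simp add: gr Bochner_Integration.integral_add)
  qed
  have n0: "\<And>x::real^'n. x \<in> annulus a b \<Longrightarrow> x \<noteq> 0" using ab by (auto simp: annulus_def)
  have E0: "(LINT x|lborel. (grad \<eta> x \<bullet> x) / norm x ^ ?n) = 0" by (rule integral_radial_derivative_zero[OF eta])
  let ?q = "\<lambda>x::real^'n. (grad \<eta> x \<bullet> x) / norm x ^ ?n"
  have bc: "integrable lborel F" if F: "continuous_on (annulus a b) F" "\<And>x. x \<notin> annulus a b \<Longrightarrow> F x = 0" for F :: "real^'n \<Rightarrow> real"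
  proof -
    have "integrable lborel (\<lambda>x. indicator (annulus a b) x *\<^sub>R F x)"
      by (rule borel_integrable_compact[OF compact_annulus F(1)])
    moreover have "(\<lambda>x. indicator (annulus a b) x *\<^sub>R F x) = F"
      using F(2) by (auto simp: fun_eq_iff split: split_indicator)
    ultimately show ?thesis by simp
  qed
  have qi: "integrable lborel ?q"
    by (rule bc) (use n0 z in \<open>auto intro!: continuous_intros continuous_on_subset[OF cont(1)]\<close>)
  have vi: "integrable lborel (\<lambda>x. v (norm x) * ?q x)"
  proof (rule bc)
    have "continuous_on (annulus a b) (\<lambda>x::real^'n. v (norm x))"
      by (rule continuous_on_compose2[OF v]) (use ab in \<open>auto simp: annulus_def intro!: continuous_intros\<close>)
    then show "continuous_on (annulus a b) (\<lambda>x. v (norm x) * ?q x)"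
      using n0 by (auto intro!: continuous_intros continuous_on_subset[OF cont(1)])
  qed (use z in auto)
  have lim1: "(\<lambda>m. LINT x|lborel. V m (norm x) * ?q x) \<longlonglongrightarrow> (LINT x|lborel. v (norm x) * ?q x)"
  proof -
    have b: "\<bar>(LINT x|lborel. V m (norm x) * ?q x) - (LINT x|lborel. v (norm x) * ?q x)\<bar> \<le> \<epsilon> m * (LINT x|lborel. \<bar>?q x\<bar>)" for m
    proof -
      define q where "q = ?q"
      define f1 where "f1 = (\<lambda>x::real^'n. V m (norm x) * q x)"
      define f2 where "f2 = (\<lambda>x::real^'n. v (norm x) * q x)"
      define K where "K = (\<lambda>x. f1 x - f2 x + v a' * q x)"
      have i: "integrable lborel q" "integrable lborel f1" "integrable lborel f2"
        unfolding f1_def f2_def q_def by (rule qi, rule int1, rule vi)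
      have Ki: "integrable lborel K" unfolding K_def
        by (intro Bochner_Integration.integrable_add Bochner_Integration.integrable_diff i) (use i(1) in simp)
      have "(LINT x|lborel. q x) = 0" unfolding q_def by (rule E0)
      then have "(LINT x|lborel. K x) = (LINT x|lborel. f1 x) - (LINT x|lborel. f2 x)"
        unfolding K_def using i by (simp add: Bochner_Integration.integral_add Bochner_Integration.integral_diff)
      moreover have "\<bar>LINT x|lborel. K x\<bar> \<le> (LINT x|lborel. \<bar>K x\<bar>)"
        using integral_norm_bound[of lborel K] by simp
      moreover have "(LINT x|lborel. \<bar>K x\<bar>) \<le> (LINT x|lborel. \<epsilon> m * \<bar>q x\<bar>)"
      proof (rule Bochner_Integration.integral_mono)
        show "integrable lborel (\<lambda>x. \<bar>K x\<bar>)" using Ki by (rule integrable_abs)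
        show "integrable lborel (\<lambda>x. \<epsilon> m * \<bar>q x\<bar>)" using i(1) by simp
        fix x :: "real^'n"
        have e: "K x = (V m (norm x) - (v (norm x) - v a')) * q x"
          by (simp add: K_def f1_def f2_def algebra_simps)
        show "\<bar>K x\<bar> \<le> \<epsilon> m * \<bar>q x\<bar>"
        proof (cases "x \<in> annulus a b")
          case True
          then show ?thesis unfolding e abs_mult by (intro mult_right_mono Vv) (auto simp: annulus_def)
        next
          case False
          then have "q x = 0" by (simp add: q_def z)
          then show ?thesis unfolding e by simp
        qed
      qed
      moreover have "(LINT x|lborel. \<epsilon> m * \<bar>q x\<bar>) = \<epsilon> m * (LINT x|lborel. \<bar>q x\<bar>)" by simp
      ultimately show ?thesis unfolding f1_def f2_def q_def by linarith
    qed
    have "(\<lambda>m. \<epsilon> m * (LINT x|lborel. \<bar>?q x\<bar>)) \<longlonglongrightarrow> 0"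
      unfolding \<epsilon>_def using g(2) by (rule tendsto_mult_left_zero)
    with b show ?thesis by (rule tendsto_if_abs_diff_le)
  qed
  let ?p = "\<lambda>x::real^'n. norm x / norm x ^ ?n * \<eta> x"
  have pw: "integrable lborel (\<lambda>x. w (norm x) * ?p x)"
    and lim2: "(\<lambda>m. LINT x|lborel. g m (norm x) * ?p x) \<longlonglongrightarrow> (LINT x|lborel. w (norm x) * ?p x)"
  proof -
    have ci: "continuous_on {a..b} (\<lambda>r. r / r ^ ?n)" using ab by (intro continuous_intros) auto
    have Pb: "\<bar>h (norm x) * ?p x\<bar> \<le> M * (indicator (annulus a b) x * (\<bar>h (norm x)\<bar> * (norm x / norm x ^ ?n)))" for h x
    proof (cases "x \<in> annulus a b")
      case True
      have "\<bar>h (norm x) * ?p x\<bar> = (\<bar>h (norm x)\<bar> * (norm x / norm x ^ ?n)) * \<bar>\<eta> x\<bar>" by (simp add: abs_mult)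
      also have "\<dots> \<le> (\<bar>h (norm x)\<bar> * (norm x / norm x ^ ?n)) * M" by (intro mult_left_mono M) auto
      finally show ?thesis using True by (simp add: mult_ac)
    qed (simp add: z)
    have hi: "integrable lborel (\<lambda>x::real^'n. indicator (annulus a b) x * (\<bar>h (norm x)\<bar> * (norm x / norm x ^ ?n)))"
      and hI: "(LINT x|lborel. indicator (annulus a b :: (real^'n) set) x * (\<bar>h (norm x)\<bar> * (norm x / norm x ^ ?n)))
        = sphere_area TYPE('n) * (LINT r:{a..b}|lborel. \<bar>h r\<bar>)"
      if hm[measurable]: "h \<in> borel_measurable borel" and h: "set_integrable lborel {a..b} h" for h
    proof -
      have m: "(\<lambda>r. \<bar>h r\<bar> * (r / r ^ ?n)) \<in> borel_measurable borel" by measurable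
      have i: "set_integrable lborel {a..b} (\<lambda>r. \<bar>h r\<bar> * (r / r ^ ?n))"
        by (intro integrable_mult_continuous_Icc set_integrable_abs h ci) measurable
      show "integrable lborel (\<lambda>x::real^'n. indicator (annulus a b) x * (\<bar>h (norm x)\<bar> * (norm x / norm x ^ ?n)))"
        by (rule polar_annulus(1)[OF m ab(1,3) i])
      have "(LINT r:{a..b}|lborel. r ^ (?n - 1) * (\<bar>h r\<bar> * (r / r ^ ?n))) = (LINT r:{a..b}|lborel. \<bar>h r\<bar>)"
      proof (rule set_lebesgue_integral_cong; safe?)
        fix r assume "r \<in> {a..b}"
        then have r: "r > 0" using ab by auto
        have "r ^ ?n = r * r ^ (?n - 1)" by (metis power_eq_if zero_less_card_finite less_irrefl finite UNIV_not_empty card_eq_0_iff)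
        then show "r ^ (?n - 1) * (\<bar>h r\<bar> * (r / r ^ ?n)) = \<bar>h r\<bar>" using r by simp
      qed auto
      then show "(LINT x|lborel. indicator (annulus a b :: (real^'n) set) x * (\<bar>h (norm x)\<bar> * (norm x / norm x ^ ?n)))
        = sphere_area TYPE('n) * (LINT r:{a..b}|lborel. \<bar>h r\<bar>)"
        using polar_annulus(2)[OF m ab(1,3) i, where 'n='n] by simp
    qed
    have pm: "?p \<in> borel_measurable borel"
      using cont(2) by (intro borel_measurable_times borel_measurable_divide borel_measurable_continuous_onI[of \<eta>]) auto
    have hint: "integrable lborel (\<lambda>x. h (norm x) * ?p x)"
      if hm[measurable]: "h \<in> borel_measurable borel" and h: "set_integrable lborel {a..b} h" for h
    proof (rule Bochner_Integration.integrable_bound[OF integrable_mult_right[OF hi[OF hm h], of M]])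
      have "(\<lambda>x::real^'n. h (norm x)) \<in> borel_measurable borel" by measurable
      from borel_measurable_times[OF this pm]
      show "(\<lambda>x. h (norm x) * ?p x) \<in> borel_measurable lborel" by (simp only: measurable_lborel2)
      show "AE x in lborel. norm (h (norm x) * ?p x) \<le> norm (M * (indicator (annulus a b) x * (\<bar>h (norm x)\<bar> * (norm x / norm x ^ ?n))))"
        by (intro AE_I2) (simp only: real_norm_def, rule order_trans[OF Pb abs_ge_self])
    qed
    have wab: "set_integrable lborel {a..b} w" by (rule wi) (use ab in auto)
    have gab: "set_integrable lborel {a..b} (g m)" for m by (rule gi) (use ab' in auto)
    show "integrable lborel (\<lambda>x. w (norm x) * ?p x)" by (rule hint[OF w wab])
    have b: "\<bar>(LINT x|lborel. g m (norm x) * ?p x) - (LINT x|lborel. w (norm x) * ?p x)\<bar> \<le> M * (sphere_area TYPE('n) * \<epsilon> m)" for m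
    proof -
      define h where "h = (\<lambda>r. g m r - w r)"
      define p where "p = ?p"
      define B where "B = (\<lambda>x::real^'n. indicator (annulus a b) x * (\<bar>h (norm x)\<bar> * (norm x / norm x ^ ?n)))"
      have hm: "h \<in> borel_measurable borel" unfolding h_def by measurable
      have h: "set_integrable lborel {a..b} h" unfolding h_def by (intro set_integral_diff gab wab)
      have i: "integrable lborel (\<lambda>x. g m (norm x) * p x)" "integrable lborel (\<lambda>x. w (norm x) * p x)"
        "integrable lborel (\<lambda>x. h (norm x) * p x)" "integrable lborel B"
        unfolding p_def B_def by (rule hint[OF gm gab], rule hint[OF w wab], rule hint[OF hm h], rule hi[OF hm h])
      have "(LINT x|lborel. h (norm x) * p x) = (LINT x|lborel. g m (norm x) * p x) - (LINT x|lborel. w (norm x) * p x)"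
        using i by (simp add: h_def left_diff_distrib Bochner_Integration.integral_diff)
      moreover have "\<bar>LINT x|lborel. h (norm x) * p x\<bar> \<le> (LINT x|lborel. M * B x)"
      proof (rule integral_abs_bound_integral[OF i(3)])
        show "integrable lborel (\<lambda>x. M * B x)" using i(4) by simp
        show "\<bar>h (norm x) * p x\<bar> \<le> M * B x" for x unfolding p_def B_def by (rule Pb)
      qed
      moreover have "(LINT x|lborel. M * B x) = M * (sphere_area TYPE('n) * (LINT r:{a..b}|lborel. \<bar>h r\<bar>))"
      proof -
        have "(LINT x|lborel. B x) = sphere_area TYPE('n) * (LINT r:{a..b}|lborel. \<bar>h r\<bar>)"
          unfolding B_def by (rule hI[OF hm h])
        then show ?thesis by simp
      qed
      moreover have "M * (sphere_area TYPE('n) * (LINT r:{a..b}|lborel. \<bar>h r\<bar>)) \<le> M * (sphere_area TYPE('n) * \<epsilon> m)"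
        unfolding \<epsilon>_def h_def
      proof (intro mult_left_mono set_integral_mono_domain)
        show "set_integrable lborel {a'..b'} (\<lambda>s. \<bar>g m s - w s\<bar>)"
          by (intro set_integrable_abs set_integral_diff gi wi) (use ab' in auto)
      qed (use ab ab' sphere_area_pos[where 'n='n] in auto)
      ultimately show ?thesis unfolding p_def by linarith
    qed
    have "(\<lambda>m. M * (sphere_area TYPE('n) * \<epsilon> m)) \<longlonglongrightarrow> 0"
      unfolding \<epsilon>_def by (intro tendsto_mult_right_zero g(2))
    with b show "(\<lambda>m. LINT x|lborel. g m (norm x) * ?p x) \<longlonglongrightarrow> (LINT x|lborel. w (norm x) * ?p x)"
      by (rule tendsto_if_abs_diff_le)
  qed
  have "(\<lambda>m. (LINT x|lborel. g m (norm x) * ?p x) + (LINT x|lborel. V m (norm x) * ?q x)) \<longlonglongrightarrow>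
    (LINT x|lborel. w (norm x) * ?p x) + (LINT x|lborel. v (norm x) * ?q x)"
    by (intro tendsto_add lim1 lim2)
  moreover have "(LINT x|lborel. g m (norm x) * ?p x) + (LINT x|lborel. V m (norm x) * ?q x) = 0" for m
    using zero[of m] by (simp add: mult.assoc)
  ultimately have "(LINT x|lborel. w (norm x) * ?p x) + (LINT x|lborel. v (norm x) * ?q x) = 0"
    by (simp add: LIMSEQ_const_iff)
  then show ?thesis by (simp add: mult.assoc)
qed

lemma DERIV_pos_part_square: "((\<lambda>t. (max 0 t)\<^sup>2) has_real_derivative 2 * max 0 t) (at t)"
proof -
  have low: "((\<lambda>t. (max 0 t)\<^sup>2) has_real_derivative 2 * max 0 t) (at t within {..0})" if "t \<le> 0" for t :: real
    using has_field_derivative_transform_within[OF DERIV_const[of 0] zero_less_one, of t "{..0}" "\<lambda>t. (max 0 t)\<^sup>2"] that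
    by (auto simp: max_def)
  have "((\<lambda>t. t\<^sup>2) has_real_derivative 2 * t) (at t within {0..})" for t :: real
    by (auto intro!: derivative_eq_intros)
  from has_field_derivative_transform_within[OF this zero_less_one, of _ "\<lambda>t. (max 0 t)\<^sup>2"]
  have high: "((\<lambda>t. (max 0 t)\<^sup>2) has_real_derivative 2 * max 0 t) (at t within {0..})" if "0 \<le> t" for t :: real
    using that by (auto simp: max_def)
  consider "t < 0" | "t = 0" | "t > 0" by linarith
  then show ?thesis
  proof cases
    case 1
    then show ?thesis using low[of t] at_within_interior[of t "{..0}"] by (simp add: interior_Iic)
  next
    case 2
    have "{..0} \<union> {0..} = (UNIV :: real set)" by auto
    then show ?thesis using has_field_derivative_within_Un[OF low[of 0] high[of 0]] 2 by simp
  next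
    case 3
    then show ?thesis using high[of t] at_within_interior[of t "{0..}"] by (simp add: interior_Ici)
  qed
qed

text \<open>Indicators of boxes inside an annulus are limits of test functions, and integrals over boxes determine a
  function almost everywhere. Annuli exhaust the punctured ball.\<close>

lemma fundamental_lemma_punctured_ball:
  fixes P :: "real^'n \<Rightarrow> real"
  assumes int: "\<And>a b. 0 < a \<Longrightarrow> a < b \<Longrightarrow> b < 1 \<Longrightarrow> P absolutely_integrable_on annulus a b"
    and zero: "\<And>\<eta>. \<eta> \<in> C1c (ball 0 1 - {0}) \<Longrightarrow> (LINT x:ball 0 1|lebesgue. P x * \<eta> x) = 0"
  shows "AE x in lebesgue. x \<in> ball 0 1 - {0} \<longrightarrow> P x = 0"
proof -
  let ?O = "ball (0::real^'n) 1 - {0}"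
  have oO: "open ?O" by auto
  have box0: "(LINT x:cbox c d|lebesgue. P x) = 0" if sub: "cbox c d \<subseteq> ?O" for c d
  proof (cases "cbox c d = {}")
    case True
    then show ?thesis by (simp add: set_lebesgue_integral_def)
  next
    case False
    then have cd: "c $ i \<le> d $ i" for i by (auto simp: interval_ne_empty_cart)
    obtain a0 b0 where ab0: "0 < a0" "a0 < b0" "b0 < 1" "cbox c d \<subseteq> annulus a0 b0"
      using compact_in_annulus[OF compact_cbox sub] by blast
    define a b where "a = a0 / 2" and "b = (b0 + 1) / 2"
    have ab: "0 < a" "a < a0" "b0 < b" "b < 1" "a < b" using ab0 by (auto simp: a_def b_def)
    define C where "C = {x::real^'n. norm x \<le> a} \<union> {x. b \<le> norm x}"
    have "closed C" unfolding C_def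
      by (intro closed_Un closed_Collect_le continuous_intros)
    moreover have "cbox c d \<inter> C = {}"
      using ab0(4) ab by (force simp: C_def annulus_def)
    ultimately obtain \<delta> where \<delta>: "\<delta> > 0" "\<And>y x. y \<in> cbox c d \<Longrightarrow> x \<in> C \<Longrightarrow> \<delta> \<le> dist y x"
      using separate_compact_closed[OF compact_cbox, of C c d] by blast
    \<comment> \<open>the squared distance to the box, a continuously differentiable function\<close>
    define s where "s = (\<lambda>x. \<Sum>i\<in>UNIV. (max 0 (x $ i - d $ i))\<^sup>2 + (max 0 (c $ i - x $ i))\<^sup>2)"
    have s0: "s x \<ge> 0" for x unfolding s_def by (intro sum_nonneg) auto
    have s_box: "s x = 0 \<longleftrightarrow> x \<in> cbox c d" for x
    proof -
      have "(max 0 (p - q))\<^sup>2 + (max 0 (e - p))\<^sup>2 = 0 \<longleftrightarrow> e \<le> p \<and> p \<le> q" for p q e :: real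
        by (auto simp: sum_power2_eq_zero_iff max_def)
      then show ?thesis unfolding s_def by (subst sum_nonneg_eq_0_iff) (auto simp: mem_box_cart)
    qed
    have s_C: "s x \<ge> \<delta>\<^sup>2" if "x \<in> C" for x
    proof -
      define y where "y = (\<chi> i. max (c $ i) (min (d $ i) (x $ i)))"
      have "y \<in> cbox c d" using cd by (auto simp: y_def mem_box_cart)
      then have "\<delta> \<le> norm (y - x)" using \<delta>(2)[OF _ that] by (simp add: dist_norm)
      then have "\<delta>\<^sup>2 \<le> (norm (y - x))\<^sup>2" using \<delta>(1) by (intro power_mono) auto
      also have "\<dots> = (\<Sum>i\<in>UNIV. (y $ i - x $ i)\<^sup>2)"
        unfolding power2_norm_eq_inner inner_vec_def by (simp add: power2_eq_square)
      also have "\<dots> = s x"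
        unfolding s_def
      proof (rule sum.cong[OF refl])
        fix i
        show "(y $ i - x $ i)\<^sup>2 = (max 0 (x $ i - d $ i))\<^sup>2 + (max 0 (c $ i - x $ i))\<^sup>2"
          using cd[of i] by (auto simp: y_def max_def min_def power2_commute)
      qed
      finally show ?thesis .
    qed
    define \<eta> where "\<eta> = (\<lambda>m x. (max 0 (1 - real m * s x))\<^sup>2)"
    obtain M0 :: nat where M0: "1 / \<delta>\<^sup>2 < real M0" using reals_Archimedean2 by blast
    have off: "\<eta> m x = 0" if "m \<ge> M0" "x \<in> C" for m x
    proof -
      have "1 \<le> real M0 * \<delta>\<^sup>2" using M0 \<delta> by (simp add: field_simps)
      also have "\<dots> \<le> real m * s x" using that s_C by (intro mult_mono) auto
      finally show ?thesis by (simp add: \<eta>_def)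
    qed
    have offK: "\<eta> m x = 0" if "m \<ge> M0" "x \<notin> annulus a b" for m x
      using off[OF that(1), of x] that(2) by (auto simp: annulus_def C_def)
    define Gs where "Gs = (\<lambda>x. \<chi> i. 2 * max 0 (x $ i - d $ i) - 2 * max 0 (c $ i - x $ i))"
    have comp: "((\<lambda>x::real^'n. x $ i) has_derivative (\<lambda>h. h $ i)) (at x)" for i x
      by (rule bounded_linear_imp_has_derivative[OF bounded_linear_vec_nth])
    have Ds: "(s has_derivative (\<lambda>h. Gs x \<bullet> h)) (at x)" for x
    proof -
      have 1: "((\<lambda>x::real^'n. (max 0 (x $ i - d $ i))\<^sup>2) has_derivative (\<lambda>h. h $ i * (2 * max 0 (x $ i - d $ i)))) (at x)" for i
      proof -
        have "((\<lambda>x::real^'n. x $ i - d $ i) has_derivative (\<lambda>h. h $ i)) (at x)"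
          by (rule derivative_eq_intros comp refl)+ simp
        from has_derivative_compose[OF this DERIV_pos_part_square[unfolded has_field_derivative_def]]
        show ?thesis by (simp add: mult_ac)
      qed
      have 2: "((\<lambda>x::real^'n. (max 0 (c $ i - x $ i))\<^sup>2) has_derivative (\<lambda>h. - h $ i * (2 * max 0 (c $ i - x $ i)))) (at x)" for i
      proof -
        have "((\<lambda>x::real^'n. c $ i - x $ i) has_derivative (\<lambda>h. - h $ i)) (at x)"
          by (rule derivative_eq_intros comp refl)+ simp
        from has_derivative_compose[OF this DERIV_pos_part_square[unfolded has_field_derivative_def]]
        show ?thesis by (simp add: mult_ac)
      qed
      have "(\<Sum>i\<in>UNIV. h $ i * (2 * max 0 (x $ i - d $ i)) + - h $ i * (2 * max 0 (c $ i - x $ i))) = Gs x \<bullet> h" for h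
        unfolding inner_vec_def by (rule sum.cong) (auto simp: Gs_def algebra_simps)
      then have eq: "(\<lambda>h. \<Sum>i\<in>UNIV. h $ i * (2 * max 0 (x $ i - d $ i)) + - h $ i * (2 * max 0 (c $ i - x $ i))) = (\<lambda>h. Gs x \<bullet> h)"
        by (rule ext)
      show ?thesis
        unfolding s_def eq[symmetric] by (rule has_derivative_sum[OF has_derivative_add[OF 1 2]])
    qed
    have sc: "continuous_on S s" for S unfolding s_def by (intro continuous_intros)
    have D\<eta>: "(\<eta> m has_derivative (\<lambda>h. ((- 2 * real m * max 0 (1 - real m * s x)) *\<^sub>R Gs x) \<bullet> h)) (at x)" for m x
    proof -
      have "((\<lambda>x. 1 - real m * s x) has_derivative (\<lambda>h. - (real m * (Gs x \<bullet> h)))) (at x)"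
        by (rule derivative_eq_intros Ds refl)+ (simp add: algebra_simps)
      from has_derivative_compose[OF this DERIV_pos_part_square[unfolded has_field_derivative_def]]
      show ?thesis by (simp add: \<eta>_def mult_ac)
    qed
    have Gc: "continuous_on ?O (\<lambda>x. (- 2 * real m * max 0 (1 - real m * s x)) *\<^sub>R Gs x)" for m
    proof -
      have "continuous_on ?O Gs" unfolding Gs_def by (intro continuous_intros)
      then show ?thesis by (intro continuous_intros sc)
    qed
    have \<eta>C: "\<eta> m \<in> C1c ?O" if "m \<ge> M0" for m
      by (rule C1cI(1)[OF compact_annulus annulus_subset oO offK D\<eta> Gc]) (use that ab in auto)
    have Pi: "P absolutely_integrable_on annulus a b" by (rule int) (use ab in auto)
    have lim: "(\<lambda>m. LINT x|lebesgue. indicator (annulus a b) x *\<^sub>R P x * \<eta> m x) \<longlonglongrightarrow> (LINT x|lebesgue. indicator (cbox c d) x *\<^sub>R P x)"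
    proof (rule integral_dominated_convergence)
      show "integrable lebesgue (\<lambda>x. indicator (annulus a b) x *\<^sub>R \<bar>P x\<bar>)"
        using set_integrable_abs[OF Pi] by (simp add: set_integrable_def)
      have Pm: "(\<lambda>x. indicator (annulus a b) x *\<^sub>R P x) \<in> borel_measurable lebesgue"
        using Pi by (auto simp: set_integrable_def)
      have "continuous_on UNIV (\<eta> m)" for m unfolding \<eta>_def by (intro continuous_intros sc)
      then have "\<eta> m \<in> borel_measurable lborel" for m by (simp add: borel_measurable_continuous_onI)
      then have "\<eta> m \<in> borel_measurable lebesgue" for m by (rule measurable_completion)
      then show "(\<lambda>x. indicator (annulus a b) x *\<^sub>R P x * \<eta> m x) \<in> borel_measurable lebesgue" for m
        by (intro borel_measurable_times Pm)
      have "(\<lambda>x. indicator (cbox c d) x *\<^sub>R P x) = (\<lambda>x. indicator (cbox c d) x *\<^sub>R (indicator (annulus a b) x *\<^sub>R P x))"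
        using ab0(4) ab by (fastforce simp: fun_eq_iff annulus_def split: split_indicator)
      moreover have "(\<lambda>x. indicator (cbox c d) x *\<^sub>R (indicator (annulus a b) x *\<^sub>R P x)) \<in> borel_measurable lebesgue"
        by (rule borel_measurable_scaleR[OF borel_measurable_indicator Pm]) simp
      ultimately show "(\<lambda>x. indicator (cbox c d) x *\<^sub>R P x) \<in> borel_measurable lebesgue" by simp
      show "AE x in lebesgue. (\<lambda>m. indicator (annulus a b) x *\<^sub>R P x * \<eta> m x) \<longlonglongrightarrow> indicator (cbox c d) x *\<^sub>R P x"
      proof (rule AE_I2)
        fix x :: "real^'n"
        show "(\<lambda>m. indicator (annulus a b) x *\<^sub>R P x * \<eta> m x) \<longlonglongrightarrow> indicator (cbox c d) x *\<^sub>R P x"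
        proof (cases "x \<in> cbox c d")
          case True
          then have "s x = 0" "x \<in> annulus a b" using s_box ab0(4) ab by (auto simp: annulus_def)
          then show ?thesis using True by (simp add: \<eta>_def)
        next
          case False
          then have sx: "s x > 0" using s0[of x] s_box[of x] by linarith
          obtain m0 :: nat where m0: "1 / s x < real m0" using reals_Archimedean2 by blast
          have "\<eta> m x = 0" if "m \<ge> m0" for m
          proof -
            have "1 \<le> real m0 * s x" using m0 sx by (simp add: field_simps)
            also have "\<dots> \<le> real m * s x" using that sx by (intro mult_right_mono) auto
            finally show ?thesis by (simp add: \<eta>_def)
          qed
          then have "\<forall>\<^sub>F m in sequentially. indicator (annulus a b) x *\<^sub>R P x * \<eta> m x = 0"
            by (auto simp: eventually_sequentially intro!: exI[of _ m0])
          then show ?thesis using False by (simp add: tendsto_eventually)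
        qed
      qed
      show "AE x in lebesgue. norm (indicator (annulus a b) x *\<^sub>R P x * \<eta> m x) \<le> indicator (annulus a b) x *\<^sub>R \<bar>P x\<bar>" for m
      proof (rule AE_I2)
        fix x :: "real^'n"
        have "max 0 (1 - real m * s x) \<le> 1" using s0[of x] by simp
        then have "\<eta> m x \<le> 1" unfolding \<eta>_def by (intro power_le_one) auto
        then have "(indicator (annulus a b) x * \<bar>P x\<bar>) * \<eta> m x \<le> (indicator (annulus a b) x * \<bar>P x\<bar>) * 1"
          by (intro mult_left_mono) auto
        then show "norm (indicator (annulus a b) x *\<^sub>R P x * \<eta> m x) \<le> indicator (annulus a b) x *\<^sub>R \<bar>P x\<bar>"
          by (simp add: abs_mult) (simp add: \<eta>_def)
      qed
    qed
    have "\<forall>\<^sub>F m in sequentially. (LINT x|lebesgue. indicator (annulus a b) x *\<^sub>R P x * \<eta> m x) = 0"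
    proof (rule eventually_mono[OF eventually_ge_at_top[of M0]])
      fix m assume m: "M0 \<le> m"
      have eq: "(\<lambda>x. indicator (annulus a b) x *\<^sub>R P x * \<eta> m x) = (\<lambda>x. indicator (ball 0 1) x *\<^sub>R (P x * \<eta> m x))"
        using offK[OF m] ab by (auto simp: fun_eq_iff annulus_def split: split_indicator)
      show "(LINT x|lebesgue. indicator (annulus a b) x *\<^sub>R P x * \<eta> m x) = 0"
        unfolding eq by (rule zero[OF \<eta>C[OF m], unfolded set_lebesgue_integral_def])
    qed
    then have "(\<lambda>m. LINT x|lebesgue. indicator (annulus a b) x *\<^sub>R P x * \<eta> m x) \<longlonglongrightarrow> 0"
      by (rule tendsto_eventually)
    from LIMSEQ_unique[OF lim this] show ?thesis by (simp add: set_lebesgue_integral_def)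
  qed
  obtain D where D: "countable D" "D \<subseteq> Pow ?O" "\<And>X. X \<in> D \<Longrightarrow> \<exists>a b. X = cbox a b" "\<Union>D = ?O"
    using open_countable_Union_open_cbox[OF oO] by metis
  have "AE x in lebesgue. \<forall>X\<in>D. x \<in> X \<longrightarrow> P x = 0"
  proof (rule AE_ball_countable'[OF _ D(1)])
    fix X assume X: "X \<in> D"
    then obtain c d where cd: "X = cbox c d" "cbox c d \<subseteq> ?O" using D(2,3) by blast
    obtain a b where ab: "0 < a" "a < b" "b < 1" "cbox c d \<subseteq> annulus a b"
      using compact_in_annulus[OF compact_cbox cd(2)] by blast
    have "set_integrable lebesgue (cbox c d) P"
      by (rule set_integrable_subset[OF int[OF ab(1-3)]]) (use ab in auto)
    then have i: "integrable lebesgue (\<lambda>x. indicator (cbox c d) x *\<^sub>R P x)" by (simp add: set_integrable_def)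
    have "AE x in lebesgue. indicator (cbox c d) x *\<^sub>R P x = 0"
    proof (rule AE_zero_if_cbox_integrals_zero[OF i])
      fix e f :: "real^'n"
      have "\<exists>p q. cbox e f \<inter> cbox c d = cbox p q" unfolding Int_interval by (intro exI) (rule refl)
      then obtain p q where pq: "cbox e f \<inter> cbox c d = cbox p q" by blast
      have "(LINT x:cbox e f|lebesgue. indicator (cbox c d) x *\<^sub>R P x) = (LINT x:cbox p q|lebesgue. P x)"
        unfolding set_lebesgue_integral_def pq[symmetric]
        by (rule Bochner_Integration.integral_cong) (auto split: split_indicator)
      also have "\<dots> = 0" by (rule box0) (use pq cd in auto)
      finally show "(LINT x:cbox e f|lebesgue. indicator (cbox c d) x *\<^sub>R P x) = 0" .
    qed
    then show "AE x in lebesgue. x \<in> X \<longrightarrow> P x = 0" by eventually_elim (auto simp: cd)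
  qed
  then show ?thesis
  proof eventually_elim
    case (elim x)
    then show ?case using D(4) by blast
  qed
qed

text \<open>The lemma of du Bois-Reymond: subtracting from an arbitrary test function a fixed multiple of one with
  integral one gives the admissible test functions of mean zero.\<close>

lemma du_Bois_Reymond_unit_interval:
  fixes f :: "real \<Rightarrow> real"
  assumes f[measurable]: "f \<in> borel_measurable borel"
    and int: "\<And>a b. 0 < a \<Longrightarrow> a < b \<Longrightarrow> b < 1 \<Longrightarrow> set_integrable lborel {a..b} f"
    and zero: "\<And>\<zeta> a b. continuous_on UNIV \<zeta> \<Longrightarrow> 0 < a \<Longrightarrow> a < b \<Longrightarrow> b < 1 \<Longrightarrow> (\<And>r. r \<notin> {a..b} \<Longrightarrow> \<zeta> r = 0)
      \<Longrightarrow> (LINT r|lborel. \<zeta> r) = 0 \<Longrightarrow> (LINT r|lborel. f r * \<zeta> r) = 0"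
  obtains C where "AE r in lborel. r \<in> {0<..<1} \<longrightarrow> f r = C"
proof -
  have fc: "integrable lborel (\<lambda>r. f r * \<zeta> r)" "integrable lborel \<zeta>"
    if \<zeta>: "continuous_on UNIV \<zeta>" "\<And>r. r \<notin> {a..b} \<Longrightarrow> \<zeta> r = 0" and ab: "0 < a" "a < b" "b < 1" for \<zeta> a b
  proof -
    have [measurable]: "\<zeta> \<in> borel_measurable borel" using \<zeta>(1) by (rule borel_measurable_continuous_onI)
    have "bounded (\<zeta> ` {a..b})"
      by (intro compact_imp_bounded compact_continuous_image continuous_on_subset[OF \<zeta>(1)]) auto
    then obtain B where B: "\<And>r. r \<in> {a..b} \<Longrightarrow> \<bar>\<zeta> r\<bar> \<le> B"
      unfolding bounded_iff by (metis imageI real_norm_def)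
    have i: "integrable lborel (\<lambda>r. B * (indicator {a..b} r *\<^sub>R f r))"
      using int[OF ab] by (simp add: set_integrable_def)
    show "integrable lborel (\<lambda>r. f r * \<zeta> r)"
    proof (rule Bochner_Integration.integrable_bound[OF i])
      show "AE r in lborel. norm (f r * \<zeta> r) \<le> norm (B * (indicator {a..b} r *\<^sub>R f r))"
      proof (rule AE_I2)
        fix r
        show "norm (f r * \<zeta> r) \<le> norm (B * (indicator {a..b} r *\<^sub>R f r))"
        proof (cases "r \<in> {a..b}")
          case True
          have "\<bar>f r\<bar> * \<bar>\<zeta> r\<bar> \<le> \<bar>f r\<bar> * \<bar>B\<bar>" using B[OF True] by (intro mult_left_mono) auto
          then show ?thesis using True by (simp add: abs_mult mult.commute)
        qed (simp add: \<zeta>(2))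
      qed
    qed simp
    have "integrable lborel (\<lambda>r. indicator {a..b} r *\<^sub>R \<zeta> r)"
      by (rule borel_integrable_compact) (use \<zeta>(1) in \<open>auto intro: continuous_on_subset\<close>)
    moreover have "(\<lambda>r. indicator {a..b} r *\<^sub>R \<zeta> r) = \<zeta>"
      using \<zeta>(2) by (force simp: fun_eq_iff split: split_indicator)
    ultimately show "integrable lborel \<zeta>" by simp
  qed
  define \<zeta>0 where "\<zeta>0 = (\<lambda>r. real (Suc 3) * smoothstep' (real (Suc 3) * (r - 1/2)))"
  have z0: "continuous_on UNIV \<zeta>0" "\<And>r. r \<notin> {1/2..3/4} \<Longrightarrow> \<zeta>0 r = 0" "(LINT r|lborel. \<zeta>0 r) = 1"
  proof -
    show "continuous_on UNIV \<zeta>0" unfolding \<zeta>0_def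
      by (intro continuous_intros continuous_on_compose2[OF continuous_smoothstep']) auto
    show "\<zeta>0 r = 0" if "r \<notin> {1/2..3/4}" for r
      using that by (auto simp: \<zeta>0_def smoothstep_simps not_le)
    show "(LINT r|lborel. \<zeta>0 r) = 1"
      using lborel_integral_real_affine[of "1/4" \<zeta>0 "1/2"] integral_smoothstep'(1) by (simp add: \<zeta>0_def)
  qed
  define C where "C = (LINT r|lborel. f r * \<zeta>0 r)"
  have box: "(LINT r:{c..d}|lborel. f r - C) = 0" if cd: "0 < c" "c \<le> d" "d < 1" for c d
  proof -
    define a b where "a = min (c/2) (1/2)" and "b = max ((d+1)/2) (3/4)"
    have ab: "0 < a" "a < b" "b < 1" "a < c" "d < b" "a \<le> 1/2" "3/4 \<le> b" using cd by (auto simp: a_def b_def less_max_iff_disj min_less_iff_disj)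
    define T where "T = (\<lambda>m r. max 0 (1 - real m * max 0 (max (c - r) (r - d))))"
    obtain M0 :: nat where M0: "1 / min (c - a) (b - d) < real M0" using reals_Archimedean2 by blast
    have Tc: "continuous_on UNIV (T m)" for m unfolding T_def by (intro continuous_intros)
    have T0: "T m r = 0" if m: "M0 \<le> m" and r: "r \<notin> {a..b}" for m r
    proof -
      have pos: "0 < min (c - a) (b - d)" using ab by auto
      have "1 \<le> real M0 * min (c - a) (b - d)" using M0 pos by (simp only: pos_divide_less_eq)
      also have "\<dots> \<le> real m * max 0 (max (c - r) (r - d))"
        using m r pos by (intro mult_mono) auto
      finally show ?thesis by (simp add: T_def)
    qed
    have eq: "(LINT r|lborel. f r * T m r) = (LINT r|lborel. T m r) * C" if m: "M0 \<le> m" for m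
    proof -
      let ?\<zeta> = "\<lambda>r. T m r - (LINT r|lborel. T m r) * \<zeta>0 r"
      note Ti = fc[OF Tc T0[OF m] ab(1-3)]
      have z0i: "integrable lborel (\<lambda>r. f r * \<zeta>0 r)" "integrable lborel \<zeta>0"
        by (rule fc[of \<zeta>0 "1/2" "3/4"]; use z0 in simp)+
      have "(LINT r|lborel. f r * ?\<zeta> r) = 0"
      proof (rule zero[of ?\<zeta> a b])
        show "?\<zeta> r = 0" if "r \<notin> {a..b}" for r
          using T0[OF m that] z0(2)[of r] that ab by auto
        show "(LINT r|lborel. ?\<zeta> r) = 0" using Ti(2) z0i(2) z0(3) by (simp add: Bochner_Integration.integral_diff)
      qed (use ab in \<open>auto intro!: continuous_intros Tc z0(1)\<close>)
      moreover have "(\<lambda>r. f r * ?\<zeta> r) = (\<lambda>r. f r * T m r - (LINT r|lborel. T m r) * (f r * \<zeta>0 r))"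
        by (simp add: algebra_simps)
      ultimately show ?thesis using Ti(1) z0i(1) by (simp add: Bochner_Integration.integral_diff C_def)
    qed
    have Tb: "0 \<le> T m r" "T m r \<le> 1" for m r by (auto simp: T_def)
    have Tlim: "(\<lambda>m. indicator {a..b} r * T m r) \<longlonglongrightarrow> indicator {c..d} r" for r
    proof (cases "r \<in> {c..d}")
      case True
      then have "max 0 (max (c - r) (r - d)) = 0" by simp
      then show ?thesis using True ab by (simp add: T_def)
    next
      case False
      define s where "s = max 0 (max (c - r) (r - d))"
      have s: "s > 0" using False by (auto simp: s_def)
      obtain m0 :: nat where m0: "1 / s < real m0" using reals_Archimedean2 by blast
      have "T m r = 0" if "m \<ge> m0" for m
      proof -
        have "1 \<le> real m0 * s" using m0 s by (simp add: field_simps)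
        also have "\<dots> \<le> real m * s" using that s by (intro mult_right_mono) auto
        finally show ?thesis by (simp add: T_def s_def)
      qed
      then have "\<forall>\<^sub>F m in sequentially. indicator {a..b} r * T m r = 0"
        by (auto simp: eventually_sequentially intro!: exI[of _ m0])
      then show ?thesis using False by (simp add: tendsto_eventually)
    qed
    have [measurable]: "T m \<in> borel_measurable borel" for m using Tc by (rule borel_measurable_continuous_onI)
    have lim: "(\<lambda>m. LINT r|lborel. h r * T m r) \<longlonglongrightarrow> (LINT r|lborel. h r * indicator {c..d} r)"
      if h[measurable]: "h \<in> borel_measurable borel" and hi: "set_integrable lborel {a..b} h" for h
    proof (rule Lim_transform_eventually)
      show "(\<lambda>m. LINT r|lborel. h r * (indicator {a..b} r * T m r)) \<longlonglongrightarrow> (LINT r|lborel. h r * indicator {c..d} r)"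
      proof (rule integral_dominated_convergence)
        show "integrable lborel (\<lambda>r. indicator {a..b} r *\<^sub>R \<bar>h r\<bar>)"
          using set_integrable_abs[OF hi] by (simp add: set_integrable_def)
        show "AE r in lborel. (\<lambda>m. h r * (indicator {a..b} r * T m r)) \<longlonglongrightarrow> h r * indicator {c..d} r"
          by (intro AE_I2 tendsto_intros Tlim)
        show "AE r in lborel. norm (h r * (indicator {a..b} r * T m r)) \<le> indicator {a..b} r *\<^sub>R \<bar>h r\<bar>" for m
          using Tb[of m] by (auto simp: abs_mult mult_left_le split: split_indicator)
      qed auto
      show "\<forall>\<^sub>F m in sequentially. (LINT r|lborel. h r * (indicator {a..b} r * T m r)) = (LINT r|lborel. h r * T m r)"
        by (rule eventually_mono[OF eventually_ge_at_top[of M0]])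
          (auto intro!: Bochner_Integration.integral_cong simp: T0 split: split_indicator)
    qed
    have "set_integrable lborel {a..b} (\<lambda>r. 1::real)"
      by (intro borel_integrable_atLeastAtMost') auto
    from lim[OF _ this] have l1: "(\<lambda>m. LINT r|lborel. T m r) \<longlonglongrightarrow> (LINT r|lborel. indicator {c..d} r)" by simp
    have l2: "(\<lambda>m. LINT r|lborel. f r * T m r) \<longlonglongrightarrow> (LINT r|lborel. f r * indicator {c..d} r)"
      by (rule lim[OF f int[OF ab(1-3)]])
    have "(\<lambda>m. LINT r|lborel. f r * T m r) \<longlonglongrightarrow> (LINT r|lborel. indicator {c..d} r) * C"
      by (rule Lim_transform_eventually[OF tendsto_mult_right[OF l1]])
        (rule eventually_mono[OF eventually_ge_at_top[of M0]], rule eq[symmetric])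
    from LIMSEQ_unique[OF this l2]
    have "(LINT r:{c..d}|lborel. f r) = (LINT r:{c..d}|lborel. C)"
      by (simp add: set_lebesgue_integral_def mult.commute)
    moreover have "set_integrable lborel {c..d} f"
      by (rule set_integrable_subset[OF int[OF ab(1-3)]]) (use ab in auto)
    moreover have "set_integrable lborel {c..d} (\<lambda>r. C)"
      by (intro borel_integrable_atLeastAtMost') auto
    ultimately show ?thesis by (simp add: set_integral_diff)
  qed
  have AEm: "AE r in lborel. r \<in> {1 / real (m + 3)..1 - 1 / real (m + 3)} \<longrightarrow> f r - C = 0" for m
  proof -
    define a b where "a = 1 / real (m + 3)" and "b = 1 - 1 / real (m + 3)"
    have "1 / real (m + 3) < 1 / 2" "0 < 1 / real (m + 3)" by (simp_all add: field_simps)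
    then have ab: "0 < a" "a < b" "b < 1" by (auto simp: a_def b_def)
    have m: "(\<lambda>r. indicator {a..b} r *\<^sub>R (f r - C)) \<in> borel_measurable lborel" by measurable
    have "set_integrable lborel {a..b} (\<lambda>r. f r - C)"
      by (intro set_integral_diff(1) int[OF ab] borel_integrable_atLeastAtMost') auto
    then have i: "integrable lebesgue (\<lambda>r. indicator {a..b} r *\<^sub>R (f r - C))"
      using integrable_completion[OF m] by (simp add: set_integrable_def)
    have "AE r in lebesgue. indicator {a..b} r *\<^sub>R (f r - C) = 0"
    proof (rule AE_zero_if_cbox_integrals_zero[OF i])
      fix e g :: real
      define p q where "p = max e a" and "q = min g b"
      have "(LINT r:cbox e g|lebesgue. indicator {a..b} r *\<^sub>R (f r - C)) = (LINT r|lebesgue. indicator {p..q} r *\<^sub>R (f r - C))"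
        unfolding set_lebesgue_integral_def
        by (rule Bochner_Integration.integral_cong) (auto simp: p_def q_def split: split_indicator)
      also have "\<dots> = (LINT r|lborel. indicator {p..q} r *\<^sub>R (f r - C))"
        by (rule integral_completion) measurable
      also have "\<dots> = 0"
      proof (cases "p \<le> q")
        case True
        then show ?thesis using box[of p q] ab by (simp add: p_def q_def set_lebesgue_integral_def)
      qed simp
      finally show "(LINT r:cbox e g|lebesgue. indicator {a..b} r *\<^sub>R (f r - C)) = 0" .
    qed
    then have "AE r in lborel. indicator {a..b} r *\<^sub>R (f r - C) = 0" by (simp add: AE_completion_iff)
    then show ?thesis by eventually_elim (auto simp: a_def b_def)
  qed
  have "AE r in lborel. \<forall>m. r \<in> {1 / real (m + 3)..1 - 1 / real (m + 3)} \<longrightarrow> f r - C = 0"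
    unfolding AE_all_countable by (rule allI) (rule AEm)
  then have "AE r in lborel. r \<in> {0<..<1} \<longrightarrow> f r = C"
  proof eventually_elim
    case (elim r)
    show ?case
    proof
      assume r: "r \<in> {0<..<1}"
      define d where "d = min r (1 - r)"
      have d: "d > 0" using r by (auto simp: d_def)
      obtain m :: nat where "1 / d < real m" using reals_Archimedean2 by blast
      then have "1 / d < real (m + 3)" by simp
      then have "1 / real (m + 3) < d" using d by (simp add: field_simps)
      then have "r \<in> {1 / real (m + 3)..1 - 1 / real (m + 3)}" unfolding d_def by (simp add: less_imp_le)
      then show "f r = C" using elim by fastforce
    qed
  qed
  then show thesis by (rule that)
qed

section \<open>The ordinary differential equation of the profile\<close>

text \<open>The equation \<open>S\<^sub>k(D\<^sup>2u) = g(u)\<close> for radial functions in divergence form, with \<open>w\<close> the derivative of the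
  profile \<open>v\<close>. No derivative of \<open>w\<close> itself is asked for, since \<open>w\<close> need not be differentiable where it vanishes.\<close>

definition profile_ode :: "nat \<Rightarrow> nat \<Rightarrow> (real \<Rightarrow> real) \<Rightarrow> (real \<Rightarrow> real) \<Rightarrow> (real \<Rightarrow> real) \<Rightarrow> bool" where
  "profile_ode n k g v w \<longleftrightarrow> continuous_on {0<..<1} w
    \<and> (\<forall>r\<in>{0<..<1}. (v has_real_derivative w r) (at r) \<and> 0 \<le> w r
      \<and> ((\<lambda>r. r ^ n * (w r / r) ^ k) has_real_derivative r ^ (n - 1) * g (v r) / c_nk n k) (at r))"

lemma lebesgue_ball_integral_eq_lborel:
  fixes F :: "real^'n \<Rightarrow> real"
  assumes "F \<in> borel_measurable borel" "\<And>x. x \<notin> ball 0 1 \<Longrightarrow> F x = 0"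
  shows "(LINT x:ball 0 1|lebesgue. F x) = (LINT x|lborel. F x)"
proof -
  have "(\<lambda>x. indicator (ball 0 1) x *\<^sub>R F x) = F" using assms(2) by (auto simp: fun_eq_iff split: split_indicator)
  then have "(LINT x:ball 0 1|lebesgue. F x) = (LINT x|lebesgue. F x)" by (simp only: set_lebesgue_integral_def)
  also have "\<dots> = (LINT x|lborel. F x)" by (rule integral_completion) (use assms(1) in simp)
  finally show ?thesis .
qed

text \<open>Both sides give the same result against every test function: the left one by the definition of the weak
  gradient, the right one by integration by parts.\<close>

lemma weak_gradient_is_radial:
  fixes u :: "real^'n \<Rightarrow> real" and w v :: "real \<Rightarrow> real"
  assumes wg: "has_weak_gradient (ball 0 1) u Du" and rad: "\<And>x. x \<in> ball 0 1 \<Longrightarrow> u x = v (norm x)"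
    and v: "continuous_on {0<..<1} v"
    and w[measurable]: "w \<in> borel_measurable borel" and nn: "\<And>r. 0 \<le> w r"
    and wi: "\<And>a b. 0 < a \<Longrightarrow> a < b \<Longrightarrow> b < 1 \<Longrightarrow> set_integrable lborel {a..b} w"
    and wv: "\<And>a b. 0 < a \<Longrightarrow> a < b \<Longrightarrow> b < 1 \<Longrightarrow> (LINT r:{a..b}|lborel. w r) = v b - v a"
  shows "AE x in lebesgue. x \<in> ball 0 1 - {0} \<longrightarrow> Du x \<bullet> x = w (norm x) * norm x"
proof -
  let ?n = "CARD('n)" and ?B = "ball (0::real^'n) 1"
  define Q where "Q = (\<lambda>x::real^'n. (Du x \<bullet> x) / norm x ^ ?n)"
  define p where "p = (\<lambda>r. w r * (r / r ^ ?n))"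
  have pm[measurable]: "p \<in> borel_measurable borel" unfolding p_def by measurable
  have Qi: "Q absolutely_integrable_on annulus a b" if ab: "0 < a" "a < b" "b < 1" for a b
    unfolding Q_def by (rule radial_flux_integral(2)[OF wg _ v ab], rule rad, assumption)
  have pi: "(\<lambda>x::real^'n. p (norm x)) absolutely_integrable_on annulus a b" if ab: "0 < a" "a < b" "b < 1" for a b
  proof -
    have "set_integrable lborel {a..b} p" unfolding p_def
      by (intro integrable_mult_continuous_Icc w wi ab continuous_intros) (use ab in auto)
    from polar_annulus(1)[OF pm ab(1,3) this]
    have i: "integrable lborel (\<lambda>x::real^'n. indicator (annulus a b) x * p (norm x))" .
    have m: "(\<lambda>x::real^'n. indicator (annulus a b) x * p (norm x)) \<in> borel_measurable lborel"
      by (intro borel_measurable_times borel_measurable_indicator) auto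
    show ?thesis using integrable_completion[OF m] i by (simp add: set_integrable_def)
  qed
  have "AE x in lebesgue. x \<in> ?B - {0} \<longrightarrow> Q x - p (norm x) = 0"
  proof (rule fundamental_lemma_punctured_ball)
    show "(\<lambda>x. Q x - p (norm x)) absolutely_integrable_on annulus a b" if ab: "0 < a" "a < b" "b < 1" for a b
      by (intro set_integral_diff Qi pi ab)
    fix \<eta> :: "real^'n \<Rightarrow> real" assume eta: "\<eta> \<in> C1c (?B - {0})"
    obtain a b M where ab: "0 < a" "a < b" "b < 1" "0 \<le> M" and z: "\<And>x. x \<notin> annulus a b \<Longrightarrow> \<eta> x = 0"
      "\<And>x. x \<notin> annulus a b \<Longrightarrow> grad \<eta> x = 0" and M: "\<And>x. \<bar>\<eta> x\<bar> \<le> M" "\<And>x. norm (grad \<eta> x) \<le> M"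
      and D: "\<And>x. (\<eta> has_derivative (\<lambda>h. grad \<eta> x \<bullet> h)) (at x)"
      and cont: "continuous_on UNIV (grad \<eta>)" "continuous_on UNIV \<eta>"
      using C1c_annulusE[OF eta] by blast
    have sub: "annulus a b \<subseteq> ?B - {0}" using ab by (intro annulus_subset)
    then have out: "x \<notin> annulus a b" if "x \<notin> ?B" for x using that by auto
    have [measurable]: "\<eta> \<in> borel_measurable borel" using cont(2) by (rule borel_measurable_continuous_onI)
    have q: "(LINT x:?B|lebesgue. Q x * \<eta> x) = (LINT x|lborel. p (norm x) * \<eta> x)"
    proof -
      let ?F = "\<lambda>x::real^'n. v (norm x) * ((grad \<eta> x \<bullet> x) / norm x ^ ?n)"
      have Fm: "?F \<in> borel_measurable borel"
      proof -
        have n0: "\<And>x::real^'n. x \<in> annulus a b \<Longrightarrow> x \<noteq> 0" using sub by auto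
        have "continuous_on (annulus a b) (\<lambda>x::real^'n. v (norm x))"
          by (rule continuous_on_compose2[OF v]) (use ab in \<open>auto simp: annulus_def intro!: continuous_intros\<close>)
        then have "continuous_on (annulus a b) ?F"
          using n0 by (auto intro!: continuous_intros continuous_on_subset[OF cont(1)])
        from borel_measurable_continuous_on_indicator[OF annulus_sets this]
        have "(\<lambda>x. indicator (annulus a b) x *\<^sub>R ?F x) \<in> borel_measurable borel" .
        moreover have "(\<lambda>x. indicator (annulus a b) x *\<^sub>R ?F x) = ?F"
          using z(2) by (auto simp: fun_eq_iff split: split_indicator)
        ultimately show ?thesis by simp
      qed
      have "- (LINT x:?B|lebesgue. Q x * \<eta> x) = (LINT x:?B|lebesgue. u x * ((grad \<eta> x \<bullet> x) / norm x ^ ?n))"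
        unfolding Q_def weak_gradient_radial_identity[OF wg eta] ..
      also have "\<dots> = (LINT x:?B|lebesgue. ?F x)"
        by (rule set_lebesgue_integral_cong) (use rad in auto)
      also have "\<dots> = (LINT x|lborel. ?F x)"
        by (rule lebesgue_ball_integral_eq_lborel[OF Fm]) (use z(2) out in auto)
      also have "\<dots> = - (LINT x|lborel. w (norm x) * norm x / norm x ^ ?n * \<eta> x)"
        by (rule radial_primitive_identity[OF w nn wi wv v eta])
      finally show ?thesis by (simp add: p_def)
    qed
    have p': "(LINT x:?B|lebesgue. p (norm x) * \<eta> x) = (LINT x|lborel. p (norm x) * \<eta> x)"
      by (rule lebesgue_ball_integral_eq_lborel) (use z(1) out in auto)
    have Bs: "?B \<in> sets lebesgue" by simp
    have i1: "(\<lambda>x. Q x * \<eta> x) absolutely_integrable_on ?B"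
      by (rule absolutely_integrable_mult_continuous[OF Qi[OF ab(1-3)] compact_annulus _ Bs])
        (use sub z(1) in \<open>auto intro: continuous_on_subset[OF cont(2)]\<close>)
    have i2: "(\<lambda>x. p (norm x) * \<eta> x) absolutely_integrable_on ?B"
      by (rule absolutely_integrable_mult_continuous[OF pi[OF ab(1-3)] compact_annulus _ Bs])
        (use sub z(1) in \<open>auto intro: continuous_on_subset[OF cont(2)]\<close>)
    have "(LINT x:?B|lebesgue. (Q x - p (norm x)) * \<eta> x) = (LINT x:?B|lebesgue. Q x * \<eta> x) - (LINT x:?B|lebesgue. p (norm x) * \<eta> x)"
      using set_integral_diff(2)[OF i1 i2] by (simp only: left_diff_distrib)
    then show "(LINT x:?B|lebesgue. (Q x - p (norm x)) * \<eta> x) = 0" using q p' by simp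
  qed
  then show ?thesis
  proof eventually_elim
    case (elim x)
    show ?case
    proof
      assume x: "x \<in> ?B - {0}"
      then have "Q x = p (norm x)" using elim by simp
      then show "Du x \<bullet> x = w (norm x) * norm x" using x by (simp add: Q_def p_def)
    qed
  qed
qed

text \<open>The radial component of the gradient is bounded by its norm, which brings the assumption on the weighted
  Sobolev norm to the half-line.\<close>

lemma weighted_energy_finite:
  fixes Du :: "real^'n \<Rightarrow> real^'n" and w :: "real \<Rightarrow> real"
  assumes ws: "weighted_sobolev k u Du" and w[measurable]: "w \<in> borel_measurable borel" and nn: "\<And>r. 0 \<le> w r"
    and AE: "AE x in lebesgue. x \<in> ball 0 1 - {0} \<longrightarrow> Du x \<bullet> x = w (norm x) * norm x"
  shows "integrable lborel (\<lambda>r. indicator {0<..<1} r * (r ^ (CARD('n) - 1) * (r powr (1 - real k) * w r ^ (k + 1))))"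
proof -
  let ?f = "\<lambda>r. r powr (1 - real k) * w r ^ (k + 1)"
  have fm: "?f \<in> borel_measurable borel" by measurable
  have m: "(\<lambda>x::real^'n. indicator (ball 0 1) x * ?f (norm x)) \<in> borel_measurable lborel"
    by (intro borel_measurable_times borel_measurable_indicator) auto
  have "integrable lebesgue (\<lambda>x::real^'n. indicator (ball 0 1) x * ?f (norm x))"
  proof (rule Bochner_Integration.integrable_bound)
    show "integrable lebesgue (\<lambda>x. indicator (ball 0 1) x *\<^sub>R (norm x powr (1 - real k) * norm (Du x) ^ (k + 1)))"
      using ws by (simp add: weighted_sobolev_def set_integrable_def)
    show "(\<lambda>x::real^'n. indicator (ball 0 1) x * ?f (norm x)) \<in> borel_measurable lebesgue"
      using m by (rule measurable_completion)
    show "AE x in lebesgue. norm (indicator (ball 0 1) x * ?f (norm x))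
      \<le> norm (indicator (ball 0 1) x *\<^sub>R (norm x powr (1 - real k) * norm (Du x) ^ (k + 1)))"
      using AE
    proof eventually_elim
      case (elim x)
      show ?case
      proof (cases "x \<in> ball 0 1 - {0}")
        case True
        then have "w (norm x) * norm x = Du x \<bullet> x" using elim by simp
        also have "\<dots> \<le> norm (Du x) * norm x" by (rule norm_cauchy_schwarz)
        finally have "w (norm x) \<le> norm (Du x)" using True by simp
        then have "w (norm x) ^ (k + 1) \<le> norm (Du x) ^ (k + 1)" by (intro power_mono nn)
        then have "norm x powr (1 - real k) * w (norm x) ^ (k + 1) \<le> norm x powr (1 - real k) * norm (Du x) ^ (k + 1)"
          by (intro mult_left_mono) auto
        then show ?thesis using True nn[of "norm x"] by (simp add: abs_mult)
      next
        case False
        then show ?thesis by (cases "x = 0") auto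
      qed
    qed
  qed
  then have "integrable lborel (\<lambda>x::real^'n. indicator (ball 0 1) x * ?f (norm x))"
    using integrable_completion[OF m] by simp
  then show ?thesis using polar_integrable_iff[OF fm, where 'n='n] by simp
qed

lemma continuous_derivative_FTC:
  fixes v w :: "real \<Rightarrow> real"
  assumes D: "\<And>r. r \<in> {0<..<1} \<Longrightarrow> (v has_real_derivative w r) (at r)" and c: "continuous_on {0<..<1} w"
    and nn: "\<And>r. r \<in> {0<..<1} \<Longrightarrow> 0 \<le> w r"
  defines "w' \<equiv> (\<lambda>r. indicator {0<..<1} r * w r)"
  shows "w' \<in> borel_measurable borel" "\<And>r. 0 \<le> w' r"
    "\<And>a b. 0 < a \<Longrightarrow> a < b \<Longrightarrow> b < 1 \<Longrightarrow> set_integrable lborel {a..b} w'"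
    "\<And>a b. 0 < a \<Longrightarrow> a < b \<Longrightarrow> b < 1 \<Longrightarrow> (LINT r:{a..b}|lborel. w' r) = v b - v a"
proof -
  have "(\<lambda>r. indicator {0<..<1} r *\<^sub>R w r) \<in> borel_measurable borel"
    by (rule borel_measurable_continuous_on_indicator[OF _ c]) simp
  then show "w' \<in> borel_measurable borel" by (simp add: w'_def)
  show "0 \<le> w' r" for r using nn[of r] by (auto simp: w'_def split: split_indicator)
  fix a b :: real assume ab: "0 < a" "a < b" "b < 1"
  have cw: "continuous_on {a..b} w" by (rule continuous_on_subset[OF c]) (use ab in auto)
  have i: "set_integrable lborel {a..b} w" by (rule borel_integrable_atLeastAtMost'[OF cw])
  have e: "indicator {a..b} r *\<^sub>R w' r = indicator {a..b} r *\<^sub>R w r" for r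
    using ab by (auto simp: w'_def split: split_indicator)
  show "set_integrable lborel {a..b} w'" using i unfolding set_integrable_def e .
  have "(w has_integral (v b - v a)) {a..b}"
    by (rule fundamental_theorem_of_calculus)
      (use ab D in \<open>auto simp flip: has_real_derivative_iff_has_vector_derivative intro: has_field_derivative_at_within\<close>)
  then have "(LINT r:{a..b}|lborel. w r) = v b - v a"
    using set_borel_integral_eq_integral(2)[OF i] by (simp add: integral_unique)
  then show "(LINT r:{a..b}|lborel. w' r) = v b - v a"
    unfolding set_lebesgue_integral_def e .
qed

lemma AE_continuous_nonneg:
  fixes G :: "real \<Rightarrow> real"
  assumes G: "continuous_on {0<..<1} G" and AE: "AE r in lborel. r \<in> {0<..<1} \<longrightarrow> 0 \<le> G r" and r: "r \<in> {0<..<1}"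
  shows "0 \<le> G r"
proof (rule ccontr)
  assume n: "\<not> 0 \<le> G r"
  have "open ({0<..<1} \<inter> G -` {..<0})" by (intro continuous_open_preimage G) auto
  moreover have "r \<in> {0<..<1} \<inter> G -` {..<0}" using n r by auto
  ultimately obtain e where e: "e > 0" "ball r e \<subseteq> {0<..<1} \<inter> G -` {..<0}" by (meson open_contains_ball)
  have "AE x in lborel. x \<notin> ball r e" using AE
  proof eventually_elim
    case (elim x)
    then show ?case using e(2) by force
  qed
  then have "emeasure lborel (ball r e) = 0" by (subst (asm) AE_iff_measurable[OF _ refl]) (auto simp: ball_def)
  then show False using e(1) by (simp add: emeasure_ball)
qed

text \<open>Radial test functions turn the weak equation into \<open>f' = H\<close> in the sense of distributions, where
  \<open>f = c r\<^sup>n (w/r)\<^sup>k\<close> and \<open>H = r\<^sup>n\<^sup>-\<^sup>1 g(v)\<close> is continuous. By the lemma of du Bois-Reymond \<open>f\<close> agrees almost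
  everywhere with a continuously differentiable function. Hence \<open>w\<close> has a continuous representative, and \<open>v\<close>
  is continuously differentiable.\<close>

lemma radial_weak_solution_profile:
  fixes u :: "real^'n \<Rightarrow> real"
  assumes k: "1 \<le> k" "k \<le> CARD('n)" and gc: "continuous_on UNIV g" and wsol: "radial_weak_solution k g u Du"
    and ws: "weighted_sobolev k u Du" and rad: "radial_with_profile u v"
    and nn: "AE x\<in>ball 0 1 in lebesgue. radial_deriv Du x \<ge> 0"
  obtains w where "profile_ode (CARD('n)) k g v w"
proof -
  let ?n = "CARD('n)" and ?B = "ball (0::real^'n) 1" and ?A = "sphere_area TYPE('n)"
  define c where "c = c_nk ?n k"
  have c0: "c > 0" using k by (simp add: c_def c_nk_def zero_less_binomial_iff)
  have wg: "has_weak_gradient ?B u Du" using ws by (simp add: weighted_sobolev_def)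
  have rad': "u x = v (norm x)" if "x \<in> ?B" for x using rad that by (auto simp: radial_with_profile_def)
  have v1: "continuous_on {0<..1} v" using rad by (simp add: radial_with_profile_def)
  have v: "continuous_on {0<..<1} v" by (rule continuous_on_subset[OF v1]) auto
  have nn': "AE x in lebesgue. x \<in> ?B \<longrightarrow> Du x \<bullet> x \<ge> 0"
    using nn
  proof eventually_elim
    case (elim x)
    then show ?case by (cases "x = 0") (auto simp: radial_deriv_def zero_le_divide_iff)
  qed
  obtain w where w[measurable]: "w \<in> borel_measurable borel" and w0: "\<And>r. 0 \<le> w r"
    and wi: "\<And>a b. 0 < a \<Longrightarrow> a < b \<Longrightarrow> b < 1 \<Longrightarrow> set_integrable lborel {a..b} w"
    and wv: "\<And>a b. 0 < a \<Longrightarrow> a < b \<Longrightarrow> b < 1 \<Longrightarrow> (LINT r:{a..b}|lborel. w r) = v b - v a"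
    using radial_profile_density[OF wg rad' v nn'] by blast
  have AEw: "AE x in lebesgue. x \<in> ?B - {0} \<longrightarrow> Du x \<bullet> x = w (norm x) * norm x"
    by (rule weak_gradient_is_radial[OF wg rad' v w w0 wi wv])
  note energy = weighted_energy_finite[OF ws w w0 AEw]
  define f where "f = (\<lambda>r. c * (r ^ ?n * (w r / r) ^ k))"
  have fm[measurable]: "f \<in> borel_measurable borel" unfolding f_def by measurable
  have fi: "set_integrable lborel {a..b} f" if ab: "0 < a" "a < b" "b < 1" for a b
  proof -
    let ?E = "\<lambda>r. indicator {0<..<1} r * (r ^ (?n - 1) * (r powr (1 - real k) * w r ^ (k + 1)))"
    have iE: "set_integrable lborel {a..b} ?E"
      unfolding set_integrable_def by (rule integrable_mult_indicator[OF _ energy]) simp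
    have "set_integrable lborel {a..b} (\<lambda>r. ?E r * (inverse (r ^ (?n - 1)) * r powr (real k - 1)))"
      by (rule integrable_mult_continuous_Icc[OF _ iE]) (use ab in \<open>auto intro!: continuous_intros\<close>)
    moreover have "indicator {a..b} r *\<^sub>R (?E r * (inverse (r ^ (?n - 1)) * r powr (real k - 1))) = indicator {a..b} r *\<^sub>R w r ^ (k + 1)" for r
    proof (cases "r \<in> {a..b}")
      case True
      then have r: "r > 0" "r < 1" using ab by auto
      have "r powr (1 - real k) * r powr (real k - 1) = 1" using r by (simp flip: powr_add)
      moreover have "r ^ (?n - 1) * inverse (r ^ (?n - 1)) = 1" using r by simp
      moreover have "?E r * (inverse (r ^ (?n - 1)) * r powr (real k - 1))
        = (r ^ (?n - 1) * inverse (r ^ (?n - 1))) * (r powr (1 - real k) * r powr (real k - 1)) * w r ^ (k + 1)"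
      proof -
        have ind: "indicator {0<..<1} r = (1::real)" using r by simp
        show ?thesis unfolding ind mult_1 by (simp only: mult_ac)
      qed
      ultimately have "?E r * (inverse (r ^ (?n - 1)) * r powr (real k - 1)) = w r ^ (k + 1)" by (simp only: mult_1)
      then show ?thesis by (simp only:)
    qed simp
    ultimately have i1: "set_integrable lborel {a..b} (\<lambda>r. w r ^ (k + 1))" by (simp only: set_integrable_def)
    have i2: "set_integrable lborel {a..b} (\<lambda>r. 1 + w r ^ (k + 1))"
      by (intro set_integral_add i1 borel_integrable_atLeastAtMost') auto
    have i3: "set_integrable lborel {a..b} (\<lambda>r. w r ^ k)"
      unfolding set_integrable_def
    proof (rule Bochner_Integration.integrable_bound[OF i2[unfolded set_integrable_def]])
      have "t ^ k \<le> 1 + t ^ (k + 1)" if "0 \<le> t" for t :: real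
      proof (cases "t \<le> 1")
        case True
        then show ?thesis using power_le_one[OF that True, of k] zero_le_power[OF that, of "k + 1"] by linarith
      next
        case False
        then have "t ^ k \<le> t ^ (k + 1)" by (intro power_increasing) auto
        then show ?thesis by simp
      qed
      then show "AE r in lborel. norm (indicator {a..b} r *\<^sub>R w r ^ k) \<le> norm (indicator {a..b} r *\<^sub>R (1 + w r ^ (k + 1)))"
        using w0 by (auto split: split_indicator)
    qed measurable
    have "set_integrable lborel {a..b} (\<lambda>r. w r ^ k * (c * (r ^ ?n / r ^ k)))"
      by (rule integrable_mult_continuous_Icc[OF _ i3]) (use ab in \<open>auto intro!: continuous_intros\<close>)
    then show ?thesis by (simp add: f_def power_divide mult_ac)
  qed
  define H where "H = (\<lambda>r. r ^ (?n - 1) * g (v r))"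
  have Hc: "continuous_on {0<..1} H"
    unfolding H_def by (intro continuous_intros continuous_on_compose2[OF gc v1]) auto
  \<comment> \<open>an antiderivative of \<open>H\<close>; integrating from \<open>1\<close> avoids the singularity at \<open>0\<close>\<close>
  define G where "G = (\<lambda>r. - integral {r..1} H)"
  have GD: "(G has_real_derivative H r) (at r)" if r: "r \<in> {0<..<1}" for r
  proof -
    define d where "d = r / 2"
    have d: "0 < d" "d < r" "r < 1" using r by (auto simp: d_def)
    have Hcd: "continuous_on {d..1} H" by (rule continuous_on_subset[OF Hc]) (use d in auto)
    have "((\<lambda>s. integral {d..s} H) has_real_derivative H r) (at r within {d..1})"
      by (rule integral_has_real_derivative[OF Hcd]) (use d in auto)
    moreover have "at r within {d..1} = at r"
      by (rule at_within_interior) (use d in \<open>simp add: interior_atLeastAtMost_real\<close>)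
    ultimately have "((\<lambda>s. integral {d..s} H) has_real_derivative H r) (at r)" by simp
    then have D: "((\<lambda>s. integral {d..s} H - integral {d..1} H) has_real_derivative H r) (at r)"
      by (auto intro!: derivative_eq_intros)
    show ?thesis
    proof (rule has_field_derivative_transform_within_open[OF D, of "{d<..<1}"])
      fix s assume s: "s \<in> {d<..<1}"
      have "integral {d..s} H + integral {s..1} H = integral {d..1} H"
        by (rule Henstock_Kurzweil_Integration.integral_combine) (use s integrable_continuous_real[OF Hcd] in auto)
      then show "integral {d..s} H - integral {d..1} H = G s" by (simp add: G_def)
    qed (use d in auto)
  qed
  have Gc: "continuous_on {0<..<1} G"
    by (rule DERIV_continuous_on, rule has_field_derivative_at_within[OF GD])
  define G' where "G' = (\<lambda>r. indicator {0<..<1} r *\<^sub>R G r)"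
  have G'm[measurable]: "G' \<in> borel_measurable borel"
    unfolding G'_def by (rule borel_measurable_continuous_on_indicator[OF _ Gc]) simp
  have G'i: "set_integrable lborel {a..b} G'" if ab: "0 < a" "a < b" "b < 1" for a b
  proof -
    have "set_integrable lborel {a..b} G"
      by (intro borel_integrable_atLeastAtMost' continuous_on_subset[OF Gc]) (use ab in auto)
    moreover have "indicator {a..b} r *\<^sub>R G' r = indicator {a..b} r *\<^sub>R G r" for r
      using ab by (auto simp: G'_def split: split_indicator)
    ultimately show ?thesis by (simp only: set_integrable_def)
  qed
  have zero: "(LINT r|lborel. (f r - G' r) * \<zeta> r) = 0"
    if zc: "continuous_on UNIV \<zeta>" and ab: "0 < a" "a < b" "b < 1" and z: "\<And>r. r \<notin> {a..b} \<Longrightarrow> \<zeta> r = 0"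
      and z1: "(LINT r|lborel. \<zeta> r) = 0" for \<zeta> a b
  proof -
    have [measurable]: "\<zeta> \<in> borel_measurable borel" using zc by (rule borel_measurable_continuous_onI)
    have zi: "set_integrable lborel S \<zeta>" if "S = {c..d}" for S c d
      unfolding that by (intro borel_integrable_atLeastAtMost' continuous_on_subset[OF zc]) auto
    define \<psi> where "\<psi> = (\<lambda>r. integral {0..r} \<zeta>)"
    have \<psi>D: "(\<psi> has_real_derivative \<zeta> r) (at r)" if r: "r \<in> {0<..<1}" for r
    proof -
      have "(\<psi> has_real_derivative \<zeta> r) (at r within {0..1})"
        unfolding \<psi>_def by (rule integral_has_real_derivative) (use r in \<open>auto intro: continuous_on_subset[OF zc]\<close>)
      moreover have "at r within {0..1} = at r"
        by (rule at_within_interior) (use r in \<open>simp add: interior_atLeastAtMost_real\<close>)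
      ultimately show ?thesis by simp
    qed
    have \<psi>L: "\<psi> r = (LINT s:{0..r}|lborel. \<zeta> s)" for r
      unfolding \<psi>_def using set_borel_integral_eq_integral(2)[OF zi[OF refl]] by simp
    have \<psi>0: "\<psi> r = 0" if r: "r \<in> {0<..<1}" "r \<notin> {a..b}" for r
    proof (cases "r < a")
      case True
      then have e: "indicator {0..r} s *\<^sub>R \<zeta> s = 0" for s using z[of s] by (auto split: split_indicator)
      show ?thesis unfolding \<psi>L set_lebesgue_integral_def e by simp
    next
      case False
      then have e: "indicator {0..r} s *\<^sub>R \<zeta> s = \<zeta> s" for s using z[of s] r ab by (auto split: split_indicator)
      show ?thesis unfolding \<psi>L set_lebesgue_integral_def e by (rule z1)
    qed
    define \<eta> where "\<eta> = (\<lambda>x::real^'n. if norm x \<in> {a..b} then \<psi> (norm x) else 0)"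
    have zc': "continuous_on {0<..<1} \<zeta>" by (rule continuous_on_subset[OF zc]) auto
    have eta: "\<eta> \<in> C1c (?B - {0})" unfolding \<eta>_def by (rule radial_C1c(1)[OF ab(1,3) \<psi>0 \<psi>D zc'])
    have ge: "grad \<eta> x = (\<zeta> (norm x) / norm x) *\<^sub>R x" if "x \<in> ?B - {0}" for x
      unfolding \<eta>_def by (rule radial_C1c(2)[OF ab(1,3) \<psi>0 \<psi>D zc' that])
    have eta': "\<eta> \<in> C1c ?B" using eta C1c_mono[of "?B - {0}" ?B] by blast
    let ?I = "\<lambda>x. 1 / real k * (real k * c * (radial_deriv Du x / norm x) ^ k * (x \<bullet> grad \<eta> x)) + g (u x) * \<eta> x"
    have I0: "(LINT x:?B|lebesgue. ?I x) = 0"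
      using wsol eta' unfolding radial_weak_solution_def c_def by blast
    define \<Phi> where "\<Phi> = (\<lambda>r. c * (w r / r) ^ k * (r * \<zeta> r) + indicator {a..b} r *\<^sub>R (g (v r) * \<psi> r))"
    have \<psi>c: "continuous_on {0<..<1} \<psi>" by (rule DERIV_continuous_on, rule has_field_derivative_at_within[OF \<psi>D])
    have gvc: "continuous_on {a..b} (\<lambda>r. g (v r))"
      by (intro continuous_on_compose2[OF gc] continuous_on_subset[OF v]) (use ab in auto)
    have ig[measurable]: "(\<lambda>r. indicator {a..b} r *\<^sub>R (g (v r) * \<psi> r)) \<in> borel_measurable borel"
    proof (rule borel_measurable_continuous_on_indicator)
      have "continuous_on {a..b} \<psi>" by (rule continuous_on_subset[OF \<psi>c]) (use ab in auto)
      then show "continuous_on {a..b} (\<lambda>r. g (v r) * \<psi> r)" by (intro continuous_on_mult gvc)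
    qed simp
    have \<Phi>m[measurable]: "\<Phi> \<in> borel_measurable borel" unfolding \<Phi>_def by measurable
    have AEI: "AE x in lebesgue. indicator ?B x *\<^sub>R ?I x = indicator ?B x *\<^sub>R \<Phi> (norm x)"
    proof -
      have s0: "AE x in lebesgue. x \<noteq> (0::real^'n)"
        using AE_lborel_singleton[of "0::real^'n"] by (rule AE_completion)
      show ?thesis using AEw s0
      proof eventually_elim
        case (elim x)
        show ?case
        proof (cases "x \<in> ?B")
          case True
          then have x: "x \<in> ?B - {0}" using elim by auto
          then have rd: "radial_deriv Du x = w (norm x)" using elim by (simp add: radial_deriv_def)
          have xg: "x \<bullet> grad \<eta> x = norm x * \<zeta> (norm x)"
            using x unfolding ge[OF x] by (simp add: power2_norm_eq_inner[symmetric] power2_eq_square)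
          have "\<eta> x = indicator {a..b} (norm x) * \<psi> (norm x)" by (simp add: \<eta>_def)
          then show ?thesis using True k(1) unfolding rd xg by (simp add: \<Phi>_def rad' mult_ac)
        qed simp
      qed
    qed
    have m\<Phi>: "(\<lambda>x::real^'n. indicator ?B x *\<^sub>R \<Phi> (norm x)) \<in> borel_measurable lebesgue"
    proof (rule measurable_completion)
      show "(\<lambda>x::real^'n. indicator ?B x *\<^sub>R \<Phi> (norm x)) \<in> borel_measurable lborel"
        by (rule borel_measurable_scaleR[OF borel_measurable_indicator]) auto
    qed
    have mI: "(\<lambda>x. indicator ?B x *\<^sub>R ?I x) \<in> borel_measurable lebesgue"
      by (rule borel_measurable_AE[OF m\<Phi>]) (use AEI in \<open>auto elim!: eventually_mono\<close>)
    have "(LINT x:?B|lebesgue. ?I x) = (LINT x:?B|lebesgue. \<Phi> (norm x))"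
      unfolding set_lebesgue_integral_def by (rule integral_cong_AE[OF mI m\<Phi> AEI])
    also have "\<dots> = ?A * (LINT r:{0<..<1}|lborel. r ^ (?n - 1) * \<Phi> r)" by (rule polar_integral[OF \<Phi>m])
    finally have P0: "(LINT r:{0<..<1}|lborel. r ^ (?n - 1) * \<Phi> r) = 0"
      using I0 sphere_area_pos[where 'n='n] by simp
    have Hcd: "continuous_on {a..b} H" by (rule continuous_on_subset[OF Hc]) (use ab in auto)
    have e1: "indicator {0<..<1} r *\<^sub>R (r ^ (?n - 1) * \<Phi> r) = indicator {a..b} r *\<^sub>R (f r * \<zeta> r) + indicator {a..b} r *\<^sub>R (H r * \<psi> r)" for r
    proof (cases "r \<in> {a..b}")
      case True
      then have r: "r > 0" "r < 1" using ab by auto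
      have "r ^ ?n = r ^ (?n - 1) * r" by (metis power_minus_mult zero_less_card_finite)
      then show ?thesis using True r by (simp add: \<Phi>_def f_def H_def algebra_simps)
    next
      case False
      then show ?thesis using z[of r] by (simp add: \<Phi>_def)
    qed
    have i1: "set_integrable lborel {a..b} (\<lambda>r. f r * \<zeta> r)"
      by (rule integrable_mult_continuous_Icc[OF fm fi[OF ab]]) (rule continuous_on_subset[OF zc], simp)
    have \<psi>cab: "continuous_on {a..b} \<psi>" by (rule continuous_on_subset[OF \<psi>c]) (use ab in auto)
    have i2: "set_integrable lborel {a..b} (\<lambda>r. H r * \<psi> r)"
      by (intro borel_integrable_atLeastAtMost' continuous_on_mult Hcd \<psi>cab)
    have Gcab: "continuous_on {a..b} G" by (rule continuous_on_subset[OF Gc]) (use ab in auto)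
    have i3: "set_integrable lborel {a..b} (\<lambda>r. G r * \<zeta> r)"
      by (intro borel_integrable_atLeastAtMost' continuous_on_mult Gcab continuous_on_subset[OF zc]) auto
    have s1: "(LINT r:{a..b}|lborel. f r * \<zeta> r) + (LINT r:{a..b}|lborel. H r * \<psi> r) = 0"
      using P0 i1 i2 unfolding set_lebesgue_integral_def set_integrable_def e1
      by (simp only: Bochner_Integration.integral_add)
    have \<psi>ab: "\<psi> a = 0" "\<psi> b = 0"
    proof -
      have e: "indicator {0..a} s *\<^sub>R \<zeta> s = indicator {a} s *\<^sub>R \<zeta> a" for s
        using z[of s] ab by (auto split: split_indicator)
      show "\<psi> a = 0" unfolding \<psi>L set_lebesgue_integral_def e by simp
      have e: "indicator {0..b} s *\<^sub>R \<zeta> s = \<zeta> s" for s using z[of s] ab by (auto split: split_indicator)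
      show "\<psi> b = 0" unfolding \<psi>L set_lebesgue_integral_def e by (rule z1)
    qed
    have "((\<lambda>r. H r * \<psi> r + G r * \<zeta> r) has_integral (G b * \<psi> b - G a * \<psi> a)) {a..b}"
    proof (rule fundamental_theorem_of_calculus)
      fix r assume "r \<in> {a..b}"
      then have r: "r \<in> {0<..<1}" using ab by auto
      have "((\<lambda>r. G r * \<psi> r) has_real_derivative H r * \<psi> r + G r * \<zeta> r) (at r)"
        using DERIV_mult[OF GD[OF r] \<psi>D[OF r]] by (simp add: algebra_simps)
      then show "((\<lambda>r. G r * \<psi> r) has_vector_derivative H r * \<psi> r + G r * \<zeta> r) (at r within {a..b})"
        unfolding has_real_derivative_iff_has_vector_derivative[symmetric] by (rule has_field_derivative_at_within)
    qed (use ab in auto)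
    then have "(LINT r:{a..b}|lborel. H r * \<psi> r + G r * \<zeta> r) = 0"
      using set_borel_integral_eq_integral(2)[OF set_integral_add(1)[OF i2 i3]] by (simp add: \<psi>ab integral_unique)
    then have s2: "(LINT r:{a..b}|lborel. H r * \<psi> r) + (LINT r:{a..b}|lborel. G r * \<zeta> r) = 0"
      using i2 i3 by simp
    have "(f r - G' r) * \<zeta> r = indicator {a..b} r *\<^sub>R (f r * \<zeta> r) - indicator {a..b} r *\<^sub>R (G r * \<zeta> r)" for r
      using z[of r] ab by (auto simp: G'_def algebra_simps split: split_indicator)
    then have "(LINT r|lborel. (f r - G' r) * \<zeta> r) = (LINT r:{a..b}|lborel. f r * \<zeta> r) - (LINT r:{a..b}|lborel. G r * \<zeta> r)"
      using i1 i3 by (simp only: set_lebesgue_integral_def set_integrable_def Bochner_Integration.integral_diff)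
    then show ?thesis using s1 s2 by simp
  qed
  have fG: "set_integrable lborel {a..b} (\<lambda>r. f r - G' r)" if "0 < a" "a < b" "b < 1" for a b
    by (intro set_integral_diff fi G'i that)
  have fGm: "(\<lambda>r. f r - G' r) \<in> borel_measurable borel" by measurable
  obtain C where "AE r in lborel. r \<in> {0<..<1} \<longrightarrow> f r - G' r = C"
    by (rule du_Bois_Reymond_unit_interval[OF fGm fG zero])
  then have AEf: "AE r in lborel. r \<in> {0<..<1} \<longrightarrow> f r = G r + C"
    by eventually_elim (auto simp: G'_def)
  \<comment> \<open>nonnegative almost everywhere and continuous, hence nonnegative; the root below needs this at every point\<close>
  have GC0: "0 \<le> G r + C" if "r \<in> {0<..<1}" for r
  proof (rule AE_continuous_nonneg[OF _ _ that])
    show "continuous_on {0<..<1} (\<lambda>r. G r + C)" by (intro continuous_intros Gc)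
    show "AE r in lborel. r \<in> {0<..<1} \<longrightarrow> 0 \<le> G r + C"
      using AEf
    proof eventually_elim
      case (elim r)
      have "r \<in> {0<..<1} \<Longrightarrow> 0 \<le> f r" unfolding f_def using c0 w0[of r] by (auto intro!: mult_nonneg_nonneg)
      then show ?case using elim by auto
    qed
  qed
  define W where "W = (\<lambda>r. r * root k ((G r + C) / (c * r ^ ?n)))"
  have Wc: "continuous_on {0<..<1} W"
    unfolding W_def by (intro continuous_intros continuous_on_compose2[OF continuous_on_real_root[OF continuous_on_id]] Gc) (use c0 in auto)
  have W0: "0 \<le> W r" if "r \<in> {0<..<1}" for r
    unfolding W_def using GC0[OF that] that c0 by (auto intro!: mult_nonneg_nonneg divide_nonneg_nonneg real_root_ge_zero)
  have wW: "AE r in lborel. r \<in> {0<..<1} \<longrightarrow> w r = W r"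
    using AEf
  proof eventually_elim
    case (elim r)
    show ?case
    proof
      assume r: "r \<in> {0<..<1}"
      then have "(w r / r) ^ k = (G r + C) / (c * r ^ ?n)" using elim c0 by (auto simp: f_def field_simps)
      moreover have "root k ((w r / r) ^ k) = w r / r" using k(1) w0[of r] r by (intro real_root_power_cancel) auto
      ultimately show "w r = W r" using r by (simp add: W_def)
    qed
  qed
  have vW: "v b - v a = integral {a..b} W" if ab: "0 < a" "a < b" "b < 1" for a b
  proof -
    have Wi: "set_integrable lborel {a..b} W"
      by (intro borel_integrable_atLeastAtMost' continuous_on_subset[OF Wc]) (use ab in auto)
    have "v b - v a = (LINT r:{a..b}|lborel. w r)" by (rule wv[OF ab, symmetric])
    also have "\<dots> = (LINT r:{a..b}|lborel. W r)"
      unfolding set_lebesgue_integral_def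
    proof (rule integral_cong_AE)
      show "(\<lambda>r. indicator {a..b} r *\<^sub>R W r) \<in> borel_measurable lborel"
        using Wi unfolding set_integrable_def by (rule borel_measurable_integrable)
      show "AE r in lborel. indicator {a..b} r *\<^sub>R w r = indicator {a..b} r *\<^sub>R W r"
        using wW by eventually_elim (use ab in \<open>auto split: split_indicator\<close>)
    qed measurable
    also have "\<dots> = integral {a..b} W" by (rule set_borel_integral_eq_integral(2)[OF Wi])
    finally show ?thesis .
  qed
  have vD: "(v has_real_derivative W r) (at r)" if r: "r \<in> {0<..<1}" for r
  proof -
    define a b where "a = r / 2" and "b = (r + 1) / 2"
    have ab: "0 < a" "a < r" "r < b" "b < 1" using r by (auto simp: a_def b_def)
    have "((\<lambda>s. integral {a..s} W) has_real_derivative W r) (at r within {a..b})"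
      by (rule integral_has_real_derivative) (use ab in \<open>auto intro: continuous_on_subset[OF Wc]\<close>)
    moreover have "at r within {a..b} = at r"
      by (rule at_within_interior) (use ab in \<open>simp add: interior_atLeastAtMost_real\<close>)
    ultimately have "((\<lambda>s. integral {a..s} W) has_real_derivative W r) (at r)" by simp
    then have D: "((\<lambda>s. v a + integral {a..s} W) has_real_derivative W r) (at r)"
      by (auto intro!: derivative_eq_intros)
    show ?thesis
    proof (rule has_field_derivative_transform_within_open[OF D, of "{a<..<b}"])
      show "v a + integral {a..s} W = v s" if "s \<in> {a<..<b}" for s using vW[of a s] that ab by auto
    qed (use ab in auto)
  qed
  have "profile_ode ?n k g v W"
    unfolding profile_ode_def
  proof (intro conjI ballI Wc vD W0)
    fix r :: real assume r: "r \<in> {0<..<1}"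
    have e: "s ^ ?n * (W s / s) ^ k = (G s + C) / c" if s: "s \<in> {0<..<1}" for s
    proof -
      have "(W s / s) ^ k = (G s + C) / (c * s ^ ?n)"
        using s k(1) GC0[OF s] c0 by (simp add: W_def real_root_pow_pos2)
      then show ?thesis using s c0 by simp
    qed
    have D: "((\<lambda>s. (G s + C) / c) has_real_derivative H r / c) (at r)"
      using DERIV_cdivide[OF DERIV_add[OF GD[OF r] DERIV_const[of C]], of c] by simp
    have "((\<lambda>s. s ^ ?n * (W s / s) ^ k) has_real_derivative H r / c) (at r)"
      by (rule has_field_derivative_transform_within_open[OF D, of "{0<..<1}"]) (use r e in auto)
    then show "((\<lambda>r. r ^ ?n * (W r / r) ^ k) has_real_derivative r ^ (?n - 1) * g (v r) / c_nk ?n k) (at r)"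
      by (simp add: H_def c_def)
  qed
  then show thesis by (rule that)
qed

text \<open>The gradient is \<open>(w(r)/r) x\<close>. Its derivative is \<open>w/r\<close> across the radial direction and \<open>w'\<close> along it.\<close>

lemma radial_hessian:
  fixes u :: "real^'n \<Rightarrow> real"
  assumes rad: "\<And>x. x \<in> ball 0 1 \<Longrightarrow> u x = v (norm x)"
    and v: "\<And>r. r \<in> {0<..<1} \<Longrightarrow> (v has_real_derivative w r) (at r)"
    and x: "x \<in> ball 0 1 - {0}" and w: "(w has_real_derivative w1) (at (norm x))"
  shows "hessian u x = rank_one_pert (w (norm x) / norm x) w1 ((1 / norm x) *\<^sub>R x)"
proof -
  let ?O = "ball (0::real^'n) 1 - {0}" and ?r = "norm x"
  have oO: "open ?O" by auto
  have r: "?r > 0" "?r < 1" using x by auto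
  have Du: "(u has_derivative (\<lambda>h. ((w (norm y) / norm y) *\<^sub>R y) \<bullet> h)) (at y)" if y: "y \<in> ?O" for y
  proof (rule has_derivative_transform_within_open[OF _ oO y])
    show "((\<lambda>x. v (norm x)) has_derivative (\<lambda>h. ((w (norm y) / norm y) *\<^sub>R y) \<bullet> h)) (at y)"
      by (rule radial_has_derivative[OF _ v]) (use y in auto)
  qed (use rad in auto)
  have g: "grad u y = (w (norm y) / norm y) *\<^sub>R y" if "y \<in> ?O" for y
    by (rule has_derivative_imp_grad[OF Du[OF that]])
  define d where "d = (w1 * ?r - w ?r) / (?r * ?r)"
  have "((\<lambda>r. w r / r) has_real_derivative d) (at ?r)"
    unfolding d_def by (rule derivative_eq_intros w refl | use r in simp)+
  from has_derivative_scaleR[OF radial_has_derivative[OF _ this] has_derivative_ident]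
  have "((\<lambda>y. (w (norm y) / norm y) *\<^sub>R y) has_derivative (\<lambda>h. (w ?r / ?r) *\<^sub>R h + (((d / ?r) *\<^sub>R x) \<bullet> h) *\<^sub>R x)) (at x)"
    using x by auto
  then have D: "(grad u has_derivative (\<lambda>h. (w ?r / ?r) *\<^sub>R h + (((d / ?r) *\<^sub>R x) \<bullet> h) *\<^sub>R x)) (at x)"
    by (rule has_derivative_transform_within_open[OF _ oO x]) (simp add: g)
  have "hessian u x = matrix (\<lambda>h. (w ?r / ?r) *\<^sub>R h + (((d / ?r) *\<^sub>R x) \<bullet> h) *\<^sub>R x)"
    unfolding hessian_def jacobian_def frechet_derivative_at[OF D, symmetric] ..
  also have "\<dots> = rank_one_pert (w ?r / ?r) w1 ((1 / ?r) *\<^sub>R x)"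
  proof -
    have "(w ?r / ?r) * axis j 1 $ i + (d / ?r * x $ j) * x $ i
        = (if i = j then w ?r / ?r else 0) + (w1 - w ?r / ?r) * ((1 / ?r * x $ i) * (1 / ?r * x $ j))" for i j
    proof -
      have "d / ?r = (w1 - w ?r / ?r) * (1 / ?r * (1 / ?r))" using r by (simp add: d_def field_simps)
      then have "(d / ?r * x $ j) * x $ i = (w1 - w ?r / ?r) * ((1 / ?r * x $ i) * (1 / ?r * x $ j))"
        by (simp only: mult_ac)
      then show ?thesis by (simp add: axis_def)
    qed
    then show ?thesis by (simp add: matrix_def rank_one_pert_def vec_eq_iff inner_axis)
  qed
  finally show ?thesis .
qed

lemma c_nk_binomial:
  assumes "1 \<le> k" "k \<le> n"
  shows "real ((n - 1) choose (k - 1)) = real k * c_nk n k" "real ((n - 1) choose k) = (real n - real k) * c_nk n k"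
proof -
  obtain m where n: "n = Suc m" using assms by (cases n) auto
  obtain j where k: "k = Suc j" using assms by (cases k) auto
  have 1: "real (Suc j) * real (Suc m choose Suc j) = real (Suc m) * real (m choose j)"
    using Suc_times_binomial_eq[of m j] by (metis of_nat_mult mult.commute)
  then show A: "real ((n - 1) choose (k - 1)) = real k * c_nk n k"
    unfolding n k c_nk_def by (simp add: field_simps)
  have "real (n choose k) = real ((n - 1) choose (k - 1)) + real ((n - 1) choose k)" unfolding n k by simp
  moreover have "real (n choose k) = real n * c_nk n k" using assms by (simp add: c_nk_def)
  ultimately show "real ((n - 1) choose k) = (real n - real k) * c_nk n k" using A by (simp add: algebra_simps)
qed

text \<open>The source of the divergence form: up to a constant and the factor \<open>r\<^sup>n\<^sup>-\<^sup>1\<close>, the right-hand side is \<open>S\<^sub>k\<close>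
  at a matrix with eigenvalue \<open>w/r\<close> of multiplicity \<open>n-1\<close> and simple eigenvalue \<open>w'\<close>.\<close>

lemma hessian_quotient_derivative:
  fixes w :: "real \<Rightarrow> real"
  assumes "r \<noteq> 0" "(w has_real_derivative w1) (at r)" "1 \<le> k" "1 \<le> n"
  shows "((\<lambda>r. r ^ n * (w r / r) ^ k) has_real_derivative
    r ^ (n - 1) * ((real n - real k) * (w r / r) ^ k + real k * ((w r / r) ^ (k - 1) * w1))) (at r)"
proof -
  have q: "((\<lambda>r. w r / r) has_real_derivative (w1 * r - w r) / (r * r)) (at r)"
    by (rule derivative_eq_intros assms refl | use assms in simp)+
  have "((\<lambda>r. r ^ n * (w r / r) ^ k) has_real_derivative
     (real n * r ^ (n - 1)) * (w r / r) ^ k + (real k * (w r / r) ^ (k - 1) * ((w1 * r - w r) / (r * r))) * r ^ n) (at r)"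
  proof (rule DERIV_mult)
    show "((\<lambda>r. r ^ n) has_real_derivative real n * r ^ (n - 1)) (at r)" using DERIV_pow[of n r UNIV] by simp
    show "((\<lambda>r. (w r / r) ^ k) has_real_derivative real k * (w r / r) ^ (k - 1) * ((w1 * r - w r) / (r * r))) (at r)"
      using DERIV_power[OF q, of k] by (simp add: mult_ac)
  qed
  moreover have "(real n * r ^ (n - 1)) * (w r / r) ^ k + (real k * (w r / r) ^ (k - 1) * ((w1 * r - w r) / (r * r))) * r ^ n
     = r ^ (n - 1) * ((real n - real k) * (w r / r) ^ k + real k * ((w r / r) ^ (k - 1) * w1))"
  proof -
    define z where "z = w r / r"
    have w: "w r = z * r" using assms(1) by (simp add: z_def)
    have "r ^ n = r ^ (n - 1) * r" using assms(4) by (metis power_minus_mult less_eq_Suc_le One_nat_def)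
    moreover have "z ^ k = z ^ (k - 1) * z" using assms(3) by (metis power_minus_mult less_eq_Suc_le One_nat_def)
    moreover define y where "y = (w1 * r - w r) / (r * r)"
    moreover have "y * r = w1 - z" using assms(1) by (simp add: w y_def field_simps)
    moreover have "a * P * (Z * z) + b * Z * y * (P * r) = P * ((a - b) * (Z * z) + b * (Z * w1))"
      if "y * r = w1 - z" for a b P Z :: real
    proof -
      have "b * Z * y * (P * r) = b * Z * P * (w1 - z)" unfolding that[symmetric] by (simp only: mult_ac)
      then show ?thesis by (simp only: algebra_simps)
    qed
    ultimately show ?thesis unfolding z_def[symmetric] by (simp only:)
  qed
  ultimately show ?thesis by simp
qed

text \<open>Restriction of \<open>u\<close> to a ray from the origin.\<close>

lemma classical_solution_profile_derivatives:
  fixes u :: "real^'n \<Rightarrow> real"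
  assumes k: "1 \<le> k" "k \<le> CARD('n)" and sol: "classical_solution k g u" and rad: "radial_with_profile u v"
  obtains w where "continuous_on {0<..<1} w" "\<And>r. r \<in> {0<..<1} \<Longrightarrow> (v has_real_derivative w r) (at r)"
    "\<And>r. r \<in> {0<..<1} \<Longrightarrow> ((\<lambda>r. r ^ CARD('n) * (w r / r) ^ k) has_real_derivative r ^ (CARD('n) - 1) * g (v r) / c_nk (CARD('n)) k) (at r)"
proof -
  let ?n = "CARD('n)" and ?B = "ball (0::real^'n) 1"
  have rad': "u x = v (norm x)" if "x \<in> ?B" for x using rad that by (auto simp: radial_with_profile_def)
  have C2: "C2_on ?B u" and S: "\<And>x. x \<in> ?B \<Longrightarrow> S_k k (hessian u x) = g (u x)"
    using sol by (auto simp: classical_solution_def)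
  obtain i0 :: 'n where True by blast
  define e :: "real^'n" where "e = axis i0 1"
  have ne: "norm e = 1" by (simp add: e_def)
  define w where "w = (\<lambda>r. grad u (r *\<^sub>R e) \<bullet> e)"
  define w1 where "w1 = (\<lambda>r. (hessian u (r *\<^sub>R e) *v e) \<bullet> e)"
  have inB: "r *\<^sub>R e \<in> ?B" if "r \<in> {0<..<1}" for r using that ne by auto
  have line: "((\<lambda>r. r *\<^sub>R e) has_derivative (\<lambda>t. t *\<^sub>R e)) (at r)" for r
    by (auto intro!: derivative_eq_intros)
  have v: "(v has_real_derivative w r) (at r)" if r: "r \<in> {0<..<1}" for r
  proof -
    have "(u has_derivative (\<lambda>h. grad u (r *\<^sub>R e) \<bullet> h)) (at (r *\<^sub>R e))"
      by (rule differentiable_has_derivative_grad) (use C2 inB[OF r] in \<open>auto simp: C2_on_def\<close>)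
    from has_derivative_compose[OF line this]
    have "((\<lambda>r. u (r *\<^sub>R e)) has_real_derivative w r) (at r)"
      by (simp add: has_field_derivative_def w_def mult_commute_abs)
    then show ?thesis
      by (rule has_field_derivative_transform_within_open[of _ _ _ "{0<..<1}"]) (use r rad' inB ne in auto)
  qed
  have wD: "(w has_real_derivative w1 r) (at r)" if r: "r \<in> {0<..<1}" for r
  proof -
    have "(grad u has_derivative (\<lambda>h. hessian u (r *\<^sub>R e) *v h)) (at (r *\<^sub>R e))"
      using C2 inB[OF r] by (simp add: C2_on_def hessian_def jacobian_works)
    from has_derivative_inner_left[OF has_derivative_compose[OF line this], of e]
    have "(w has_derivative (\<lambda>t. (hessian u (r *\<^sub>R e) *v (t *\<^sub>R e)) \<bullet> e)) (at r)" by (simp add: w_def)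
    moreover have "(hessian u (r *\<^sub>R e) *v (t *\<^sub>R e)) \<bullet> e = w1 r * t" for t
      by (simp add: w1_def matrix_vector_mult_scaleR)
    ultimately show ?thesis by (simp add: has_field_derivative_def)
  qed
  show thesis
  proof (rule that[OF _ v])
    show "continuous_on {0<..<1} w"
      by (rule DERIV_continuous_on, rule has_field_derivative_at_within[OF wD])
    fix r :: real assume r: "r \<in> {0<..<1}"
    let ?x = "r *\<^sub>R e"
    have x: "?x \<in> ?B - {0}" "norm ?x = r" using inB[OF r] r ne by auto
    have "hessian u ?x = rank_one_pert (w r / r) (w1 r) ((1 / r) *\<^sub>R ?x)"
      using radial_hessian[OF rad' v x(1), of "w1 r"] wD[OF r] x(2) by simp
    moreover have "norm ((1 / r) *\<^sub>R ?x) = 1" using r ne by simp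
    ultimately have "g (v r) = real ((?n - 1) choose k) * (w r / r) ^ k + real ((?n - 1) choose (k - 1)) * (w r / r) ^ (k - 1) * w1 r"
      using S_k_rank_one_pert[OF _ k] S[of ?x] rad'[of ?x] x by auto
    then have g: "g (v r) = c_nk ?n k * ((real ?n - real k) * (w r / r) ^ k + real k * ((w r / r) ^ (k - 1) * w1 r))"
      unfolding c_nk_binomial[OF k] by (simp add: algebra_simps)
    have c0: "c_nk ?n k \<noteq> 0" using k by (simp add: c_nk_def zero_less_binomial_iff)
    have n1: "1 \<le> ?n" using k by linarith
    have "((\<lambda>r. r ^ ?n * (w r / r) ^ k) has_real_derivative
      r ^ (?n - 1) * ((real ?n - real k) * (w r / r) ^ k + real k * ((w r / r) ^ (k - 1) * w1 r))) (at r)"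
      by (rule hessian_quotient_derivative[OF _ wD[OF r] k(1) n1]) (use r in auto)
    moreover have "r ^ (?n - 1) * ((real ?n - real k) * (w r / r) ^ k + real k * ((w r / r) ^ (k - 1) * w1 r)) = r ^ (?n - 1) * g (v r) / c_nk ?n k"
      using c0 by (simp add: g)
    ultimately show "((\<lambda>r. r ^ ?n * (w r / r) ^ k) has_real_derivative r ^ (?n - 1) * g (v r) / c_nk ?n k) (at r)" by simp
  qed
qed

section \<open>Linearization with an outer function that is differentiable almost everywhere\<close>

lemma locally_lipschitz_on_Icc:
  assumes "locally_lipschitz g"
  obtains L where "L-lipschitz_on {a..b} g"
proof -
  have "local_lipschitz {0::real} {a..b} (\<lambda>_. g)"
    unfolding local_lipschitz_def
  proof (intro ballI)
    fix x t :: real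
    obtain e L where e: "e > 0" "L-lipschitz_on (ball x e) g"
      using assms unfolding locally_lipschitz_def by blast
    have "L-lipschitz_on (cball x (e / 2) \<inter> {a..b}) g"
      by (rule lipschitz_on_subset[OF e(2)]) (use e in auto)
    then show "\<exists>u>0. \<exists>L. \<forall>t\<in>cball t u \<inter> {0}. L-lipschitz_on (cball x u \<inter> {a..b}) g"
      using e(1) by (intro exI[of _ "e / 2"]) auto
  qed
  from local_lipschitz_compact_implies_lipschitz[OF this compact_Icc compact_insert[OF compact_empty]]
  obtain L where "\<And>t. t \<in> {0::real} \<Longrightarrow> L-lipschitz_on {a..b} g" by (auto intro: continuous_intros)
  then show thesis using that by blast
qed

text \<open>Discrete integration by parts: a translation of the variable moves the difference quotient to the
  differentiable factor \<open>\<psi>\<close>.\<close>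

lemma limit_of_difference_quotient_integrals:
  fixes h \<psi> :: "real \<Rightarrow> real"
  assumes h: "K-lipschitz_on UNIV h" and hb: "\<And>r. \<bar>h r\<bar> \<le> M"
    and \<psi>: "\<And>r. (\<psi> has_real_derivative \<psi>' r) (at r)" "continuous_on UNIV \<psi>'"
    and z: "\<And>r. r \<notin> {a..b} \<Longrightarrow> \<psi> r = 0"
  shows "(\<lambda>m. LINT r|lborel. real (Suc m) * (h (r + 1 / real (Suc m)) - h r) * \<psi> r) \<longlonglongrightarrow> - (LINT r|lborel. h r * \<psi>' r)"
proof -
  have hc: "continuous_on UNIV h" using h by (rule lipschitz_on_continuous_on)
  have \<psi>c: "continuous_on UNIV \<psi>" using \<psi>(1) by (auto intro!: DERIV_continuous_on)
  have [measurable]: "h \<in> borel_measurable borel" "\<psi> \<in> borel_measurable borel" "\<psi>' \<in> borel_measurable borel"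
    using hc \<psi>c \<psi>(2) by (auto intro: borel_measurable_continuous_onI)
  have z': "\<psi>' r = 0" if "r \<notin> {a..b}" for r
  proof -
    have "(\<psi> has_real_derivative 0) (at r)"
      by (rule has_field_derivative_transform_within_open[OF DERIV_const[of 0], of "- {a..b}"]) (use that z in auto)
    then show ?thesis using \<psi>(1) DERIV_unique by blast
  qed
  obtain B where B: "\<And>r. \<bar>\<psi>' r\<bar> \<le> B"
  proof -
    have "bounded (\<psi>' ` {a..b})"
      by (intro compact_imp_bounded compact_continuous_image continuous_on_subset[OF \<psi>(2)]) auto
    then obtain B where "\<And>r. r \<in> {a..b} \<Longrightarrow> \<bar>\<psi>' r\<bar> \<le> B" unfolding bounded_iff by (metis imageI real_norm_def)
    then have "\<bar>\<psi>' r\<bar> \<le> \<bar>B\<bar>" for r using z'[of r] by (cases "r \<in> {a..b}") fastforce+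
    then show thesis using that by blast
  qed
  have bc: "integrable lborel F" if F: "continuous_on UNIV F" "\<And>r. r \<notin> {c..d} \<Longrightarrow> F r = 0" for F :: "real \<Rightarrow> real" and c d
  proof -
    have "integrable lborel (\<lambda>r. indicator {c..d} r *\<^sub>R F r)"
      by (rule borel_integrable_compact) (use F(1) in \<open>auto intro: continuous_on_subset\<close>)
    moreover have "(\<lambda>r. indicator {c..d} r *\<^sub>R F r) = F" using F(2) by (force simp: fun_eq_iff split: split_indicator)
    ultimately show ?thesis by simp
  qed
  have sh: "continuous_on UNIV (\<lambda>r. F (r + t))" if "continuous_on UNIV F" for F :: "real \<Rightarrow> real" and t
    by (rule continuous_on_compose2[OF that]) (auto intro!: continuous_intros)
  have eq: "(LINT r|lborel. real (Suc m) * (h (r + 1 / real (Suc m)) - h r) * \<psi> r)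
    = (LINT r|lborel. h r * (real (Suc m) * (\<psi> (r + - 1 / real (Suc m)) - \<psi> r)))" for m
  proof -
    let ?t = "1 / real (Suc m)"
    have i1: "integrable lborel (\<lambda>r. h (r + ?t) * \<psi> r)"
      by (rule bc[of _ a b]) (auto intro!: continuous_intros sh hc \<psi>c simp: z)
    have i2: "integrable lborel (\<lambda>r. h r * \<psi> r)"
      by (rule bc[of _ a b]) (auto intro!: continuous_intros hc \<psi>c simp: z)
    have i3: "integrable lborel (\<lambda>r. h r * \<psi> (r + - ?t))"
      by (rule bc[of _ "a + ?t" "b + ?t"]) (auto intro!: continuous_intros sh[of \<psi> "- ?t", simplified] hc \<psi>c simp: z)
    have tr: "(LINT r|lborel. h (r + ?t) * \<psi> r) = (LINT r|lborel. h r * \<psi> (r + - ?t))"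
      using lborel_integral_real_affine[of 1 "\<lambda>r. h r * \<psi> (r + - ?t)" ?t] by (simp add: add.commute)
    have "(LINT r|lborel. real (Suc m) * (h (r + ?t) - h r) * \<psi> r) = (LINT r|lborel. real (Suc m) * (h (r + ?t) * \<psi> r - h r * \<psi> r))"
      by (rule Bochner_Integration.integral_cong) (auto simp: algebra_simps)
    also have "\<dots> = real (Suc m) * ((LINT r|lborel. h r * \<psi> (r + - ?t)) - (LINT r|lborel. h r * \<psi> r))"
      using i1 i2 tr by (simp add: Bochner_Integration.integral_diff)
    also have "\<dots> = (LINT r|lborel. real (Suc m) * (h r * \<psi> (r + - ?t) - h r * \<psi> r))"
      using i2 i3 by (simp add: Bochner_Integration.integral_diff)
    also have "\<dots> = (LINT r|lborel. h r * (real (Suc m) * (\<psi> (r + - 1 / real (Suc m)) - \<psi> r)))"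
      by (rule Bochner_Integration.integral_cong) (auto simp: algebra_simps)
    finally show ?thesis .
  qed
  have "(\<lambda>m. LINT r|lborel. h r * (real (Suc m) * (\<psi> (r + - 1 / real (Suc m)) - \<psi> r))) \<longlonglongrightarrow> (LINT r|lborel. h r * - \<psi>' r)"
  proof (rule integral_dominated_convergence)
    show "integrable lborel (\<lambda>r. indicator {a..b + 1} r *\<^sub>R (M * B))"
      by (rule borel_integrable_compact) auto
    show "AE r in lborel. (\<lambda>m. h r * (real (Suc m) * (\<psi> (r + - 1 / real (Suc m)) - \<psi> r))) \<longlonglongrightarrow> h r * - \<psi>' r"
    proof (rule AE_I2)
      fix r
      have "((\<lambda>t. (\<psi> (r + t) - \<psi> r) / t) \<longlongrightarrow> \<psi>' r) (at 0)" using \<psi>(1)[of r] by (simp add: DERIV_def)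
      moreover have "filterlim (\<lambda>m. - 1 / real (Suc m)) (at 0) sequentially"
        using tendsto_minus[OF LIMSEQ_inverse_real_of_nat] by (auto simp: filterlim_at inverse_eq_divide)
      ultimately have "(\<lambda>m. (\<psi> (r + - 1 / real (Suc m)) - \<psi> r) / (- 1 / real (Suc m))) \<longlonglongrightarrow> \<psi>' r"
        by (rule filterlim_compose)
      from tendsto_mult[OF tendsto_const[of "h r"] tendsto_minus[OF this]]
      show "(\<lambda>m. h r * (real (Suc m) * (\<psi> (r + - 1 / real (Suc m)) - \<psi> r))) \<longlonglongrightarrow> h r * - \<psi>' r"
        by (simp add: mult.commute)
    qed
    show "AE r in lborel. norm (h r * (real (Suc m) * (\<psi> (r + - 1 / real (Suc m)) - \<psi> r))) \<le> indicator {a..b + 1} r *\<^sub>R (M * B)" for m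
    proof (rule AE_I2)
      fix r
      let ?t = "1 / real (Suc m)"
      have t: "0 < ?t" "?t \<le> 1" by auto
      show "norm (h r * (real (Suc m) * (\<psi> (r + - 1 / real (Suc m)) - \<psi> r))) \<le> indicator {a..b + 1} r *\<^sub>R (M * B)"
      proof (cases "r \<in> {a..b + 1}")
        case True
        have "\<bar>\<psi> (r - ?t) - \<psi> r\<bar> \<le> B * \<bar>(r - ?t) - r\<bar>"
          using field_differentiable_bound[OF convex_UNIV, of \<psi> \<psi>' B "r - ?t" r] \<psi>(1) B by auto
        also have "\<bar>(r - ?t) - r\<bar> = ?t" using t by linarith
        finally have "real (Suc m) * \<bar>\<psi> (r - ?t) - \<psi> r\<bar> \<le> B" by (simp add: field_simps)
        then have "\<bar>h r\<bar> * (real (Suc m) * \<bar>\<psi> (r - ?t) - \<psi> r\<bar>) \<le> M * B"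
          using hb[of r] by (intro mult_mono) (auto intro: order_trans[OF abs_ge_zero])
        then show ?thesis using True by (simp add: abs_mult)
      next
        case False
        have "r - s \<notin> {a..b}" if "0 < s" "s \<le> 1" for s using False that by auto
        from this[OF t] have "\<psi> (r + - 1 / real (Suc m)) = 0" by (intro z) simp
        moreover have "\<psi> r = 0" using False by (intro z) auto
        ultimately show ?thesis using False by simp
      qed
    qed
  qed measurable
  then show ?thesis unfolding eq by simp
qed

text \<open>The chain rule \<open>(g \<circ> v)' = g'(v) w\<close> is wanted almost everywhere, although \<open>g\<close> may fail to be differentiable on
  a null set. The composition is monotone and Lipschitz, hence differentiable almost everywhere. Since \<open>w > 0\<close>,
  the inverse of \<open>v\<close> is differentiable, so \<open>g\<close> is differentiable at \<open>v r\<close> whenever \<open>g \<circ> v\<close> is at \<open>r\<close>. Freezing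
  \<open>v\<close> outside \<open>[a, b]\<close> provides a function on the whole line.\<close>

lemma ae_differentiable_outer_function:
  fixes g v w :: "real \<Rightarrow> real"
  assumes g: "antimono g" "locally_lipschitz g"
    and v: "\<And>r. r \<in> {0<..<1} \<Longrightarrow> (v has_real_derivative w r) (at r)" "\<And>r. r \<in> {0<..<1} \<Longrightarrow> 0 < w r"
      "continuous_on {0<..<1} w"
    and ab: "0 < a" "a < b" "b < 1"
  defines "h \<equiv> (\<lambda>r. g (v (max a (min b r))))"
  obtains K M where "K-lipschitz_on UNIV h" "\<And>r. \<bar>h r\<bar> \<le> M"
    "AE r in lborel. r \<in> {a<..<b} \<longrightarrow> (h has_real_derivative deriv g (v r) * w r) (at r)"
proof -
  have vmono: "v r < v s" if "r \<in> {0<..<1}" "s \<in> {0<..<1}" "r < s" for r s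
  proof (rule DERIV_pos_imp_increasing[OF that(3)])
    fix x assume "r \<le> x" "x \<le> s"
    then have "x \<in> {0<..<1}" using that by auto
    then show "\<exists>y. (v has_real_derivative y) (at x) \<and> 0 < y" using v(1,2) by blast
  qed
  have vle: "v r \<le> v s" if "r \<in> {0<..<1}" "s \<in> {0<..<1}" "r \<le> s" for r s
    using vmono[of r s] that by (cases "r = s") auto
  have cl: "max a (min b r) \<in> {a..b}" "max a (min b r) \<in> {0<..<1}" for r using ab by auto
  have "bounded (w ` {a..b})"
    by (intro compact_imp_bounded compact_continuous_image continuous_on_subset[OF v(3)]) (use ab in auto)
  then obtain W where W: "\<And>r. r \<in> {a..b} \<Longrightarrow> \<bar>w r\<bar> \<le> W" unfolding bounded_iff by (metis imageI real_norm_def)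
  have W0: "W \<ge> 0" using W[of a] ab by auto
  have vL: "W-lipschitz_on {a..b} v"
  proof (rule lipschitz_onI[OF _ W0])
    fix x y assume "x \<in> {a..b}" "y \<in> {a..b}"
    moreover have "(v has_field_derivative w r) (at r within {a..b})" if "r \<in> {a..b}" for r
      using v(1)[of r] that ab by (auto intro: has_field_derivative_at_within)
    ultimately show "dist (v x) (v y) \<le> W * dist x y"
      using field_differentiable_bound[of "{a..b}" v w W x y] W by (auto simp: dist_norm)
  qed
  obtain L where L: "L-lipschitz_on {v a..v b} g" using locally_lipschitz_on_Icc[OF g(2)] by blast
  have vin: "v (max a (min b r)) \<in> {v a..v b}" for r
    using vle[of a "max a (min b r)"] vle[of "max a (min b r)" b] cl[of r] ab by auto
  have L0: "L \<ge> 0" using L by (rule lipschitz_on_nonneg)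
  have hL: "(L * W)-lipschitz_on UNIV h"
  proof (rule lipschitz_onI)
    show "0 \<le> L * W" using L0 W0 by simp
    fix x y :: real
    have "dist (h x) (h y) \<le> L * dist (v (max a (min b x))) (v (max a (min b y)))"
      unfolding h_def by (rule lipschitz_onD[OF L vin vin])
    also have "\<dots> \<le> L * (W * dist (max a (min b x)) (max a (min b y)))"
      by (intro mult_left_mono lipschitz_onD[OF vL] cl L0)
    also have "\<dots> \<le> L * (W * dist x y)"
      by (intro mult_left_mono L0 W0) (auto simp: dist_real_def max_def min_def)
    finally show "dist (h x) (h y) \<le> L * W * dist x y" by (simp add: mult.assoc)
  qed
  have hb: "\<bar>h r\<bar> \<le> \<bar>g (v a)\<bar> + \<bar>g (v b)\<bar>" for r
    using antimonoD[OF g(1), of "v a" "v (max a (min b r))"] antimonoD[OF g(1), of "v (max a (min b r))" "v b"] vin[of r]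
    by (auto simp: h_def abs_if)
  have "mono (\<lambda>r. - h r)"
  proof (rule monoI)
    fix x y :: real assume "x \<le> y"
    then have "v (max a (min b x)) \<le> v (max a (min b y))" by (intro vle cl) auto
    then show "- h x \<le> - h y" unfolding h_def using antimonoD[OF g(1)] by simp
  qed
  moreover have "(L * W)-lipschitz_on UNIV (\<lambda>r. - h r)" using hL by (simp add: lipschitz_on_def dist_minus)
  ultimately have "negligible {r. \<not> (\<lambda>r. - h r) differentiable (at r)}" by (rule lipschitz_mono_ae_differentiable)
  then have "AE r in lborel. \<not> \<not> (\<lambda>r. - h r) differentiable (at r)"
    using AE_not_in[of "{r. \<not> (\<lambda>r. - h r) differentiable (at r)}" lebesgue]
    by (simp add: negligible_iff_null_sets AE_completion_iff)
  then have "AE r in lborel. r \<in> {a<..<b} \<longrightarrow> (h has_real_derivative deriv g (v r) * w r) (at r)"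
  proof eventually_elim
    case (elim r)
    show ?case
    proof
      assume r: "r \<in> {a<..<b}"
      have r01: "r \<in> {0<..<1}" using r ab by auto
      have "(\<lambda>r. - h r) differentiable (at r)" using elim by (rule notnotD)
      from differentiable_minus[OF this] have "h differentiable (at r)" by simp
      then obtain d where d: "(h has_real_derivative d) (at r)" using real_differentiable_def by blast
      define vi where "vi = the_inv_into {a<..<b} v"
      have inj: "inj_on v {a<..<b}"
      proof (rule linorder_inj_onI)
        show "v x \<noteq> v y" if "x < y" "x \<in> {a<..<b}" "y \<in> {a<..<b}" for x y
          using vmono[of x y] that ab by auto
      qed auto
      have vi: "vi (v x) = x" if "x \<in> {a<..<b}" for x unfolding vi_def by (rule the_inv_into_f_f[OF inj that])
      have cv: "continuous_on {a<..<b} v"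
        by (rule DERIV_continuous_on, rule has_field_derivative_at_within[OF v(1)]) (use ab in auto)
      define r1 r2 where "r1 = (a + r) / 2" and "r2 = (r + b) / 2"
      have rr: "a < r1" "r1 < r" "r < r2" "r2 < b" using r by (auto simp: r1_def r2_def)
      have im: "y \<in> v ` {r1..r2}" if "v r1 \<le> y" "y \<le> v r2" for y
      proof -
        have "\<exists>x\<ge>r1. x \<le> r2 \<and> v x = y"
        proof (rule IVT'[of v, OF that])
          show "continuous_on {r1..r2} v" by (rule continuous_on_subset[OF cv]) (use rr in auto)
        qed (use rr in simp)
        then show ?thesis by auto
      qed
      have vv: "v r1 < v r" "v r < v r2" using vmono[of r1 r] vmono[of r r2] rr ab by auto
      have civ: "isCont vi (v r)"
      proof (rule isCont_inverse_function2[of r1 r r2 vi v])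
        show "vi (v z) = z" if "r1 \<le> z" "z \<le> r2" for z using vi[of z] that rr by auto
        show "isCont v z" if "r1 \<le> z" "z \<le> r2" for z
          using v(1)[of z] that rr ab by (auto intro: DERIV_isCont)
      qed (use rr in auto)
      have Dvi: "(vi has_real_derivative inverse (w r)) (at (v r))"
      proof (rule DERIV_inverse_function[where f = v and a = "v r1" and b = "v r2"])
        show "(v has_real_derivative w r) (at (vi (v r)))" using v(1)[OF r01] vi[OF r] by simp
        show "w r \<noteq> 0" using v(2)[OF r01] by simp
        show "v (vi y) = y" if "v r1 < y" "y < v r2" for y
          using im[of y] that rr vi by auto
      qed (use vv civ in auto)
      have hvi: "((\<lambda>y. h (vi y)) has_real_derivative d * inverse (w r)) (at (v r))"
        by (rule DERIV_chain2[OF _ Dvi]) (use d vi[OF r] in simp)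
      have "(g has_real_derivative d * inverse (w r)) (at (v r))"
      proof (rule has_field_derivative_transform_within_open[OF hvi, of "{v r1<..<v r2}"])
        show "h (vi y) = g y" if y: "y \<in> {v r1<..<v r2}" for y
        proof -
          have "y \<in> v ` {r1..r2}" using im[of y] y by auto
          then obtain x where x: "x \<in> {r1..r2}" "v x = y" by auto
          then show ?thesis using vi[of x] rr by (auto simp: h_def)
        qed
      qed (use vv in auto)
      then have "deriv g (v r) = d * inverse (w r)" by (rule DERIV_imp_deriv)
      then have "deriv g (v r) * w r = d" using v(2)[OF r01] by simp
      then show "(h has_real_derivative deriv g (v r) * w r) (at r)" using d by simp
    qed
  qed
  with hL hb show thesis by (rule that)
qed

section \<open>The semistability inequality for the profile\<close>

text \<open>Where \<open>w\<close> is positive it is \<open>r\<close> times the \<open>k\<close>-th root of a differentiable positive function; its derivative is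
  then determined by the equation.\<close>

lemma profile_second_derivative:
  assumes k: "1 \<le> k" "k \<le> n" and ode: "profile_ode n k g v w" and pos: "\<And>r. r \<in> {0<..<1} \<Longrightarrow> 0 < w r"
    and gc: "continuous_on UNIV g"
  obtains w1 where "continuous_on {0<..<1} w1"
    "\<And>r. r \<in> {0<..<1} \<Longrightarrow> (w has_real_derivative w1 r) (at r)"
    "\<And>r. r \<in> {0<..<1} \<Longrightarrow> g (v r) = c_nk n k * ((real n - real k) * (w r / r) ^ k + real k * ((w r / r) ^ (k - 1) * w1 r))"
proof -
  define c where "c = c_nk n k"
  have c0: "c > 0" using k by (simp add: c_def c_nk_def zero_less_binomial_iff)
  have n1: "1 \<le> n" using k by linarith
  have kk: "real k > 0" using k by simp
  have wc: "continuous_on {0<..<1} w"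
    and v: "\<And>r. r \<in> {0<..<1} \<Longrightarrow> (v has_real_derivative w r) (at r)"
    and FD: "\<And>r. r \<in> {0<..<1} \<Longrightarrow> ((\<lambda>r. r ^ n * (w r / r) ^ k) has_real_derivative r ^ (n - 1) * g (v r) / c) (at r)"
    using ode by (auto simp: profile_ode_def c_def)
  define w1 where "w1 = (\<lambda>r. (g (v r) / c - (real n - real k) * (w r / r) ^ k) / (real k * (w r / r) ^ (k - 1)))"
  have vc: "continuous_on {0<..<1} v"
    by (rule DERIV_continuous_on, rule has_field_derivative_at_within[OF v])
  have gvc: "continuous_on {0<..<1} (\<lambda>r. g (v r))"
    by (rule continuous_on_compose2[OF gc vc]) auto
  have w1c: "continuous_on {0<..<1} w1"
    unfolding w1_def by (intro continuous_intros gvc wc) (use kk c0 pos in \<open>auto simp: less_imp_neq[symmetric]\<close>)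
  have ex: "\<exists>d. (w has_real_derivative d) (at r)" if r: "r \<in> {0<..<1}" for r
  proof -
    define F where "F = (\<lambda>r. r ^ n * (w r / r) ^ k)"
    have q: "\<exists>q. ((\<lambda>r. F r / r ^ n) has_real_derivative q) (at r)"
      unfolding F_def by (rule exI, rule DERIV_divide[OF FD[OF r] DERIV_pow]) (use r in simp)
    then obtain q where q: "((\<lambda>r. F r / r ^ n) has_real_derivative q) (at r)" by blast
    have Fe: "F s / s ^ n = (w s / s) ^ k" if "s \<in> {0<..<1}" for s using that by (simp add: F_def)
    have F0: "0 < F r / r ^ n" unfolding Fe[OF r] using pos[OF r] r by simp
    have rt: "(root k has_real_derivative inverse (real k * root k (F r / r ^ n) ^ (k - Suc 0))) (at (F r / r ^ n))"
      by (rule DERIV_real_root) (use k F0 in auto)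
    have "((\<lambda>r. r * root k (F r / r ^ n)) has_real_derivative
        1 * root k (F r / r ^ n) + (inverse (real k * root k (F r / r ^ n) ^ (k - Suc 0)) * q) * r) (at r)"
      by (rule DERIV_mult[OF DERIV_ident DERIV_chain2[OF rt q]])
    then have "(w has_real_derivative
        1 * root k (F r / r ^ n) + (inverse (real k * root k (F r / r ^ n) ^ (k - Suc 0)) * q) * r) (at r)"
    proof (rule has_field_derivative_transform_within_open[of _ _ _ "{0<..<1}"])
      fix s :: real assume s: "s \<in> {0<..<1}"
      have "root k ((w s / s) ^ k) = w s / s"
        by (rule real_root_power_cancel) (use k pos[OF s] s in auto)
      then show "s * root k (F s / s ^ n) = w s" unfolding Fe[OF s] using s by simp
    qed (use r in auto)
    then show ?thesis by blast
  qed
  have D: "(w has_real_derivative w1 r) (at r) \<and> g (v r) = c * ((real n - real k) * (w r / r) ^ k + real k * ((w r / r) ^ (k - 1) * w1 r))"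
    if r: "r \<in> {0<..<1}" for r
  proof -
    obtain d where d: "(w has_real_derivative d) (at r)" using ex[OF r] by blast
    have r0: "r \<noteq> 0" "r > 0" using r by auto
    have L0: "(w r / r) ^ (k - 1) > 0" using pos[OF r] r0 by simp
    have "r ^ (n - 1) * ((real n - real k) * (w r / r) ^ k + real k * ((w r / r) ^ (k - 1) * d)) = r ^ (n - 1) * g (v r) / c"
      by (rule DERIV_unique[OF hessian_quotient_derivative[OF r0(1) d k(1) n1] FD[OF r]])
    then have "r ^ (n - 1) * ((real n - real k) * (w r / r) ^ k + real k * ((w r / r) ^ (k - 1) * d)) = r ^ (n - 1) * (g (v r) / c)"
      unfolding times_divide_eq_right .
    have rp: "r ^ (n - 1) \<noteq> 0" using r0(1) by simp
    have e: "(real n - real k) * (w r / r) ^ k + real k * ((w r / r) ^ (k - 1) * d) = g (v r) / c"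
      by (rule mult_left_cancel[OF rp, THEN iffD1]) fact
    have "w1 r = d"
    proof -
      have "g (v r) / c - (real n - real k) * (w r / r) ^ k = d * (real k * (w r / r) ^ (k - 1))" using e by (simp add: mult_ac)
      then have "w1 r = d * (real k * (w r / r) ^ (k - 1)) / (real k * (w r / r) ^ (k - 1))" unfolding w1_def by (simp only:)
      moreover have "real k * (w r / r) ^ (k - 1) \<noteq> 0" using mult_pos_pos[OF kk L0] by linarith
      ultimately show ?thesis by (metis nonzero_mult_div_cancel_right)
    qed
    moreover have "g (v r) = c * ((real n - real k) * (w r / r) ^ k + real k * ((w r / r) ^ (k - 1) * d))"
      unfolding e using c0 by simp
    ultimately show ?thesis using d by simp
  qed
  show thesis by (rule that[OF w1c]) (use D in \<open>auto simp: c_def\<close>)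
qed

text \<open>Serves to regard functions with support in \<open>[a, b]\<close> as functions on the line.\<close>

lemma extend_by_zero_continuous:
  fixes f :: "real \<Rightarrow> real"
  assumes "0 < a" "b < 1" and f: "continuous_on {0<..<1} f" and z: "\<And>r. r \<in> {0<..<1} \<Longrightarrow> r \<notin> {a..b} \<Longrightarrow> f r = 0"
  defines "f0 \<equiv> (\<lambda>r. if r \<in> {0<..<1} then f r else 0)"
  shows "continuous_on UNIV f0" "\<exists>B\<ge>0. \<forall>r. \<bar>f0 r\<bar> \<le> B" "\<And>r. r \<notin> {a..b} \<Longrightarrow> f0 r = 0" "f0 \<in> borel_measurable borel"
proof -
  show z0: "f0 r = 0" if "r \<notin> {a..b}" for r using z that by (simp add: f0_def)
  have "continuous_on ({0<..<1} \<union> - {a..b}) f0"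
  proof (rule continuous_on_open_Un)
    show "continuous_on {0<..<1} f0" using f by (rule continuous_on_eq) (simp add: f0_def)
    show "continuous_on (- {a..b}) f0" by (rule continuous_on_eq[OF continuous_on_const[of _ 0]]) (simp add: z0)
  qed auto
  moreover have "{0<..<1} \<union> - {a..b} = UNIV" using assms(1,2) by auto
  ultimately show c: "continuous_on UNIV f0" by simp
  then show "f0 \<in> borel_measurable borel" by (rule borel_measurable_continuous_onI)
  have "bounded (f0 ` {a..b})"
    by (intro compact_imp_bounded compact_continuous_image continuous_on_subset[OF c]) auto
  then obtain B where B: "\<And>r. r \<in> {a..b} \<Longrightarrow> \<bar>f0 r\<bar> \<le> B" unfolding bounded_iff by (metis imageI real_norm_def)
  have "\<bar>f0 r\<bar> \<le> \<bar>B\<bar>" for r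
  proof (cases "r \<in> {a..b}")
    case True
    then show ?thesis using B[of r] by linarith
  qed (simp add: z0)
  then show "\<exists>B\<ge>0. \<forall>r. \<bar>f0 r\<bar> \<le> B" by (intro exI[of _ "\<bar>B\<bar>"]) auto
qed

lemma integrable_bounded_supported:
  fixes f :: "real \<Rightarrow> real"
  assumes [measurable]: "f \<in> borel_measurable borel" and B: "\<And>r. \<bar>f r\<bar> \<le> B" and z: "\<And>r. r \<notin> {a..b} \<Longrightarrow> f r = 0"
  shows "integrable lborel f"
proof (rule Bochner_Integration.integrable_bound)
  show "integrable lborel (\<lambda>r. B * indicator {a..b} r)"
    by (intro integrable_mult_right integrable_real_indicator) (auto simp: emeasure_lborel_Icc_eq)
  show "AE r in lborel. norm (f r) \<le> norm (B * indicator {a..b} r)"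
    using B z by (intro AE_I2) (auto split: split_indicator intro: order_trans[OF _ abs_ge_self])
qed simp

lemma difference_quotient_sequence:
  assumes "(h has_real_derivative d) (at r)"
  shows "(\<lambda>m. real (Suc m) * (h (r + 1 / real (Suc m)) - h r)) \<longlonglongrightarrow> d"
proof -
  have "(\<lambda>m. 1 / real (Suc m)) \<longlonglongrightarrow> 0" using LIMSEQ_inverse_real_of_nat by (simp add: inverse_eq_divide)
  then have "filterlim (\<lambda>m. 1 / real (Suc m)) (at 0) sequentially" by (simp add: filterlim_at)
  from filterlim_compose[OF assms[unfolded DERIV_def] this]
  show ?thesis by (simp add: mult.commute)
qed

text \<open>Semistability with the test function \<open>w \<eta>\<close>. The term \<open>g'(v) w\<^sup>2 \<eta>\<^sup>2 = (g \<circ> v)' w \<eta>\<^sup>2\<close> is the limit of difference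
  quotients of \<open>g \<circ> v\<close>, times \<open>w \<eta>\<^sup>2\<close>. These are bounded, so the integrals converge, and the limit of the
  integrals can be computed by moving the difference quotient to \<open>r\<^sup>n\<^sup>-\<^sup>1 w \<eta>\<^sup>2\<close>. This eliminates \<open>g'\<close>.\<close>

lemma semistable_profile_inequality:
  fixes u :: "real^'n \<Rightarrow> real"
  assumes k: "1 \<le> k" "k \<le> CARD('n)" and g: "antimono g" "locally_lipschitz g"
    and rad: "radial_with_profile u v" and st: "semistable k g u"
    and v: "\<And>r. r \<in> {0<..<1} \<Longrightarrow> (v has_real_derivative w r) (at r)"
    and pos: "\<And>r. r \<in> {0<..<1} \<Longrightarrow> 0 < w r"
    and w: "\<And>r. r \<in> {0<..<1} \<Longrightarrow> (w has_real_derivative w1 r) (at r)" and w1c: "continuous_on {0<..<1} w1"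
    and ab: "0 < a" "a < b" "b < 1"
    and \<eta>: "\<And>r. r \<in> {0<..<1} \<Longrightarrow> (\<eta> has_real_derivative \<eta>' r) (at r)" "continuous_on {0<..<1} \<eta>'"
    and z: "\<And>r. r \<in> {0<..<1} \<Longrightarrow> r \<notin> {a<..<b} \<Longrightarrow> \<eta> r = 0"
  shows "0 \<le> (LINT r:{a..b}|lborel. r ^ (CARD('n) - 1) * (real k * c_nk (CARD('n)) k * (w r / r) ^ (k - 1) * (w1 r * \<eta> r + w r * \<eta>' r)\<^sup>2)
     - g (v r) * (r ^ (CARD('n) - 1) * (real (CARD('n) - 1) * (w r * (\<eta> r)\<^sup>2) / r + w1 r * (\<eta> r)\<^sup>2 + 2 * w r * \<eta> r * \<eta>' r)))"
proof -
  let ?n = "CARD('n)" and ?B = "ball (0::real^'n) 1" and ?A = "sphere_area TYPE('n)"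
  have rad': "u x = v (norm x)" if "x \<in> ?B" for x using rad that by (auto simp: radial_with_profile_def)
  have wc: "continuous_on {0<..<1} w" by (rule DERIV_continuous_on, rule has_field_derivative_at_within[OF w])
  have \<eta>c: "continuous_on {0<..<1} \<eta>" by (rule DERIV_continuous_on, rule has_field_derivative_at_within[OF \<eta>(1)])
  have z': "\<eta> r = 0" "\<eta>' r = 0" if r: "r \<in> {0<..<1}" "r \<notin> {a..b}" for r
  proof -
    show "\<eta> r = 0" using z r by auto
    have "(\<eta> has_real_derivative 0) (at r)"
      by (rule has_field_derivative_transform_within_open[OF DERIV_const[of 0], of "{0<..<1} - {a..b}"])
        (use r z in \<open>auto intro: open_Diff\<close>)
    then show "\<eta>' r = 0" using \<eta>(1)[OF r(1)] DERIV_unique by blast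
  qed
  define \<xi> \<xi>' where "\<xi> = (\<lambda>r. w r * \<eta> r)" and "\<xi>' = (\<lambda>r. w1 r * \<eta> r + w r * \<eta>' r)"
  have \<xi>D: "(\<xi> has_real_derivative \<xi>' r) (at r)" if "r \<in> {0<..<1}" for r
    using DERIV_mult[OF w[OF that] \<eta>(1)[OF that]] by (simp add: \<xi>_def \<xi>'_def mult_ac)
  have \<xi>'c: "continuous_on {0<..<1} \<xi>'" unfolding \<xi>'_def by (intro continuous_intros wc w1c \<eta>c \<eta>(2))
  have \<xi>z: "\<xi> r = 0" if "r \<in> {0<..<1}" "r \<notin> {a..b}" for r using z'[OF that] by (simp add: \<xi>_def)
  define \<phi> where "\<phi> = (\<lambda>x::real^'n. if norm x \<in> {a..b} then \<xi> (norm x) else 0)"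
  have \<phi>C: "\<phi> \<in> C1c (?B - {0})" unfolding \<phi>_def by (rule radial_C1c(1)[OF ab(1,3) \<xi>z \<xi>D \<xi>'c])
  have \<phi>g: "grad \<phi> x = (\<xi>' (norm x) / norm x) *\<^sub>R x" if "x \<in> ?B - {0}" for x
    unfolding \<phi>_def by (rule radial_C1c(2)[OF ab(1,3) \<xi>z \<xi>D \<xi>'c that])
  define F where "F = (\<lambda>x. (\<Sum>i\<in>UNIV. \<Sum>j\<in>UNIV. grad \<phi> x $ i * grad \<phi> x $ j * S_k_deriv k (hessian u x) i j)
      + deriv g (u x) * (\<phi> x)\<^sup>2)"
  have Fi: "F absolutely_integrable_on ?B" and F0: "0 \<le> (LINT x:?B|lebesgue. F x)"
    using st \<phi>C unfolding semistable_def F_def Let_def by blast+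
  define c where "c = c_nk ?n k"
  define q0 where "q0 = (\<lambda>r. real k * c * (w r / r) ^ (k - 1) * (\<xi>' r)\<^sup>2)"
  define q where "q = (\<lambda>r. if r \<in> {0<..<1} then q0 r else 0)"
  have q0c: "continuous_on {0<..<1} q0" unfolding q0_def by (intro continuous_intros wc \<xi>'c) auto
  have q0z: "q0 r = 0" if "r \<in> {0<..<1}" "r \<notin> {a..b}" for r using z'[OF that] by (simp add: q0_def \<xi>'_def)
  have qq: "continuous_on UNIV q" "\<exists>B\<ge>0. \<forall>r. \<bar>q r\<bar> \<le> B" "q \<in> borel_measurable borel"
    unfolding q_def by (rule extend_by_zero_continuous[OF ab(1,3) q0c], erule (1) q0z)+
  define p0 where "p0 = (\<lambda>r. w r * (\<eta> r)\<^sup>2)"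
  define p where "p = (\<lambda>r. if r \<in> {0<..<1} then p0 r else 0)"
  have p0c: "continuous_on {0<..<1} p0" unfolding p0_def by (intro continuous_intros wc \<eta>c)
  have p0z: "p0 r = 0" if "r \<in> {0<..<1}" "r \<notin> {a..b}" for r using z'[OF that] by (simp add: p0_def)
  have pp: "continuous_on UNIV p" "\<exists>B\<ge>0. \<forall>r. \<bar>p r\<bar> \<le> B" "p \<in> borel_measurable borel"
    unfolding p_def by (rule extend_by_zero_continuous[OF ab(1,3) p0c], erule (1) p0z)+
  obtain Bq where Bq: "Bq \<ge> 0" "\<And>r. \<bar>q r\<bar> \<le> Bq" using qq(2) by blast
  obtain Bp where Bp: "Bp \<ge> 0" "\<And>r. \<bar>p r\<bar> \<le> Bp" using pp(2) by blast
  have qz: "q r = 0" and pz: "p r = 0" if "r \<notin> {a..b}" for r using q0z p0z that by (auto simp: q_def p_def)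
  have [measurable]: "q \<in> borel_measurable borel" "p \<in> borel_measurable borel" using qq(3) pp(3) by auto
  have Fe: "F x = q (norm x) + deriv g (v (norm x)) * w (norm x) * p (norm x)" if x: "x \<in> ?B - {0}" for x
  proof -
    define r y where "r = norm x" and "y = (1 / norm x) *\<^sub>R x"
    have r: "r \<in> {0<..<1}" and y1: "norm y = 1" using x by (auto simp: r_def y_def)
    have H: "hessian u x = rank_one_pert (w r / r) (w1 r) y"
      unfolding r_def y_def by (rule radial_hessian[OF rad' v x]) (use w[OF r] in \<open>auto simp: r_def\<close>)
    have G: "grad \<phi> x = \<xi>' r *\<^sub>R y" using \<phi>g[OF x] by (simp add: r_def y_def)
    have "(\<Sum>i\<in>UNIV. \<Sum>j\<in>UNIV. grad \<phi> x $ i * grad \<phi> x $ j * S_k_deriv k (hessian u x) i j)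
       = (\<xi>' r)\<^sup>2 * (\<Sum>i\<in>UNIV. \<Sum>j\<in>UNIV. y $ i * y $ j * S_k_deriv k (rank_one_pert (w r / r) (w1 r) y) i j)"
      unfolding H G by (simp add: sum_distrib_left power2_eq_square mult_ac)
    also have "\<dots> = q r"
      unfolding sum_S_k_deriv_rank_one_pert[OF y1 k] c_nk_binomial(1)[OF k] using r by (simp add: q_def q0_def c_def)
    finally have 1: "(\<Sum>i\<in>UNIV. \<Sum>j\<in>UNIV. grad \<phi> x $ i * grad \<phi> x $ j * S_k_deriv k (hessian u x) i j) = q r" .
    have "(\<phi> x)\<^sup>2 = w r * p r"
    proof (cases "r \<in> {a..b}")
      case True
      then show ?thesis using r by (simp add: \<phi>_def r_def[symmetric] \<xi>_def p_def p0_def power2_eq_square)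
    next
      case False
      then show ?thesis using pz[OF False] by (auto simp: \<phi>_def r_def[symmetric])
    qed
    then show ?thesis using 1 x by (simp add: F_def rad' r_def)
  qed
  \<comment> \<open>room around the support of the test function\<close>
  define a' b' where "a' = a / 2" and "b' = (b + 1) / 2"
  have ab': "0 < a'" "a' < b'" "b' < 1" "a' < a" "b < b'" using ab by (auto simp: a'_def b'_def)
  define h where "h = (\<lambda>r. g (v (max a' (min b' r))))"
  obtain K M where hK: "K-lipschitz_on UNIV h" and hM: "\<And>r. \<bar>h r\<bar> \<le> M"
    and hD: "AE r in lborel. r \<in> {a'<..<b'} \<longrightarrow> (h has_real_derivative deriv g (v r) * w r) (at r)"
    using ae_differentiable_outer_function[OF g v pos wc ab'(1-3)] unfolding h_def by blast
  have [measurable]: "h \<in> borel_measurable borel"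
    by (rule borel_measurable_continuous_onI[OF lipschitz_on_continuous_on[OF hK]])
  define \<delta> where "\<delta> = (\<lambda>m r. real (Suc m) * (h (r + 1 / real (Suc m)) - h r))"
  have [measurable]: "\<delta> m \<in> borel_measurable borel" for m unfolding \<delta>_def by measurable
  have K0: "K \<ge> 0" using hK by (rule lipschitz_on_nonneg)
  have \<delta>K: "\<bar>\<delta> m r\<bar> \<le> K" for m r
  proof -
    have "\<bar>h (r + 1 / real (Suc m)) - h r\<bar> \<le> K * (1 / real (Suc m))"
      using lipschitz_onD[OF hK UNIV_I UNIV_I, of "r + 1 / real (Suc m)" r] by (simp add: dist_real_def)
    then have "real (Suc m) * \<bar>h (r + 1 / real (Suc m)) - h r\<bar> \<le> real (Suc m) * (K * (1 / real (Suc m)))"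
      by (intro mult_left_mono) auto
    then show ?thesis by (simp add: \<delta>_def abs_mult)
  qed
  define \<Phi> where "\<Phi> = (\<lambda>m r. q r + \<delta> m r * p r)"
  have [measurable]: "\<Phi> m \<in> borel_measurable borel" for m unfolding \<Phi>_def by measurable
  have \<Phi>B: "\<bar>\<Phi> m r\<bar> \<le> Bq + K * Bp" for m r
  proof -
    have "\<bar>\<delta> m r * p r\<bar> \<le> K * Bp" unfolding abs_mult by (intro mult_mono \<delta>K Bp K0) auto
    then show ?thesis unfolding \<Phi>_def using Bq(2)[of r] by linarith
  qed
  have lim1: "(\<lambda>m. LINT x:?B|lebesgue. \<Phi> m (norm x)) \<longlonglongrightarrow> (LINT x:?B|lebesgue. F x)"
    unfolding set_lebesgue_integral_def
  proof (rule integral_dominated_convergence[where w = "\<lambda>x. indicator ?B x *\<^sub>R (Bq + K * Bp)"])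
    show "(\<lambda>x. indicator ?B x *\<^sub>R F x) \<in> borel_measurable lebesgue"
      using Fi by (auto simp: set_integrable_def)
    show "(\<lambda>x. indicator ?B x *\<^sub>R \<Phi> m (norm x)) \<in> borel_measurable lebesgue" for m
    proof -
      have "(\<lambda>x. indicator ?B x *\<^sub>R \<Phi> m (norm x)) \<in> borel_measurable lborel"
        by (intro borel_measurable_scaleR borel_measurable_indicator) auto
      then show ?thesis by (rule measurable_completion)
    qed
    have "(\<lambda>x. Bq + K * Bp) absolutely_integrable_on ?B"
      by (rule absolutely_integrable_on_const) simp
    then show "integrable lebesgue (\<lambda>x. indicator ?B x *\<^sub>R (Bq + K * Bp))" by (simp only: set_integrable_def)
    show "AE x in lebesgue. norm (indicator ?B x *\<^sub>R \<Phi> m (norm x)) \<le> indicator ?B x *\<^sub>R (Bq + K * Bp)" for m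
      using \<Phi>B[of m] by (intro AE_I2) (auto split: split_indicator)
    have "AE r in lborel. r \<in> {0<..<1} \<longrightarrow> (\<lambda>m. \<Phi> m r) \<longlonglongrightarrow> q r + deriv g (v r) * w r * p r"
      using hD
    proof eventually_elim
      case (elim r)
      show ?case
      proof (cases "r \<in> {a'<..<b'}")
        case True
        then have "(h has_real_derivative deriv g (v r) * w r) (at r)" using elim by blast
        from difference_quotient_sequence[OF this]
        have l: "(\<lambda>m. \<delta> m r) \<longlonglongrightarrow> deriv g (v r) * w r" by (simp only: \<delta>_def)
        show ?thesis unfolding \<Phi>_def by (intro impI tendsto_add tendsto_mult tendsto_const l)
      next
        case False
        then have "p r = 0" using pz[of r] ab' by auto
        then show ?thesis by (simp add: \<Phi>_def)
      qed
    qed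
    from AE_norm_ball[OF this]
    show "AE x in lebesgue. (\<lambda>m. indicator ?B x *\<^sub>R \<Phi> m (norm x)) \<longlonglongrightarrow> indicator ?B x *\<^sub>R F x"
      using AE_completion[OF AE_lborel_singleton[of "0::real^'n"]]
    proof eventually_elim
      case (elim x)
      show ?case
      proof (cases "x \<in> ?B")
        case True
        then have "x \<in> ?B - {0}" using elim(2) by simp
        from Fe[OF this] show ?thesis using elim True by simp
      qed simp
    qed
  qed
  define Q where "Q = (\<lambda>r. r ^ (?n - 1) * q r)"
  define \<psi> where "\<psi> = (\<lambda>r. r ^ (?n - 1) * p r)"
  define s0 where "s0 = (\<lambda>r. r ^ (?n - 1) * (real (?n - 1) * (w r * (\<eta> r)\<^sup>2) / r + w1 r * (\<eta> r)\<^sup>2 + 2 * w r * \<eta> r * \<eta>' r))"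
  define \<psi>' where "\<psi>' = (\<lambda>r. if r \<in> {0<..<1} then s0 r else 0)"
  have s0c: "continuous_on {0<..<1} s0" unfolding s0_def by (intro continuous_intros wc w1c \<eta>c \<eta>(2)) auto
  have s0z: "s0 r = 0" if "r \<in> {0<..<1}" "r \<notin> {a..b}" for r using z'[OF that] by (simp add: s0_def)
  have ss: "continuous_on UNIV \<psi>'" "\<exists>B\<ge>0. \<forall>r. \<bar>\<psi>' r\<bar> \<le> B" "\<psi>' \<in> borel_measurable borel"
    unfolding \<psi>'_def by (rule extend_by_zero_continuous[OF ab(1,3) s0c], erule (1) s0z)+
  have \<psi>'z: "\<psi>' r = 0" if "r \<notin> {a..b}" for r using s0z that by (auto simp: \<psi>'_def)
  have [measurable]: "\<psi>' \<in> borel_measurable borel" using ss(3) by auto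
  have \<psi>z: "\<psi> r = 0" if "r \<notin> {a..b}" for r using pz[OF that] by (simp add: \<psi>_def)
  have \<psi>D: "(\<psi> has_real_derivative \<psi>' r) (at r)" for r
  proof (cases "r \<in> {0<..<1}")
    case True
    have 1: "(p0 has_real_derivative w1 r * (\<eta> r)\<^sup>2 + (2 * \<eta> r * \<eta>' r) * w r) (at r)"
      unfolding p0_def power2_eq_square
      using DERIV_mult[OF w[OF True] DERIV_mult[OF \<eta>(1)[OF True] \<eta>(1)[OF True]]] by (simp add: algebra_simps)
    have "((\<lambda>r. r ^ (?n - 1) * p0 r) has_real_derivative
       (real (?n - 1) * r ^ (?n - 1 - Suc 0)) * p0 r + (w1 r * (\<eta> r)\<^sup>2 + (2 * \<eta> r * \<eta>' r) * w r) * r ^ (?n - 1)) (at r)"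
      by (rule DERIV_mult[OF DERIV_pow 1])
    moreover have "(real (?n - 1) * r ^ (?n - 1 - Suc 0)) * p0 r + (w1 r * (\<eta> r)\<^sup>2 + (2 * \<eta> r * \<eta>' r) * w r) * r ^ (?n - 1) = s0 r"
    proof -
      have "real (?n - 1) * r ^ (?n - 1 - Suc 0) = real (?n - 1) * r ^ (?n - 1) / r"
        using True by (cases "?n - 1") auto
      then show ?thesis unfolding s0_def p0_def by (simp add: algebra_simps)
    qed
    ultimately have "((\<lambda>r. r ^ (?n - 1) * p0 r) has_real_derivative \<psi>' r) (at r)" using True by (simp add: \<psi>'_def)
    then show ?thesis
      by (rule has_field_derivative_transform_within_open[of _ _ _ "{0<..<1}"]) (use True in \<open>auto simp: \<psi>_def p_def\<close>)
  next
    case False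
    then have o: "r \<notin> {a..b}" using ab by auto
    have "(\<psi> has_real_derivative 0) (at r)"
      by (rule has_field_derivative_transform_within_open[OF DERIV_const[of 0], of "- {a..b}"]) (use o \<psi>z in auto)
    then show ?thesis using \<psi>'z[OF o] by simp
  qed
  have lim2: "(\<lambda>m. LINT r|lborel. \<delta> m r * \<psi> r) \<longlonglongrightarrow> - (LINT r|lborel. h r * \<psi>' r)"
    unfolding \<delta>_def by (rule limit_of_difference_quotient_integrals[OF hK hM \<psi>D ss(1) \<psi>z]) auto
  have pw: "\<bar>r ^ (?n - 1) * x\<bar> \<le> B" if "\<bar>x\<bar> \<le> B" "r \<notin> {a..b} \<Longrightarrow> x = 0" for r x B :: real
  proof (cases "r \<in> {a..b}")
    case True
    then have "\<bar>r\<bar> ^ (?n - 1) \<le> 1" using ab by (intro power_le_one) auto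
    then have "\<bar>r\<bar> ^ (?n - 1) * \<bar>x\<bar> \<le> 1 * B" by (intro mult_mono that) auto
    then show ?thesis by (simp add: abs_mult power_abs)
  qed (use that in auto)
  have [measurable]: "Q \<in> borel_measurable borel" "\<psi> \<in> borel_measurable borel" unfolding Q_def \<psi>_def by measurable
  have Qi: "integrable lborel Q"
  proof (rule integrable_bounded_supported[where B = Bq and a = a and b = b])
    show "\<bar>Q r\<bar> \<le> Bq" for r unfolding Q_def by (rule pw[OF Bq(2) qz])
  qed (auto simp: Q_def qz)
  have \<delta>\<psi>i: "integrable lborel (\<lambda>r. \<delta> m r * \<psi> r)" for m
  proof (rule integrable_bounded_supported[where B = "K * Bp" and a = a and b = b])
    show "\<bar>\<delta> m r * \<psi> r\<bar> \<le> K * Bp" for r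
    proof -
      have "\<bar>\<psi> r\<bar> \<le> Bp" unfolding \<psi>_def by (rule pw[OF Bp(2) pz])
      then show ?thesis unfolding abs_mult by (intro mult_mono \<delta>K K0) auto
    qed
  qed (auto simp: \<psi>z)
  have pol: "(LINT x:?B|lebesgue. \<Phi> m (norm x)) = ?A * ((LINT r|lborel. Q r) + (LINT r|lborel. \<delta> m r * \<psi> r))" for m
  proof -
    have "(LINT x:?B|lebesgue. \<Phi> m (norm x)) = ?A * (LINT r:{0<..<1}|lborel. r ^ (?n - 1) * \<Phi> m r)"
      by (rule polar_integral) measurable
    also have "(LINT r:{0<..<1}|lborel. r ^ (?n - 1) * \<Phi> m r) = (LINT r|lborel. Q r + \<delta> m r * \<psi> r)"
      unfolding set_lebesgue_integral_def
      by (rule arg_cong[where f = "integral\<^sup>L lborel"], rule ext)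
        (auto simp: Q_def \<Phi>_def \<psi>_def q_def p_def algebra_simps split: split_indicator)
    also have "\<dots> = (LINT r|lborel. Q r) + (LINT r|lborel. \<delta> m r * \<psi> r)"
      by (rule Bochner_Integration.integral_add[OF Qi \<delta>\<psi>i])
    finally show ?thesis .
  qed
  have "(\<lambda>m. ?A * ((LINT r|lborel. Q r) + (LINT r|lborel. \<delta> m r * \<psi> r)))
     \<longlonglongrightarrow> ?A * ((LINT r|lborel. Q r) + - (LINT r|lborel. h r * \<psi>' r))"
    by (intro tendsto_intros lim2)
  then have "(LINT x:?B|lebesgue. F x) = ?A * ((LINT r|lborel. Q r) + - (LINT r|lborel. h r * \<psi>' r))"
    using lim1 unfolding pol by (rule LIMSEQ_unique[rotated])
  then have nn: "0 \<le> (LINT r|lborel. Q r) - (LINT r|lborel. h r * \<psi>' r)"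
    using F0 sphere_area_pos[where 'n = 'n] by (simp add: zero_le_mult_iff)
  obtain Bs where Bs: "Bs \<ge> 0" "\<And>r. \<bar>\<psi>' r\<bar> \<le> Bs" using ss(2) by blast
  have M0: "M \<ge> 0" using hM[of 0] by linarith
  have hi: "integrable lborel (\<lambda>r. h r * \<psi>' r)"
  proof (rule integrable_bounded_supported[where B = "M * Bs" and a = a and b = b])
    show "\<bar>h r * \<psi>' r\<bar> \<le> M * Bs" for r unfolding abs_mult by (intro mult_mono hM Bs M0) auto
  qed (auto simp: \<psi>'z)
  have "(LINT r|lborel. Q r) - (LINT r|lborel. h r * \<psi>' r) = (LINT r|lborel. Q r - h r * \<psi>' r)"
    by (rule Bochner_Integration.integral_diff[OF Qi hi, symmetric])
  also have "\<dots> = (LINT r:{a..b}|lborel. r ^ (?n - 1) * q0 r - g (v r) * s0 r)"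
    unfolding set_lebesgue_integral_def
  proof (rule arg_cong[where f = "integral\<^sup>L lborel"], rule ext)
    fix r
    show "Q r - h r * \<psi>' r = indicator {a..b} r *\<^sub>R (r ^ (?n - 1) * q0 r - g (v r) * s0 r)"
    proof (cases "r \<in> {a..b}")
      case True
      then have "r \<in> {0<..<1}" "max a' (min b' r) = r" using ab ab' by auto
      then show ?thesis using True by (simp add: Q_def q_def \<psi>'_def h_def)
    qed (simp add: Q_def qz \<psi>'z)
  qed
  finally show ?thesis using nn unfolding q0_def s0_def \<xi>'_def c_def by simp
qed

text \<open>Read \<open>W = w\<close>, \<open>W1 = w'\<close>, \<open>e = \<eta>\<close>, \<open>d = \<eta>'\<close> and \<open>y = 1/r\<close>. The squares of \<open>w'\<close> cancel, and the terms that are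
  linear in \<open>w'\<close> combine to a multiple of the derivative of \<open>r\<^sup>n\<^sup>-\<^sup>k\<^sup>-\<^sup>1 w\<^sup>k\<^sup>+\<^sup>1 \<eta>\<^sup>2\<close>, which is the last bracket.\<close>

lemma semistable_test_identity:
  fixes y W W1 e d n k :: real
  shows "(k + 1) * (k * (W1 * e + W * d)\<^sup>2 - ((n - k) * (W * y) + k * W1) * ((n - 1) * (W * e\<^sup>2) * y + W1 * e\<^sup>2 + 2 * W * e * d))
    = (k + 1) * k * (W\<^sup>2 * d\<^sup>2) + 2 * k * (k - 1) * (W\<^sup>2 * e * d * y) - k * (2 * n - k - 1) * (W\<^sup>2 * e\<^sup>2 * y\<^sup>2)
      - (k * n + n - 2 * k) * ((n - k - 1) * (W\<^sup>2 * e\<^sup>2 * y\<^sup>2) + (k + 1) * (W * W1 * e\<^sup>2 * y) + 2 * (W\<^sup>2 * e * d * y))"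
  by (simp add: power2_eq_square algebra_simps)

text \<open>The equation expresses \<open>g(v)\<close> by \<open>w\<close> and \<open>w'\<close>. After that all terms containing \<open>w'\<close> form the derivative of
  a multiple of \<open>r\<^sup>n\<^sup>-\<^sup>k\<^sup>-\<^sup>1 w\<^sup>k\<^sup>+\<^sup>1 \<eta>\<^sup>2\<close>, which vanishes at both end points.\<close>

lemma semistable_reduced_inequality:
  fixes u :: "real^'n \<Rightarrow> real"
  assumes k: "1 \<le> k" "k \<le> CARD('n)" and g: "antimono g" "locally_lipschitz g" and gc: "continuous_on UNIV g"
    and rad: "radial_with_profile u v" and st: "semistable k g u"
    and ode: "profile_ode (CARD('n)) k g v w"
    and pos: "\<And>r. r \<in> {0<..<1} \<Longrightarrow> 0 < w r"
    and ab: "0 < a" "a < b" "b < 1"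
    and \<eta>: "\<And>r. r \<in> {0<..<1} \<Longrightarrow> (\<eta> has_real_derivative \<eta>' r) (at r)" "continuous_on {0<..<1} \<eta>'"
    and z: "\<And>r. r \<in> {0<..<1} \<Longrightarrow> r \<notin> {a<..<b} \<Longrightarrow> \<eta> r = 0"
  shows "0 \<le> (LINT r:{a..b}|lborel. r ^ CARD('n) / r ^ k * w r ^ (k + 1) * ((\<eta>' r)\<^sup>2
          + 2 * ((real k - 1) / (real k + 1)) * (\<eta> r * \<eta>' r / r)
          - (2 * real (CARD('n)) - real k - 1) / (real k + 1) * ((\<eta> r)\<^sup>2 / r\<^sup>2)))"
proof -
  let ?n = "CARD('n)"
  define c where "c = c_nk ?n k"
  have c0: "c > 0" using k by (simp add: c_def c_nk_def zero_less_binomial_iff)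
  have v: "\<And>r. r \<in> {0<..<1} \<Longrightarrow> (v has_real_derivative w r) (at r)" and wc: "continuous_on {0<..<1} w"
    using ode by (auto simp: profile_ode_def)
  obtain w1 where w1c: "continuous_on {0<..<1} w1" and w1: "\<And>r. r \<in> {0<..<1} \<Longrightarrow> (w has_real_derivative w1 r) (at r)"
    and gv: "\<And>r. r \<in> {0<..<1} \<Longrightarrow> g (v r) = c * ((real ?n - real k) * (w r / r) ^ k + real k * ((w r / r) ^ (k - 1) * w1 r))"
    using profile_second_derivative[OF k ode pos gc] unfolding c_def by blast
  have \<eta>c: "continuous_on {0<..<1} \<eta>" by (rule DERIV_continuous_on, rule has_field_derivative_at_within[OF \<eta>(1)])
  define E where "E = (\<lambda>r. r ^ ?n / r ^ k * w r ^ (k + 1) * ((\<eta>' r)\<^sup>2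
          + 2 * ((real k - 1) / (real k + 1)) * (\<eta> r * \<eta>' r / r)
          - (2 * real ?n - real k - 1) / (real k + 1) * ((\<eta> r)\<^sup>2 / r\<^sup>2)))"
  define P where "P = (\<lambda>r. r ^ ?n * (w r / r) ^ (k + 1) * (\<eta> r)\<^sup>2)"
  \<comment> \<open>the derivative of \<open>P\<close>, in the variables of the polynomial identity\<close>
  define P' where "P' = (\<lambda>r. r ^ (?n - 1) * (w r / r) ^ (k - 1) * ((real ?n - real k - 1) * ((w r)\<^sup>2 * (\<eta> r)\<^sup>2 * (1 / r)\<^sup>2)
      + (real k + 1) * (w r * w1 r * (\<eta> r)\<^sup>2 * (1 / r)) + 2 * ((w r)\<^sup>2 * \<eta> r * \<eta>' r * (1 / r))))"
  define J where "J = (\<lambda>r. r ^ (?n - 1) * (real k * c * (w r / r) ^ (k - 1) * (w1 r * \<eta> r + w r * \<eta>' r)\<^sup>2)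
     - g (v r) * (r ^ (?n - 1) * (real (?n - 1) * (w r * (\<eta> r)\<^sup>2) / r + w1 r * (\<eta> r)\<^sup>2 + 2 * w r * \<eta> r * \<eta>' r)))"
  define \<kappa> where "\<kappa> = (real k * real ?n + real ?n - 2 * real k) / (real k + 1)"
  have J0: "0 \<le> (LINT r:{a..b}|lborel. J r)"
    unfolding J_def c_def by (rule semistable_profile_inequality[OF k g rad st v pos w1 w1c ab \<eta> z])
  have n1: "1 \<le> ?n" using k by linarith
  have in01: "r \<in> {0<..<1}" if "r \<in> {a..b}" for r using that ab by auto
  have lam2: "(w r / r) ^ (k + 1) = (w r / r) ^ (k - 1) * (w r / r)\<^sup>2" "(w r / r) ^ k = (w r / r) ^ (k - 1) * (w r / r)" for r
    using k by (cases k; simp add: power2_eq_square)+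
  have rn: "r ^ ?n = r ^ (?n - 1) * r" for r :: real using n1 by (cases ?n) auto
  have PD: "(P has_real_derivative P' r) (at r)" if r: "r \<in> {0<..<1}" for r
  proof -
    have r0: "r \<noteq> 0" using r by auto
    have kk: "1 \<le> k + 1" using k by simp
    have "(P has_real_derivative
      (r ^ (?n - 1) * ((real ?n - real (k + 1)) * (w r / r) ^ (k + 1) + real (k + 1) * ((w r / r) ^ (k + 1 - 1) * w1 r))) * (\<eta> r)\<^sup>2
      + (2 * \<eta> r * \<eta>' r) * (r ^ ?n * (w r / r) ^ (k + 1))) (at r)"
      unfolding P_def
    proof (rule DERIV_mult[OF hessian_quotient_derivative[OF r0 w1[OF r] kk n1]])
      show "((\<lambda>r. (\<eta> r)\<^sup>2) has_real_derivative 2 * \<eta> r * \<eta>' r) (at r)"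
        using DERIV_power[OF \<eta>(1)[OF r], of 2] by (simp add: mult_ac)
    qed
    moreover have "(r ^ (?n - 1) * ((real ?n - real (k + 1)) * (w r / r) ^ (k + 1) + real (k + 1) * ((w r / r) ^ (k + 1 - 1) * w1 r))) * (\<eta> r)\<^sup>2
      + (2 * \<eta> r * \<eta>' r) * (r ^ ?n * (w r / r) ^ (k + 1)) = P' r"
    proof -
      have "r * (w r / r)\<^sup>2 = (w r)\<^sup>2 * (1 / r)" using r0 by (simp add: power2_eq_square)
      then have 1: "r ^ ?n * (w r / r) ^ (k + 1) = r ^ (?n - 1) * (w r / r) ^ (k - 1) * ((w r)\<^sup>2 * (1 / r))"
        unfolding rn[of r] lam2(1) by (metis mult.assoc mult.left_commute)
      have 2: "(w r / r) ^ (k + 1 - 1) = (w r / r) ^ (k - 1) * (w r * (1 / r))" using lam2(2)[of r] by simp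
      have 3: "(w r / r) ^ (k + 1) = (w r / r) ^ (k - 1) * ((w r)\<^sup>2 * (1 / r)\<^sup>2)" unfolding lam2(1) by (simp add: power_divide)
      show ?thesis unfolding 1 unfolding 2 3 P'_def by (simp add: algebra_simps)
    qed
    ultimately show ?thesis by simp
  qed
  have P'c: "continuous_on {0<..<1} P'" unfolding P'_def by (intro continuous_intros wc w1c \<eta>c \<eta>(2)) auto
  have Ec: "continuous_on {0<..<1} E" unfolding E_def by (intro continuous_intros wc \<eta>c \<eta>(2)) auto
  have "(P' has_integral (P b - P a)) {a..b}"
    by (rule fundamental_theorem_of_calculus)
      (use ab PD in01 in \<open>auto simp: has_real_derivative_iff_has_vector_derivative[symmetric] intro: has_field_derivative_at_within\<close>)
  moreover have "P a = 0" "P b = 0" using z[of a] z[of b] ab by (auto simp: P_def)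
  ultimately have PI: "integral {a..b} P' = 0" by (simp add: integral_unique)
  have P'i: "set_integrable lborel {a..b} P'"
    by (rule borel_integrable_atLeastAtMost'[OF continuous_on_subset[OF P'c]]) (use in01 in blast)
  have Ei: "set_integrable lborel {a..b} E"
    by (rule borel_integrable_atLeastAtMost'[OF continuous_on_subset[OF Ec]]) (use in01 in blast)
  have P'0: "(LINT r:{a..b}|lborel. P' r) = 0" using set_borel_integral_eq_integral(2)[OF P'i] PI by simp
  have id: "J r = real k * c * E r - c * \<kappa> * P' r" if r: "r \<in> {a..b}" for r
  proof -
    have r0: "r > 0" using in01[OF r] by simp
    define Z y where "Z = r ^ (?n - 1) * (w r / r) ^ (k - 1)" and "y = 1 / r"
    have n1': "real (?n - 1) = real ?n - 1" using n1 by simp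
    have gZ: "g (v r) * r ^ (?n - 1) = c * Z * ((real ?n - real k) * (w r * y) + real k * w1 r)"
      unfolding gv[OF in01[OF r]] lam2(2) Z_def y_def by (simp add: algebra_simps add_divide_distrib diff_divide_distrib)
    have "J r = c * Z * (real k * (w1 r * \<eta> r + w r * \<eta>' r)\<^sup>2) - (g (v r) * r ^ (?n - 1)) *
        ((real ?n - 1) * (w r * (\<eta> r)\<^sup>2) * y + w1 r * (\<eta> r)\<^sup>2 + 2 * w r * \<eta> r * \<eta>' r)"
      unfolding J_def n1' Z_def y_def by (simp add: mult_ac)
    also have "\<dots> = c * Z * (real k * (w1 r * \<eta> r + w r * \<eta>' r)\<^sup>2 - ((real ?n - real k) * (w r * y) + real k * w1 r) *
        ((real ?n - 1) * (w r * (\<eta> r)\<^sup>2) * y + w1 r * (\<eta> r)\<^sup>2 + 2 * w r * \<eta> r * \<eta>' r))" (is "_ = c * Z * ?X")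
      unfolding gZ by (simp only: right_diff_distrib mult.assoc)
    finally have J: "J r = c * Z * ?X" .
    define Y where "Y = (real ?n - real k - 1) * ((w r)\<^sup>2 * (\<eta> r)\<^sup>2 * y\<^sup>2) + (real k + 1) * (w r * w1 r * (\<eta> r)\<^sup>2 * y) + 2 * ((w r)\<^sup>2 * \<eta> r * \<eta>' r * y)"
    have P'e: "P' r = Z * Y" by (simp add: P'_def Z_def Y_def y_def)
    have RZ: "r ^ ?n / r ^ k * w r ^ (k + 1) = Z * (w r)\<^sup>2"
    proof -
      have "r ^ k = r ^ (k - 1) * r" using k by (cases k) auto
      moreover have "w r ^ (k + 1) = w r ^ (k - 1) * (w r)\<^sup>2" using k by (cases k) (auto simp: power2_eq_square)
      ultimately show ?thesis using r0 by (simp add: Z_def rn power_divide)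
    qed
    have Ee: "E r = Z * (w r)\<^sup>2 * ((\<eta>' r)\<^sup>2 + 2 * ((real k - 1) / (real k + 1)) * (\<eta> r * \<eta>' r * y)
          - (2 * real ?n - real k - 1) / (real k + 1) * ((\<eta> r)\<^sup>2 * y\<^sup>2))"
      unfolding E_def RZ y_def by (simp add: power_divide)
    have q0: "real k + 1 \<noteq> 0" by linarith
    define U where "U = (w r)\<^sup>2 * ((\<eta>' r)\<^sup>2 + 2 * ((real k - 1) / (real k + 1)) * (\<eta> r * \<eta>' r * y)
          - (2 * real ?n - real k - 1) / (real k + 1) * ((\<eta> r)\<^sup>2 * y\<^sup>2))"
    have "(real k + 1) * (real k * U) = (real k + 1) * real k * ((w r)\<^sup>2 * (\<eta>' r)\<^sup>2) + 2 * real k * (real k - 1) * ((w r)\<^sup>2 * \<eta> r * \<eta>' r * y)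
       - real k * (2 * real ?n - real k - 1) * ((w r)\<^sup>2 * (\<eta> r)\<^sup>2 * y\<^sup>2)"
    proof -
      define t1 t2 where "t1 = (real k - 1) / (real k + 1)" and "t2 = (2 * real ?n - real k - 1) / (real k + 1)"
      have t: "real k - 1 = t1 * (real k + 1)" "2 * real ?n - real k - 1 = t2 * (real k + 1)" using q0 by (auto simp: t1_def t2_def)
      show ?thesis unfolding U_def unfolding t1_def[symmetric] t2_def[symmetric] unfolding t by (simp add: algebra_simps)
    qed
    moreover have "(real k + 1) * \<kappa> = real k * real ?n + real ?n - 2 * real k" using q0 by (simp add: \<kappa>_def)
    ultimately have "(real k + 1) * ?X = (real k + 1) * (real k * U) - ((real k + 1) * \<kappa>) * Y"
      unfolding semistable_test_identity Y_def by simp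
    then have "(real k + 1) * ?X = (real k + 1) * (real k * U - \<kappa> * Y)" by (simp add: right_diff_distrib)
    then have X: "?X = real k * U - \<kappa> * Y" using q0 mult_left_cancel by blast
    have "E r = Z * U" unfolding Ee U_def by (simp only: mult.assoc)
    then show ?thesis unfolding J X P'e by (simp add: right_diff_distrib)
  qed
  have "(LINT r:{a..b}|lborel. J r) = (LINT r:{a..b}|lborel. real k * c * E r - c * \<kappa> * P' r)"
    by (rule set_lebesgue_integral_cong) (auto simp: id)
  also have "\<dots> = (LINT r:{a..b}|lborel. real k * c * E r) - (LINT r:{a..b}|lborel. c * \<kappa> * P' r)"
    by (rule set_integral_diff) (use Ei P'i in auto)
  also have "\<dots> = real k * c * (LINT r:{a..b}|lborel. E r)"
    using P'0 by (simp add: set_integral_mult_right)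
  finally have "0 \<le> (real k * c) * (LINT r:{a..b}|lborel. E r)" using J0 by simp
  moreover have "real k * c > 0" using k c0 by simp
  ultimately have "0 \<le> (LINT r:{a..b}|lborel. E r)" by (simp add: zero_le_mult_iff)
  then show ?thesis by (simp only: E_def)
qed

section \<open>Decay of the derivative of the profile\<close>

text \<open>The negative of this number is the negative root of \<open>t\<^sup>2 + 2(k-1)/(k+1) t - (2n-k-1)/(k+1)\<close>, the value of the
  quadratic form of the reduced inequality at \<open>\<eta> = r\<^sup>t\<close>, up to a power of \<open>r\<close>.\<close>

definition decay_root :: "nat \<Rightarrow> nat \<Rightarrow> real" where
  "decay_root n k = (real k - 1 + sqrt (2 * (real k + 1) * real n - 4 * real k)) / (real k + 1)"

text \<open>With \<open>-\<alpha>\<close> and \<open>\<beta>\<close> the roots of the quadratic and \<open>s = \<alpha> + \<beta>\<close>, the test function is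
  \<open>\<eta> = 1/(r\<^sup>\<alpha> + m r\<^sup>-\<^sup>\<beta>)\<close> with \<open>m = r\<^sub>0\<^sup>s\<close>, cut off near \<open>0\<close> and on \<open>[1/2, 3/4]\<close>. The powers \<open>r\<^sup>-\<^sup>\<alpha>\<close> and \<open>r\<^sup>\<beta>\<close> make
  the quadratic form vanish; the transition between them at \<open>r\<^sub>0\<close> makes it negative, of a size that is explicit
  on \<open>[r\<^sub>0/2, r\<^sub>0]\<close>. There \<open>w \<ge> w(r\<^sub>0)/2\<close> because \<open>w/r\<close> decreases. The cut-off near \<open>0\<close> costs nothing in the limit,
  since \<open>\<eta> \<le> r/m\<close> there (because \<open>\<beta> \<ge> 1\<close>, a consequence of \<open>n \<ge> 2k\<close>) and the energy is finite. The cut-off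
  on \<open>[1/2, 3/4]\<close> costs a multiple of \<open>w(1/2)\<^sup>k\<^sup>+\<^sup>1\<close>.\<close>

lemma profile_decay:
  fixes n k :: nat
  assumes k: "1 \<le> k" and n: "2 * k \<le> n"
  obtains K where "0 \<le> K"
    "\<And>w. \<lbrakk>continuous_on {0<..<1} w; \<And>r. r \<in> {0<..<1} \<Longrightarrow> 0 \<le> w r;
      \<And>r s. 0 < r \<Longrightarrow> r \<le> s \<Longrightarrow> s < 1 \<Longrightarrow> w s / s \<le> w r / r;
      integrable lborel (\<lambda>r. indicator {0<..<1} r * (r ^ (n - 1) * (r powr (1 - real k) * w r ^ (k + 1))));
      \<And>a b \<eta> \<eta>'. \<lbrakk>0 < a; a < b; b < 1; \<And>r. r \<in> {0<..<1} \<Longrightarrow> (\<eta> has_real_derivative \<eta>' r) (at r);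
        continuous_on {0<..<1} \<eta>'; \<And>r. r \<in> {0<..<1} \<Longrightarrow> r \<notin> {a<..<b} \<Longrightarrow> \<eta> r = 0\<rbrakk>
        \<Longrightarrow> 0 \<le> (LINT r:{a..b}|lborel. r ^ n / r ^ k * w r ^ (k + 1) * ((\<eta>' r)\<^sup>2
          + 2 * ((real k - 1) / (real k + 1)) * (\<eta> r * \<eta>' r / r)
          - (2 * real n - real k - 1) / (real k + 1) * ((\<eta> r)\<^sup>2 / r\<^sup>2)))\<rbrakk>
      \<Longrightarrow> (\<forall>r\<in>{0<..1/2}. w r ^ (k + 1) \<le> K * w (1/2) ^ (k + 1) * r powr (2 * decay_root n k - real n + real k + 1))"
proof -
  define X where "X = sqrt (2 * (real k + 1) * real n - 4 * real k)"
  have nk: "2 * real k \<le> real n" using n by (metis of_nat_le_iff of_nat_mult of_nat_numeral)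
  have k1: "real k \<ge> 1" using k by simp
  have pos: "2 * (real k + 1) * real n - 4 * real k \<ge> (2 * real k)\<^sup>2"
  proof -
    have "2 * (real k + 1) * (2 * real k) \<le> 2 * (real k + 1) * real n" using nk by (intro mult_left_mono) auto
    then show ?thesis by (simp add: power2_eq_square algebra_simps)
  qed
  have X2: "X\<^sup>2 = 2 * (real k + 1) * real n - 4 * real k"
    unfolding X_def using pos by (intro real_sqrt_pow2 order_trans[OF zero_le_power2])
  have Xk: "2 * real k \<le> X" unfolding X_def by (rule real_le_rsqrt[OF pos])
  define q where "q = real k + 1"
  have q: "q > 0" using k1 by (simp add: q_def)
  define \<alpha> \<beta> bb cc where "\<alpha> = (real k - 1 + X) / q" and "\<beta> = (X - (real k - 1)) / q"
    and "bb = (real k - 1) / q" and "cc = (2 * real n - real k - 1) / q"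
  have \<alpha>: "\<alpha> = decay_root n k" by (simp add: \<alpha>_def decay_root_def X_def q_def)
  have \<beta>1: "1 \<le> \<beta>" using Xk q by (simp add: \<beta>_def q_def)
  have \<alpha>0: "0 < \<alpha>" using Xk k1 q by (auto simp: \<alpha>_def intro!: divide_pos_pos)
  have bb0: "0 \<le> bb" using k1 q by (simp add: bb_def)
  have bb: "2 * bb = \<alpha> - \<beta>" using q by (simp add: bb_def \<alpha>_def \<beta>_def field_simps)
  have cc: "cc = \<alpha> * \<beta>"
  proof -
    have "(real k - 1 + X) * (X - (real k - 1)) = X\<^sup>2 - (real k - 1)\<^sup>2" by (simp add: algebra_simps power2_eq_square)
    also have "\<dots> = (2 * real n - real k - 1) * q" unfolding X2 q_def by (simp add: algebra_simps power2_eq_square)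
    finally have e: "(real k - 1 + X) * (X - (real k - 1)) = (2 * real n - real k - 1) * q" .
    have "\<alpha> * \<beta> = ((real k - 1 + X) * (X - (real k - 1))) / (q * q)" by (simp add: \<alpha>_def \<beta>_def)
    then show ?thesis unfolding e using q by (simp add: cc_def)
  qed
  have cc0: "0 \<le> cc" using cc \<alpha>0 \<beta>1 by simp
  define s where "s = \<alpha> + \<beta>"
  have s0: "s > 0" using \<alpha>0 \<beta>1 by (simp add: s_def)
  define B where "B = (8 + s)\<^sup>2 + 2 * bb * (8 + s)"
  have B0: "B \<ge> 0" using s0 bb0 by (simp add: B_def)
  define B4 where "B4 = B * (2 powr \<alpha>)\<^sup>2 * 4 * 2 ^ (k + 1)"
  have B40: "B4 \<ge> 0" using B0 by (simp add: B4_def)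
  define c1 where "c1 = s\<^sup>2 * 2 powr (- (2 * bb)) / (1 + 2 powr \<beta>) ^ 4 * (1/2) ^ (n - k) * (1/2) ^ (k + 1)"
  have c10: "c1 > 0" using s0 by (auto simp: c1_def intro!: mult_pos_pos divide_pos_pos zero_less_power add_pos_pos)
  define K where "K = B4 / c1"
  have K0: "K \<ge> 0" using B40 c10 by (simp add: K_def)
  show thesis
  proof (rule that[OF K0], intro ballI)
    fix w :: "real \<Rightarrow> real" and r0 :: real
    assume wc: "continuous_on {0<..<1} w" and w0: "\<And>r. r \<in> {0<..<1} \<Longrightarrow> 0 \<le> w r"
      and dec: "\<And>r s. 0 < r \<Longrightarrow> r \<le> s \<Longrightarrow> s < 1 \<Longrightarrow> w s / s \<le> w r / r"
      and energy: "integrable lborel (\<lambda>r. indicator {0<..<1} r * (r ^ (n - 1) * (r powr (1 - real k) * w r ^ (k + 1))))"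
      and ineq: "\<And>a b \<eta> \<eta>'. \<lbrakk>0 < a; a < b; b < 1; \<And>r. r \<in> {0<..<1} \<Longrightarrow> (\<eta> has_real_derivative \<eta>' r) (at r);
        continuous_on {0<..<1} \<eta>'; \<And>r. r \<in> {0<..<1} \<Longrightarrow> r \<notin> {a<..<b} \<Longrightarrow> \<eta> r = 0\<rbrakk>
        \<Longrightarrow> 0 \<le> (LINT r:{a..b}|lborel. r ^ n / r ^ k * w r ^ (k + 1) * ((\<eta>' r)\<^sup>2
          + 2 * ((real k - 1) / (real k + 1)) * (\<eta> r * \<eta>' r / r)
          - (2 * real n - real k - 1) / (real k + 1) * ((\<eta> r)\<^sup>2 / r\<^sup>2)))"
      and r0: "r0 \<in> {0<..1/2}"
    have r0': "0 < r0" "r0 \<le> 1/2" using r0 by auto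
    \<comment> \<open>this choice makes the two summands of \<open>D\<close> equal at \<open>r0\<close>\<close>
    define m where "m = r0 powr s"
    have m0: "m > 0" using r0' by (simp add: m_def)
    define D where "D = (\<lambda>r. r powr \<alpha> + m * r powr (- \<beta>))"
    have D0: "D r > 0" if "r > 0" for r using that m0 by (simp add: D_def add_pos_pos)
    define \<eta>0 where "\<eta>0 = (\<lambda>r. 1 / D r)"
    \<comment> \<open>\<open>P\<close> is the logarithmic derivative \<open>r \<eta>'/\<eta>\<close> of the test function before the cut-off\<close>
    define P where "P = (\<lambda>r. (\<beta> * (m * r powr (- \<beta>)) - \<alpha> * r powr \<alpha>) / D r)"
    have Pb: "\<bar>P r\<bar> \<le> s" if r: "r > 0" for r
    proof -
      define x y where "x = r powr \<alpha>" and "y = m * r powr (- \<beta>)"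
      have xy: "x > 0" "y > 0" using r m0 by (auto simp: x_def y_def)
      have p: "\<beta> * y \<ge> 0" "\<alpha> * x \<ge> 0" "\<beta> * x \<ge> 0" "\<alpha> * y \<ge> 0" using xy \<alpha>0 \<beta>1 by auto
      have "s * (x + y) = \<alpha> * x + \<beta> * y + \<beta> * x + \<alpha> * y" by (simp add: s_def algebra_simps)
      then have "\<bar>\<beta> * y - \<alpha> * x\<bar> \<le> s * (x + y)" using p by linarith
      then have "\<bar>\<beta> * y - \<alpha> * x\<bar> / (x + y) \<le> s" using xy by (simp add: pos_divide_le_eq)
      then show ?thesis using xy by (simp add: P_def D_def x_def[symmetric] y_def[symmetric] abs_divide)
    qed
    have \<eta>0D: "(\<eta>0 has_real_derivative P r * \<eta>0 r / r) (at r)" if r: "r > 0" for r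
    proof -
      have "((\<lambda>r. r powr \<alpha>) has_real_derivative \<alpha> * r powr \<alpha> / r) (at r)"
        using has_real_derivative_powr[OF r, of \<alpha>] r by (simp add: powr_diff)
      moreover have "((\<lambda>r. r powr (- \<beta>)) has_real_derivative - \<beta> * r powr (- \<beta>) / r) (at r)"
        using has_real_derivative_powr[OF r, of "- \<beta>"] r by (simp add: powr_diff)
      ultimately have DD: "(D has_real_derivative \<alpha> * r powr \<alpha> / r + m * (- \<beta> * r powr (- \<beta>) / r)) (at r)"
        unfolding D_def by (intro DERIV_add DERIV_cmult)
      have "(\<eta>0 has_real_derivative (0 * D r - 1 * (\<alpha> * r powr \<alpha> / r + m * (- \<beta> * r powr (- \<beta>) / r))) / (D r * D r)) (at r)"
        unfolding \<eta>0_def by (rule DERIV_divide[OF DERIV_const DD]) (use D0[OF r] in simp)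
      moreover have "(0 * D r - 1 * (\<alpha> * r powr \<alpha> / r + m * (- \<beta> * r powr (- \<beta>) / r))) / (D r * D r) = P r * \<eta>0 r / r"
        using r D0[OF r] by (simp add: P_def \<eta>0_def field_simps)
      ultimately show ?thesis by simp
    qed
    \<comment> \<open>the quadratic at \<open>P r\<close>, factored by its roots; negative for every \<open>r\<close>, and of order one only near \<open>r0\<close>\<close>
    have form: "(P r)\<^sup>2 + 2 * bb * P r - cc = - (s\<^sup>2 * (m * r powr (\<alpha> - \<beta>)) / (D r)\<^sup>2)" if r: "r > 0" for r
    proof -
      define x y d where "x = r powr \<alpha>" and "y = m * r powr (- \<beta>)" and "d = D r"
      have d: "d = x + y" "d \<noteq> 0" using D0[OF r] by (auto simp: d_def D_def x_def y_def)
      have "(P r)\<^sup>2 + 2 * bb * P r - cc = (P r + \<alpha>) * (P r - \<beta>)"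
        unfolding bb cc by (simp add: algebra_simps power2_eq_square)
      moreover have "P r + \<alpha> = s * y / d"
        using d(2) by (simp add: P_def x_def[symmetric] y_def[symmetric] d_def[symmetric] s_def d(1) field_simps)
      moreover have "P r - \<beta> = - (s * x / d)"
        using d(2) by (simp add: P_def x_def[symmetric] y_def[symmetric] d_def[symmetric] s_def d(1) field_simps)
      moreover have "(s * y / d) * (- (s * x / d)) = - (s\<^sup>2 * (x * y) / d\<^sup>2)"
        by (simp add: power2_eq_square mult_ac)
      moreover have "x * y = m * r powr (\<alpha> - \<beta>)" using r by (simp add: x_def y_def powr_add[symmetric])
      ultimately show ?thesis by (simp only: d_def)
    qed
    define R where "R = (\<lambda>r::real. r ^ n / r ^ k)"
    have R: "R r = r ^ (n - k)" if "r > 0" for r using that n by (simp add: R_def power_diff)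
    have RE: "R r = r ^ (n - 1) * r powr (1 - real k)" if r: "r > 0" for r
    proof -
      have "r ^ n = r ^ (n - 1) * r" using n k by (metis power_minus_mult zero_less_iff_neq_zero mult_is_0 le_0_eq not_one_le_zero zero_neq_numeral)
      moreover have "r powr (1 - real k) = r / r ^ k" using r by (simp add: powr_diff powr_realpow)
      ultimately show ?thesis by (simp add: R_def)
    qed
    \<comment> \<open>rises from 0 to 1 on \<open>[e, 2e]\<close> and falls back to 0 on \<open>[1/2, 3/4]\<close>\<close>
    define cut where "cut = (\<lambda>e r. smoothstep (r / e - 1) * (1 - smoothstep (4 * (r - 1/2))))"
    define cut' where "cut' = (\<lambda>e r. (smoothstep' (r / e - 1) / e) * (1 - smoothstep (4 * (r - 1/2)))
       - smoothstep (r / e - 1) * (4 * smoothstep' (4 * (r - 1/2))))"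
    define T where "T = (\<lambda>y z r. y\<^sup>2 + 2 * bb * (z * y / r) - cc * (z\<^sup>2 / r\<^sup>2))"
    define G0 where "G0 = c1 * r0 powr (real n - real k - 2 * \<alpha> - 2) * w r0 ^ (k + 1)"
    have key: "G0 * (r0 / 2) \<le> B / m\<^sup>2 * (LINT r:{e..2*e}|lborel. R r * w r ^ (k + 1)) + B4 * w (1/2) ^ (k + 1) * (1/4)"
      if e: "0 < e" "4 * e < r0" for e
    proof -
      define \<eta> where "\<eta> = (\<lambda>r. cut e r * \<eta>0 r)"
      define \<eta>' where "\<eta>' = (\<lambda>r. cut' e r * \<eta>0 r + cut e r * (P r * \<eta>0 r / r))"
      have cutD: "(cut e has_real_derivative cut' e r) (at r)" for r
      proof -
        have "((\<lambda>r. r / e - 1) has_real_derivative 1 / e) (at r)" using e(1) by (auto intro!: derivative_eq_intros)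
        from DERIV_chain2[OF smoothstep_has_derivative this]
        have 1: "((\<lambda>r. smoothstep (r / e - 1)) has_real_derivative smoothstep' (r / e - 1) * (1 / e)) (at r)" .
        have "((\<lambda>r. 4 * (r - 1/2)) has_real_derivative (4::real)) (at r)" by (auto intro!: derivative_eq_intros)
        from DERIV_chain2[OF smoothstep_has_derivative this]
        have 2: "((\<lambda>r. 1 - smoothstep (4 * (r - 1/2))) has_real_derivative 0 - smoothstep' (4 * (r - 1/2)) * 4) (at r)"
          by (intro DERIV_diff DERIV_const)
        show ?thesis unfolding cut_def cut'_def using DERIV_mult[OF 1 2] by (simp add: mult_ac)
      qed
      have \<eta>D: "(\<eta> has_real_derivative \<eta>' r) (at r)" if "r \<in> {0<..<1}" for r
        unfolding \<eta>_def \<eta>'_def using DERIV_mult[OF cutD \<eta>0D, of r] that by (simp add: algebra_simps)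
      have cs: "continuous_on S smoothstep" for S
        by (rule continuous_on_subset[OF DERIV_continuous_on[OF smoothstep_has_derivative]]) simp
      have cut'c: "continuous_on S (cut' e)" for S
        unfolding cut'_def using e(1)
        by (intro continuous_intros continuous_on_compose2[OF continuous_smoothstep'[of UNIV]] continuous_on_compose2[OF cs[of UNIV]]) auto
      have cutc: "continuous_on S (cut e)" for S
        unfolding cut_def using e(1) by (intro continuous_intros continuous_on_compose2[OF cs[of UNIV]]) auto
      have Dc: "continuous_on {0<..<1} D" unfolding D_def by (intro continuous_intros) auto
      have D0': "\<And>r. r \<in> {0<..<1} \<Longrightarrow> D r \<noteq> 0" using D0 by force
      have \<eta>0c: "continuous_on {0<..<1} \<eta>0" unfolding \<eta>0_def using D0' by (intro continuous_intros Dc) auto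
      have Pc: "continuous_on {0<..<1} P" unfolding P_def using D0' by (intro continuous_intros Dc) auto
      have \<eta>'c: "continuous_on {0<..<1} \<eta>'"
        unfolding \<eta>'_def by (intro continuous_intros cut'c cutc \<eta>0c Pc) auto
      have z: "\<eta> r = 0" if "r \<in> {0<..<1}" "r \<notin> {e<..<3/4}" for r
      proof (cases "r \<le> e")
        case True
        then have "r / e - 1 \<le> 0" using e by simp
        then show ?thesis by (simp add: \<eta>_def cut_def smoothstep_simps)
      next
        case False
        then have "1 \<le> 4 * (r - 1/2)" using that by auto
        then show ?thesis by (simp add: \<eta>_def cut_def smoothstep_simps)
      qed
      define J where "J = (\<lambda>r. R r * w r ^ (k + 1) * T (\<eta>' r) (\<eta> r) r)"
      have J0: "0 \<le> (LINT r:{e..3/4}|lborel. J r)"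
        using ineq[of e "3/4" \<eta> \<eta>', OF e(1) _ _ \<eta>D \<eta>'c z] e r0'
        by (simp add: J_def R_def T_def bb_def cc_def q_def)
      have cut01: "0 \<le> cut e r" "cut e r \<le> 1" for r
        unfolding cut_def using smoothstep_bounds(1,2)[of "r / e - 1"] smoothstep_bounds(1,2)[of "4 * (r - 1/2)"]
        by (auto intro!: mult_nonneg_nonneg mult_le_one)
      have cut'b: "\<bar>cut' e r\<bar> \<le> 8 / r" if r: "r \<in> {e..3/4}" for r
      proof (cases "r \<le> 1/2")
        case True
        have "smoothstep' (4 * (r - 1/2)) = 0" "smoothstep (4 * (r - 1/2)) = 0" using True by (auto simp: smoothstep_simps)
        then have c: "cut' e r = smoothstep' (r / e - 1) / e" by (simp add: cut'_def)
        show ?thesis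
        proof (cases "r \<le> 2 * e")
          case T: True
          have "smoothstep' (r / e - 1) / e \<le> 2 / e" using e smoothstep_bounds(4) by (intro divide_right_mono) auto
          also have "\<dots> \<le> 8 / r" using T e r by (simp add: field_simps)
          finally show ?thesis unfolding c using e smoothstep_bounds(3)[of "r / e - 1"] by simp
        next
          case F: False
          then have "1 \<le> r / e - 1" using e by (simp add: field_simps)
          then have "cut' e r = 0" unfolding c by (simp add: smoothstep_simps)
          then show ?thesis using r e by simp
        qed
      next
        case False
        then have "1 \<le> r / e - 1" using e r0' by (simp add: field_simps)
        then have "smoothstep' (r / e - 1) = 0" "smoothstep (r / e - 1) = 1" by (auto simp: smoothstep_simps)
        then have "\<bar>cut' e r\<bar> = 4 * smoothstep' (4 * (r - 1/2))"
          using smoothstep_bounds(3)[of "4 * (r - 1/2)"] by (simp add: cut'_def)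
        also have "\<dots> \<le> 8" using smoothstep_bounds(4)[of "4 * (r - 1/2)"] by simp
        also have "8 \<le> 8 / r" using r False by (simp add: field_simps)
        finally show ?thesis .
      qed
      have \<eta>00: "\<eta>0 r > 0" if "r > 0" for r using D0[OF that] by (simp add: \<eta>0_def)
      have Tb: "T (\<eta>' r) (\<eta> r) r \<le> B * ((\<eta>0 r)\<^sup>2 / r\<^sup>2)" if r: "r \<in> {e..3/4}" for r
      proof -
        have rp: "r > 0" using r e by auto
        define h where "h = \<eta>0 r / r"
        have h: "h > 0" using \<eta>00[OF rp] rp by (simp add: h_def)
        have "\<bar>\<eta>' r\<bar> \<le> \<bar>cut' e r\<bar> * \<eta>0 r + cut e r * (\<bar>P r\<bar> * \<eta>0 r / r)"
          unfolding \<eta>'_def using \<eta>00[OF rp] rp cut01[of r]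
          by (intro order_trans[OF abs_triangle_ineq]) (simp add: abs_mult)
        also have "\<dots> \<le> (8 / r) * \<eta>0 r + 1 * (s * \<eta>0 r / r)"
          using cut'b[OF r] Pb[OF rp] cut01[of r] \<eta>00[OF rp] rp s0
          by (intro add_mono mult_mono divide_right_mono) auto
        also have "\<dots> = (8 + s) * h" by (simp add: h_def algebra_simps add_divide_distrib)
        finally have e1: "\<bar>\<eta>' r\<bar> \<le> (8 + s) * h" .
        have "\<bar>\<eta> r\<bar> \<le> \<eta>0 r" unfolding \<eta>_def using cut01[of r] \<eta>00[OF rp] by (simp add: abs_mult mult_left_le_one_le)
        then have e2: "\<bar>\<eta> r / r\<bar> \<le> h" using rp by (simp add: h_def divide_right_mono)
        have "(\<eta>' r)\<^sup>2 \<le> ((8 + s) * h)\<^sup>2" using e1 by (metis abs_ge_zero power2_abs power_mono)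
        moreover have "\<eta> r * \<eta>' r / r \<le> (8 + s) * h\<^sup>2"
        proof -
          have "\<eta> r * \<eta>' r / r \<le> \<bar>\<eta> r / r\<bar> * \<bar>\<eta>' r\<bar>" by (metis abs_ge_self abs_mult times_divide_eq_left)
          also have "\<dots> \<le> h * ((8 + s) * h)" using e1 e2 h by (intro mult_mono) auto
          finally show ?thesis by (simp add: power2_eq_square mult_ac)
        qed
        then have "2 * bb * (\<eta> r * \<eta>' r / r) \<le> 2 * bb * ((8 + s) * h\<^sup>2)" using bb0 by (intro mult_left_mono) auto
        moreover have "0 \<le> cc * ((\<eta> r)\<^sup>2 / r\<^sup>2)" using cc0 by simp
        ultimately have "T (\<eta>' r) (\<eta> r) r \<le> ((8 + s) * h)\<^sup>2 + 2 * bb * ((8 + s) * h\<^sup>2)" unfolding T_def by linarith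
        also have "\<dots> = B * h\<^sup>2" by (simp only: B_def power_mult_distrib) (simp add: algebra_simps)
        finally show ?thesis by (simp add: h_def power_divide)
      qed
      \<comment> \<open>between the cut-offs the test function is \<open>\<eta>0\<close>, and the factorization applies\<close>
      have mid: "T (\<eta>' r) (\<eta> r) r = - (s\<^sup>2 * (m * r powr (\<alpha> - \<beta>)) / (D r ^ 4 * r\<^sup>2))"
        if r: "2 * e \<le> r" "r \<le> 1/2" for r
      proof -
        have rp: "r > 0" using r e by auto
        have 1: "1 \<le> r / e - 1" using r e by (simp add: field_simps)
        have "cut e r = 1" "cut' e r = 0"
          using r 1 by (auto simp: cut_def cut'_def smoothstep_simps)
        then have "T (\<eta>' r) (\<eta> r) r = ((P r)\<^sup>2 + 2 * bb * P r - cc) * ((\<eta>0 r)\<^sup>2 / r\<^sup>2)"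
          using rp by (simp add: T_def \<eta>_def \<eta>'_def power2_eq_square algebra_simps diff_divide_distrib add_divide_distrib)
        also have "\<dots> = - (s\<^sup>2 * (m * r powr (\<alpha> - \<beta>)) / (D r)\<^sup>2) * ((1 / D r)\<^sup>2 / r\<^sup>2)" by (simp only: form[OF rp] \<eta>0_def)
        also have "\<dots> = - (s\<^sup>2 * (m * r powr (\<alpha> - \<beta>)) / (D r ^ 4 * r\<^sup>2))"
          by (simp add: power_divide power4_eq_xxxx power2_eq_square mult_ac)
        finally show ?thesis .
      qed
      \<comment> \<open>the three parts bound the integrand at the inner cut-off, at the outer cut-off and around \<open>r0\<close>\<close>
      define U where "U = (\<lambda>r. indicator {e..2*e} r * (B / m\<^sup>2 * (R r * w r ^ (k + 1))) + indicator {1/2..3/4} r * (B4 * w (1/2) ^ (k + 1))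
         - indicator {r0/2..r0} r * G0)"
      have half: "0 \<le> w (1/2)" by (rule w0) simp
      have JU: "J r \<le> U r" if r: "r \<in> {e..3/4}" for r
      proof -
        have rp: "r > 0" "r < 1" using r e by auto
        have Rw: "0 \<le> R r * w r ^ (k + 1)" using rp w0[of r] by (simp add: R_def)
        have B4w: "0 \<le> B4 * w (1/2) ^ (k + 1)" using B40 half by simp
        have Jb: "J r \<le> R r * w r ^ (k + 1) * (B * ((\<eta>0 r)\<^sup>2 / r\<^sup>2))"
          unfolding J_def by (rule mult_left_mono[OF Tb[OF r] Rw])
        consider "r < 2 * e" | "2 * e \<le> r" "r \<le> 1/2" | "1/2 < r" by linarith
        then show ?thesis
        proof cases
          case 1
          have "\<eta>0 r \<le> r powr \<beta> / m"
          proof -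
            have "m * r powr (- \<beta>) \<le> D r" using rp by (simp add: D_def)
            then have "\<eta>0 r \<le> 1 / (m * r powr (- \<beta>))" unfolding \<eta>0_def using m0 rp by (intro divide_left_mono mult_pos_pos D0) auto
            then show ?thesis using rp by (simp add: powr_minus field_simps)
          qed
          also have "\<dots> \<le> r / m" using rp m0 \<beta>1 powr_mono'[of 1 \<beta> r] by (intro divide_right_mono) auto
          finally have "\<eta>0 r / r \<le> 1 / m" using rp m0 by (simp add: field_simps)
          then have "(\<eta>0 r / r)\<^sup>2 \<le> (1 / m)\<^sup>2" using \<eta>00[of r] rp by (intro power_mono) auto
          then have "B * ((\<eta>0 r)\<^sup>2 / r\<^sup>2) \<le> B * (1 / m\<^sup>2)" using B0 by (intro mult_left_mono) (auto simp: power_divide)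
          then have "R r * w r ^ (k + 1) * (B * ((\<eta>0 r)\<^sup>2 / r\<^sup>2)) \<le> R r * w r ^ (k + 1) * (B * (1 / m\<^sup>2))"
            using Rw by (rule mult_left_mono)
          also have "\<dots> = B / m\<^sup>2 * (R r * w r ^ (k + 1))" by simp
          finally have "J r \<le> B / m\<^sup>2 * (R r * w r ^ (k + 1))" using Jb by linarith
          moreover have "indicator {e..2*e} r = (1::real)" "indicator {1/2..3/4} r = (0::real)" "indicator {r0/2..r0} r = (0::real)"
            using 1 r e r0' by auto
          ultimately show ?thesis by (simp add: U_def)
        next
          case 2
          have Jm: "J r = - (R r * w r ^ (k + 1) * (s\<^sup>2 * (m * r powr (\<alpha> - \<beta>)) / (D r ^ 4 * r\<^sup>2)))"
            unfolding J_def mid[OF 2] by simp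
          have U1: "0 \<le> indicator {e..2*e} r * (B / m\<^sup>2 * (R r * w r ^ (k + 1)))" using B0 Rw by (auto split: split_indicator)
          have U2: "0 \<le> indicator {1/2..3/4} r * (B4 * w (1/2) ^ (k + 1))" using B4w by (auto split: split_indicator)
          show ?thesis
          proof (cases "r \<in> {r0/2..r0}")
            case False
            have "J r \<le> 0" unfolding Jm using Rw m0 D0[OF rp(1)] by (simp add: mult_nonneg_nonneg)
            then show ?thesis using U1 U2 False unfolding U_def by simp
          next
            case True
            have rr: "r0 / 2 \<le> r" "r \<le> r0" using True by auto
            have Dle: "D r \<le> r0 powr \<alpha> * (1 + 2 powr \<beta>)"
            proof -
              have "r powr \<alpha> \<le> r0 powr \<alpha>" using rr rp \<alpha>0 by (intro powr_mono2) auto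
              moreover have "m * r powr (- \<beta>) \<le> m * (r0 / 2) powr (- \<beta>)"
                using m0 rr r0' \<beta>1 by (intro mult_left_mono powr_mono2') auto
              moreover have "m * (r0 / 2) powr (- \<beta>) = r0 powr \<alpha> * 2 powr \<beta>"
                using r0' by (simp add: m_def s_def powr_add powr_divide powr_minus field_simps)
              ultimately show ?thesis by (simp add: D_def distrib_left)
            qed
            have D4: "D r ^ 4 * r\<^sup>2 \<le> (r0 powr \<alpha> * (1 + 2 powr \<beta>)) ^ 4 * r0\<^sup>2"
              using Dle D0[OF rp(1)] rr rp by (intro mult_mono power_mono) auto
            have num: "r0 powr s * (r0 powr (2 * bb) * 2 powr (- (2 * bb))) \<le> m * r powr (\<alpha> - \<beta>)"
            proof -
              have "r0 powr (2 * bb) * 2 powr (- (2 * bb)) = (r0 / 2) powr (2 * bb)"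
                using r0' by (simp add: powr_divide powr_minus field_simps)
              also have "\<dots> \<le> r powr (2 * bb)" using rr r0' bb0 by (intro powr_mono2) auto
              finally show ?thesis unfolding m_def bb using r0' by (intro mult_left_mono) (auto simp: bb)
            qed
            have fr: "s\<^sup>2 * (r0 powr s * (r0 powr (2 * bb) * 2 powr (- (2 * bb)))) / ((r0 powr \<alpha> * (1 + 2 powr \<beta>)) ^ 4 * r0\<^sup>2)
              \<le> s\<^sup>2 * (m * r powr (\<alpha> - \<beta>)) / (D r ^ 4 * r\<^sup>2)"
              using num D4 D0[OF rp(1)] rp m0 by (intro frac_le mult_left_mono) auto
            have Rr: "(r0 / 2) ^ (n - k) \<le> R r" unfolding R[OF rp(1)] using rr r0' by (intro power_mono) auto
            have "w r0 / r0 \<le> w r / r" using dec[of r r0] rr rp r0' by auto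
            then have "w r0 * (r / r0) \<le> w r" using rp r0' by (simp add: field_simps)
            moreover have "w r0 * (1/2) \<le> w r0 * (r / r0)" using rr r0' w0[of r0] by (intro mult_left_mono) (auto simp: field_simps)
            ultimately have "w r0 * (1/2) \<le> w r" by linarith
            then have wr: "(w r0 * (1/2)) ^ (k + 1) \<le> w r ^ (k + 1)" using w0[of r0] r0' by (intro power_mono) auto
            have "G0 = ((r0 / 2) ^ (n - k) * (w r0 * (1/2)) ^ (k + 1)) * (s\<^sup>2 * (r0 powr s * (r0 powr (2 * bb) * 2 powr (- (2 * bb)))) / ((r0 powr \<alpha> * (1 + 2 powr \<beta>)) ^ 4 * r0\<^sup>2))"
            proof -
              have "r0 powr (real n - real k - 2 * \<alpha> - 2) = r0 ^ (n - k) * (r0 powr s * r0 powr (2 * bb)) / ((r0 powr \<alpha>) ^ 4 * r0\<^sup>2)"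
              proof -
                have a1: "r0 ^ (n - k) = r0 powr (real n - real k)" using r0' n by (simp add: powr_realpow[symmetric] of_nat_diff)
                have a2: "(r0 powr \<alpha>) ^ 4 = r0 powr (4 * \<alpha>)" using r0' by (simp add: powr_powr mult.commute flip: powr_numeral)
                have a3: "r0\<^sup>2 = r0 powr 2" using r0' by simp
                have e: "real n - real k - 2 * \<alpha> - 2 = (real n - real k) + (s + 2 * bb) - (4 * \<alpha> + 2)" by (simp add: bb s_def)
                show ?thesis unfolding a1 a2 a3 e by (simp only: powr_diff powr_add)
              qed
              then show ?thesis
                unfolding G0_def c1_def by (simp add: power_mult_distrib power_divide mult_ac)
            qed
            also have "\<dots> \<le> (R r * w r ^ (k + 1)) * (s\<^sup>2 * (m * r powr (\<alpha> - \<beta>)) / (D r ^ 4 * r\<^sup>2))"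
              using Rr wr fr w0[of r0] r0' Rw rp by (intro mult_mono) (auto simp: R_def intro!: mult_nonneg_nonneg divide_nonneg_nonneg)
            finally have "J r \<le> - G0" unfolding Jm by linarith
            then show ?thesis using U1 U2 True unfolding U_def by simp
          qed
        next
          case 3
          have r3: "1/2 \<le> r" "r \<le> 3/4" using 3 r by auto
          have "r powr \<alpha> \<le> D r" using rp m0 by (simp add: D_def)
          then have "\<eta>0 r \<le> 1 / r powr \<alpha>" unfolding \<eta>0_def using rp by (intro divide_left_mono mult_pos_pos D0) auto
          also have "\<dots> = (1 / r) powr \<alpha>" using rp by (simp add: powr_divide)
          also have "\<dots> \<le> 2 powr \<alpha>" using r3 \<alpha>0 by (intro powr_mono2) (auto simp: field_simps)
          finally have "(\<eta>0 r)\<^sup>2 \<le> (2 powr \<alpha>)\<^sup>2" using \<eta>00[OF rp(1)] by (intro power_mono) auto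
          moreover have "1 / r\<^sup>2 \<le> 4"
          proof -
            have "(1/2)\<^sup>2 \<le> r\<^sup>2" using r3 by (intro power_mono) auto
            then show ?thesis using rp by (simp add: field_simps power2_eq_square)
          qed
          ultimately have "(\<eta>0 r)\<^sup>2 * (1 / r\<^sup>2) \<le> (2 powr \<alpha>)\<^sup>2 * 4" by (intro mult_mono) auto
          then have e1: "B * ((\<eta>0 r)\<^sup>2 / r\<^sup>2) \<le> B * ((2 powr \<alpha>)\<^sup>2 * 4)" using B0 by (intro mult_left_mono) auto
          have "R r \<le> 1" unfolding R[OF rp(1)] using rp by (intro power_le_one) auto
          moreover have "w r ^ (k + 1) \<le> (2 * w (1/2)) ^ (k + 1)"
          proof (rule power_mono)
            have "w r / r \<le> w (1/2) / (1/2)" using dec[of "1/2" r] r3 rp by auto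
            then have "w r \<le> 2 * w (1/2) * r" using rp by (simp add: field_simps)
            also have "\<dots> \<le> 2 * w (1/2) * 1" using half rp by (intro mult_left_mono) auto
            finally show "w r \<le> 2 * w (1/2)" by simp
          qed (use w0 rp in auto)
          ultimately have e2: "R r * w r ^ (k + 1) \<le> 1 * (2 * w (1/2)) ^ (k + 1)"
            using w0[of r] rp by (intro mult_mono) auto
          have "J r \<le> (1 * (2 * w (1/2)) ^ (k + 1)) * (B * ((2 powr \<alpha>)\<^sup>2 * 4))"
            using Jb mult_mono[OF e2 e1] B0 half by (auto intro: order_trans)
          also have "\<dots> = B4 * w (1/2) ^ (k + 1)" unfolding B4_def power_mult_distrib by (simp add: mult_ac)
          finally have "J r \<le> B4 * w (1/2) ^ (k + 1)" .
          moreover have "indicator {e..2*e} r = (0::real)" "indicator {1/2..3/4} r = (1::real)" "indicator {r0/2..r0} r = (0::real)"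
            using 3 r3 e r0' by auto
          ultimately show ?thesis by (simp add: U_def)
        qed
      qed
      have \<eta>c: "continuous_on {0<..<1} \<eta>"
        by (rule DERIV_continuous_on, rule has_field_derivative_at_within[OF \<eta>D])
      have "continuous_on {e..3/4} J"
        unfolding J_def T_def R_def using e
        by (intro continuous_intros continuous_on_subset[OF wc] continuous_on_subset[OF \<eta>'c]
            continuous_on_subset[OF \<eta>c]) auto
      then have Ji: "set_integrable lborel {e..3/4} J" by (rule borel_integrable_atLeastAtMost')
      have Ri: "set_integrable lborel {e..2*e} (\<lambda>r. R r * w r ^ (k + 1))"
        unfolding R_def using e r0'
        by (intro borel_integrable_atLeastAtMost' continuous_intros continuous_on_subset[OF wc]) auto
      have i1: "integrable lborel (\<lambda>r. indicator {e..2*e} r * (B / m\<^sup>2 * (R r * w r ^ (k + 1))))"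
      proof -
        have "integrable lborel (\<lambda>r. B / m\<^sup>2 * (indicator {e..2*e} r * (R r * w r ^ (k + 1))))"
          by (rule integrable_mult_right) (use Ri in \<open>simp only: set_integrable_def real_scaleR_def\<close>)
        then show ?thesis by (simp only: mult.left_commute[of _ "B / m\<^sup>2"])
      qed
      have i2: "integrable lborel (\<lambda>r::real. indicator {1/2..3/4} r * (B4 * w (1/2) ^ (k + 1)))"
        and i3: "integrable lborel (\<lambda>r. indicator {r0/2..r0} r * G0)"
        by (intro integrable_mult_left integrable_real_indicator; simp add: emeasure_lborel_Icc_eq)+
      have Ui: "integrable lborel U"
        unfolding U_def by (rule Bochner_Integration.integrable_diff[OF Bochner_Integration.integrable_add[OF i1 i2] i3])
      have Usupp: "indicator {e..3/4} r *\<^sub>R U r = U r" for r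
        using e r0' by (auto simp: U_def split: split_indicator)
      have "(LINT r:{e..3/4}|lborel. J r) \<le> (LINT r:{e..3/4}|lborel. U r)"
        by (rule set_integral_mono[OF Ji]) (use Ui JU in \<open>auto simp: set_integrable_def Usupp[unfolded real_scaleR_def]\<close>)
      also have "\<dots> = (LINT r|lborel. U r)" by (simp only: set_lebesgue_integral_def Usupp)
      also have "\<dots> = B / m\<^sup>2 * (LINT r:{e..2*e}|lborel. R r * w r ^ (k + 1)) + B4 * w (1/2) ^ (k + 1) * (1/4) - G0 * (r0 / 2)"
      proof -
        have I1: "(LINT r|lborel. indicator {e..2*e} r * (B / m\<^sup>2 * (R r * w r ^ (k + 1)))) = B / m\<^sup>2 * (LINT r:{e..2*e}|lborel. R r * w r ^ (k + 1))"
          by (simp only: mult.left_commute[of _ "B / m\<^sup>2"] integral_mult_right_zero set_lebesgue_integral_def real_scaleR_def)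
        have I2: "(LINT r|(lborel::real measure). indicator {1/2..3/4} r * (B4 * w (1/2) ^ (k + 1))) = B4 * w (1/2) ^ (k + 1) * (1/4)"
          by simp
        have I3: "(LINT r|lborel. indicator {r0/2..r0} r * G0) = G0 * (r0 / 2)" using r0' by simp
        show ?thesis unfolding U_def
          by (simp only: Bochner_Integration.integral_diff[OF Bochner_Integration.integrable_add[OF i1 i2] i3]
              Bochner_Integration.integral_add[OF i1 i2] I1 I2 I3)
      qed
      finally show ?thesis using J0 by linarith
    qed
    \<comment> \<open>tails of the convergent energy integral; \<open>8\<close> keeps \<open>4 e < r0\<close>\<close>
    have lim: "(\<lambda>j. LINT r:{r0 / (8 * real (Suc j))..2 * (r0 / (8 * real (Suc j)))}|lborel. R r * w r ^ (k + 1)) \<longlonglongrightarrow> 0"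
    proof -
      let ?S = "\<lambda>j. {r0 / (8 * real (Suc j))..2 * (r0 / (8 * real (Suc j)))}"
      let ?E = "\<lambda>r. indicator {0<..<1} r * (r ^ (n - 1) * (r powr (1 - real k) * w r ^ (k + 1)))"
      have "(\<lambda>j. LINT r|lborel. indicator (?S j) r * ?E r) \<longlonglongrightarrow> (LINT r|(lborel::real measure). 0)"
      proof (rule integral_dominated_convergence[OF _ _ integrable_abs[OF energy]])
        show "AE r in lborel. (\<lambda>j. indicator (?S j) r * ?E r) \<longlonglongrightarrow> 0"
        proof (rule AE_I2)
          fix r :: real
          show "(\<lambda>j. indicator (?S j) r * ?E r) \<longlonglongrightarrow> 0"
          proof (cases "r > 0")
            case True
            obtain j0 :: nat where j0: "r0 / r < real j0" using reals_Archimedean2 by blast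
            have "r \<notin> ?S j" if "j \<ge> j0" for j
            proof -
              have "r0 / r < real (Suc j)" using j0 that by simp
              then have "r0 < r * real (Suc j)" using True by (simp add: pos_divide_less_eq mult.commute)
              then have "2 * (r0 / (8 * real (Suc j))) < r" using r0' True by (simp add: field_simps)
              then show ?thesis by simp
            qed
            then have "\<forall>\<^sub>F j in sequentially. indicator (?S j) r * ?E r = 0"
              by (intro eventually_mono[OF eventually_ge_at_top[of j0]]) (simp add: indicator_eq_0_iff)
            then show ?thesis by (rule tendsto_eventually)
          qed simp
        qed
        have Em: "?E \<in> borel_measurable lborel" using energy by (rule borel_measurable_integrable)
        show "(\<lambda>r. indicator (?S j) r * ?E r) \<in> borel_measurable lborel" for j
          by (rule borel_measurable_times[OF _ Em]) simp
        show "AE r in lborel. norm (indicator (?S j) r * ?E r) \<le> \<bar>?E r\<bar>" for j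
          by (intro AE_I2) (simp split: split_indicator)
      qed simp
      moreover have "indicator (?S j) r * ?E r = indicator (?S j) r *\<^sub>R (R r * w r ^ (k + 1))" for j r
      proof (cases "r \<in> ?S j")
        case True
        have "0 < r0 / (8 * real (Suc j))" using r0' by simp
        moreover have "2 * (r0 / (8 * real (Suc j))) < 1" using r0' by (simp add: field_simps)
        ultimately have r: "0 < r" "r < 1" using True unfolding atLeastAtMost_iff by linarith+
        have "indicator {0<..<1} r = (1::real)" using r by simp
        then show ?thesis using True by (simp only: RE[OF r(1)] mult_1 real_scaleR_def mult.assoc)
      next
        case False
        then have "indicator (?S j) r = (0::real)" by (rule indicator_simps(2))
        then show ?thesis by (simp only: mult_zero_left scaleR_zero_left)
      qed
      ultimately show ?thesis by (simp only: set_lebesgue_integral_def) simp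
    qed
    have "(\<lambda>j. B / m\<^sup>2 * (LINT r:{r0 / (8 * real (Suc j))..2 * (r0 / (8 * real (Suc j)))}|lborel. R r * w r ^ (k + 1)) + B4 * w (1/2) ^ (k + 1) * (1/4))
      \<longlonglongrightarrow> B / m\<^sup>2 * 0 + B4 * w (1/2) ^ (k + 1) * (1/4)"
      by (intro tendsto_intros lim)
    then have "G0 * (r0 / 2) \<le> B / m\<^sup>2 * 0 + B4 * w (1/2) ^ (k + 1) * (1/4)"
    proof (rule LIMSEQ_le_const, intro exI[of _ 0] allI impI)
      fix j :: nat
      show "G0 * (r0 / 2) \<le> B / m\<^sup>2 * (LINT r:{r0 / (8 * real (Suc j))..2 * (r0 / (8 * real (Suc j)))}|lborel. R r * w r ^ (k + 1)) + B4 * w (1/2) ^ (k + 1) * (1/4)"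
        by (rule key) (use r0' in \<open>simp_all add: field_simps add_pos_nonneg\<close>)
    qed
    then have G1: "G0 * (r0 / 2) \<le> B4 * w (1/2) ^ (k + 1) * (1/4)" by (simp only: mult_zero_right add_0_left)
    have "0 \<le> w (1/2)" by (rule w0) simp
    then have "0 \<le> B4 * w (1/2) ^ (k + 1)" using B40 by (intro mult_nonneg_nonneg zero_le_power)
    moreover have "G0 * (r0 / 2) = G0 * r0 / 2" by simp
    ultimately have "G0 * r0 \<le> B4 * w (1/2) ^ (k + 1)" using G1 by linarith
    moreover have "G0 * r0 = c1 * r0 powr (real n - real k - 2 * \<alpha> - 1) * w r0 ^ (k + 1)"
    proof -
      have "r0 powr (real n - real k - 2 * \<alpha> - 2) * r0 = r0 powr (real n - real k - 2 * \<alpha> - 1)"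
      proof -
        have e: "real n - real k - 2 * \<alpha> - 1 = (real n - real k - 2 * \<alpha> - 2) + 1" by simp
        show ?thesis unfolding e powr_add using r0' by simp
      qed
      then show ?thesis unfolding G0_def by (metis mult.assoc mult.commute)
    qed
    ultimately have "c1 * r0 powr (real n - real k - 2 * \<alpha> - 1) * w r0 ^ (k + 1) \<le> B4 * w (1/2) ^ (k + 1)" by simp
    then have "(c1 * r0 powr (real n - real k - 2 * \<alpha> - 1) * w r0 ^ (k + 1)) * r0 powr (2 * \<alpha> - real n + real k + 1)
      \<le> (B4 * w (1/2) ^ (k + 1)) * r0 powr (2 * \<alpha> - real n + real k + 1)" by (intro mult_right_mono) auto
    moreover have "(c1 * r0 powr (real n - real k - 2 * \<alpha> - 1) * w r0 ^ (k + 1)) * r0 powr (2 * \<alpha> - real n + real k + 1) = c1 * w r0 ^ (k + 1)"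
    proof -
      have "r0 powr (real n - real k - 2 * \<alpha> - 1) * r0 powr (2 * \<alpha> - real n + real k + 1) = 1"
        using r0' by (simp flip: powr_add)
      moreover have "(x * p * y) * z = x * y * (p * z)" for x p y z :: real by simp
      ultimately show ?thesis by (metis mult_1_right)
    qed
    ultimately have "c1 * w r0 ^ (k + 1) \<le> (B4 * w (1/2) ^ (k + 1)) * r0 powr (2 * \<alpha> - real n + real k + 1)"
      by (simp only:)
    then have "w r0 ^ (k + 1) \<le> ((B4 * w (1/2) ^ (k + 1)) * r0 powr (2 * \<alpha> - real n + real k + 1)) / c1"
      unfolding pos_le_divide_eq[OF c10] by (simp only: mult.commute[of _ c1])
    then show "w r0 ^ (k + 1) \<le> K * w (1/2) ^ (k + 1) * r0 powr (2 * decay_root n k - real n + real k + 1)"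
      unfolding \<alpha>[symmetric] K_def by simp
  qed
qed

section \<open>Monotone quantities of the profile and the main estimate\<close>

lemma locally_lipschitz_continuous:
  assumes "locally_lipschitz g"
  shows "continuous_on UNIV g"
  unfolding continuous_on_eq_continuous_at[OF open_UNIV]
proof
  fix s
  obtain e L where e: "e > 0" "L-lipschitz_on (ball s e) g" using assms unfolding locally_lipschitz_def by blast
  have "continuous_on (ball s e) g" by (rule lipschitz_on_continuous_on[OF e(2)])
  then show "isCont g s" using e(1) by (simp add: continuous_on_eq_continuous_at)
qed

text \<open>For a classical solution the sign of \<open>w\<close> comes from the sign of the radial component of the weak gradient:
  a negative value would make \<open>v\<close> decrease somewhere.\<close>

lemma solution_profile_ode:
  fixes u :: "real^'n \<Rightarrow> real"
  assumes k: "1 \<le> k" "k \<le> CARD('n)" and gc: "continuous_on UNIV g"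
    and ws: "weighted_sobolev k u Du" and rad: "radial_with_profile u v"
    and nn: "AE x\<in>ball 0 1 in lebesgue. radial_deriv Du x \<ge> 0"
    and sol: "classical_solution k g u \<or> radial_weak_solution k g u Du"
  obtains w where "profile_ode (CARD('n)) k g v w"
  using sol
proof
  assume "radial_weak_solution k g u Du"
  from radial_weak_solution_profile[OF k gc this ws rad nn] show thesis using that by blast
next
  assume cl: "classical_solution k g u"
  obtain w where w: "continuous_on {0<..<1} w" "\<And>r. r \<in> {0<..<1} \<Longrightarrow> (v has_real_derivative w r) (at r)"
    "\<And>r. r \<in> {0<..<1} \<Longrightarrow> ((\<lambda>r. r ^ CARD('n) * (w r / r) ^ k) has_real_derivative r ^ (CARD('n) - 1) * g (v r) / c_nk (CARD('n)) k) (at r)"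
    using classical_solution_profile_derivatives[OF k cl rad] by blast
  have wg: "has_weak_gradient (ball 0 1) u Du" using ws by (simp add: weighted_sobolev_def)
  have rad': "u x = v (norm x)" if "x \<in> ball 0 1" for x using rad that by (auto simp: radial_with_profile_def)
  have v: "continuous_on {0<..<1} v"
    by (rule continuous_on_subset[of "{0<..1}"]) (use rad in \<open>auto simp: radial_with_profile_def\<close>)
  have nn': "AE x in lebesgue. x \<in> ball 0 1 \<longrightarrow> Du x \<bullet> x \<ge> 0"
    using nn
  proof eventually_elim
    case (elim x)
    then show ?case by (cases "x = 0") (auto simp: radial_deriv_def zero_le_divide_iff)
  qed
  obtain w0 where w0: "\<And>r. 0 \<le> w0 r" "\<And>a b. 0 < a \<Longrightarrow> a < b \<Longrightarrow> b < 1 \<Longrightarrow> (LINT r:{a..b}|lborel. w0 r) = v b - v a"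
    by (rule radial_profile_density[OF wg rad' v nn']) auto
  have mono: "v a \<le> v b" if ab: "0 < a" "a < b" "b < 1" for a b
  proof -
    have "0 \<le> (LINT r:{a..b}|lborel. w0 r)"
      unfolding set_lebesgue_integral_def by (rule Bochner_Integration.integral_nonneg) (simp add: w0(1))
    then show ?thesis using w0(2)[OF ab] by linarith
  qed
  have "0 \<le> w r" if r: "r \<in> {0<..<1}" for r
  proof (rule ccontr)
    assume "\<not> 0 \<le> w r"
    then obtain d where d: "d > 0" "\<And>h. 0 < h \<Longrightarrow> h < d \<Longrightarrow> v (r + h) < v r"
      using DERIV_neg_dec_right[OF w(2)[OF r]] by force
    define h where "h = min (d / 2) ((1 - r) / 2)"
    have h: "0 < h" "h < d" "r + h < 1" using d(1) r by (auto simp: h_def min_def field_simps)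
    show False using d(2)[OF h(1,2)] mono[of r "r + h"] h r by auto
  qed
  then have "profile_ode (CARD('n)) k g v w" using w by (simp add: profile_ode_def)
  then show thesis by (rule that)
qed

lemma profile_energy:
  fixes u :: "real^'n \<Rightarrow> real"
  assumes ws: "weighted_sobolev k u Du" and rad: "radial_with_profile u v" and ode: "profile_ode (CARD('n)) k g v w"
  shows "integrable lborel (\<lambda>r. indicator {0<..<1} r * (r ^ (CARD('n) - 1) * (r powr (1 - real k) * w r ^ (k + 1))))"
proof -
  have w: "continuous_on {0<..<1} w" "\<And>r. r \<in> {0<..<1} \<Longrightarrow> (v has_real_derivative w r) (at r)"
    "\<And>r. r \<in> {0<..<1} \<Longrightarrow> 0 \<le> w r" using ode by (auto simp: profile_ode_def)
  have wg: "has_weak_gradient (ball 0 1) u Du" using ws by (simp add: weighted_sobolev_def)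
  have rad': "u x = v (norm x)" if "x \<in> ball 0 1" for x using rad that by (auto simp: radial_with_profile_def)
  have v: "continuous_on {0<..<1} v"
    by (rule continuous_on_subset[of "{0<..1}"]) (use rad in \<open>auto simp: radial_with_profile_def\<close>)
  define w' where "w' = (\<lambda>r. indicator {0<..<1} r * w r)"
  have w'm: "w' \<in> borel_measurable borel" unfolding w'_def by (rule continuous_derivative_FTC(1)[OF w(2,1,3)])
  have w'n: "0 \<le> w' r" for r using w(3)[of r] by (auto simp: w'_def split: split_indicator)
  have w'i: "set_integrable lborel {a..b} w'" if "0 < a" "a < b" "b < 1" for a b
    unfolding w'_def by (rule continuous_derivative_FTC(3)[OF w(2,1,3) that])
  have w'v: "(LINT r:{a..b}|lborel. w' r) = v b - v a" if "0 < a" "a < b" "b < 1" for a b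
    unfolding w'_def by (rule continuous_derivative_FTC(4)[OF w(2,1,3) that])
  have "AE x in lebesgue. x \<in> ball 0 1 - {0} \<longrightarrow> Du x \<bullet> x = w' (norm x) * norm x"
    by (rule weak_gradient_is_radial[OF wg rad' v w'm w'n w'i w'v])
  from weighted_energy_finite[OF ws w'm w'n this]
  have "integrable lborel (\<lambda>r. indicator {0<..<1} r * (r ^ (CARD('n) - 1) * (r powr (1 - real k) * w' r ^ (k + 1))))" .
  moreover have "indicator {0<..<1} r * (r ^ (CARD('n) - 1) * (r powr (1 - real k) * w' r ^ (k + 1)))
     = indicator {0<..<1} r * (r ^ (CARD('n) - 1) * (r powr (1 - real k) * w r ^ (k + 1)))" for r
    by (simp add: w'_def split: split_indicator)
  ultimately show ?thesis by (simp only:)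
qed

text \<open>The first quantity has the nonnegative derivative \<open>r\<^sup>n\<^sup>-\<^sup>1 g(v)/c\<close>. For the second, \<open>v\<close> increases and \<open>g\<close> decreases,
  so \<open>g(v(x)) \<ge> g(v(t))\<close> for \<open>x \<le> t\<close>; integrating the equation from \<open>0\<close> gives
  \<open>t\<^sup>n (w/t)\<^sup>k \<ge> g(v(t)) t\<^sup>n/(n c)\<close>. This is the inequality that makes the derivative of \<open>(w/t)\<^sup>k\<close> nonpositive.\<close>

lemma profile_ode_monotone:
  assumes k: "1 \<le> k" "k \<le> n" and ode: "profile_ode n k g v w" and g: "antimono g" "\<And>s. 0 \<le> g s"
    and rs: "0 < r" "r \<le> s" "s < 1"
  shows "r ^ n * (w r / r) ^ k \<le> s ^ n * (w s / s) ^ k" "w s / s \<le> w r / r"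
proof -
  define c where "c = c_nk n k"
  have c0: "c > 0" using k by (simp add: c_def c_nk_def zero_less_binomial_iff)
  have n0: "real n > 0" using k by simp
  define F where "F = (\<lambda>r. r ^ n * (w r / r) ^ k)"
  have v: "\<And>r. r \<in> {0<..<1} \<Longrightarrow> (v has_real_derivative w r) (at r)" and w0: "\<And>r. r \<in> {0<..<1} \<Longrightarrow> 0 \<le> w r"
    and FD: "\<And>r. r \<in> {0<..<1} \<Longrightarrow> (F has_real_derivative r ^ (n - 1) * g (v r) / c) (at r)"
    using ode by (auto simp: profile_ode_def c_def F_def)
  have in01: "x \<in> {0<..<1}" if "0 < a" "b < 1" "a \<le> x" "x \<le> b" for a b x :: real using that by auto
  have vm: "v a \<le> v b" if ab: "0 < a" "a \<le> b" "b < 1" for a b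
  proof (rule DERIV_nonneg_imp_nondecreasing[OF ab(2)])
    fix x assume "a \<le> x" "x \<le> b"
    then have "x \<in> {0<..<1}" using ab by auto
    then show "\<exists>y. (v has_real_derivative y) (at x) \<and> 0 \<le> y" using v w0 by blast
  qed
  have "F r \<le> F s"
  proof (rule DERIV_nonneg_imp_nondecreasing[OF rs(2)])
    fix x assume "r \<le> x" "x \<le> s"
    then have x: "x \<in> {0<..<1}" using rs by auto
    moreover have "0 \<le> x ^ (n - 1) * g (v x) / c" using x c0 g(2) by simp
    ultimately show "\<exists>y. (F has_real_derivative y) (at x) \<and> 0 \<le> y" using FD by blast
  qed
  then show "r ^ n * (w r / r) ^ k \<le> s ^ n * (w s / s) ^ k" by (simp add: F_def)
  have low: "g (v t) * t ^ n / (real n * c) \<le> F t" if t: "0 < t" "t < 1" for t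
  proof -
    have step: "g (v t) * (t ^ n - x ^ n) / (real n * c) \<le> F t" if x: "0 < x" "x < t" for x
    proof -
      define H where "H = (\<lambda>y. F y - g (v t) / (real n * c) * y ^ n)"
      have "H x \<le> H t"
      proof (rule DERIV_nonneg_imp_nondecreasing[OF less_imp_le[OF x(2)]])
        fix y assume y: "x \<le> y" "y \<le> t"
        then have y01: "y \<in> {0<..<1}" "0 < y" "y < 1" using x t by auto
        have D: "(H has_real_derivative y ^ (n - 1) * g (v y) / c - g (v t) / (real n * c) * (real n * y ^ (n - Suc 0))) (at y)"
          unfolding H_def by (intro DERIV_diff FD[OF y01(1)] DERIV_cmult DERIV_pow)
        have "g (v t) \<le> g (v y)" using antimonoD[OF g(1) vm[OF y01(2) y(2) t(2)]] .
        then have "0 \<le> y ^ (n - 1) * (g (v y) - g (v t)) / c" using y01 c0 by simp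
        also have "\<dots> = y ^ (n - 1) * g (v y) / c - g (v t) / (real n * c) * (real n * y ^ (n - Suc 0))"
          using n0 c0 by (simp add: field_simps)
        finally show "\<exists>z. (H has_real_derivative z) (at y) \<and> 0 \<le> z" using D by blast
      qed
      moreover have "0 \<le> F x" using x t w0[of x] by (simp add: F_def)
      ultimately show ?thesis unfolding H_def by (simp add: right_diff_distrib diff_divide_distrib)
    qed
    have lim: "((\<lambda>x. g (v t) * (t ^ n - x ^ n) / (real n * c)) \<longlongrightarrow> g (v t) * (t ^ n - 0 ^ n) / (real n * c)) (at_right 0)"
      using n0 c0 by (intro tendsto_intros) auto
    have ev: "\<forall>\<^sub>F x in at_right 0. g (v t) * (t ^ n - x ^ n) / (real n * c) \<le> F t"
      unfolding eventually_at_right[OF t(1)] by (intro exI[of _ t] conjI t(1) allI impI step)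
    have "g (v t) * (t ^ n - 0 ^ n) / (real n * c) \<le> F t"
      by (rule tendsto_upperbound[OF lim ev]) simp
    moreover have "(0::real) ^ n = 0" using k by (simp add: zero_power)
    ultimately show ?thesis by (simp only: diff_zero)
  qed
  have "F s / s ^ n \<le> F r / r ^ n"
  proof (rule DERIV_nonpos_imp_nonincreasing[OF rs(2)])
    fix x assume "r \<le> x" "x \<le> s"
    then have x: "x \<in> {0<..<1}" "0 < x" "x < 1" using rs by auto
    have D: "((\<lambda>x. F x / x ^ n) has_real_derivative
       ((x ^ (n - 1) * g (v x) / c) * x ^ n - F x * (real n * x ^ (n - Suc 0))) / (x ^ n * x ^ n)) (at x)"
      by (rule DERIV_divide[OF FD[OF x(1)] DERIV_pow]) (use x in simp)
    have "g (v x) * x ^ n \<le> F x * (real n * c)"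
      using low[OF x(2,3)] n0 c0 by (simp add: pos_divide_le_eq)
    then have "g (v x) * x ^ n / c \<le> F x * real n" using c0 by (simp add: pos_divide_le_eq mult.assoc)
    then have "x ^ (n - 1) * (g (v x) * x ^ n / c) \<le> x ^ (n - 1) * (F x * real n)" using x by (intro mult_left_mono) auto
    then have "(x ^ (n - 1) * g (v x) / c) * x ^ n - F x * (real n * x ^ (n - Suc 0)) \<le> 0" by (simp add: mult_ac)
    then have "((x ^ (n - 1) * g (v x) / c) * x ^ n - F x * (real n * x ^ (n - Suc 0))) / (x ^ n * x ^ n) \<le> 0"
      using x by (intro divide_nonpos_pos) auto
    with D show "\<exists>y. ((\<lambda>x. F x / x ^ n) has_real_derivative y) (at x) \<and> y \<le> 0" by blast
  qed
  then have "(w s / s) ^ k \<le> (w r / r) ^ k" using rs by (simp add: F_def)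
  moreover have "0 \<le> w s / s" "0 \<le> w r / r" using w0[of s] w0[of r] rs by auto
  ultimately show "w s / s \<le> w r / r" using power_mono_iff[of "w s / s" "w r / r" k] k by auto
qed

lemma derivative_at_left_end:
  fixes v w :: "real \<Rightarrow> real"
  assumes v: "continuous_on {0<..1} v" "\<And>r. r \<in> {0<..<1} \<Longrightarrow> (v has_real_derivative w r) (at r)"
    and L: "(w \<longlongrightarrow> L) (at_left 1)"
  shows "at (1::real) within {0<..1} = at_left 1" "(v has_real_derivative L) (at 1 within {0<..1})"
proof -
  show e: "at (1::real) within {0<..1} = at_left 1"
    by (rule at_within_nhd[of _ "{0<..}"]) auto
  have ev: "\<forall>\<^sub>F x in at_left (1::real). x \<in> {0<..<1}"
    unfolding eventually_at_left[OF zero_less_one] by (intro exI[of _ 0]) auto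
  have "(v \<longlongrightarrow> v 1) (at_left 1)" using v(1) unfolding continuous_on_def e[symmetric] by auto
  then have v0: "((\<lambda>x. v x - v 1) \<longlongrightarrow> 0) (at_left 1)" by (simp add: LIM_zero)
  have i0: "((\<lambda>x::real. x - 1) \<longlongrightarrow> 0) (at_left 1)" by (intro tendsto_eq_intros) auto
  have "LIM x at_left 1. (v x - v 1) / (x - 1) :> nhds L"
  proof (rule lhopital_left[OF v0 i0, where f' = w and g' = "\<lambda>_. 1"])
    show "\<forall>\<^sub>F x in at_left (1::real). x - 1 \<noteq> 0" using ev by eventually_elim auto
    show "\<forall>\<^sub>F x in at_left 1. ((\<lambda>x. v x - v 1) has_real_derivative w x) (at x)"
      using ev by eventually_elim (auto intro!: derivative_eq_intros v(2))
    show "\<forall>\<^sub>F x in at_left 1. ((\<lambda>x::real. x - 1) has_real_derivative 1) (at x)"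
      by (intro always_eventually allI) (auto intro!: derivative_eq_intros)
  qed (use L in auto)
  then show "(v has_real_derivative L) (at 1 within {0<..1})" unfolding has_field_derivative_iff e .
qed

text \<open>The monotone quantity \<open>r\<^sup>n (w/r)\<^sup>k\<close> bounds \<open>w\<close> on \<open>[1/2, 1)\<close> from below by \<open>w(1/2)\<close>. At the end point the
  monotone function \<open>w/r\<close> has a limit, which is the one-sided derivative of \<open>v\<close> by de l'Hospital's rule.\<close>

lemma min_deriv_lower_bound:
  assumes k: "1 \<le> k" "k \<le> n" and ode: "profile_ode n k g v w" and g: "antimono g" "\<And>s. 0 \<le> g s"
    and vc: "continuous_on {0<..1} v"
  shows "(1/2) ^ n * w (1/2) \<le> min_deriv v"
proof -
  have v: "\<And>r. r \<in> {0<..<1} \<Longrightarrow> (v has_real_derivative w r) (at r)" and w0: "\<And>r. r \<in> {0<..<1} \<Longrightarrow> 0 \<le> w r"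
    using ode by (auto simp: profile_ode_def)
  have W: "0 \<le> w (1/2)" by (rule w0) simp
  have low: "(1/2) ^ n * w (1/2) \<le> w s" if s: "1/2 \<le> s" "s < 1" for s
  proof -
    have s0: "0 < s" "s \<in> {0<..<1}" using s by auto
    have "(1/2) ^ n * (w (1/2) / (1/2)) ^ k \<le> s ^ n * (w s / s) ^ k"
      by (rule profile_ode_monotone(1)[OF k ode g]) (use s in auto)
    also have "\<dots> \<le> s ^ k * (w s / s) ^ k"
      using s0 s w0[OF s0(2)] k by (intro mult_right_mono power_decreasing) auto
    also have "\<dots> = w s ^ k" using s0 by (simp add: power_divide)
    finally have 1: "(1/2) ^ n * (w (1/2) / (1/2)) ^ k \<le> w s ^ k" .
    have "((1/2) ^ n * w (1/2)) ^ k = ((1/2) ^ n) ^ k * w (1/2) ^ k" by (rule power_mult_distrib)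
    also have "\<dots> \<le> (1/2) ^ n * (w (1/2) / (1/2)) ^ k"
    proof (rule mult_mono)
      have "((1/2::real) ^ n) ^ k \<le> ((1/2) ^ n) ^ 1" using k by (intro power_decreasing power_le_one) auto
      then show "((1/2::real) ^ n) ^ k \<le> (1/2) ^ n" by simp
      show "w (1/2) ^ k \<le> (w (1/2) / (1/2)) ^ k" using W by (intro power_mono) auto
    qed (use W in auto)
    finally have "((1/2) ^ n * w (1/2)) ^ k \<le> w s ^ k" using 1 by linarith
    then show ?thesis using power_mono_iff[of "(1/2) ^ n * w (1/2)" "w s" k] k W w0[OF s0(2)] by auto
  qed
  define q where "q = (\<lambda>s. w s / s)"
  \<comment> \<open>the limit of a decreasing function at the right end point is its infimum\<close>
  define L where "L = Inf (q ` {1/2..<1})"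
  have bdd: "bdd_below (q ` {1/2..<1})" using w0 by (intro bdd_belowI2[of _ 0]) (auto simp: q_def)
  have "(q \<longlongrightarrow> L) (at_left 1)"
  proof (rule decreasing_tendsto)
    show "\<forall>\<^sub>F s in at_left 1. L \<le> q s"
      unfolding eventually_at_left[OF zero_less_one] L_def
      by (intro exI[of _ "1/2"]) (auto intro!: cINF_lower[OF bdd])
    fix x assume "L < x"
    then obtain s0 where s0: "s0 \<in> {1/2..<1}" "q s0 < x"
      unfolding L_def using cInf_less_iff[OF _ bdd] by fastforce
    show "\<forall>\<^sub>F s in at_left 1. q s < x"
      unfolding eventually_at_left[OF zero_less_one]
    proof (intro exI[of _ s0] conjI allI impI)
      fix s assume s: "s0 < s" "s < 1"
      have "q s \<le> q s0" unfolding q_def by (rule profile_ode_monotone(2)[OF k ode g]) (use s s0 in auto)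
      then show "q s < x" using s0(2) by linarith
    qed (use s0 in auto)
  qed
  then have "((\<lambda>s. s * q s) \<longlongrightarrow> 1 * L) (at_left 1)" by (intro tendsto_mult) auto
  then have "((\<lambda>s. s * q s) \<longlongrightarrow> L) (at_left 1)" by simp
  then have wL: "(w \<longlongrightarrow> L) (at_left 1)"
  proof (rule Lim_transform_eventually)
    show "\<forall>\<^sub>F s in at_left 1. s * q s = w s"
      unfolding eventually_at_left[OF zero_less_one] q_def by (intro exI[of _ "0"]) auto
  qed
  have L: "(1/2) ^ n * w (1/2) \<le> L"
  proof (rule tendsto_lowerbound[OF wL])
    show "\<forall>\<^sub>F s in at_left 1. (1/2) ^ n * w (1/2) \<le> w s"
      unfolding eventually_at_left[OF zero_less_one] using low by (intro exI[of _ "1/2"]) auto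
  qed simp
  note left = derivative_at_left_end[OF vc v wL]
  show ?thesis unfolding min_deriv_def
  proof (rule cINF_greatest)
    fix t :: real assume t: "t \<in> {1/2..1}"
    show "(1/2) ^ n * w (1/2) \<le> vector_derivative v (at t within {0<..1})"
    proof (cases "t = 1")
      case True
      have "vector_derivative v (at 1 within {0<..1}) = L"
        by (rule vector_derivative_within)
          (use left in \<open>auto simp: has_real_derivative_iff_has_vector_derivative[symmetric]\<close>)
      then show ?thesis using L True by simp
    next
      case False
      then have t1: "1/2 \<le> t" "t < 1" "t \<in> {0<..<1}" using t by auto
      have "at t within {0<..1} = at t within UNIV" by (rule at_within_nhd[of _ "{0<..<1}"]) (use t1 in auto)
      then have "vector_derivative v (at t within {0<..1}) = w t"
        using vector_derivative_at[of v "w t" t] v[OF t1(3)] by (simp add: has_real_derivative_iff_has_vector_derivative)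
      then show ?thesis using low[OF t1(1,2)] by simp
    qed
  qed simp
qed

text \<open>Comparing derivatives avoids integrals that are improper at \<open>0\<close> and at \<open>1\<close>.\<close>

lemma profile_oscillation_bound:
  fixes v w \<Phi> \<phi> :: "real \<Rightarrow> real"
  assumes v: "continuous_on {0<..1} v" "\<And>r. r \<in> {0<..<1} \<Longrightarrow> (v has_real_derivative w r) (at r)"
    and \<Phi>: "continuous_on {0<..1} \<Phi>" "\<And>r. r \<in> {0<..<1} \<Longrightarrow> (\<Phi> has_real_derivative \<phi> r) (at r)"
    and w: "\<And>r. r \<in> {0<..<1} \<Longrightarrow> 0 \<le> w r" "\<And>r. r \<in> {0<..<1} \<Longrightarrow> w r \<le> \<phi> r" and r: "r \<in> {0<..1}"
  shows "\<bar>v r - v 1\<bar> \<le> \<Phi> 1 - \<Phi> r"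
proof -
  have sub: "{r..1} \<subseteq> {0<..1}" using r by auto
  have r1: "r \<le> 1" using r by simp
  have in01: "x \<in> {0<..<1}" if "r < x" "x < 1" for x using that r by auto
  have "v r \<le> v 1"
    by (rule DERIV_nonneg_imp_increasing_open[OF r1])
      (use in01 v(2) w(1) continuous_on_subset[OF v(1) sub] in \<open>blast+\<close>)
  moreover have "\<Phi> r - v r \<le> \<Phi> 1 - v 1"
  proof (rule DERIV_nonneg_imp_increasing_open[OF r1])
    show "continuous_on {r..1} (\<lambda>r. \<Phi> r - v r)"
      by (intro continuous_intros continuous_on_subset[OF v(1) sub] continuous_on_subset[OF \<Phi>(1) sub])
    fix x assume "r < x" "x < 1"
    then have x: "x \<in> {0<..<1}" by (rule in01)
    have "((\<lambda>r. \<Phi> r - v r) has_real_derivative \<phi> x - w x) (at x)" by (rule DERIV_diff[OF \<Phi>(2)[OF x] v(2)[OF x]])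
    moreover have "0 \<le> \<phi> x - w x" using w(2)[OF x] by simp
    ultimately show "\<exists>y. ((\<lambda>r. \<Phi> r - v r) has_real_derivative y) (at x) \<and> 0 \<le> y" by blast
  qed
  ultimately show ?thesis by linarith
qed

text \<open>The exponent of the estimate in high dimensions.\<close>

definition decay_exponent :: "nat \<Rightarrow> nat \<Rightarrow> real" where
  "decay_exponent n k = (- (real k + 1) * real n + 2 * sqrt (2 * (real k + 1) * real n - 4 * real k)
                   + 2 * (real k)\<^sup>2 + 6 * real k) / (real k + 1)\<^sup>2"

text \<open>With \<open>X\<close> the square root in the exponent, the numerator is \<open>(2k+4-X)(2k+X)/2\<close>, and
  \<open>(2k+4-X)(2k+4+X) = 2(k+1)(2k+8-n)\<close>.\<close>

lemma decay_exponent_sign: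
  assumes k: "1 \<le> k" and n: "2 * k \<le> n"
  shows "2 * decay_root n k - real n + real k + 1 = (real k + 1) * (decay_exponent n k - 1)"
    "n < 2 * k + 8 \<Longrightarrow> 0 < decay_exponent n k" "n = 2 * k + 8 \<Longrightarrow> decay_exponent n k = 0"
    "n > 2 * k + 8 \<Longrightarrow> decay_exponent n k < 0"
proof -
  define X where "X = sqrt (2 * (real k + 1) * real n - 4 * real k)"
  have nk: "2 * real k \<le> real n" using n by (metis of_nat_le_iff of_nat_mult of_nat_numeral)
  have k1: "real k \<ge> 1" using k by simp
  have "2 * (real k + 1) * (2 * real k) \<le> 2 * (real k + 1) * real n" using nk by (intro mult_left_mono) auto
  moreover have "4 * real k \<le> 2 * (real k + 1) * (2 * real k)" using k1 by (simp add: algebra_simps)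
  ultimately have p: "0 \<le> 2 * (real k + 1) * real n - 4 * real k" by linarith
  have X0: "0 \<le> X" using p by (simp add: X_def)
  have X2: "X\<^sup>2 = 2 * (real k + 1) * real n - 4 * real k" unfolding X_def by (rule real_sqrt_pow2[OF p])
  have q: "real k + 1 > 0" using k1 by linarith
  define N where "N = - (real k + 1) * real n + 2 * X + 2 * (real k)\<^sup>2 + 6 * real k"
  have de: "decay_exponent n k = N / (real k + 1)\<^sup>2" by (simp add: decay_exponent_def N_def X_def)
  have N2: "2 * N = (2 * real k + 4 - X) * (2 * real k + X)"
  proof -
    have "2 * N = - (X\<^sup>2 + 4 * real k) + 4 * X + 4 * (real k)\<^sup>2 + 12 * real k" unfolding X2 N_def by (simp add: algebra_simps)
    also have "\<dots> = (2 * real k + 4 - X) * (2 * real k + X)" by (simp add: power2_eq_square algebra_simps)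
    finally show ?thesis .
  qed
  have Y: "(2 * real k + 4 - X) * (2 * real k + 4 + X) = 2 * (real k + 1) * (2 * real k + 8 - real n)"
  proof -
    have "(2 * real k + 4 - X) * (2 * real k + 4 + X) = (2 * real k + 4)\<^sup>2 - X\<^sup>2" by (simp add: power2_eq_square algebra_simps)
    then show ?thesis unfolding X2 by (simp add: power2_eq_square algebra_simps)
  qed
  have p1: "2 * real k + X > 0" "2 * real k + 4 + X > 0" using k1 X0 by auto
  have q2: "(real k + 1)\<^sup>2 > 0" using q by simp
  show "2 * decay_root n k - real n + real k + 1 = (real k + 1) * (decay_exponent n k - 1)"
  proof -
    have "decay_root n k = (real k - 1 + X) / (real k + 1)" by (simp add: decay_root_def X_def)
    then have "(real k + 1) * (2 * decay_root n k - real n + real k + 1) = 2 * (real k - 1 + X) + (real k + 1) * (- real n + real k + 1)"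
      using q by (simp add: field_simps)
    also have "\<dots> = N - (real k + 1)\<^sup>2" by (simp add: N_def power2_eq_square algebra_simps)
    also have "\<dots> = (real k + 1) * ((real k + 1) * (decay_exponent n k - 1))"
    proof -
      have "N - y\<^sup>2 = y * (y * (N / y\<^sup>2 - 1))" if "y \<noteq> 0" for y :: real
        using that by (simp add: power2_eq_square right_diff_distrib)
      from this[of "real k + 1"] show ?thesis unfolding de using q by simp
    qed
    finally show ?thesis using q by simp
  qed
  show "0 < decay_exponent n k" if "n < 2 * k + 8"
  proof -
    have "real n < 2 * real k + 8" using that by linarith
    then have "0 < (2 * real k + 4 - X) * (2 * real k + 4 + X)" unfolding Y using q by simp
    then have "0 < 2 * real k + 4 - X" using p1(2) by (simp add: zero_less_mult_iff)
    then have "0 < 2 * N" unfolding N2 using p1 by simp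
    then show ?thesis unfolding de using q2 by simp
  qed
  show "decay_exponent n k = 0" if "n = 2 * k + 8"
  proof -
    have "real n = 2 * real k + 8" using that by simp
    then have "(2 * real k + 4 - X) * (2 * real k + 4 + X) = 0" unfolding Y by simp
    then have "2 * real k + 4 - X = 0" using p1(2) by (metis mult_eq_0_iff less_irrefl)
    then have "2 * N = 0" unfolding N2 by simp
    then show ?thesis unfolding de by simp
  qed
  show "decay_exponent n k < 0" if "n > 2 * k + 8"
  proof -
    have "real n > 2 * real k + 8" using that by linarith
    then have "(2 * real k + 4 - X) * (2 * real k + 4 + X) < 0" unfolding Y using q by (simp add: mult_pos_neg)
    then have "2 * real k + 4 - X < 0" using p1(2) by (simp add: mult_less_0_iff)
    then have "2 * N < 0" unfolding N2 using p1 by (simp add: mult_neg_pos)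
    then show ?thesis unfolding de using q2 by (simp add: divide_neg_pos)
  qed
qed

text \<open>On \<open>[1/2, 1)\<close> the function \<open>w\<close> is at most \<open>2 w(1/2)\<close>, as \<open>w/r\<close> decreases, and \<open>r\<^sup>p\<close> is bounded away from zero.\<close>

lemma power_bound_extends_to_unit_interval:
  fixes w :: "real \<Rightarrow> real"
  assumes dec: "\<And>r s. 0 < r \<Longrightarrow> r \<le> s \<Longrightarrow> s < 1 \<Longrightarrow> w s / s \<le> w r / r"
    and W: "0 \<le> w (1/2)" and K: "0 \<le> K"
    and near: "\<And>r. r \<in> {0<..1/2} \<Longrightarrow> w r \<le> K * w (1/2) * r powr p"
    and r: "r \<in> {0<..<1}"
  shows "w r \<le> (K + 2 * 2 powr \<bar>p\<bar>) * w (1/2) * r powr p"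
proof (cases "r \<le> 1/2")
  case True
  have "0 \<le> 2 * 2 powr \<bar>p\<bar> * w (1/2) * r powr p" using W by simp
  then show ?thesis using near[of r] True r by (simp add: algebra_simps)
next
  case False
  then have r1: "1/2 \<le> r" "0 < r" "r < 1" using r by auto
  have "w r / r \<le> w (1/2) / (1/2)" by (rule dec) (use r1 in auto)
  then have "w r \<le> 2 * w (1/2) * r" using r1 by (simp add: field_simps)
  also have "\<dots> \<le> 2 * w (1/2) * 1" using W r1 by (intro mult_left_mono) auto
  finally have 1: "w r \<le> 2 * w (1/2)" by simp
  have "1 \<le> 2 powr \<bar>p\<bar> * r powr p"
  proof (cases "0 \<le> p")
    case True
    have "1 \<le> (2 * r) powr p" using True r1 by (intro ge_one_powr_ge_zero) auto
    then show ?thesis using True r1 by (simp add: powr_mult)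
  next
    case False
    have "1 \<le> (1 / r) powr (- p)" using False r1 by (intro ge_one_powr_ge_zero) auto
    also have "\<dots> = r powr p" using r1 by (simp add: powr_divide powr_minus inverse_eq_divide)
    finally have a: "1 \<le> r powr p" .
    have "(1::real) \<le> 2 powr \<bar>p\<bar>" by (intro ge_one_powr_ge_zero) auto
    then have "1 * 1 \<le> 2 powr \<bar>p\<bar> * r powr p" using a by (intro mult_mono) auto
    then show ?thesis by simp
  qed
  then have "2 * w (1/2) * 1 \<le> 2 * w (1/2) * (2 powr \<bar>p\<bar> * r powr p)" using W by (intro mult_left_mono) auto
  moreover have "0 \<le> K * w (1/2) * r powr p" using W K by simp
  ultimately show ?thesis using 1 by (simp add: algebra_simps)
qed

text \<open>For \<open>n \<ge> 2k\<close> this is the decay estimate. For \<open>n < 2k\<close> it is the monotonicity of \<open>r\<^sup>n (w/r)\<^sup>k\<close>, with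
  \<open>\<gamma> = (2k-n)/k\<close>. The reduced inequality needs \<open>w > 0\<close>; otherwise the two monotone quantities force \<open>w\<close> to
  vanish identically.\<close>

lemma semistable_profile_derivative_bound:
  fixes k :: nat
  assumes k: "1 \<le> k" "k \<le> CARD('n::finite)"
  obtains C \<gamma> :: real where "0 \<le> C" "CARD('n) < 2 * k + 8 \<Longrightarrow> 0 < \<gamma>" "CARD('n) \<ge> 2 * k + 8 \<Longrightarrow> \<gamma> = decay_exponent (CARD('n)) k"
    "\<And>g (u :: real^'n \<Rightarrow> real) Du v w r. \<lbrakk>\<And>s. 0 \<le> g s; antimono g; locally_lipschitz g; weighted_sobolev k u Du;
        radial_with_profile u v; semistable k g u; profile_ode (CARD('n)) k g v w; r \<in> {0<..<1}\<rbrakk>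
      \<Longrightarrow> w r \<le> C * w (1/2) * r powr (\<gamma> - 1)"
proof (cases "2 * k \<le> CARD('n)")
  case big: True
  let ?n = "CARD('n)"
  show thesis
  proof (rule profile_decay[OF k(1) big])
    fix K :: real assume K: "0 \<le> K" and decay: "\<And>w. \<lbrakk>continuous_on {0<..<1} w; \<And>r. r \<in> {0<..<1} \<Longrightarrow> 0 \<le> w r;
      \<And>r s. 0 < r \<Longrightarrow> r \<le> s \<Longrightarrow> s < 1 \<Longrightarrow> w s / s \<le> w r / r;
      integrable lborel (\<lambda>r. indicator {0<..<1} r * (r ^ (?n - 1) * (r powr (1 - real k) * w r ^ (k + 1))));
      \<And>a b \<eta> \<eta>'. \<lbrakk>0 < a; a < b; b < 1; \<And>r. r \<in> {0<..<1} \<Longrightarrow> (\<eta> has_real_derivative \<eta>' r) (at r);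
        continuous_on {0<..<1} \<eta>'; \<And>r. r \<in> {0<..<1} \<Longrightarrow> r \<notin> {a<..<b} \<Longrightarrow> \<eta> r = 0\<rbrakk>
        \<Longrightarrow> 0 \<le> (LINT r:{a..b}|lborel. r ^ ?n / r ^ k * w r ^ (k + 1) * ((\<eta>' r)\<^sup>2
          + 2 * ((real k - 1) / (real k + 1)) * (\<eta> r * \<eta>' r / r)
          - (2 * real ?n - real k - 1) / (real k + 1) * ((\<eta> r)\<^sup>2 / r\<^sup>2)))\<rbrakk>
      \<Longrightarrow> (\<forall>r\<in>{0<..1/2}. w r ^ (k + 1) \<le> K * w (1/2) ^ (k + 1) * r powr (2 * decay_root ?n k - real ?n + real k + 1))"
    define K1 where "K1 = root (k + 1) K"
    have K1: "0 \<le> K1" "K1 ^ (k + 1) = K" using K by (auto simp: K1_def simp del: power_Suc)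
    define p where "p = decay_exponent ?n k - 1"
    show thesis
    proof (rule that[of "K1 + 2 * 2 powr \<bar>p\<bar>" "decay_exponent ?n k"])
      show "0 \<le> K1 + 2 * 2 powr \<bar>p\<bar>" using K1 by simp
      show "0 < decay_exponent ?n k" if "?n < 2 * k + 8" by (rule decay_exponent_sign(2)[OF k(1) big that])
      show "decay_exponent ?n k = decay_exponent ?n k" ..
      fix g :: "real \<Rightarrow> real" and u :: "real^'n \<Rightarrow> real" and Du v w and r :: real
      assume g0: "\<And>s. 0 \<le> g s" and g: "antimono g" "locally_lipschitz g" and ws: "weighted_sobolev k u Du"
        and rad: "radial_with_profile u v" and st: "semistable k g u" and ode: "profile_ode ?n k g v w" and r: "r \<in> {0<..<1}"
      have wc: "continuous_on {0<..<1} w" and w0: "\<And>r. r \<in> {0<..<1} \<Longrightarrow> 0 \<le> w r"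
        using ode by (auto simp: profile_ode_def)
      have W: "0 \<le> w (1/2)" by (rule w0) simp
      note mono = profile_ode_monotone[OF k ode g(1) g0]
      show "w r \<le> (K1 + 2 * 2 powr \<bar>p\<bar>) * w (1/2) * r powr (decay_exponent ?n k - 1)"
        unfolding p_def[symmetric]
      proof (rule power_bound_extends_to_unit_interval[OF mono(2) W K1(1) _ r])
        fix r :: real assume r: "r \<in> {0<..1/2}"
        then have r': "r \<in> {0<..<1}" "0 < r" by auto
        show "w r \<le> K1 * w (1/2) * r powr p"
        proof (cases "\<exists>r1\<in>{0<..<1}. w r1 = 0")
          case True
          then obtain r1 where r1: "0 < r1" "r1 < 1" "w r1 = 0" by auto
          have "w r \<le> 0"
          proof (cases "r \<le> r1")
            case True
            have "r ^ ?n * (w r / r) ^ k \<le> r1 ^ ?n * (w r1 / r1) ^ k" by (rule mono(1)) (use True r1 r' in auto)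
            also have "\<dots> = 0" using r1 k by simp
            finally have le: "r ^ ?n * (w r / r) ^ k \<le> 0" .
            have rn: "0 < r ^ ?n" using r' by simp
            have "\<not> 0 < (w r / r) ^ k" using mult_pos_pos[OF rn] le by fastforce
            moreover have "0 \<le> (w r / r) ^ k" using w0[OF r'(1)] r' by simp
            ultimately have "(w r / r) ^ k = 0" by linarith
            then show ?thesis using r' by simp
          next
            case False
            have "w r / r \<le> w r1 / r1" by (rule mono(2)) (use False r1 r' in auto)
            then show ?thesis using r1 r' by (simp add: divide_le_0_iff)
          qed
          also have "0 \<le> K1 * w (1/2) * r powr p" using K1 W by simp
          finally show ?thesis .
        next
          case False
          have pos: "0 < w r" if "r \<in> {0<..<1}" for r using w0[OF that] False that by force
          have "\<forall>r\<in>{0<..1/2}. w r ^ (k + 1) \<le> K * w (1/2) ^ (k + 1) * r powr (2 * decay_root ?n k - real ?n + real k + 1)"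
            by (rule decay[OF wc w0 mono(2) profile_energy[OF ws rad ode]
                semistable_reduced_inequality[OF k g locally_lipschitz_continuous[OF g(2)] rad st ode pos]])
          then have "w r ^ (k + 1) \<le> K * w (1/2) ^ (k + 1) * r powr (2 * decay_root ?n k - real ?n + real k + 1)"
            using r by blast
          also have "r powr (2 * decay_root ?n k - real ?n + real k + 1) = (r powr p) ^ (k + 1)"
          proof -
            have "(r powr p) ^ (k + 1) = r powr (p * real (k + 1))" using r' by (simp add: powr_realpow[symmetric] powr_powr del: power_Suc)
            then show ?thesis unfolding decay_exponent_sign(1)[OF k(1) big] p_def by (simp add: mult.commute add.commute)
          qed
          also have "K * w (1/2) ^ (k + 1) * (r powr p) ^ (k + 1) = (K1 * w (1/2) * r powr p) ^ (k + 1)"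
            unfolding power_mult_distrib K1(2) ..
          finally show ?thesis
            by (rule power_le_imp_le_base[of _ k, unfolded Suc_eq_plus1]) (use K1 W in simp)
        qed
      qed
    qed
  qed
next
  case small: False
  let ?n = "CARD('n)"
  define p where "p = (real k - real ?n) / real k"
  have kk: "real k > 0" using k by simp
  show thesis
  proof (rule that[of "2 + 2 * 2 powr \<bar>p\<bar>" "p + 1"])
    show "0 \<le> 2 + 2 * 2 powr \<bar>p\<bar>" by (intro add_nonneg_nonneg mult_nonneg_nonneg powr_ge_zero) auto
    have "p + 1 = (2 * real k - real ?n) / real k" using kk by (simp add: p_def field_simps)
    moreover have "real ?n < 2 * real k" using small by linarith
    ultimately show "0 < p + 1" using kk by simp
    show "p + 1 = decay_exponent ?n k" if "2 * k + 8 \<le> ?n" using that small by linarith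
    fix g :: "real \<Rightarrow> real" and u :: "real^'n \<Rightarrow> real" and Du v w and r :: real
    assume g0: "\<And>s. 0 \<le> g s" and g: "antimono g" and ode: "profile_ode ?n k g v w" and r: "r \<in> {0<..<1}"
    have w0: "\<And>r. r \<in> {0<..<1} \<Longrightarrow> 0 \<le> w r" using ode by (auto simp: profile_ode_def)
    have W: "0 \<le> w (1/2)" by (rule w0) simp
    note mono = profile_ode_monotone[OF k ode g g0]
    have "w r \<le> (2 + 2 * 2 powr \<bar>p\<bar>) * w (1/2) * r powr p"
    proof (rule power_bound_extends_to_unit_interval[OF mono(2) W _ _ r])
      fix r :: real assume r: "r \<in> {0<..1/2}"
      then have r': "r \<in> {0<..<1}" "0 < r" "r \<le> 1/2" by auto
      have "r ^ ?n * (w r / r) ^ k \<le> (1/2) ^ ?n * (w (1/2) / (1/2)) ^ k" by (rule mono(1)) (use r' in auto)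
      also have "\<dots> \<le> 1 * (2 * w (1/2)) ^ k"
        using W by (intro mult_mono power_mono power_le_one) auto
      finally have 1: "r ^ ?n * (w r / r) ^ k \<le> (2 * w (1/2)) ^ k" by simp
      have e: "(r powr p) ^ k = r ^ k / r ^ ?n"
      proof -
        have "(r powr p) ^ k = r powr (p * real k)" using r' by (simp add: powr_realpow[symmetric] powr_powr)
        also have "p * real k = real k - real ?n" using kk by (simp add: p_def)
        finally show ?thesis using r' by (simp add: powr_diff powr_realpow)
      qed
      have "w r ^ k = (r ^ ?n * (w r / r) ^ k) * (r powr p) ^ k" unfolding e using r' by (simp add: power_divide)
      also have "\<dots> \<le> (2 * w (1/2)) ^ k * (r powr p) ^ k" by (intro mult_right_mono 1) simp
      also have "\<dots> = (2 * w (1/2) * r powr p) ^ k" by (simp only: power_mult_distrib)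
      finally show "w r \<le> 2 * w (1/2) * r powr p"
        using power_mono_iff[of "w r" "2 * w (1/2) * r powr p" k] w0[OF r'(1)] W k by simp
    qed auto
    then show "w r \<le> (2 + 2 * 2 powr \<bar>p\<bar>) * w (1/2) * r powr (p + 1 - 1)" by simp
  qed
qed

text \<open>For \<open>\<gamma> > 1\<close> the exponent is first lowered to 1, since \<open>(1 - r\<^sup>\<gamma>)/\<gamma> \<le> (1 - r)/\<gamma>\<close> fails there.\<close>

lemma integrated_power_bound:
  fixes v w :: "real \<Rightarrow> real"
  assumes v: "continuous_on {0<..1} v" "\<And>r. r \<in> {0<..<1} \<Longrightarrow> (v has_real_derivative w r) (at r)"
    and w: "\<And>r. r \<in> {0<..<1} \<Longrightarrow> 0 \<le> w r" "\<And>r. r \<in> {0<..<1} \<Longrightarrow> w r \<le> A * r powr (\<gamma> - 1)"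
    and A: "0 \<le> A" and r: "r \<in> {0<..1}"
  shows "0 < \<gamma> \<Longrightarrow> \<bar>v r - v 1\<bar> \<le> A / min \<gamma> 1 * (1 - r)"
    "\<gamma> = 0 \<Longrightarrow> \<bar>v r - v 1\<bar> \<le> A * \<bar>ln r\<bar>"
    "\<gamma> < 0 \<Longrightarrow> \<bar>v r - v 1\<bar> \<le> A / (- \<gamma>) * (r powr \<gamma> - 1)"
proof -
  have pw: "\<bar>v r - v 1\<bar> \<le> A / \<delta> * (1 - r powr \<delta>)" if \<delta>: "\<delta> \<noteq> 0" and le: "\<And>r. r \<in> {0<..<1} \<Longrightarrow> r powr (\<gamma> - 1) \<le> r powr (\<delta> - 1)" for \<delta>
  proof -
    have "\<bar>v r - v 1\<bar> \<le> A / \<delta> * 1 powr \<delta> - A / \<delta> * r powr \<delta>"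
    proof (rule profile_oscillation_bound[OF v _ _ w(1) _ r, where \<phi> = "\<lambda>r. A * r powr (\<delta> - 1)"])
      show "continuous_on {0<..1} (\<lambda>r. A / \<delta> * r powr \<delta>)" using \<delta> by (intro continuous_intros) auto
      fix s :: real assume s: "s \<in> {0<..<1}"
      then have "s > 0" by simp
      from DERIV_cmult[OF has_real_derivative_powr[OF this, of \<delta>], of "A / \<delta>"]
      show "((\<lambda>r. A / \<delta> * r powr \<delta>) has_real_derivative A * s powr (\<delta> - 1)) (at s)" using \<delta> by simp
      show "w s \<le> A * s powr (\<delta> - 1)"
        using w(2)[OF s] mult_left_mono[OF le[OF s] A] by linarith
    qed
    then show ?thesis by (simp add: right_diff_distrib)
  qed
  show "\<bar>v r - v 1\<bar> \<le> A / min \<gamma> 1 * (1 - r)" if \<gamma>: "0 < \<gamma>"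
  proof -
    have "\<bar>v r - v 1\<bar> \<le> A / min \<gamma> 1 * (1 - r powr (min \<gamma> 1))"
      by (rule pw) (use \<gamma> in \<open>auto intro!: powr_mono'\<close>)
    also have "\<dots> \<le> A / min \<gamma> 1 * (1 - r)"
    proof (rule mult_left_mono)
      have "r powr 1 \<le> r powr (min \<gamma> 1)" using r by (intro powr_mono') auto
      then show "1 - r powr (min \<gamma> 1) \<le> 1 - r" using r by simp
    qed (use A \<gamma> in auto)
    finally show ?thesis .
  qed
  show "\<bar>v r - v 1\<bar> \<le> A / (- \<gamma>) * (r powr \<gamma> - 1)" if "\<gamma> < 0"
  proof -
    have "\<bar>v r - v 1\<bar> \<le> A / \<gamma> * (1 - r powr \<gamma>)" by (rule pw) (use \<open>\<gamma> < 0\<close> in auto)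
    also have "\<dots> = A / (- \<gamma>) * (r powr \<gamma> - 1)" using \<open>\<gamma> < 0\<close> by (simp add: field_simps)
    finally show ?thesis .
  qed
  show "\<bar>v r - v 1\<bar> \<le> A * \<bar>ln r\<bar>" if \<gamma>: "\<gamma> = 0"
  proof -
    have "\<bar>v r - v 1\<bar> \<le> A * ln 1 - A * ln r"
    proof (rule profile_oscillation_bound[OF v _ _ w(1) _ r, where \<phi> = "\<lambda>r. A * (1 / r)"])
      show "continuous_on {0<..1} (\<lambda>r. A * ln r)" by (intro continuous_intros) auto
      fix s :: real assume s: "s \<in> {0<..<1}"
      then have s0: "s > 0" by simp
      show "((\<lambda>r. A * ln r) has_real_derivative A * (1 / s)) (at s)"
        by (rule DERIV_cmult[OF DERIV_ln_divide[OF s0]])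
      have "s powr (\<gamma> - 1) = 1 / s" using s0 by (simp add: \<gamma> powr_minus inverse_eq_divide)
      then show "w s \<le> A * (1 / s)" using w(2)[OF s] by simp
    qed
    moreover have "\<bar>ln r\<bar> = - ln r" using r by (intro abs_of_nonpos) simp
    ultimately show ?thesis by simp
  qed
qed

theorem theorem1p11:
  fixes k :: nat
  assumes "CARD('n::finite) \<ge> 2" and "k \<in> {1..CARD('n)}"
  shows "\<exists>D::real. \<forall>(g::real \<Rightarrow> real) (u::real^'n \<Rightarrow> real) (Du::real^'n \<Rightarrow> real^'n) (v::real \<Rightarrow> real).
    (\<forall>s. g s \<ge> 0) \<and> antimono g \<and> locally_lipschitz g \<and>
    weighted_sobolev k u Du \<and> radial_with_profile u v \<and>
    (AE x\<in>ball 0 1 in lebesgue. radial_deriv Du x \<ge> 0) \<and>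
    (classical_solution k g u \<or> radial_weak_solution k g u Du) \<and> semistable k g u
    \<longrightarrow> (let n = CARD('n); C = D * min_deriv v in
      (n < 2 * k + 8 \<longrightarrow> (\<forall>r\<in>{0<..1}. \<bar>v r - v 1\<bar> \<le> C * (1 - r))) \<and>
      (n = 2 * k + 8 \<longrightarrow> (\<forall>r\<in>{0<..1}. \<bar>v r - v 1\<bar> \<le> C * \<bar>ln r\<bar>)) \<and>
      (n > 2 * k + 8 \<longrightarrow> (\<forall>r\<in>{0<..1}. \<bar>v r - v 1\<bar> \<le> C *
         (r powr ((- (real k + 1) * real n + 2 * sqrt (2 * (real k + 1) * real n - 4 * real k)
                   + 2 * (real k)\<^sup>2 + 6 * real k) / (real k + 1)\<^sup>2) - 1))))"
proof -
  let ?n = "CARD('n)"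
  have k: "1 \<le> k" "k \<le> ?n" using assms(2) by auto
  show ?thesis
  proof (rule semistable_profile_derivative_bound[OF k])
    fix C0 \<gamma> :: real assume C0: "0 \<le> C0" and \<gamma>1: "?n < 2 * k + 8 \<Longrightarrow> 0 < \<gamma>"
    and \<gamma>2: "?n \<ge> 2 * k + 8 \<Longrightarrow> \<gamma> = decay_exponent ?n k"
    and bound: "\<And>g (u :: real^'n \<Rightarrow> real) Du v w r. \<lbrakk>\<And>s. 0 \<le> g s; antimono g; locally_lipschitz g; weighted_sobolev k u Du;
        radial_with_profile u v; semistable k g u; profile_ode ?n k g v w; r \<in> {0<..<1}\<rbrakk>
      \<Longrightarrow> w r \<le> C0 * w (1/2) * r powr (\<gamma> - 1)"
    \<comment> \<open>the denominators that arise when \<open>r\<^sup>\<gamma>\<^sup>-\<^sup>1\<close> is integrated in the three cases\<close>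
    define \<delta> where "\<delta> = (if \<gamma> = 0 then 1 else if 0 < \<gamma> then min \<gamma> 1 else - \<gamma>)"
    have \<delta>0: "\<delta> > 0" by (auto simp: \<delta>_def)
    define D where "D = C0 * 2 ^ ?n / \<delta>"
    show ?thesis
    proof (intro exI[of _ D] allI impI, elim conjE)
      fix g :: "real \<Rightarrow> real" and u :: "real^'n \<Rightarrow> real" and Du v
      assume g0': "\<forall>s. g s \<ge> 0" and g: "antimono g" "locally_lipschitz g" and ws: "weighted_sobolev k u Du"
        and rad: "radial_with_profile u v" and nn: "AE x\<in>ball 0 1 in lebesgue. radial_deriv Du x \<ge> 0"
        and sol: "classical_solution k g u \<or> radial_weak_solution k g u Du" and st: "semistable k g u"
      have g0: "0 \<le> g s" for s using g0' by simp
      obtain w where ode: "profile_ode ?n k g v w"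
        using solution_profile_ode[OF k locally_lipschitz_continuous[OF g(2)] ws rad nn sol] by blast
      have v: "\<And>r. r \<in> {0<..<1} \<Longrightarrow> (v has_real_derivative w r) (at r)" and w0: "\<And>r. r \<in> {0<..<1} \<Longrightarrow> 0 \<le> w r"
        using ode by (auto simp: profile_ode_def)
      have vc: "continuous_on {0<..1} v" using rad by (simp add: radial_with_profile_def)
      define m where "m = min_deriv v"
      have W: "0 \<le> w (1/2)" by (rule w0) simp
      have "(1/2) ^ ?n * w (1/2) \<le> m" unfolding m_def by (rule min_deriv_lower_bound[OF k ode g(1) g0 vc])
      then have "2 ^ ?n * ((1/2) ^ ?n * w (1/2)) \<le> 2 ^ ?n * m" by (intro mult_left_mono) auto
      then have Wm: "w (1/2) \<le> 2 ^ ?n * m" by (simp add: power_divide)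
      define A where "A = C0 * w (1/2)"
      have A0: "0 \<le> A" using C0 W by (simp add: A_def)
      have wb: "w r \<le> A * r powr (\<gamma> - 1)" if "r \<in> {0<..<1}" for r
        unfolding A_def by (rule bound[OF g0 g ws rad st ode that])
      have "A \<le> C0 * (2 ^ ?n * m)" unfolding A_def by (intro mult_left_mono Wm C0)
      then have AD: "A / \<delta> \<le> D * m" using \<delta>0 by (simp add: D_def divide_right_mono mult.assoc)
      have osc: "0 < \<gamma> \<Longrightarrow> \<bar>v r - v 1\<bar> \<le> A / min \<gamma> 1 * (1 - r)"
          "\<gamma> = 0 \<Longrightarrow> \<bar>v r - v 1\<bar> \<le> A * \<bar>ln r\<bar>"
          "\<gamma> < 0 \<Longrightarrow> \<bar>v r - v 1\<bar> \<le> A / (- \<gamma>) * (r powr \<gamma> - 1)" if r: "r \<in> {0<..1}" for r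
        by (rule integrated_power_bound[OF vc v w0 wb A0 r]; assumption)+
      have c1: "\<bar>v r - v 1\<bar> \<le> D * m * (1 - r)" if n: "?n < 2 * k + 8" and r: "r \<in> {0<..1}" for r
      proof -
        have "\<bar>v r - v 1\<bar> \<le> A / \<delta> * (1 - r)" using osc(1)[OF r \<gamma>1[OF n]] \<gamma>1[OF n] by (simp add: \<delta>_def)
        also have "\<dots> \<le> D * m * (1 - r)" using r by (intro mult_right_mono AD) auto
        finally show ?thesis .
      qed
      have c2: "\<bar>v r - v 1\<bar> \<le> D * m * \<bar>ln r\<bar>" if n: "?n = 2 * k + 8" and r: "r \<in> {0<..1}" for r
      proof -
        have z: "\<gamma> = 0" using \<gamma>2 decay_exponent_sign(3)[OF k(1) _ n] n by simp
        have "\<bar>v r - v 1\<bar> \<le> A / \<delta> * \<bar>ln r\<bar>" using osc(2)[OF r z] z by (simp add: \<delta>_def)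
        also have "\<dots> \<le> D * m * \<bar>ln r\<bar>" by (intro mult_right_mono AD) auto
        finally show ?thesis .
      qed
      have c3: "\<bar>v r - v 1\<bar> \<le> D * m * (r powr decay_exponent ?n k - 1)" if n: "?n > 2 * k + 8" and r: "r \<in> {0<..1}" for r
      proof -
        have e: "\<gamma> = decay_exponent ?n k" using \<gamma>2 n by simp
        have z: "\<gamma> < 0" unfolding e by (rule decay_exponent_sign(4)[OF k(1) _ n]) (use n in simp)
        have "\<bar>v r - v 1\<bar> \<le> A / \<delta> * (r powr \<gamma> - 1)" using osc(3)[OF r z] z by (simp add: \<delta>_def)
        also have "\<dots> \<le> D * m * (r powr \<gamma> - 1)"
        proof (intro mult_right_mono AD)
          have "r powr 0 \<le> r powr \<gamma>" using r z by (intro powr_mono') auto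
          then show "0 \<le> r powr \<gamma> - 1" using r by simp
        qed
        finally show ?thesis unfolding e .
      qed
      show "let n = ?n; C = D * min_deriv v in
        (n < 2 * k + 8 \<longrightarrow> (\<forall>r\<in>{0<..1}. \<bar>v r - v 1\<bar> \<le> C * (1 - r))) \<and>
        (n = 2 * k + 8 \<longrightarrow> (\<forall>r\<in>{0<..1}. \<bar>v r - v 1\<bar> \<le> C * \<bar>ln r\<bar>)) \<and>
        (n > 2 * k + 8 \<longrightarrow> (\<forall>r\<in>{0<..1}. \<bar>v r - v 1\<bar> \<le> C *
           (r powr ((- (real k + 1) * real n + 2 * sqrt (2 * (real k + 1) * real n - 4 * real k)
                     + 2 * (real k)\<^sup>2 + 6 * real k) / (real k + 1)\<^sup>2) - 1)))"
        unfolding Let_def m_def[symmetric] decay_exponent_def[symmetric] by (intro conjI impI ballI c1 c2 c3)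
    qed
  qed
qed

end
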